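(* Let $M$ be a closed connected oriented smooth $2n$-manifold, $\rho$ a positive volume form on $M$, and $J\in\mathcal{J}(M)$. The Ricci form $\mathrm{Ric}_{\rho,J}\in\Omega^2(M)$ is independent of the choice of the torsion-free $\rho$-connection $\nabla$ used to define it. It is closed, represents the cohomology class $2\pi c_1(TM,J)$, satisfies $\phi^*\mathrm{Ric}_{\rho,J}=\mathrm{Ric}_{\phi^*\rho,\phi^*J}$ for every diffeomorphism $\phi$ of $M$, and satisfies $\mathrm{Ric}_{e^f\rho,J}=\mathrm{Ric}_{\rho,J}+\tfrac12 d(df\circ J)$ for all $f\in\Omega^0(M)$. Moreover, the map $J\mapsto 2\,\mathrm{Ric}_{\rho,J}$ is a moment map for the action (by pullback) of the group $\mathrm{Diff}^{\mathrm{ex}}(M,\rho)$ of exact volume preserving diffeomorphisms on $\mathcal{J}(M)$ with respect to the symplectic form $\Omega_\rho$, i.e. if $t\mapsto J_t$ is a smooth path in $\mathcal{J}(M)$, then $$\frac{d}{dt}\int_M 2\,\mathrm{Ric}_{\rho,J_t}\wedge\alpha=\frac12\int_M\mathrm{trace}\bigl((\partial_tJ_t)J_t(\mathcal{L}_{v_\alpha}J_t)\bigr)\rho$$ for all $t\in\mathbb{R}$ and all $\alpha\in\Omega^{2n-2}(M)$, where the vector field $v_\alpha$ is defined by $\iota(v_\alpha)\rho=d\alpha$.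
   Context: $\mathcal{J}(M)$ is the space of almost complex structures on $M$ compatible with the orientation, with tangent space $T_J\mathcal{J}(M)=\Omega^{0,1}_J(M,TM)=\{\hat J\in\Omega^0(M,\mathrm{End}(TM)) : \hat JJ+J\hat J=0\}$. It carries the symplectic form $\Omega_{\rho,J}(\hat J_1,\hat J_2)=\tfrac12\int_M\mathrm{trace}(\hat J_1J\hat J_2)\rho$. A positive volume form is one inducing the given orientation. A $\rho$-connection is a connection $\nabla$ on $TM$ with $\nabla\rho=0$. For a torsion-free $\rho$-connection $\nabla$ the Ricci form is $$\mathrm{Ric}_{\rho,J}(u,v):=\tfrac14\mathrm{trace}\bigl((\nabla_uJ)J(\nabla_vJ)\bigr)+\tfrac12\mathrm{trace}\bigl(JR^\nabla(u,v)\bigr)+\tfrac12 d\lambda^\nabla_J(u,v)$$ for vector fields $u,v$, where $R^\nabla$ is the (usual) curvature tensor of $\nabla$ and $\lambda^\nabla_J\in\Omega^1(M)$ is defined by $\lambda_J^\nabla(u):=\mathrm{trace}((\nabla J)u)$, the trace of the endomorphism $w\mapsto(\nabla_wJ)u$. (The formula makes sense for any volume form and any almost complex structure; this is used for $\phi^*\rho,\phi^*J$ when $\phi$ reverses orientation.) $\mathcal{L}_v$ denotes the usual Lie derivative. $\mathrm{Diff}^{\mathrm{ex}}(M,\rho)$ is the group of diffeomorphisms $\phi$ for which there exist a smooth isotopy $\phi_t$, $0\le t\le1$, and a smooth family of vector fields $v_t$ with $\partial_t\phi_t=v_t\circ\phi_t$, $\phi_0=\mathrm{id}$, $\phi_1=\phi$,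 and $\iota(v_t)\rho$ exact for all $t$. *)

theory Defs
  imports "HOL-Analysis.Analysis"
begin

section \<open>Smooth functions on open subsets of normed spaces\<close>

text \<open>These two notions are only used for open sets \<open>S\<close>; then \<open>ck_on k S f\<close> says that all iterated
  directional derivatives up to order \<open>k\<close> exist as Frechet derivatives and are continuous.\<close>

primrec ck_on ::
  "nat \<Rightarrow> 'a::euclidean_space set \<Rightarrow> ('a \<Rightarrow> 'b::euclidean_space) \<Rightarrow> bool" where
  "ck_on 0 S f \<longleftrightarrow> continuous_on S f"
| "ck_on (Suc k) S f \<longleftrightarrow> (\<forall>x\<in>S. f differentiable (at x)) \<and>
     (\<forall>v. ck_on k S (\<lambda>x. frechet_derivative f (at x) v))"

definition smooth_on :: "'a::euclidean_space set \<Rightarrow> ('a \<Rightarrow> 'b::euclidean_space) \<Rightarrow> bool" where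
  "smooth_on S f \<longleftrightarrow> (\<forall>k. ck_on k S f)"


section \<open>Closed connected oriented smooth manifolds\<close>

text \<open>The manifold is the whole Hausdorff space \<open>'m\<close>, modelled on \<open>real^'d\<close>; its dimension is
  \<open>CARD('d)\<close>. The well-order on \<open>'d\<close> fixes the order of the coordinates (hence the standard
  orientation of \<open>real^'d\<close>). A chart is a pair of its domain and its coordinate map; values of the
  coordinate map outside the domain are irrelevant.\<close>

type_synonym ('m, 'd) chart = "'m set \<times> ('m \<Rightarrow> real^'d)"
type_synonym ('m, 'd) vfield = "'m \<Rightarrow> real^'d"
type_synonym ('m, 'd) endo = "'m \<Rightarrow> real^'d^'d"
type_synonym ('m, 'd) form = "'m \<Rightarrow> (nat \<Rightarrow> real^'d) \<Rightarrow> real"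
type_synonym ('m, 'd) conn = "('m, 'd) vfield \<Rightarrow> ('m, 'd) endo"

definition cinv :: "('m, 'd::finite) chart \<Rightarrow> real^'d \<Rightarrow> 'm" where
  "cinv c = inv_into (fst c) (snd c)"

definition cimg :: "('m, 'd::finite) chart \<Rightarrow> (real^'d) set" where
  "cimg c = snd c ` fst c"

definition is_chart :: "('m::t2_space, 'd::finite) chart \<Rightarrow> bool" where
  "is_chart c \<longleftrightarrow> open (fst c) \<and> open (cimg c) \<and> homeomorphism (fst c) (cimg c) (snd c) (cinv c)"

text \<open>All transition maps of an oriented atlas preserve the orientation. The atlas need not be
  maximal.\<close>

definition oriented_atlas :: "('m::t2_space, 'd::finite) chart set \<Rightarrow> bool" where
  "oriented_atlas A \<longleftrightarrow> (\<forall>c\<in>A. is_chart c) \<and> (\<Union>c\<in>A. fst c) = UNIV \<and>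
     (\<forall>c\<in>A. \<forall>c'\<in>A. smooth_on (snd c ` (fst c \<inter> fst c')) (snd c' \<circ> cinv c) \<and>
        (\<forall>x\<in>snd c ` (fst c \<inter> fst c'). det (jacobian (snd c' \<circ> cinv c) (at x)) > 0))"

definition closed_connected_oriented_manifold :: "('m::t2_space, 'd::finite) chart set \<Rightarrow> bool" where
  "closed_connected_oriented_manifold A \<longleftrightarrow>
     oriented_atlas A \<and> compact (UNIV :: 'm set) \<and> connected (UNIV :: 'm set)"

text \<open>The tangent space at \<open>p\<close> is the class of all pairs (chart around \<open>p\<close>, vector) modulo the
  Jacobians of the transition maps. Each class is represented by its vector in one preferred
  chart \<open>chart_at A p\<close>, so that every tangent space is the type \<open>real^'d\<close>; \<open>to_chart\<close> and
  \<open>from_chart\<close> pass between the preferred chart and any other chart. Consequently the value of a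
  tensor field at \<open>p\<close> is a tensor on \<open>real^'d\<close>, but smoothness has to be tested after passing to
  the components in a fixed chart.\<close>

definition chart_at :: "('m::t2_space, 'd::finite) chart set \<Rightarrow> 'm \<Rightarrow> ('m, 'd) chart" where
  "chart_at A p = (SOME c. c \<in> A \<and> p \<in> fst c)"

definition coord_at :: "('m::t2_space, 'd::finite) chart set \<Rightarrow> 'm \<Rightarrow> real^'d" where
  "coord_at A p = snd (chart_at A p) p"

definition to_chart ::
  "('m::t2_space, 'd::finite) chart set \<Rightarrow> ('m, 'd) chart \<Rightarrow> 'm \<Rightarrow> real^'d^'d" where
  "to_chart A c p = jacobian (snd c \<circ> cinv (chart_at A p)) (at (coord_at A p))"

definition from_chart ::
  "('m::t2_space, 'd::finite) chart set \<Rightarrow> ('m, 'd) chart \<Rightarrow> 'm \<Rightarrow> real^'d^'d" where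
  "from_chart A c p = jacobian (snd (chart_at A p) \<circ> cinv c) (at (snd c p))"


section \<open>Functions, vector fields, endomorphism fields and differential forms\<close>

definition smooth_fun :: "('m::t2_space, 'd::finite) chart set \<Rightarrow> ('m \<Rightarrow> real) \<Rightarrow> bool" where
  "smooth_fun A f \<longleftrightarrow> (\<forall>c\<in>A. smooth_on (cimg c) (f \<circ> cinv c))"

definition dfun ::
  "('m::t2_space, 'd::finite) chart set \<Rightarrow> ('m \<Rightarrow> real) \<Rightarrow> 'm \<Rightarrow> real^'d \<Rightarrow> real" where
  "dfun A f p = frechet_derivative (f \<circ> cinv (chart_at A p)) (at (coord_at A p))"

definition vf_rep ::
  "('m::t2_space, 'd::finite) chart set \<Rightarrow> ('m, 'd) chart \<Rightarrow> ('m, 'd) vfield \<Rightarrow> real^'d \<Rightarrow> real^'d" where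
  "vf_rep A c X x = to_chart A c (cinv c x) *v X (cinv c x)"

definition smooth_vf :: "('m::t2_space, 'd::finite) chart set \<Rightarrow> ('m, 'd) vfield \<Rightarrow> bool" where
  "smooth_vf A X \<longleftrightarrow> (\<forall>c\<in>A. smooth_on (cimg c) (vf_rep A c X))"

definition endo_rep ::
  "('m::t2_space, 'd::finite) chart set \<Rightarrow> ('m, 'd) chart \<Rightarrow> ('m, 'd) endo \<Rightarrow> real^'d \<Rightarrow> real^'d^'d" where
  "endo_rep A c B x =
     to_chart A c (cinv c x) ** B (cinv c x) ** from_chart A c (cinv c x)"

definition smooth_endo :: "('m::t2_space, 'd::finite) chart set \<Rightarrow> ('m, 'd) endo \<Rightarrow> bool" where
  "smooth_endo A B \<longleftrightarrow> (\<forall>c\<in>A. smooth_on (cimg c) (endo_rep A c B))"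

definition form_rep ::
  "('m::t2_space, 'd::finite) chart set \<Rightarrow> ('m, 'd) chart \<Rightarrow> ('m, 'd) form
    \<Rightarrow> real^'d \<Rightarrow> (nat \<Rightarrow> real^'d) \<Rightarrow> real" where
  "form_rep A c \<omega> x w = \<omega> (cinv c x) (\<lambda>i. from_chart A c (cinv c x) *v w i)"

text \<open>A \<open>k\<close>-form takes its arguments \<open>w 0, \<dots>, w (k - 1)\<close> from a sequence of vectors and ignores
  the rest of the sequence.\<close>

definition alternating_form :: "nat \<Rightarrow> ((nat \<Rightarrow> real^'d::finite) \<Rightarrow> real) \<Rightarrow> bool" where
  "alternating_form k g \<longleftrightarrow>
     (\<forall>w w'. (\<forall>i<k. w i = w' i) \<longrightarrow> g w = g w') \<and>
     (\<forall>w. \<forall>i<k. linear (\<lambda>x. g (w(i := x)))) \<and>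
     (\<forall>w. \<forall>i<k. \<forall>j<k. i \<noteq> j \<and> w i = w j \<longrightarrow> g w = 0)"

definition forms :: "('m::t2_space, 'd::finite) chart set \<Rightarrow> nat \<Rightarrow> ('m, 'd) form set" where
  "forms A k = {\<omega>. (\<forall>p. alternating_form k (\<omega> p)) \<and>
     (\<forall>c\<in>A. \<forall>w. smooth_on (cimg c) (\<lambda>x. form_rep A c \<omega> x w))}"

text \<open>Exterior derivative of a \<open>k\<close>-form, by the usual formula in local coordinates; at \<open>p\<close> it is
  evaluated in the chart \<open>chart_at A p\<close>.\<close>

definition ext_d ::
  "('m::t2_space, 'd::finite) chart set \<Rightarrow> nat \<Rightarrow> ('m, 'd) form \<Rightarrow> ('m, 'd) form" where
  "ext_d A k \<omega> p w = (\<Sum>i\<le>k. (-1) ^ i *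
     frechet_derivative
       (\<lambda>x. form_rep A (chart_at A p) \<omega> x (\<lambda>j. w (if j < i then j else Suc j)))
       (at (coord_at A p)) (w i))"

definition closed_form ::
  "('m::t2_space, 'd::finite) chart set \<Rightarrow> nat \<Rightarrow> ('m, 'd) form \<Rightarrow> bool" where
  "closed_form A k \<omega> \<longleftrightarrow> \<omega> \<in> forms A k \<and> (\<forall>p w. ext_d A k \<omega> p w = 0)"

definition exact_form ::
  "('m::t2_space, 'd::finite) chart set \<Rightarrow> nat \<Rightarrow> ('m, 'd) form \<Rightarrow> bool" where
  "exact_form A k \<omega> \<longleftrightarrow> k \<ge> 1 \<and> (\<exists>\<beta>\<in>forms A (k - 1). \<omega> = ext_d A (k - 1) \<beta>)"

text \<open>The de Rham class of a closed \<open>k\<close>-form (\<open>k \<ge> 1\<close>), as the set of its representatives.\<close>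

definition de_rham_class ::
  "('m::t2_space, 'd::finite) chart set \<Rightarrow> nat \<Rightarrow> ('m, 'd) form \<Rightarrow> ('m, 'd) form set" where
  "de_rham_class A k \<omega> = {\<omega>'. \<omega>' \<in> forms A k \<and> exact_form A k (\<lambda>p w. \<omega>' p w - \<omega> p w)}"

definition wedge :: "nat \<Rightarrow> nat \<Rightarrow> ('m, 'd::finite) form \<Rightarrow> ('m, 'd) form \<Rightarrow> ('m, 'd) form" where
  "wedge k l \<omega> \<eta> p w =
     (\<Sum>\<sigma> | \<sigma> permutes {..<k + l}.
        of_int (sign \<sigma>) * \<omega> p (\<lambda>i. w (\<sigma> i)) * \<eta> p (\<lambda>i. w (\<sigma> (k + i)))) / (fact k * fact l)"

definition interior_prod ::
  "('m, 'd::finite) vfield \<Rightarrow> ('m, 'd) form \<Rightarrow> ('m, 'd) form" where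
  "interior_prod v \<omega> p w = \<omega> p (case_nat (v p) w)"


section \<open>Orientation, volume forms and integration\<close>

text \<open>\<open>card {..<b}\<close> is the position of the index \<open>b\<close> in the well-order of \<open>'d\<close>.\<close>

definition frame_det :: "(nat \<Rightarrow> real^'d::{finite,wellorder}) \<Rightarrow> real" where
  "frame_det w = det (\<chi> a b. w (card {..<b}) $ a)"

definition std_frame :: "nat \<Rightarrow> real^'d::{finite,wellorder}" where
  "std_frame i = (\<chi> a. if card {..<a} = i then 1 else 0)"

definition volume_form ::
  "('m::t2_space, 'd::{finite,wellorder}) chart set \<Rightarrow> ('m, 'd) form \<Rightarrow> bool" where
  "volume_form A \<rho> \<longleftrightarrow> \<rho> \<in> forms A CARD('d) \<and> (\<forall>p. \<exists>w. \<rho> p w \<noteq> 0)"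

definition positive_volume_form ::
  "('m::t2_space, 'd::{finite,wellorder}) chart set \<Rightarrow> ('m, 'd) form \<Rightarrow> bool" where
  "positive_volume_form A \<rho> \<longleftrightarrow>
     volume_form A \<rho> \<and> (\<forall>p w. frame_det w > 0 \<longrightarrow> \<rho> p w > 0)"

definition partition_of_unity ::
  "('m::t2_space, 'd::finite) chart set \<Rightarrow> ('m, 'd) chart set \<Rightarrow> (('m, 'd) chart \<Rightarrow> 'm \<Rightarrow> real) \<Rightarrow> bool" where
  "partition_of_unity A C \<theta> \<longleftrightarrow> finite C \<and> C \<subseteq> A \<and>
     (\<forall>c\<in>C. smooth_fun A (\<theta> c) \<and> (\<forall>p. \<theta> c p \<ge> 0) \<and> closure {p. \<theta> c p \<noteq> 0} \<subseteq> fst c) \<and>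
     (\<forall>p. (\<Sum>c\<in>C. \<theta> c p) = 1)"

text \<open>Integral of a top-degree form over the (compact, oriented) manifold.\<close>

definition form_integral ::
  "('m::t2_space, 'd::{finite,wellorder}) chart set \<Rightarrow> ('m, 'd) form \<Rightarrow> real" where
  "form_integral A \<omega> =
     (let (C, \<theta>) = (SOME (C, \<theta>). partition_of_unity A C \<theta>)
      in \<Sum>c\<in>C. integral (cimg c) (\<lambda>x. \<theta> c (cinv c x) * form_rep A c \<omega> x std_frame))"


section \<open>Diffeomorphisms and pullback\<close>

definition smooth_map :: "('m::t2_space, 'd::finite) chart set \<Rightarrow> ('m \<Rightarrow> 'm) \<Rightarrow> bool" where
  "smooth_map A \<phi> \<longleftrightarrow> continuous_on UNIV \<phi> \<and>
     (\<forall>c\<in>A. \<forall>c'\<in>A. smooth_on {x \<in> cimg c. \<phi> (cinv c x) \<in> fst c'} (\<lambda>x. snd c' (\<phi> (cinv c x))))"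

definition diffeo :: "('m::t2_space, 'd::finite) chart set \<Rightarrow> ('m \<Rightarrow> 'm) \<Rightarrow> bool" where
  "diffeo A \<phi> \<longleftrightarrow> bij \<phi> \<and> smooth_map A \<phi> \<and> smooth_map A (inv \<phi>)"

definition dmap :: "('m::t2_space, 'd::finite) chart set \<Rightarrow> ('m \<Rightarrow> 'm) \<Rightarrow> 'm \<Rightarrow> real^'d^'d" where
  "dmap A \<phi> p =
     jacobian (\<lambda>x. snd (chart_at A (\<phi> p)) (\<phi> (cinv (chart_at A p) x))) (at (coord_at A p))"

definition pull_form ::
  "('m::t2_space, 'd::finite) chart set \<Rightarrow> ('m \<Rightarrow> 'm) \<Rightarrow> ('m, 'd) form \<Rightarrow> ('m, 'd) form" where
  "pull_form A \<phi> \<omega> p w = \<omega> (\<phi> p) (\<lambda>i. dmap A \<phi> p *v w i)"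

definition pull_endo ::
  "('m::t2_space, 'd::finite) chart set \<Rightarrow> ('m \<Rightarrow> 'm) \<Rightarrow> ('m, 'd) endo \<Rightarrow> ('m, 'd) endo" where
  "pull_endo A \<phi> B p = matrix_inv (dmap A \<phi> p) ** B (\<phi> p) ** dmap A \<phi> p"


section \<open>Lie bracket and Lie derivative\<close>

text \<open>Sign convention: the bracket is the commutator of the associated derivations.\<close>

definition lie_bracket ::
  "('m::t2_space, 'd::finite) chart set \<Rightarrow> ('m, 'd) vfield \<Rightarrow> ('m, 'd) vfield \<Rightarrow> ('m, 'd) vfield" where
  "lie_bracket A X Y p =
     frechet_derivative (vf_rep A (chart_at A p) Y) (at (coord_at A p)) (X p) -
     frechet_derivative (vf_rep A (chart_at A p) X) (at (coord_at A p)) (Y p)"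

text \<open>Some global smooth vector field with value \<open>z\<close> at \<open>p\<close>. It serves to evaluate expressions that
  are tensorial in a vector field on a tangent vector.\<close>

definition vf_ext :: "('m::t2_space, 'd::finite) chart set \<Rightarrow> 'm \<Rightarrow> real^'d \<Rightarrow> ('m, 'd) vfield" where
  "vf_ext A p z = (SOME X. smooth_vf A X \<and> X p = z)"

definition app :: "('m, 'd::finite) endo \<Rightarrow> ('m, 'd) vfield \<Rightarrow> ('m, 'd) vfield" where
  "app B X p = B p *v X p"

text \<open>Leibniz rule: \<open>(L_v B) X = [v, B X] - B [v, X]\<close>.\<close>

definition lie_endo ::
  "('m::t2_space, 'd::finite) chart set \<Rightarrow> ('m, 'd) vfield \<Rightarrow> ('m, 'd) endo \<Rightarrow> ('m, 'd) endo" where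
  "lie_endo A v B p = matrix (\<lambda>z. lie_bracket A v (app B (vf_ext A p z)) p
                                  - B p *v lie_bracket A v (vf_ext A p z) p)"


section \<open>Connections on the tangent bundle\<close>

text \<open>A connection sends a vector field \<open>X\<close> to the endomorphism field \<open>\<nabla>X\<close>, so \<open>nab X p *v z\<close> is the
  covariant derivative of \<open>X\<close> at \<open>p\<close> in the direction \<open>z\<close>.\<close>

definition connection :: "('m::t2_space, 'd::finite) chart set \<Rightarrow> ('m, 'd) conn \<Rightarrow> bool" where
  "connection A nab \<longleftrightarrow>
     (\<forall>X. smooth_vf A X \<longrightarrow> smooth_endo A (nab X)) \<and>
     (\<forall>X Y. smooth_vf A X \<and> smooth_vf A Y \<longrightarrow>
        (\<forall>p. nab (\<lambda>q. X q + Y q) p = nab X p + nab Y p)) \<and>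
     (\<forall>f X. smooth_fun A f \<and> smooth_vf A X \<longrightarrow>
        (\<forall>p z. nab (\<lambda>q. f q *\<^sub>R X q) p *v z = dfun A f p z *\<^sub>R X p + f p *\<^sub>R (nab X p *v z)))"

definition cov :: "('m, 'd::finite) conn \<Rightarrow> ('m, 'd) vfield \<Rightarrow> ('m, 'd) vfield \<Rightarrow> ('m, 'd) vfield" where
  "cov nab u X p = nab X p *v u p"

definition torsion_free :: "('m::t2_space, 'd::finite) chart set \<Rightarrow> ('m, 'd) conn \<Rightarrow> bool" where
  "torsion_free A nab \<longleftrightarrow> (\<forall>X Y. smooth_vf A X \<and> smooth_vf A Y \<longrightarrow>
     (\<forall>p. cov nab X Y p - cov nab Y X p = lie_bracket A X Y p))"

definition preserves_form ::
  "('m::t2_space, 'd::finite) chart set \<Rightarrow> nat \<Rightarrow> ('m, 'd) form \<Rightarrow> ('m, 'd) conn \<Rightarrow> bool" where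
  "preserves_form A k \<omega> nab \<longleftrightarrow> (\<forall>u X. smooth_vf A u \<and> (\<forall>i::nat. smooth_vf A (X i)) \<longrightarrow>
     (\<forall>p. dfun A (\<lambda>q. \<omega> q (\<lambda>i. X i q)) p (u p)
          - (\<Sum>i<k. \<omega> p ((\<lambda>j. X j p)(i := cov nab u (X i) p))) = 0))"

definition torsion_free_rho_connection ::
  "('m::t2_space, 'd::{finite,wellorder}) chart set \<Rightarrow> ('m, 'd) form \<Rightarrow> ('m, 'd) conn \<Rightarrow> bool" where
  "torsion_free_rho_connection A \<rho> nab \<longleftrightarrow>
     connection A nab \<and> torsion_free A nab \<and> preserves_form A CARD('d) \<rho> nab"

definition curv ::
  "('m::t2_space, 'd::finite) chart set \<Rightarrow> ('m, 'd) conn \<Rightarrow> ('m, 'd) vfield \<Rightarrow> ('m, 'd) vfield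
    \<Rightarrow> ('m, 'd) vfield \<Rightarrow> ('m, 'd) vfield" where
  "curv A nab u v X p = cov nab u (cov nab v X) p - cov nab v (cov nab u X) p
     - cov nab (lie_bracket A u v) X p"

definition curv_endo ::
  "('m::t2_space, 'd::finite) chart set \<Rightarrow> ('m, 'd) conn \<Rightarrow> ('m, 'd) vfield \<Rightarrow> ('m, 'd) vfield
    \<Rightarrow> ('m, 'd) endo" where
  "curv_endo A nab u v p = matrix (\<lambda>z. curv A nab u v (vf_ext A p z) p)"

definition cov_endo ::
  "('m::t2_space, 'd::finite) chart set \<Rightarrow> ('m, 'd) conn \<Rightarrow> ('m, 'd) vfield \<Rightarrow> ('m, 'd) endo
    \<Rightarrow> ('m, 'd) endo" where
  "cov_endo A nab u B p = matrix (\<lambda>z. cov nab u (app B (vf_ext A p z)) p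
                                      - B p *v cov nab u (vf_ext A p z) p)"


section \<open>Almost complex structures and the first Chern class\<close>

definition almost_complex :: "('m::t2_space, 'd::finite) chart set \<Rightarrow> ('m, 'd) endo \<Rightarrow> bool" where
  "almost_complex A J \<longleftrightarrow> smooth_endo A J \<and> (\<forall>p. J p ** J p = - mat 1)"

text \<open>Compatibility with the orientation: every basis \<open>v\<^sub>1, J v\<^sub>1, v\<^sub>2, J v\<^sub>2, \<dots>\<close> of a tangent space
  is positively oriented.\<close>

definition acs :: "('m::t2_space, 'd::{finite,wellorder}) chart set \<Rightarrow> ('m, 'd) endo set" where
  "acs A = {J. almost_complex A J \<and>
     (\<forall>p v. let w = (\<lambda>i. if even i then v (i div 2) else J p *v v (i div 2))
            in frame_det w \<noteq> 0 \<longrightarrow> frame_det w > 0)}"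

text \<open>The complex trace of a complex linear endomorphism \<open>B\<close> of the complex vector space
  \<open>(real^'d, J)\<close>: its real trace is \<open>2 Re\<close> of the complex trace, and \<open>J ** B\<close> has \<open>\<i>\<close> times the
  complex trace of \<open>B\<close>.\<close>

definition complex_trace :: "real^'d^'d::finite \<Rightarrow> real^'d^'d \<Rightarrow> complex" where
  "complex_trace J B = Complex (trace B / 2) (- trace (J ** B) / 2)"

definition complex_connection ::
  "('m::t2_space, 'd::finite) chart set \<Rightarrow> ('m, 'd) endo \<Rightarrow> ('m, 'd) conn \<Rightarrow> bool" where
  "complex_connection A J nab \<longleftrightarrow> connection A nab \<and>
     (\<forall>X. smooth_vf A X \<longrightarrow> (\<forall>p. nab (app J X) p = J p ** nab X p))"

text \<open>Chern--Weil: the first Chern class in real cohomology is the class of \<open>\<i> / (2 \<pi>)\<close> times the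
  complex trace of the curvature of any complex connection on \<open>(TM, J)\<close>. The imaginary part of this
  closed form is exact, and vanishes for unitary connections.\<close>

definition chern_form ::
  "('m::t2_space, 'd::finite) chart set \<Rightarrow> ('m, 'd) endo \<Rightarrow> ('m, 'd) conn \<Rightarrow> ('m, 'd) form" where
  "chern_form A J nab p w =
     Re (\<i> / (2 * of_real pi) *
         complex_trace (J p) (curv_endo A nab (vf_ext A p (w 0)) (vf_ext A p (w 1)) p))"

definition c1 :: "('m::t2_space, 'd::finite) chart set \<Rightarrow> ('m, 'd) endo \<Rightarrow> ('m, 'd) form set" where
  "c1 A J = de_rham_class A 2 (chern_form A J (SOME nab. complex_connection A J nab))"


section \<open>The Ricci form\<close>

text \<open>The endomorphism \<open>w \<mapsto> (\<nabla>\<^sub>w J) u = \<nabla>\<^sub>w (J u) - J (\<nabla>\<^sub>w u)\<close> and its trace, as a 1-form.\<close>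

definition cov_endo_vf :: "('m, 'd::finite) conn \<Rightarrow> ('m, 'd) endo \<Rightarrow> ('m, 'd) vfield \<Rightarrow> ('m, 'd) endo" where
  "cov_endo_vf nab J u p = nab (app J u) p - J p ** nab u p"

definition lambda_form ::
  "('m::t2_space, 'd::finite) chart set \<Rightarrow> ('m, 'd) conn \<Rightarrow> ('m, 'd) endo \<Rightarrow> ('m, 'd) form" where
  "lambda_form A nab J p w = trace (cov_endo_vf nab J (vf_ext A p (w 0)) p)"

definition ricci ::
  "('m::t2_space, 'd::finite) chart set \<Rightarrow> ('m, 'd) conn \<Rightarrow> ('m, 'd) endo
    \<Rightarrow> ('m, 'd) vfield \<Rightarrow> ('m, 'd) vfield \<Rightarrow> 'm \<Rightarrow> real" where
  "ricci A nab J u v p =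
     1/4 * trace (cov_endo A nab u J p ** J p ** cov_endo A nab v J p)
     + 1/2 * trace (J p ** curv_endo A nab u v p)
     + 1/2 * ext_d A 1 (lambda_form A nab J) p (\<lambda>i. if i = 0 then u p else v p)"

definition ricci_form ::
  "('m::t2_space, 'd::{finite,wellorder}) chart set \<Rightarrow> ('m, 'd) form \<Rightarrow> ('m, 'd) endo
    \<Rightarrow> ('m, 'd) form" where
  "ricci_form A \<rho> J p w =
     ricci A (SOME nab. torsion_free_rho_connection A \<rho> nab) J
       (vf_ext A p (w 0)) (vf_ext A p (w 1)) p"


section \<open>Exact volume preserving diffeomorphisms and moment maps\<close>

text \<open>Smoothness on the closed interval \<open>[0, 1]\<close> means that there is a smooth extension to an open
  interval \<open>(-e, 1 + e)\<close>.\<close>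

definition smooth_family_maps ::
  "('m::t2_space, 'd::finite) chart set \<Rightarrow> real set \<Rightarrow> (real \<Rightarrow> 'm \<Rightarrow> 'm) \<Rightarrow> bool" where
  "smooth_family_maps A I \<phi> \<longleftrightarrow> continuous_on (I \<times> UNIV) (\<lambda>(t, p). \<phi> t p) \<and>
     (\<forall>c\<in>A. \<forall>c'\<in>A.
        smooth_on {(t, x). t \<in> I \<and> x \<in> cimg c \<and> \<phi> t (cinv c x) \<in> fst c'}
          (\<lambda>(t, x). snd c' (\<phi> t (cinv c x))))"

definition smooth_family_vf ::
  "('m::t2_space, 'd::finite) chart set \<Rightarrow> real set \<Rightarrow> (real \<Rightarrow> ('m, 'd) vfield) \<Rightarrow> bool" where
  "smooth_family_vf A I v \<longleftrightarrow> (\<forall>c\<in>A. smooth_on (I \<times> cimg c) (\<lambda>(t, x). vf_rep A c (v t) x))"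

definition Diff_ex ::
  "('m::t2_space, 'd::{finite,wellorder}) chart set \<Rightarrow> ('m, 'd) form \<Rightarrow> ('m \<Rightarrow> 'm) set" where
  "Diff_ex A \<rho> = {\<phi>. \<exists>\<Phi> v e. e > 0 \<and>
     smooth_family_maps A {-e<..<1+e} \<Phi> \<and> smooth_family_vf A {-e<..<1+e} v \<and>
     \<Phi> 0 = id \<and> \<Phi> 1 = \<phi> \<and>
     (\<forall>t\<in>{0..1}. diffeo A (\<Phi> t) \<and>
        (\<forall>p. ((\<lambda>s. snd (chart_at A (\<Phi> t p)) (\<Phi> s p)) has_vector_derivative v t (\<Phi> t p)) (at t)) \<and>
        exact_form A (CARD('d) - 1) (interior_prod (v t) \<rho>))}"

definition smooth_acs_path ::
  "('m::t2_space, 'd::{finite,wellorder}) chart set \<Rightarrow> (real \<Rightarrow> ('m, 'd) endo) \<Rightarrow> bool" where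
  "smooth_acs_path A J \<longleftrightarrow> (\<forall>t. J t \<in> acs A) \<and>
     (\<forall>c\<in>A. smooth_on (UNIV \<times> cimg c) (\<lambda>(t, x). endo_rep A c (J t) x))"

definition symp_form ::
  "('m::t2_space, 'd::{finite,wellorder}) chart set \<Rightarrow> ('m, 'd) form \<Rightarrow> ('m, 'd) endo
    \<Rightarrow> ('m, 'd) endo \<Rightarrow> ('m, 'd) endo \<Rightarrow> real" where
  "symp_form A \<rho> J B1 B2 = 1/2 * form_integral A (\<lambda>p w. trace (B1 p ** J p ** B2 p) * \<rho> p w)"

text \<open>The vector field \<open>v\<close> with \<open>\<iota>(v) \<rho> = d\<alpha>\<close>; unique because \<open>\<rho>\<close> is a volume form.\<close>

definition exact_vf ::
  "('m::t2_space, 'd::{finite,wellorder}) chart set \<Rightarrow> ('m, 'd) form \<Rightarrow> ('m, 'd) form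
    \<Rightarrow> ('m, 'd) vfield" where
  "exact_vf A \<rho> \<alpha> = (THE v. interior_prod v \<rho> = ext_d A (CARD('d) - 2) \<alpha>)"

text \<open>\<open>\<mu>\<close> assigns to each almost complex structure a 2-form, which is paired with the exact vector
  field of \<open>\<alpha>\<close> by integrating \<open>\<mu> J \<and> \<alpha>\<close>; the infinitesimal action of a vector field \<open>v\<close> at \<open>J\<close> is
  \<open>L_v J\<close>. The first conjunct says that the group acts and that \<open>\<mu>\<close> is equivariant, the second one
  is the Hamiltonian identity.\<close>

definition moment_map_Diff_ex ::
  "('m::t2_space, 'd::{finite,wellorder}) chart set \<Rightarrow> ('m, 'd) form
    \<Rightarrow> (('m, 'd) endo \<Rightarrow> ('m, 'd) form) \<Rightarrow> bool" where
  "moment_map_Diff_ex A \<rho> \<mu> \<longleftrightarrow>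
     (\<forall>\<phi>\<in>Diff_ex A \<rho>. \<forall>J\<in>acs A.
        pull_endo A \<phi> J \<in> acs A \<and> \<mu> (pull_endo A \<phi> J) = pull_form A \<phi> (\<mu> J)) \<and>
     (\<forall>J t. \<forall>\<alpha>\<in>forms A (CARD('d) - 2). smooth_acs_path A J \<longrightarrow>
        ((\<lambda>s. form_integral A (wedge 2 (CARD('d) - 2) (\<mu> (J s)) \<alpha>)) has_real_derivative
          symp_form A \<rho> (J t)
            (\<lambda>p. vector_derivative (\<lambda>s. J s p) (at t))
            (lie_endo A (exact_vf A \<rho> \<alpha>) (J t)))
        (at t))"

end

theory Submission
  imports Defs
begin

text \<open>Everything is read off from a local formula. In a chart, possibly orientation reversing, let \<open>J\<close> be
  the matrix of the almost complex structure, \<open>r\<close> the density of \<open>\<rho>\<close> and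
  \<open>\<lambda>(u) = tr (w \<mapsto> (D\<^sub>w J) u) + dr(J u) / r\<close>. For a torsion-free \<open>\<rho>\<close>-connection the terms
  quadratic in the Christoffel symbols cancel, and
  \<open>Ric(u, v) = 1/4 tr ((D\<^sub>u J) J (D\<^sub>v J)) + 1/2 d\<lambda>(u, v)\<close>, which no longer mentions the connection;
  closedness, naturality (use the pulled back chart) and the behaviour under \<open>\<rho> \<mapsto> e\<^sup>f \<rho>\<close> follow at once.
  For every connection the first two terms of \<open>Ric\<close> equal \<open>1/4 tr ((D\<^sub>u J) J (D\<^sub>v J))\<close> plus an exact
  form, and for a complex connection they are \<open>2 \<pi>\<close> times the Chern form.

  For the moment map, a variation \<open>K\<close> of \<open>J\<close> changes \<open>2 Ric\<close> by \<open>d\<Lambda>\<close> with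
  \<open>\<Lambda>(u) = tr (w \<mapsto> (D\<^sub>w K) u) + dr(K u) / r + 1/2 tr (K J D\<^sub>u J)\<close>. By a partition of unity \<open>\<alpha>\<close> may be
  supported in a chart; regarded as a bivector density \<open>a\<close> it satisfies \<open>r v\<^sub>i = \<Sum>j. \<partial>\<^sub>j a\<^sub>i\<^sub>j\<close>, and the
  integrands on the two sides of the identity differ by the divergence of
  \<open>W\<^sub>i = \<Sum>j. \<Lambda>\<^sub>j a\<^sub>i\<^sub>j + r (K v)\<^sub>i\<close>. The same formula shows that \<open>r v\<close> is divergence free, so flows of exact
  vector fields preserve \<open>\<rho>\<close>, and equivariance is a case of naturality.\<close>

section \<open>Calculus of smooth functions on open sets\<close>

text \<open>The quadratic cancellation still leaves \<open>1/2 d\<close> of the one-form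
  \<open>u \<mapsto> tr (J \<Gamma>(u))\<close>, which depends on the connection and on the chart.
  The term with \<open>\<lambda>\<close> is designed to remove exactly this: for a torsion-free
  connection \<open>\<lambda>(u) = tr (w \<mapsto> (D\<^sub>w J) u) + tr \<Gamma>(J u) - tr (J
  \<Gamma>(u))\<close> in a chart, and preservation of the volume form evaluates the second summand,
  since \<open>tr \<Gamma>(h)\<close> is the logarithmic derivative of the density along
  \<open>h\<close>. The obstacle is that the notions are global: a connection acts on global vector
  fields, tensors are evaluated on chosen extensions, and connections, partitions of unity and
  preferred charts are choices. Christoffel symbols must be extracted with cutoff functions, and
  each choice needs an existence proof before it means anything. The volume form may be negative in
  most of the development, because the results are also applied to pullbacks under
  orientation-reversing diffeomorphisms. Positivity serves to show that exact diffeomorphisms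
  preserve the orientation.\<close>

abbreviation dd :: "('a::real_normed_vector \<Rightarrow> 'b::real_normed_vector) \<Rightarrow> 'a \<Rightarrow> 'a \<Rightarrow> 'b" where
  "dd f x \<equiv> frechet_derivative f (at x)"

lemma has_derivative_cong_open:
  assumes "open S" "x \<in> S" "\<And>y. y \<in> S \<Longrightarrow> f y = g y"
  shows "(f has_derivative F) (at x) \<longleftrightarrow> (g has_derivative F) (at x)"
  using assms by (metis has_derivative_transform_within_open)

lemma dd_cong:
  assumes "open S" "x \<in> S" "\<And>y. y \<in> S \<Longrightarrow> f y = g y"
  shows "dd f x = dd g x"
  unfolding frechet_derivative_def using has_derivative_cong_open[OF assms] by simp

lemma differentiable_cong_open:
  assumes "open S" "x \<in> S" "\<And>y. y \<in> S \<Longrightarrow> f y = g y"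
  shows "f differentiable (at x) \<longleftrightarrow> g differentiable (at x)"
  unfolding differentiable_def using has_derivative_cong_open[OF assms] by simp

lemma dd_eq: "(f has_derivative F) (at x) \<Longrightarrow> dd f x = F"
  using frechet_derivative_at by metis

lemma dd_works: "f differentiable (at x) \<Longrightarrow> (f has_derivative dd f x) (at x)"
  by (simp add: frechet_derivative_works)

lemma dd_linear: "f differentiable (at x) \<Longrightarrow> linear (dd f x)"
  using dd_works has_derivative_linear by blast

lemma linear_basis_expand:
  assumes "linear (h :: 'a::euclidean_space \<Rightarrow> 'b::real_vector)"
  shows "h v = (\<Sum>b\<in>Basis. (v \<bullet> b) *\<^sub>R h b)"
proof -
  have "h v = h (\<Sum>b\<in>Basis. (v \<bullet> b) *\<^sub>R b)" by (simp add: euclidean_representation)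
  also have "\<dots> = (\<Sum>b\<in>Basis. (v \<bullet> b) *\<^sub>R h b)"
    by (simp add: linear_sum[OF assms] linear_scale[OF assms])
  finally show ?thesis .
qed

section \<open>Closure properties of the classes C^k on open sets\<close>

lemma ck_on_cong:
  assumes "open S" "\<And>y. y \<in> S \<Longrightarrow> f y = g y"
  shows "ck_on k S f \<longleftrightarrow> ck_on k S g"
  using assms(2)
proof (induction k arbitrary: f g)
  case 0
  then show ?case by (simp cong: continuous_on_cong)
next
  case (Suc k)
  have 1: "dd f x v = dd g x v" if "x \<in> S" for x v
    using dd_cong[OF assms(1) that Suc.prems] by simp
  have 2: "f differentiable (at x) \<longleftrightarrow> g differentiable (at x)" if "x \<in> S" for x
    using differentiable_cong_open[OF assms(1) that Suc.prems] by simp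
  show ?case
    using Suc.IH[OF 1] 2 by simp
qed

lemma ck_on_subset: "ck_on k S f \<Longrightarrow> T \<subseteq> S \<Longrightarrow> ck_on k T f"
proof (induction k arbitrary: f)
  case 0
  then show ?case using continuous_on_subset by auto
next
  case (Suc k)
  then show ?case by auto
qed

lemma ck_on_local:
  assumes "\<And>x. x \<in> S \<Longrightarrow> \<exists>U. open U \<and> x \<in> U \<and> ck_on k U f"
  shows "ck_on k S f"
  using assms
proof (induction k arbitrary: f)
  case 0
  then have "isCont f x" if "x \<in> S" for x
    using that continuous_on_eq_continuous_at by (metis ck_on.simps(1))
  then show ?case by (simp add: continuous_at_imp_continuous_on)
next
  case (Suc k)
  have "f differentiable (at x)" if "x \<in> S" for x
    using Suc.prems[OF that] by auto
  moreover have "ck_on k S (\<lambda>x. dd f x v)" for v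
    by (rule Suc.IH) (use Suc.prems in fastforce)
  ultimately show ?case by simp
qed

lemma ck_on_mono: "ck_on (Suc k) S f \<Longrightarrow> ck_on k S f"
proof (induction k arbitrary: f)
  case 0
  then show ?case
    by (auto intro!: continuous_at_imp_continuous_on differentiable_imp_continuous_within)
next
  case (Suc k)
  then show ?case by (simp only: ck_on.simps) blast
qed

lemma ck_on_const: "ck_on k S (\<lambda>x. c)"
  by (induction k arbitrary: c) auto

lemma ck_on_linear:
  assumes "bounded_linear L"
  shows "ck_on k S L"
proof (cases k)
  case 0
  then show ?thesis using assms linear_continuous_on by auto
next
  case (Suc j)
  have "(L has_derivative L) (at x)" for x
    using assms bounded_linear_imp_has_derivative by blast
  then have "dd L x = L" "L differentiable (at x)" for x
    using dd_eq differentiable_def by blast+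
  then show ?thesis using Suc by (simp add: ck_on_const)
qed

lemma ck_on_comp_linear:
  assumes "bounded_linear L" "open S" "ck_on k S f"
  shows "ck_on k S (\<lambda>x. L (f x))"
  using assms(3)
proof (induction k arbitrary: f)
  case 0
  then show ?case using assms(1) by (simp add: bounded_linear.continuous_on)
next
  case (Suc k)
  have der: "((\<lambda>x. L (f x)) has_derivative (\<lambda>v. L (dd f x v))) (at x)" if "x \<in> S" for x
    using Suc.prems that by (auto intro!: bounded_linear.has_derivative[OF assms(1)] dd_works)
  have "ck_on k S (\<lambda>x. L (dd f x v))" for v using Suc by simp
  then have "ck_on k S (\<lambda>x. dd (\<lambda>x. L (f x)) x v)" for v
    using ck_on_cong[OF assms(2), of "\<lambda>x. dd (\<lambda>x. L (f x)) x v" "\<lambda>x. L (dd f x v)"] dd_eq[OF der]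
    by simp
  then show ?case using der by (auto intro: differentiableI)
qed

lemma ck_on_add:
  assumes "open S" "ck_on k S f" "ck_on k S g"
  shows "ck_on k S (\<lambda>x. f x + g x)"
  using assms(2,3)
proof (induction k arbitrary: f g)
  case 0
  then show ?case by (simp add: continuous_on_add)
next
  case (Suc k)
  have der: "((\<lambda>x. f x + g x) has_derivative (\<lambda>v. dd f x v + dd g x v)) (at x)" if "x \<in> S" for x
    using Suc.prems that by (auto intro!: has_derivative_add dd_works)
  have "ck_on k S (\<lambda>x. dd f x v + dd g x v)" for v using Suc by simp
  then have "ck_on k S (\<lambda>x. dd (\<lambda>x. f x + g x) x v)" for v
    using ck_on_cong[OF assms(1), of "\<lambda>x. dd (\<lambda>x. f x + g x) x v" "\<lambda>x. dd f x v + dd g x v"] dd_eq[OF der]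
    by simp
  then show ?case using der by (auto intro: differentiableI)
qed

lemma ck_on_bilinear:
  assumes "bounded_bilinear b" "open S" "ck_on k S f" "ck_on k S g"
  shows "ck_on k S (\<lambda>x. b (f x) (g x))"
  using assms(3,4)
proof (induction k arbitrary: f g)
  case 0
  then show ?case using assms(1) by (simp add: bounded_bilinear.continuous_on)
next
  case (Suc k)
  have der: "((\<lambda>x. b (f x) (g x)) has_derivative (\<lambda>v. b (f x) (dd g x v) + b (dd f x v) (g x))) (at x)"
    if "x \<in> S" for x
    using Suc.prems that by (auto intro!: bounded_bilinear.FDERIV[OF assms(1)] dd_works)
  have "ck_on k S (\<lambda>x. b (f x) (dd g x v) + b (dd f x v) (g x))" for v
    using Suc ck_on_mono by (intro ck_on_add[OF assms(2)]; simp only: ck_on.simps; blast)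
  then have "ck_on k S (\<lambda>x. dd (\<lambda>x. b (f x) (g x)) x v)" for v
    using ck_on_cong[OF assms(2), of "\<lambda>x. dd (\<lambda>x. b (f x) (g x)) x v"
      "\<lambda>x. b (f x) (dd g x v) + b (dd f x v) (g x)"] dd_eq[OF der]
    by simp
  then show ?case using der by (auto intro: differentiableI)
qed

lemma ck_on_sum:
  assumes "open S" "\<And>i. i \<in> I \<Longrightarrow> ck_on k S (f i)"
  shows "ck_on k S (\<lambda>x. \<Sum>i\<in>I. f i x)"
  using assms(2)
  by (induction I rule: infinite_finite_induct) (auto intro!: ck_on_const ck_on_add[OF assms(1)])

text \<open>The chain rule produces a derivative of \<open>f\<close> in a direction that varies with
  the point, which \<open>ck_on\<close> does not speak about. Expanding that direction in the basis
  leaves products of scalar functions with derivatives in fixed directions, and the induction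
  hypothesis applies to these.\<close>

lemma ck_on_compose:
  assumes "open S" "open T" "g ` S \<subseteq> T" "ck_on k S g" "ck_on k T f"
  shows "ck_on k S (\<lambda>x. f (g x))"
  using assms(4,5)
proof (induction k arbitrary: f)
  case 0
  then show ?case using assms(3) continuous_on_compose2 by auto
next
  case (Suc k)
  have der: "((\<lambda>x. f (g x)) has_derivative (\<lambda>v. dd f (g x) (dd g x v))) (at x)" if "x \<in> S" for x
    using Suc.prems that assms(3)
    by (intro has_derivative_compose[of g _ x UNIV f] dd_works) auto
  have eq: "dd f (g x) (dd g x v) = (\<Sum>b\<in>Basis. (dd g x v \<bullet> b) *\<^sub>R dd f (g x) b)" if "x \<in> S" for x v
  proof -
    have "g x \<in> T" using that assms(3) by blast
    then have "linear (dd f (g x))" using Suc.prems by (auto intro!: dd_linear)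
    then show ?thesis by (rule linear_basis_expand)
  qed
  have "ck_on k S (\<lambda>x. \<Sum>b\<in>Basis. (dd g x v \<bullet> b) *\<^sub>R dd f (g x) b)" for v
  proof (intro ck_on_sum[OF assms(1)] ck_on_bilinear[OF bounded_bilinear_scaleR assms(1)]
      ck_on_comp_linear[OF bounded_linear_inner_left assms(1)])
    show "ck_on k S (\<lambda>x. dd g x v)" using Suc.prems by simp
    fix b show "ck_on k S (\<lambda>x. dd f (g x) b)"
      using Suc.IH[of "\<lambda>y. dd f y b"] Suc.prems ck_on_mono by auto
  qed
  then have "ck_on k S (\<lambda>x. dd (\<lambda>x. f (g x)) x v)" for v
    using ck_on_cong[OF assms(1), of "\<lambda>x. dd (\<lambda>x. f (g x)) x v"
      "\<lambda>x. \<Sum>b\<in>Basis. (dd g x v \<bullet> b) *\<^sub>R dd f (g x) b"] dd_eq[OF der] eq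
    by simp
  then show ?case using der by (auto intro: differentiableI)
qed

section \<open>Closure properties of smooth functions\<close>

lemma smooth_on_cong:
  "open S \<Longrightarrow> (\<And>y. y \<in> S \<Longrightarrow> f y = g y) \<Longrightarrow> smooth_on S f \<longleftrightarrow> smooth_on S g"
  unfolding smooth_on_def using ck_on_cong by blast

lemma smooth_on_eq_on:
  "smooth_on S g \<Longrightarrow> open S \<Longrightarrow> (\<And>y. y \<in> S \<Longrightarrow> f y = g y) \<Longrightarrow> smooth_on S f"
  using smooth_on_cong[of S f g] by simp

lemma smooth_on_subset: "smooth_on S f \<Longrightarrow> T \<subseteq> S \<Longrightarrow> smooth_on T f"
  unfolding smooth_on_def using ck_on_subset by blast

lemma smooth_on_local:
  "(\<And>x. x \<in> S \<Longrightarrow> \<exists>U. open U \<and> x \<in> U \<and> smooth_on U f) \<Longrightarrow> smooth_on S f"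
  unfolding smooth_on_def by (meson ck_on_local)

lemma smooth_on_Un: "open S \<Longrightarrow> open T \<Longrightarrow> smooth_on S f \<Longrightarrow> smooth_on T f \<Longrightarrow> smooth_on (S \<union> T) f"
  by (rule smooth_on_local) blast

lemma smooth_on_compose:
  "smooth_on T f \<Longrightarrow> smooth_on S g \<Longrightarrow> open S \<Longrightarrow> open T \<Longrightarrow> (\<And>x. x \<in> S \<Longrightarrow> g x \<in> T) \<Longrightarrow>
    smooth_on S (\<lambda>x. f (g x))"
  unfolding smooth_on_def using ck_on_compose by (metis image_subsetI)

named_theorems smooth_intros

lemma smooth_on_const[smooth_intros]: "smooth_on S (\<lambda>x. c)"
  unfolding smooth_on_def using ck_on_const by blast

lemma smooth_on_bounded_linear: "bounded_linear L \<Longrightarrow> open S \<Longrightarrow> smooth_on S f \<Longrightarrow> smooth_on S (\<lambda>x. L (f x))"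
  unfolding smooth_on_def using ck_on_comp_linear by blast

lemma smooth_on_bilinear:
  "bounded_bilinear b \<Longrightarrow> open S \<Longrightarrow> smooth_on S f \<Longrightarrow> smooth_on S g \<Longrightarrow> smooth_on S (\<lambda>x. b (f x) (g x))"
  unfolding smooth_on_def using ck_on_bilinear by blast

lemma smooth_on_ident[smooth_intros]: "smooth_on S (\<lambda>x. x)"
  unfolding smooth_on_def using ck_on_linear bounded_linear_ident by blast

lemma smooth_on_add[smooth_intros]:
  "open S \<Longrightarrow> smooth_on S f \<Longrightarrow> smooth_on S g \<Longrightarrow> smooth_on S (\<lambda>x. f x + g x)"
  unfolding smooth_on_def using ck_on_add by blast

lemma smooth_on_sum[smooth_intros]:
  "open S \<Longrightarrow> (\<And>i. i \<in> I \<Longrightarrow> smooth_on S (f i)) \<Longrightarrow> smooth_on S (\<lambda>x. \<Sum>i\<in>I. f i x)"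
  by (simp add: smooth_on_def ck_on_sum)

lemma smooth_on_scaleR[smooth_intros]:
  "open S \<Longrightarrow> smooth_on S f \<Longrightarrow> smooth_on S g \<Longrightarrow> smooth_on S (\<lambda>x. f x *\<^sub>R g x)"
  by (rule smooth_on_bilinear[OF bounded_bilinear_scaleR])

lemma smooth_on_mult[smooth_intros]:
  fixes f g :: "'a::euclidean_space \<Rightarrow> real"
  shows "open S \<Longrightarrow> smooth_on S f \<Longrightarrow> smooth_on S g \<Longrightarrow> smooth_on S (\<lambda>x. f x * g x)"
  by (rule smooth_on_bilinear[OF bounded_bilinear_mult])

lemma smooth_on_minus[smooth_intros]: "open S \<Longrightarrow> smooth_on S f \<Longrightarrow> smooth_on S (\<lambda>x. - f x)"
  by (intro smooth_on_bounded_linear[of "\<lambda>x. - x"] bounded_linear_minus bounded_linear_ident)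

lemma smooth_on_diff[smooth_intros]:
  "open S \<Longrightarrow> smooth_on S f \<Longrightarrow> smooth_on S g \<Longrightarrow> smooth_on S (\<lambda>x. f x - g x)"
  using smooth_on_add[of S f "\<lambda>x. - g x"] smooth_on_minus by auto

lemma smooth_on_inner_left[smooth_intros]: "open S \<Longrightarrow> smooth_on S f \<Longrightarrow> smooth_on S (\<lambda>x. f x \<bullet> b)"
  by (rule smooth_on_bounded_linear[OF bounded_linear_inner_left])

lemma smooth_on_componentwise:
  "open S \<Longrightarrow> (\<And>b. b \<in> Basis \<Longrightarrow> smooth_on S (\<lambda>x. f x \<bullet> b)) \<Longrightarrow> smooth_on S f"
  using smooth_on_sum[of S Basis "\<lambda>b x. (f x \<bullet> b) *\<^sub>R b", OF _ smooth_on_scaleR[OF _ _ smooth_on_const]]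
  by (simp add: euclidean_representation)

lemma smooth_on_vec_nth[smooth_intros]:
  fixes f :: "'a::euclidean_space \<Rightarrow> 'b::euclidean_space ^ 'n"
  shows "open S \<Longrightarrow> smooth_on S f \<Longrightarrow> smooth_on S (\<lambda>x. f x $ i)"
  by (rule smooth_on_bounded_linear[OF bounded_linear_vec_nth])

lemma smooth_on_vec_lambda[smooth_intros]:
  fixes f :: "'n::finite \<Rightarrow> 'a::euclidean_space \<Rightarrow> 'b::euclidean_space"
  assumes "open S" "\<And>i. smooth_on S (f i)"
  shows "smooth_on S (\<lambda>x. \<chi> i. f i x)"
proof (rule smooth_on_componentwise[OF assms(1)])
  fix b :: "'b ^ 'n" assume "b \<in> Basis"
  then obtain i u where "b = axis i u" by (auto simp: Basis_vec_def)
  then show "smooth_on S (\<lambda>x. (\<chi> i. f i x) \<bullet> b)"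
    by (simp add: inner_axis smooth_on_inner_left assms)
qed

lemma smooth_on_Pair[smooth_intros]:
  assumes "open S" "smooth_on S f" "smooth_on S g"
  shows "smooth_on S (\<lambda>x. (f x, g x))"
proof (rule smooth_on_componentwise[OF assms(1)])
  fix b :: "'b \<times> 'c" assume "b \<in> Basis"
  show "smooth_on S (\<lambda>x. (f x, g x) \<bullet> b)"
    unfolding inner_prod_def fst_conv snd_conv
    by (intro smooth_on_add smooth_on_inner_left assms)
qed

lemma smooth_on_fst[smooth_intros]:
  fixes f :: "'a::euclidean_space \<Rightarrow> 'b::euclidean_space \<times> 'c::euclidean_space"
  shows "open S \<Longrightarrow> smooth_on S f \<Longrightarrow> smooth_on S (\<lambda>x. fst (f x))"
  by (rule smooth_on_bounded_linear[OF bounded_linear_fst])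

lemma smooth_on_snd[smooth_intros]:
  fixes f :: "'a::euclidean_space \<Rightarrow> 'b::euclidean_space \<times> 'c::euclidean_space"
  shows "open S \<Longrightarrow> smooth_on S f \<Longrightarrow> smooth_on S (\<lambda>x. snd (f x))"
  by (rule smooth_on_bounded_linear[OF bounded_linear_snd])

section \<open>Matrix-valued functions\<close>

lemma bounded_bilinear_matrix_vector_mult:
  "bounded_bilinear ((*v) :: real^'n^'m \<Rightarrow> real^'n \<Rightarrow> real^'m)"
  unfolding bilinear_conv_bounded_bilinear[symmetric] bilinear_def
  by (auto intro!: linearI simp: vec_eq_iff matrix_vector_mult_def sum.distrib sum_distrib_left
      algebra_simps)

lemma bounded_bilinear_matrix_mult:
  "bounded_bilinear ((**) :: real^'n^'m \<Rightarrow> real^'p^'n \<Rightarrow> real^'p^'m)"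
  unfolding bilinear_conv_bounded_bilinear[symmetric] bilinear_def
  by (auto intro!: linearI simp: vec_eq_iff matrix_matrix_mult_def sum.distrib sum_distrib_left
      algebra_simps)

lemma bounded_linear_trace: "bounded_linear (trace :: real^'n^'n \<Rightarrow> real)"
  unfolding linear_conv_bounded_linear[symmetric]
  by (auto intro!: linearI simp: trace_def sum.distrib sum_distrib_left)

lemma smooth_on_matrix_vector[smooth_intros]:
  fixes f :: "'a::euclidean_space \<Rightarrow> real^'n^'m"
  shows "open S \<Longrightarrow> smooth_on S f \<Longrightarrow> smooth_on S g \<Longrightarrow> smooth_on S (\<lambda>x. f x *v g x)"
  by (rule smooth_on_bilinear[OF bounded_bilinear_matrix_vector_mult])

lemma smooth_on_matrix_mult[smooth_intros]:
  fixes f :: "'a::euclidean_space \<Rightarrow> real^'n^'m"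
  shows "open S \<Longrightarrow> smooth_on S f \<Longrightarrow> smooth_on S g \<Longrightarrow> smooth_on S (\<lambda>x. f x ** g x)"
  by (rule smooth_on_bilinear[OF bounded_bilinear_matrix_mult])

lemma smooth_on_trace[smooth_intros]:
  fixes f :: "'a::euclidean_space \<Rightarrow> real^'n^'n"
  shows "open S \<Longrightarrow> smooth_on S f \<Longrightarrow> smooth_on S (\<lambda>x. trace (f x))"
  by (rule smooth_on_bounded_linear[OF bounded_linear_trace])

lemma smooth_on_Suc: "smooth_on S f \<Longrightarrow> ck_on (Suc k) S f"
  by (simp only: smooth_on_def)

lemma smooth_on_dd[smooth_intros]: "smooth_on S f \<Longrightarrow> smooth_on S (\<lambda>x. dd f x v)"
  using smooth_on_Suc[of S f] unfolding smooth_on_def[of S "\<lambda>x. dd f x v"] by simp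

lemma smooth_on_differentiable: "smooth_on S f \<Longrightarrow> x \<in> S \<Longrightarrow> f differentiable (at x)"
  using smooth_on_Suc[of S f 0] by simp

lemma smooth_on_has_derivative: "smooth_on S f \<Longrightarrow> x \<in> S \<Longrightarrow> (f has_derivative dd f x) (at x)"
  using smooth_on_differentiable dd_works by blast

lemma smooth_on_imp_continuous_on: "smooth_on S f \<Longrightarrow> continuous_on S f"
  unfolding smooth_on_def by (metis ck_on.simps(1))

lemma dd_basis_expand:
  assumes "f differentiable (at x)"
  shows "dd f x v = (\<Sum>b\<in>Basis. (v \<bullet> b) *\<^sub>R dd f x b)"
  by (rule linear_basis_expand[OF dd_linear[OF assms]])

lemma smooth_on_dd_dir[smooth_intros]:
  assumes "open S" "smooth_on S f" "smooth_on S g"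
  shows "smooth_on S (\<lambda>x. dd f x (g x))"
proof -
  have "smooth_on S (\<lambda>x. \<Sum>b\<in>Basis. (g x \<bullet> b) *\<^sub>R dd f x b)"
    by (intro smooth_intros assms)
  moreover have "dd f x (g x) = (\<Sum>b\<in>Basis. (g x \<bullet> b) *\<^sub>R dd f x b)" if "x \<in> S" for x
    by (rule dd_basis_expand[OF smooth_on_differentiable[OF assms(2) that]])
  ultimately show ?thesis by (rule smooth_on_eq_on[OF _ assms(1)])
qed

lemma smooth_on_matrix_dd[smooth_intros]:
  fixes f :: "real^'n \<Rightarrow> real^'m"
  assumes "open S" "smooth_on S f"
  shows "smooth_on S (\<lambda>x. matrix (dd f x))"
  unfolding matrix_def by (intro smooth_intros assms)

lemma smooth_on_jacobian[smooth_intros]: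
  fixes f :: "real^'n \<Rightarrow> real^'m"
  assumes "open S" "smooth_on S f"
  shows "smooth_on S (\<lambda>x. jacobian f (at x))"
  unfolding jacobian_def by (intro smooth_intros assms)

text \<open>Only orders below \<open>k\<close> of the composite with the derivative are assumed. For
  \<open>exp\<close> and the reciprocal, whose derivatives are polynomials in the function itself,
  this lets strong induction on the order close the circle.\<close>

lemma ck_on_real_comp:
  assumes "open S" "\<And>j. j < k \<Longrightarrow> ck_on j S f \<Longrightarrow> ck_on j S (\<lambda>x. h' (f x))" "ck_on k S f"
    "\<And>x. x \<in> S \<Longrightarrow> (h has_real_derivative h' (f x)) (at (f x))"
  shows "ck_on k S (\<lambda>x. h (f x))"
proof (cases k)
  case 0
  then have "continuous_on S f" using assms by simp
  then have "isCont (\<lambda>x. h (f x)) x" if "x \<in> S" for x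
    using isCont_o2[where f = f and g = h and a = x, OF _ DERIV_isCont[OF assms(4)[OF that]]]
      continuous_on_eq_continuous_at[OF assms(1), of f] that by simp
  then show ?thesis using 0 by (simp add: continuous_at_imp_continuous_on)
next
  case (Suc j)
  then have f: "ck_on j S f" "\<And>v. ck_on j S (\<lambda>x. dd f x v)" "\<And>x. x \<in> S \<Longrightarrow> f differentiable (at x)"
    using assms(3) ck_on_mono by auto
  have der: "((\<lambda>x. h (f x)) has_derivative (\<lambda>v. h' (f x) * dd f x v)) (at x)" if "x \<in> S" for x
    using has_derivative_compose[OF dd_works[OF f(3)[OF that]], of h] assms(4)[OF that]
    by (simp add: has_field_derivative_def)
  have "ck_on j S (\<lambda>x. h' (f x) * dd f x v)" for v
    using f assms(2)[of j] Suc by (intro ck_on_bilinear[OF bounded_bilinear_mult assms(1)]) auto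
  then have "ck_on j S (\<lambda>x. dd (\<lambda>x. h (f x)) x v)" for v
    using ck_on_cong[OF assms(1), of "\<lambda>x. dd (\<lambda>x. h (f x)) x v" "\<lambda>x. h' (f x) * dd f x v"] dd_eq[OF der]
    by simp
  then show ?thesis using der Suc by (auto intro: differentiableI)
qed

lemma smooth_on_exp[smooth_intros]:
  assumes "open S" "smooth_on S f"
  shows "smooth_on S (\<lambda>x. exp (f x :: real))"
proof -
  have f: "ck_on k S f" for k using assms(2) by (simp add: smooth_on_def)
  have "ck_on k S (\<lambda>x. exp (f x :: real))" for k
  proof (induction k rule: less_induct)
    case (less k)
    show ?case
      using ck_on_real_comp[OF assms(1), of k f exp exp] less f DERIV_exp by blast
  qed
  then show ?thesis by (simp add: smooth_on_def)
qed

lemma smooth_on_inverse[smooth_intros]: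
  assumes "open S" "smooth_on S f" "\<And>x. x \<in> S \<Longrightarrow> f x \<noteq> 0"
  shows "smooth_on S (\<lambda>x. inverse (f x :: real))"
proof -
  have f: "ck_on k S f" for k using assms(2) by (simp add: smooth_on_def)
  have "ck_on k S (\<lambda>x. inverse (f x :: real))" for k
  proof (induction k rule: less_induct)
    case (less k)
    have 1: "ck_on j S (\<lambda>x. - (inverse (f x) * inverse (f x)))" if "j < k" for j
      using ck_on_comp_linear[OF bounded_linear_minus[OF bounded_linear_ident] assms(1)
          ck_on_bilinear[OF bounded_bilinear_mult assms(1) less[OF that] less[OF that]]] .
    have 2: "(inverse has_real_derivative - (inverse (f x) * inverse (f x))) (at (f x))" if "x \<in> S" for x
      using DERIV_inverse[OF assms(3)[OF that]] by (simp add: power2_eq_square)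
    show ?case
      using ck_on_real_comp[OF assms(1), of k f "\<lambda>y. - (inverse y * inverse y)" inverse] 1 2 f by blast
  qed
  then show ?thesis by (simp add: smooth_on_def)
qed

lemma smooth_on_divide[smooth_intros]:
  fixes f g :: "'a::euclidean_space \<Rightarrow> real"
  shows "open S \<Longrightarrow> smooth_on S f \<Longrightarrow> smooth_on S g \<Longrightarrow> (\<And>x. x \<in> S \<Longrightarrow> g x \<noteq> 0) \<Longrightarrow> smooth_on S (\<lambda>x. f x / g x)"
  unfolding divide_inverse by (intro smooth_intros)

subsection \<open>Symmetry of second derivatives\<close>

text \<open>The mean value theorem is used twice: first in direction \<open>u\<close> for the
  difference of \<open>f\<close> across the edge \<open>h *\<^sub>R v\<close>, then in direction
  \<open>v\<close> for the resulting derivative. Convexity keeps the whole parallelogram inside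
  \<open>S\<close>.\<close>

lemma second_difference_mvt:
  fixes f :: "'a::euclidean_space \<Rightarrow> real"
  assumes S: "convex S" "open S" and f: "ck_on 2 S f" and h: "h > 0"
    and in_S: "x \<in> S" "x + h *\<^sub>R u \<in> S" "x + h *\<^sub>R v \<in> S" "x + h *\<^sub>R u + h *\<^sub>R v \<in> S"
  obtains s t where "0 < s" "s < h" "0 < t" "t < h"
    "f (x + h *\<^sub>R u + h *\<^sub>R v) - f (x + h *\<^sub>R u) - f (x + h *\<^sub>R v) + f x
     = h * h * dd (\<lambda>y. dd f y u) (x + s *\<^sub>R u + t *\<^sub>R v) v"
proof -
  have f1: "f differentiable (at y)" "(\<lambda>y. dd f y u) differentiable (at y)" if "y \<in> S" for y
    using f that by (auto simp: numeral_2_eq_2)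
  have inS: "x + s *\<^sub>R u + t *\<^sub>R v \<in> S" if "0 \<le> s" "s \<le> h" "0 \<le> t" "t \<le> h" for s t
  proof -
    have 1: "x + s *\<^sub>R u + c *\<^sub>R v \<in> S" if c: "x + c *\<^sub>R v \<in> S" "x + h *\<^sub>R u + c *\<^sub>R v \<in> S" for c
    proof -
      have "x + s *\<^sub>R u + c *\<^sub>R v = (1 - s / h) *\<^sub>R (x + c *\<^sub>R v) + (s / h) *\<^sub>R (x + h *\<^sub>R u + c *\<^sub>R v)"
        using h by (simp add: algebra_simps)
      then show ?thesis using convexD_alt[OF S(1) c, of "s / h"] h \<open>0 \<le> s\<close> \<open>s \<le> h\<close> by simp
    qed
    have "x + s *\<^sub>R u \<in> S" "x + s *\<^sub>R u + h *\<^sub>R v \<in> S" using 1[of 0] 1[of h] in_S by auto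
    moreover have "x + s *\<^sub>R u + t *\<^sub>R v = (1 - t / h) *\<^sub>R (x + s *\<^sub>R u) + (t / h) *\<^sub>R (x + s *\<^sub>R u + h *\<^sub>R v)"
      using h by (simp add: algebra_simps)
    ultimately show ?thesis using convexD_alt[OF S(1), of _ _ "t / h"] h \<open>0 \<le> t\<close> \<open>t \<le> h\<close> by simp
  qed
  define g where "g = (\<lambda>s. f (x + s *\<^sub>R u + h *\<^sub>R v) - f (x + s *\<^sub>R u))"
  have gder: "(g has_real_derivative dd f (x + s *\<^sub>R u + h *\<^sub>R v) u - dd f (x + s *\<^sub>R u) u) (at s)"
    if "0 \<le> s" "s \<le> h" for s
  proof -
    have f': "(f has_derivative dd f (x + s *\<^sub>R u + h *\<^sub>R v)) (at (x + s *\<^sub>R u + h *\<^sub>R v))"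
      "(f has_derivative dd f (x + s *\<^sub>R u)) (at (x + s *\<^sub>R u))"
      using inS[OF that, of h] inS[OF that, of 0] h f1 dd_works by auto
    have l: "((\<lambda>s. x + s *\<^sub>R u + h *\<^sub>R v) has_derivative (\<lambda>k. k *\<^sub>R u)) (at s)"
      "((\<lambda>s. x + s *\<^sub>R u) has_derivative (\<lambda>k. k *\<^sub>R u)) (at s)"
      by (auto intro!: derivative_eq_intros)
    have "(g has_derivative (\<lambda>k. dd f (x + s *\<^sub>R u + h *\<^sub>R v) (k *\<^sub>R u) - dd f (x + s *\<^sub>R u) (k *\<^sub>R u))) (at s)"
      unfolding g_def
      using has_derivative_diff[OF has_derivative_compose[OF l(1) f'(1)] has_derivative_compose[OF l(2) f'(2)]] .
    moreover have "dd f y (k *\<^sub>R u) = dd f y u * k" if "y \<in> S" for y k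
      using dd_linear[OF f1(1)[OF that]] by (simp add: linear_scale)
    ultimately show ?thesis
      using inS[OF that, of h] inS[OF that, of 0] h
      by (simp add: has_field_derivative_def algebra_simps)
        (erule has_derivative_eq_rhs, simp add: fun_eq_iff algebra_simps)
  qed
  obtain s where s: "0 < s" "s < h" "g h - g 0 = h * (dd f (x + s *\<^sub>R u + h *\<^sub>R v) u - dd f (x + s *\<^sub>R u) u)"
    using MVT2[OF h, of g "\<lambda>s. dd f (x + s *\<^sub>R u + h *\<^sub>R v) u - dd f (x + s *\<^sub>R u) u"] gder by auto
  have kder: "((\<lambda>t. dd f (x + s *\<^sub>R u + t *\<^sub>R v) u) has_real_derivative dd (\<lambda>y. dd f y u) (x + s *\<^sub>R u + t *\<^sub>R v) v) (at t)"
    if "0 \<le> t" "t \<le> h" for t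
  proof -
    have S': "x + s *\<^sub>R u + t *\<^sub>R v \<in> S" using inS s that by simp
    have "((\<lambda>t. x + s *\<^sub>R u + t *\<^sub>R v) has_derivative (\<lambda>k. k *\<^sub>R v)) (at t)"
      by (auto intro!: derivative_eq_intros)
    from has_derivative_compose[OF this dd_works[OF f1(2)[OF S']]]
    show ?thesis
      unfolding has_field_derivative_def
      by (rule has_derivative_eq_rhs) (use dd_linear[OF f1(2)[OF S']] in \<open>simp add: fun_eq_iff linear_scale mult.commute\<close>)
  qed
  obtain t where t: "0 < t" "t < h" "dd f (x + s *\<^sub>R u + h *\<^sub>R v) u - dd f (x + s *\<^sub>R u) u = h * dd (\<lambda>y. dd f y u) (x + s *\<^sub>R u + t *\<^sub>R v) v"
    using MVT2[OF h, of "\<lambda>t. dd f (x + s *\<^sub>R u + t *\<^sub>R v) u" "\<lambda>t. dd (\<lambda>y. dd f y u) (x + s *\<^sub>R u + t *\<^sub>R v) v"] kder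
    by auto
  show ?thesis
    by (rule that[OF s(1,2) t(1,2)]) (use s(3) t(3) in \<open>simp add: g_def\<close>)
qed

text \<open>The second difference of \<open>f\<close> over a parallelogram does not depend on the
  order of \<open>u\<close> and \<open>v\<close>, so the two mixed derivatives agree at suitable
  points of every small parallelogram. By continuity a gap at \<open>x\<close> would persist at
  these points.\<close>

lemma dd_symmetric_real:
  fixes f :: "'a::euclidean_space \<Rightarrow> real"
  assumes "open S" "ck_on 2 S f" "x \<in> S"
  shows "dd (\<lambda>y. dd f y u) x v = dd (\<lambda>y. dd f y v) x u"
proof (rule ccontr)
  define F where "F = (\<lambda>y. dd (\<lambda>y. dd f y u) y v)"
  define G where "G = (\<lambda>y. dd (\<lambda>y. dd f y v) y u)"
  assume "dd (\<lambda>y. dd f y u) x v \<noteq> dd (\<lambda>y. dd f y v) x u"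
  then have e: "\<bar>F x - G x\<bar> / 2 > 0" by (simp add: F_def G_def)
  have "continuous_on S F" "continuous_on S G"
    using assms(2) by (auto simp: F_def G_def numeral_2_eq_2)
  then have "isCont F x" "isCont G x"
    using assms(1,3) continuous_on_eq_continuous_at by blast+
  then obtain d1 d2 where d: "d1 > 0" "d2 > 0" "\<And>y. dist y x < d1 \<Longrightarrow> \<bar>F y - F x\<bar> < \<bar>F x - G x\<bar> / 2"
    "\<And>y. dist y x < d2 \<Longrightarrow> \<bar>G y - G x\<bar> < \<bar>F x - G x\<bar> / 2"
    using e unfolding continuous_at_eps_delta real_norm_def dist_real_def by blast
  obtain r where r: "r > 0" "ball x r \<subseteq> S" using assms openE by metis
  define R where "R = min r (min d1 d2)"
  have R: "R > 0" "ball x R \<subseteq> S" using r d by (auto simp: R_def)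
  \<comment> \<open>The summand 1 avoids a zero denominator when both directions vanish; the factor
    2 leaves the parallelogram strictly inside the ball.\<close>
  define h where "h = R / (2 * (norm u + norm v + 1))"
  have nn: "norm u + norm v + 1 > 0" by (smt (verit) norm_ge_zero)
  have h: "h > 0" using R nn by (simp add: h_def)
  have hb: "h * (norm u + norm v) < R"
  proof -
    have "h * (norm u + norm v) \<le> h * (norm u + norm v + 1)" using h by simp
    also have "\<dots> = R / 2" using nn by (simp add: h_def field_simps)
    finally show ?thesis using R by simp
  qed
  have inb: "dist (x + s *\<^sub>R u + t *\<^sub>R v) x < R" if "0 \<le> s" "s \<le> h" "0 \<le> t" "t \<le> h" for s t
  proof -
    have "dist (x + s *\<^sub>R u + t *\<^sub>R v) x = norm (s *\<^sub>R u + t *\<^sub>R v)" by (simp add: dist_norm)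
    also have "\<dots> \<le> s * norm u + t * norm v" using that norm_triangle_ineq[of "s *\<^sub>R u" "t *\<^sub>R v"] by simp
    also have "\<dots> \<le> h * norm u + h * norm v" using that by (intro add_mono mult_right_mono) auto
    finally show ?thesis using hb by (simp add: algebra_simps)
  qed
  have ins: "x + s *\<^sub>R u + t *\<^sub>R v \<in> ball x R" if "0 \<le> s" "s \<le> h" "0 \<le> t" "t \<le> h" for s t
    using inb[OF that] by (simp add: dist_commute)
  have ck: "ck_on 2 (ball x R) f" using assms R ck_on_subset by blast
  have pts: "x \<in> ball x R" "x + h *\<^sub>R u \<in> ball x R" "x + h *\<^sub>R v \<in> ball x R" "x + h *\<^sub>R u + h *\<^sub>R v \<in> ball x R"
    "x + h *\<^sub>R v + h *\<^sub>R u \<in> ball x R"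
    using ins[of 0 0] ins[of h 0] ins[of 0 h] ins[of h h] h by (auto simp: algebra_simps)
  obtain s t where st: "0 < s" "s < h" "0 < t" "t < h"
    "f (x + h *\<^sub>R u + h *\<^sub>R v) - f (x + h *\<^sub>R u) - f (x + h *\<^sub>R v) + f x = h * h * F (x + s *\<^sub>R u + t *\<^sub>R v)"
    using second_difference_mvt[OF convex_ball open_ball ck h pts(1-4)] unfolding F_def by blast
  obtain s' t' where st': "0 < s'" "s' < h" "0 < t'" "t' < h"
    "f (x + h *\<^sub>R v + h *\<^sub>R u) - f (x + h *\<^sub>R v) - f (x + h *\<^sub>R u) + f x = h * h * G (x + s' *\<^sub>R v + t' *\<^sub>R u)"
    using second_difference_mvt[OF convex_ball open_ball ck h pts(1,3,2,5)] unfolding G_def by blast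
  have "h * h * F (x + s *\<^sub>R u + t *\<^sub>R v) = h * h * G (x + s' *\<^sub>R v + t' *\<^sub>R u)"
    using st(5) st'(5) by (simp add: algebra_simps)
  then have "F (x + s *\<^sub>R u + t *\<^sub>R v) = G (x + s' *\<^sub>R v + t' *\<^sub>R u)" using h by simp
  moreover have "\<bar>F (x + s *\<^sub>R u + t *\<^sub>R v) - F x\<bar> < \<bar>F x - G x\<bar> / 2"
    using d(3) inb[of s t] st by (simp add: R_def)
  moreover have "\<bar>G (x + s' *\<^sub>R v + t' *\<^sub>R u) - G x\<bar> < \<bar>F x - G x\<bar> / 2"
    using d(4) inb[of t' s'] st' by (simp add: R_def algebra_simps)
  ultimately show False by (auto simp: abs_if split: if_splits)
qed

lemma dd_symmetric:
  fixes f :: "'a::euclidean_space \<Rightarrow> 'b::euclidean_space"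
  assumes "open S" "smooth_on S f" "x \<in> S"
  shows "dd (\<lambda>y. dd f y u) x v = dd (\<lambda>y. dd f y v) x u"
proof (rule euclidean_eqI)
  fix b :: 'b
  have *: "dd (\<lambda>y. dd (\<lambda>z. f z \<bullet> b) y u) x v = dd (\<lambda>y. dd f y u) x v \<bullet> b" for u v
  proof -
    have 1: "dd (\<lambda>z. f z \<bullet> b) y u = dd f y u \<bullet> b" if "y \<in> S" for y
      using dd_eq[OF has_derivative_inner_left[OF smooth_on_has_derivative[OF assms(2) that]]] by simp
    have "dd (\<lambda>y. dd (\<lambda>z. f z \<bullet> b) y u) x = dd (\<lambda>y. dd f y u \<bullet> b) x"
      by (rule dd_cong[OF assms(1,3) 1])
    then show ?thesis
      using dd_eq[OF has_derivative_inner_left[OF smooth_on_has_derivative[OF smooth_on_dd[OF assms(2)] assms(3)]]] by simp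
  qed
  have "ck_on 2 S (\<lambda>z. f z \<bullet> b)"
    using smooth_on_inner_left[OF assms(1,2)] by (simp add: smooth_on_def)
  from dd_symmetric_real[OF assms(1) this assms(3), of u v]
  show "dd (\<lambda>y. dd f y u) x v \<bullet> b = dd (\<lambda>y. dd f y v) x u \<bullet> b"
    by (simp add: *)
qed

section \<open>Alternating forms\<close>

definition omit :: "nat \<Rightarrow> (nat \<Rightarrow> 'a) \<Rightarrow> nat \<Rightarrow> 'a" where
  "omit i w = (\<lambda>j. w (if j < i then j else Suc j))"

lemma alternating_form_cong:
  "alternating_form k g \<Longrightarrow> (\<And>i. i < k \<Longrightarrow> w i = w' i) \<Longrightarrow> g w = g w'"
  unfolding alternating_form_def by blast

lemma alternating_form_linear: "alternating_form k g \<Longrightarrow> i < k \<Longrightarrow> linear (\<lambda>x. g (w(i := x)))"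
  unfolding alternating_form_def by blast

lemma alternating_form_repeat:
  "alternating_form k g \<Longrightarrow> i < k \<Longrightarrow> j < k \<Longrightarrow> i \<noteq> j \<Longrightarrow> w i = w j \<Longrightarrow> g w = 0"
  unfolding alternating_form_def by blast

lemma alternating_form_expand:
  assumes "alternating_form k g" "i < k"
  shows "g (w(i := v)) = (\<Sum>b\<in>Basis. (v \<bullet> b) * g (w(i := b)))"
  using linear_basis_expand[OF alternating_form_linear[OF assms], of w v] by simp

text \<open>Polarisation: the value with \<open>x + y\<close> in both slots is zero, and so are the
  two diagonal terms of its expansion.\<close>

lemma alternating_form_swap:
  assumes "alternating_form k g" "i < k" "j < k" "i \<noteq> j"
  shows "g (w(i := x, j := y)) = - g (w(i := y, j := x))"
proof -
  have lin: "g (w(i := a + b, j := c)) = g (w(i := a, j := c)) + g (w(i := b, j := c))"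
    "g (w(i := c, j := a + b)) = g (w(i := c, j := a)) + g (w(i := c, j := b))" for a b c
    using linear_add[OF alternating_form_linear[OF assms(1,2), of "w(j := c)"], of a b]
      linear_add[OF alternating_form_linear[OF assms(1,3), of "w(i := c)"], of a b] assms(4)
    by (simp_all add: fun_upd_twist)
  have zero: "g (w(i := a, j := a)) = 0" for a
    using alternating_form_repeat[OF assms] assms(4) by simp
  from lin(1)[of x y "x + y"] lin(2)[of x x y] lin(2)[of y x y] zero[of x] zero[of y] zero[of "x + y"]
  show ?thesis by simp
qed

lemma alternating_form_transpose:
  assumes "alternating_form k g" "i < k" "j < k" "i \<noteq> j"
  shows "g (w \<circ> Transposition.transpose i j) = - g w"
proof -
  have "w \<circ> Transposition.transpose i j = w(i := w j, j := w i)"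
    using assms(4) by (auto simp: fun_eq_iff Transposition.transpose_def)
  moreover have "w = w(i := w i, j := w j)" by auto
  ultimately show ?thesis using alternating_form_swap[OF assms, of w "w j" "w i"] by simp
qed

lemma alternating_form_permutes:
  assumes "alternating_form k g" "\<sigma> permutes {..<k}"
  shows "g (\<lambda>i. w (\<sigma> i)) = of_int (sign \<sigma>) * g w"
  using finite_lessThan assms(2)
proof (induction \<sigma> arbitrary: w rule: permutes_rev_induct)
  case id
  then show ?case by (simp add: sign_id id_def)
next
  case (swap a b p)
  have "p permutes {..<k}" using swap by simp
  then have perm: "permutation p" using permutation_permutes finite_lessThan by blast
  show ?case
  proof (cases "a = b")
    case False
    have "g (\<lambda>i. w ((p \<circ> Transposition.transpose a b) i)) = g ((\<lambda>i. w (p i)) \<circ> Transposition.transpose a b)"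
      by (simp add: o_def)
    also have "\<dots> = - g (\<lambda>i. w (p i))"
      using alternating_form_transpose[OF assms(1), of a b] swap False by simp
    also have "\<dots> = of_int (sign (p \<circ> Transposition.transpose a b)) * g w"
      using swap False perm by (simp add: sign_compose permutation_swap_id sign_swap_id)
    finally show ?thesis .
  qed (use swap in simp)
qed

text \<open>Each exchange with the left neighbour costs a sign, and the entry at position
  \<open>i\<close> passes \<open>i\<close> neighbours while the others keep their order.\<close>

lemma alternating_form_move_front:
  assumes "alternating_form (Suc k) g" "i \<le> k"
  shows "g w = (-1) ^ i * g (case_nat (w i) (omit i w))"
  using assms(2)
proof (induction i arbitrary: w)
  case 0
  have "w = case_nat (w 0) (omit 0 w)" by (auto simp: omit_def fun_eq_iff split: nat.split)
  then show ?case by simp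
next
  case (Suc i)
  define w' where "w' = w \<circ> Transposition.transpose i (Suc i)"
  have "omit i w' = omit (Suc i) w" "w' i = w (Suc i)"
    by (auto simp: omit_def w'_def fun_eq_iff Transposition.transpose_def less_Suc_eq)
  moreover have "g w' = - g w"
    unfolding w'_def by (rule alternating_form_transpose[OF assms(1)]) (use Suc in auto)
  moreover have "g w' = (-1) ^ i * g (case_nat (w' i) (omit i w'))"
    using Suc.IH[of w'] Suc.prems by linarith
  ultimately show ?case by (metis minus_equation_iff mult_minus_left power_Suc mult_1)
qed

lemma alternating_form_upd:
  assumes "alternating_form k g" "m < k"
  shows "g (w(m := s)) = (-1) ^ m * g (case_nat s (omit m w))"
proof -
  obtain j where k: "k = Suc j" using assms(2) by (cases k) auto
  have "omit m (w(m := s)) = omit m w" by (auto simp: omit_def fun_eq_iff)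
  then show ?thesis
    using alternating_form_move_front[of j g m "w(m := s)"] assms k by simp
qed

lemma alternating_form_precomp:
  fixes M :: "real^'a::finite^'b::finite"
  assumes "alternating_form k g"
  shows "alternating_form k (\<lambda>w. g (\<lambda>i. M *v w i))"
  unfolding alternating_form_def
proof (intro conjI allI impI)
  fix w w' :: "nat \<Rightarrow> real^'a" assume "\<forall>i<k. w i = w' i"
  then show "g (\<lambda>i. M *v w i) = g (\<lambda>i. M *v w' i)"
    using alternating_form_cong[OF assms] by (metis (mono_tags, lifting))
next
  fix w :: "nat \<Rightarrow> real^'a" and i assume i: "i < k"
  have "(\<lambda>x. g (\<lambda>j. M *v (w(i := x)) j)) = (\<lambda>x. g ((\<lambda>j. M *v w j)(i := x))) \<circ> (\<lambda>x. M *v x)"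
    by (auto simp: fun_eq_iff intro!: arg_cong[of _ _ g])
  then show "linear (\<lambda>x. g (\<lambda>j. M *v (w(i := x)) j))"
    using linear_compose[OF matrix_vector_mul_linear alternating_form_linear[OF assms i]] by metis
next
  fix w :: "nat \<Rightarrow> real^'a" and i j assume "i < k" "j < k" "i \<noteq> j \<and> w i = w j"
  then show "g (\<lambda>i. M *v w i) = 0" using alternating_form_repeat[OF assms, of i j] by simp
qed

text \<open>Smoothness is known for constant arguments. The arguments are made variable one slot at
  a time: linearity in that slot turns the moving argument into smooth coefficients in front of
  basis vectors.\<close>

lemma alternating_form_smooth:
  fixes F :: "'a::euclidean_space \<Rightarrow> (nat \<Rightarrow> real^'d::finite) \<Rightarrow> real"
  assumes alt: "\<And>x. alternating_form k (F x)" and S: "open S"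
    and F: "\<And>w. smooth_on S (\<lambda>x. F x w)" and W: "\<And>i. smooth_on S (W i)"
  shows "smooth_on S (\<lambda>x. F x (\<lambda>i. W i x))"
proof -
  have "smooth_on S (\<lambda>x. F x (\<lambda>i. if i < m then W i x else w i))" if "m \<le> k" for m w
    using that
  proof (induction m arbitrary: w)
    case 0
    then show ?case using F by simp
  next
    case (Suc m)
    have "(\<lambda>i. if i < Suc m then W i x else w i) = (\<lambda>i. if i < m then W i x else w i)(m := W m x)" for x
      by (auto simp: fun_eq_iff)
    moreover have "(\<lambda>i. if i < m then W i x else w i)(m := b) = (\<lambda>i. if i < m then W i x else (w(m := b)) i)" for x b
      by (auto simp: fun_eq_iff)
    ultimately have "F x (\<lambda>i. if i < Suc m then W i x else w i)
      = (\<Sum>b\<in>Basis. (W m x \<bullet> b) * F x (\<lambda>i. if i < m then W i x else (w(m := b)) i))" for x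
      using alternating_form_expand[OF alt, where i = m and w = "\<lambda>i. if i < m then W i x else w i" and v = "W m x"] Suc.prems by simp
    then show ?case
      using Suc by (auto intro!: smooth_intros S W)
  qed
  from this[of k] have "smooth_on S (\<lambda>x. F x (\<lambda>i. if i < k then W i x else 0))" by simp
  moreover have "F x (\<lambda>i. if i < k then W i x else 0) = F x (\<lambda>i. W i x)" for x
    by (rule alternating_form_cong[OF alt]) simp
  ultimately show ?thesis by simp
qed

text \<open>Product rule for a multilinear expression whose coefficients move as well. As for
  smoothness, the slots are treated successively, and the base of the induction is the derivative
  with all arguments frozen.\<close>

lemma alternating_form_has_derivative:
  fixes F :: "'a::euclidean_space \<Rightarrow> (nat \<Rightarrow> real^'d::finite) \<Rightarrow> real"
  assumes alt: "\<And>x. alternating_form k (F x)" 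
    and F: "\<And>w. (\<lambda>x. F x w) differentiable (at x0)"
    and W: "\<And>i. i < k \<Longrightarrow> (W i has_derivative W' i) (at x0)"
  shows "((\<lambda>x. F x (\<lambda>i. W i x)) has_derivative
    (\<lambda>h. dd (\<lambda>x. F x (\<lambda>i. W i x0)) x0 h + (\<Sum>i<k. F x0 ((\<lambda>j. W j x0)(i := W' i h))))) (at x0)"
proof -
  have *: "((\<lambda>x. F x (\<lambda>i. if i < m then W i x else w i)) has_derivative
    (\<lambda>h. dd (\<lambda>x. F x (\<lambda>i. if i < m then W i x0 else w i)) x0 h
      + (\<Sum>i<m. F x0 ((\<lambda>i. if i < m then W i x0 else w i)(i := W' i h))))) (at x0)" if "m \<le> k" for m w
    using that
  proof (induction m arbitrary: w)
    case 0
    then show ?case using dd_works[OF F] by simp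
  next
    case (Suc m)
    define c where "c = (\<lambda>b x i. if i < m then W i x else (w(m := b)) i)"
    have cS: "(\<lambda>i. if i < Suc m then W i x else w i) = (c b x)(m := W m x)" for x b
      by (auto simp: fun_eq_iff c_def)
    have cm: "(c b x)(m := b') = c b' x" for b b' x by (auto simp: fun_eq_iff c_def)
    have expand: "F y ((c b' x)(m := v)) = (\<Sum>b\<in>Basis. (v \<bullet> b) * F y (c b x))" for x y b' v
      using alternating_form_expand[OF alt, where i = m and w = "c b' x" and v = v] Suc.prems by (simp add: cm)
    have IH: "((\<lambda>x. F x (c b x)) has_derivative
       (\<lambda>h. dd (\<lambda>x. F x (c b x0)) x0 h + (\<Sum>i<m. F x0 ((c b x0)(i := W' i h))))) (at x0)" for b
      unfolding c_def by (rule Suc.IH) (use Suc.prems in simp)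
    have "((\<lambda>x. \<Sum>b\<in>Basis. (W m x \<bullet> b) * F x (c b x)) has_derivative
      (\<lambda>h. \<Sum>b\<in>Basis. (W m x0 \<bullet> b) * (dd (\<lambda>x. F x (c b x0)) x0 h + (\<Sum>i<m. F x0 ((c b x0)(i := W' i h))))
         + (W' m h \<bullet> b) * F x0 (c b x0))) (at x0)"
      using Suc.prems by (intro has_derivative_sum has_derivative_mult has_derivative_inner_left IH W) auto
    moreover have "(\<lambda>x. F x (\<lambda>i. if i < Suc m then W i x else w i)) = (\<lambda>x. \<Sum>b\<in>Basis. (W m x \<bullet> b) * F x (c b x))"
      unfolding cS[of _ 0] expand ..
    moreover have "(\<Sum>b\<in>Basis. (W m x0 \<bullet> b) * (dd (\<lambda>x. F x (c b x0)) x0 h + (\<Sum>i<m. F x0 ((c b x0)(i := W' i h))))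
         + (W' m h \<bullet> b) * F x0 (c b x0)) =
       dd (\<lambda>x. F x (\<lambda>i. if i < Suc m then W i x0 else w i)) x0 h
      + (\<Sum>i<Suc m. F x0 ((\<lambda>i. if i < Suc m then W i x0 else w i)(i := W' i h)))" (is "?L = ?R") for h
    proof -
      have 1: "dd (\<lambda>x. F x (\<lambda>i. if i < Suc m then W i x0 else w i)) x0 h
        = (\<Sum>b\<in>Basis. (W m x0 \<bullet> b) * dd (\<lambda>x. F x (c b x0)) x0 h)"
      proof -
        have d: "((\<lambda>x. \<Sum>b\<in>Basis. (W m x0 \<bullet> b) * F x (c b x0)) has_derivative
           (\<lambda>h. \<Sum>b\<in>Basis. (W m x0 \<bullet> b) * dd (\<lambda>x. F x (c b x0)) x0 h)) (at x0)"
          by (intro has_derivative_sum has_derivative_mult_right dd_works F)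
        have e: "(\<lambda>x. F x (\<lambda>i. if i < Suc m then W i x0 else w i))
            = (\<lambda>x. \<Sum>b\<in>Basis. (W m x0 \<bullet> b) * F x (c b x0))"
          unfolding cS[of _ 0] expand ..
        show ?thesis unfolding e dd_eq[OF d] ..
      qed
      have 2: "F x0 ((\<lambda>i. if i < Suc m then W i x0 else w i)(m := W' m h))
        = (\<Sum>b\<in>Basis. (W' m h \<bullet> b) * F x0 (c b x0))"
        using expand[of x0 0 x0 "W' m h"] cS[of x0 0] by simp
      have 3: "F x0 ((\<lambda>i. if i < Suc m then W i x0 else w i)(i := W' i h))
        = (\<Sum>b\<in>Basis. (W m x0 \<bullet> b) * F x0 ((c b x0)(i := W' i h)))" if "i < m" for i
      proof -
        have "(\<lambda>i. if i < Suc m then W i x0 else w i)(i := W' i h) = ((c 0 x0)(i := W' i h))(m := W m x0)"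
          using cS[of x0 0] that by (simp add: fun_upd_twist)
        moreover have "((c 0 x0)(i := W' i h))(m := b) = (c b x0)(i := W' i h)" for b
          using cm[of 0 x0 b] that by (metis fun_upd_twist nat_neq_iff)
        ultimately show ?thesis
          using alternating_form_expand[OF alt, where i = m and w = "(c 0 x0)(i := W' i h)" and v = "W m x0"] Suc.prems by simp
      qed
      have "?R = (\<Sum>b\<in>Basis. (W m x0 \<bullet> b) * dd (\<lambda>x. F x (c b x0)) x0 h)
        + ((\<Sum>i<m. \<Sum>b\<in>Basis. (W m x0 \<bullet> b) * F x0 ((c b x0)(i := W' i h))) + (\<Sum>b\<in>Basis. (W' m h \<bullet> b) * F x0 (c b x0)))"
        using 1 2 3 by simp
      also have "(\<Sum>i<m. \<Sum>b\<in>Basis. (W m x0 \<bullet> b) * F x0 ((c b x0)(i := W' i h)))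
        = (\<Sum>b\<in>Basis. \<Sum>i<m. (W m x0 \<bullet> b) * F x0 ((c b x0)(i := W' i h)))"
        by (rule sum.swap)
      finally have R: "?R = (\<Sum>b\<in>Basis. (W m x0 \<bullet> b) * dd (\<lambda>x. F x (c b x0)) x0 h)
        + ((\<Sum>b\<in>Basis. \<Sum>i<m. (W m x0 \<bullet> b) * F x0 ((c b x0)(i := W' i h))) + (\<Sum>b\<in>Basis. (W' m h \<bullet> b) * F x0 (c b x0)))" .
      show ?thesis unfolding R
        by (simp only: sum.distrib sum_distrib_left distrib_left add.assoc)
    qed
    ultimately show ?case by (simp only:)
  qed
  \<comment> \<open>A \<open>k\<close>-form reads its first \<open>k\<close> arguments, so the
    padding by 0 used in the induction can be removed.\<close>
  have cut: "F x (\<lambda>i. if i < k then a i else 0) = F x a" for x a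
    by (rule alternating_form_cong[OF alt]) simp
  have cut': "F x0 ((\<lambda>i. if i < k then a i else 0)(j := b)) = F x0 (a(j := b))" for a b j
    by (rule alternating_form_cong[OF alt]) simp
  show ?thesis using *[of k "\<lambda>_. 0"] by (simp add: cut cut')
qed

text \<open>The pairs with \<open>i \<le> m\<close> are matched with those with \<open>m < i\<close>
  by the map from \<open>(i, m)\<close> to \<open>(Suc m, i)\<close>. This shift is the one that
  occurs when two entries of a tuple are omitted in either order.\<close>

lemma sum_antisymmetric_pairs:
  fixes T :: "nat \<Rightarrow> nat \<Rightarrow> real"
  assumes "\<And>i m. i \<le> m \<Longrightarrow> m < k \<Longrightarrow> T (Suc m) i = - T i m"
  shows "(\<Sum>i\<le>k. \<Sum>m<k. T i m) = 0"
proof -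
  let ?P = "{(i, m). i \<le> m \<and> m < k}" and ?Q = "{(i, m). m < i \<and> i \<le> k}"
  have fin: "finite ?P" "finite ?Q"
    by (rule finite_subset[of _ "{..k} \<times> {..k}"]; force)+
  have "(\<Sum>i\<le>k. \<Sum>m<k. T i m) = (\<Sum>(i, m)\<in>{..k} \<times> {..<k}. T i m)"
    by (simp add: sum.cartesian_product)
  also have "{..k} \<times> {..<k} = ?P \<union> ?Q" by auto
  also have "(\<Sum>(i, m)\<in>?P \<union> ?Q. T i m) = (\<Sum>(i, m)\<in>?P. T i m) + (\<Sum>(i, m)\<in>?Q. T i m)"
    by (rule sum.union_disjoint[OF fin]) auto
  also have "(\<Sum>(i, m)\<in>?Q. T i m) = (\<Sum>(i, m)\<in>?P. T (Suc m) i)"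
    by (rule sum.reindex_bij_witness[of _ "\<lambda>(i, m). (Suc m, i)" "\<lambda>(i, m). (m, i - 1)"]) auto
  also have "\<dots> = (\<Sum>(i, m)\<in>?P. - T i m)"
    by (rule sum.cong) (auto simp: assms)
  finally show ?thesis by (simp add: sum_negf split_def)
qed

text \<open>The exterior derivative in coordinates with the sign convention of \<open>ext_d\<close>.
  It is kept free of charts so that its behaviour under a change of coordinates can be
  stated.\<close>

definition dloc :: "nat \<Rightarrow> ('a::euclidean_space \<Rightarrow> (nat \<Rightarrow> 'a) \<Rightarrow> real) \<Rightarrow> 'a \<Rightarrow> (nat \<Rightarrow> 'a) \<Rightarrow> real" where
  "dloc k F x w = (\<Sum>i\<le>k. (-1) ^ i * dd (\<lambda>y. F y (omit i w)) x (w i))"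

lemma dloc_cong:
  assumes "open S" "x \<in> S" "\<And>y w. y \<in> S \<Longrightarrow> F y w = G y w"
  shows "dloc k F x w = dloc k G x w"
  unfolding dloc_def using dd_cong[OF assms(1,2)] assms(3) by (metis (mono_tags, lifting))

text \<open>The chain rule gives the right-hand side and additional terms containing second
  derivatives of \<open>g\<close>. Such a term is determined by the two slots it uses; taking them
  in the other order gives the same second derivative by symmetry but the opposite sign, so the
  additional terms cancel in pairs.\<close>

lemma dloc_pullback:
  fixes F :: "real^'d::finite \<Rightarrow> (nat \<Rightarrow> real^'d) \<Rightarrow> real"
  assumes alt: "\<And>y. alternating_form k (F y)"
    and F: "\<And>w. (\<lambda>y. F y w) differentiable (at (g x))"
    and g: "open S" "x \<in> S" "smooth_on S g"
  shows "dloc k (\<lambda>y w. F (g y) (\<lambda>i. dd g y (w i))) x w = dloc k F (g x) (\<lambda>i. dd g x (w i))"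
proof -
  define S2 where "S2 = (\<lambda>a b. dd (\<lambda>y. dd g y a) x b)"
  define w' where "w' = (\<lambda>i. dd g x (w i))"
  have om: "(\<lambda>j. dd g x (omit i w j)) = omit i w'" for i by (auto simp: omit_def w'_def fun_eq_iff)
  have der: "dd (\<lambda>y. F (g y) (\<lambda>j. dd g y (omit i w j))) x h = dd (\<lambda>y. F y (omit i w')) (g x) (dd g x h)
    + (\<Sum>m<k. F (g x) ((omit i w')(m := S2 (omit i w m) h)))" for i h
  proof -
    have g': "(g has_derivative dd g x) (at x)" using smooth_on_has_derivative g by blast
    have comp: "((\<lambda>y. F (g y) u) has_derivative (\<lambda>h. dd (\<lambda>y. F y u) (g x) (dd g x h))) (at x)" for u
      using has_derivative_compose[OF g' dd_works[OF F]] .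
    have "((\<lambda>y. F (g y) (\<lambda>j. dd g y (omit i w j))) has_derivative
      (\<lambda>h. dd (\<lambda>y. F (g y) (\<lambda>j. dd g x (omit i w j))) x h
        + (\<Sum>m<k. F (g x) ((\<lambda>j. dd g x (omit i w j))(m := S2 (omit i w m) h))))) (at x)"
      unfolding S2_def
      by (rule alternating_form_has_derivative[where F = "\<lambda>y. F (g y)"])
        (use alt comp differentiable_def smooth_on_has_derivative[OF smooth_on_dd[OF g(3)] g(2)] in blast)+
    from dd_eq[OF this] show ?thesis by (simp only: om dd_eq[OF comp])
  qed
  have "(\<Sum>i\<le>k. (-1) ^ i * (\<Sum>m<k. F (g x) ((omit i w')(m := S2 (omit i w m) (w i)))))
    = (\<Sum>i\<le>k. \<Sum>m<k. (-1) ^ (i + m) * F (g x) (case_nat (S2 (omit i w m) (w i)) (omit m (omit i w'))))"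
    unfolding sum_distrib_left
    by (intro sum.cong refl) (simp add: alternating_form_upd[OF alt] power_add)
  also have "\<dots> = 0"
  proof (rule sum_antisymmetric_pairs)
    fix i m assume im: "i \<le> m" "m < k"
    have "omit i (omit (Suc m) w') = omit m (omit i w')"
      using im by (auto simp: omit_def fun_eq_iff)
    moreover have "S2 (omit (Suc m) w i) (w (Suc m)) = S2 (omit i w m) (w i)"
      using im dd_symmetric[OF g(1,3,2)] by (simp add: omit_def S2_def)
    ultimately show "(-1) ^ (Suc m + i) * F (g x) (case_nat (S2 (omit (Suc m) w i) (w (Suc m))) (omit i (omit (Suc m) w')))
      = - ((-1) ^ (i + m) * F (g x) (case_nat (S2 (omit i w m) (w i)) (omit m (omit i w'))))"
      by (simp add: power_add)
  qed
  finally have 0: "(\<Sum>i\<le>k. (-1) ^ i * (\<Sum>m<k. F (g x) ((omit i w')(m := S2 (omit i w m) (w i))))) = 0" .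
  have "dloc k (\<lambda>y w. F (g y) (\<lambda>i. dd g y (w i))) x w
    = (\<Sum>i\<le>k. (-1) ^ i * dd (\<lambda>y. F y (omit i w')) (g x) (w' i))
      + (\<Sum>i\<le>k. (-1) ^ i * (\<Sum>m<k. F (g x) ((omit i w')(m := S2 (omit i w m) (w i)))))"
    unfolding dloc_def der by (simp add: w'_def distrib_left sum.distrib)
  then show ?thesis unfolding 0 by (simp add: dloc_def w'_def)
qed

section \<open>Compatible charts\<close>

text \<open>Charts compatible with the atlas up to orientation. Allowing orientation-reversing ones makes
  the pullback of a chart under any diffeomorphism available, which reduces naturality under
  diffeomorphisms to independence of the chart.\<close>

definition compat :: "('m::t2_space, 'd::finite) chart set \<Rightarrow> ('m, 'd) chart \<Rightarrow> bool" where
  "compat A c \<longleftrightarrow> is_chart c \<and> (\<forall>c'\<in>A. smooth_on (snd c ` (fst c \<inter> fst c')) (snd c' \<circ> cinv c) \<and>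
     smooth_on (snd c' ` (fst c \<inter> fst c')) (snd c \<circ> cinv c'))"

definition jac :: "('m::t2_space, 'd::finite) chart \<Rightarrow> ('m, 'd) chart \<Rightarrow> 'm \<Rightarrow> real^'d^'d" where
  "jac c c' p = jacobian (snd c' \<circ> cinv c) (at (snd c p))"

lemma cinv_coord [simp]: "is_chart c \<Longrightarrow> p \<in> fst c \<Longrightarrow> cinv c (snd c p) = p"
  unfolding is_chart_def by (auto simp: homeomorphism_def)

lemma coord_cinv [simp]: "is_chart c \<Longrightarrow> x \<in> cimg c \<Longrightarrow> snd c (cinv c x) = x"
  unfolding is_chart_def by (auto simp: homeomorphism_def)

lemma cinv_in [simp]: "is_chart c \<Longrightarrow> x \<in> cimg c \<Longrightarrow> cinv c x \<in> fst c"
  unfolding is_chart_def by (auto simp: homeomorphism_def)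

lemma coord_in [simp]: "p \<in> fst c \<Longrightarrow> snd c p \<in> cimg c"
  unfolding cimg_def by blast

lemma is_chart_open [simp]: "is_chart c \<Longrightarrow> open (fst c)" "is_chart c \<Longrightarrow> open (cimg c)"
  unfolding is_chart_def by auto

lemma coord_image:
  assumes "is_chart c" "U \<subseteq> fst c"
  shows "snd c ` U = {x \<in> cimg c. cinv c x \<in> U}"
proof -
  have "cinv c (snd c p) = p" if "p \<in> U" for p using assms that by auto
  moreover have "x \<in> snd c ` U" if "x \<in> cimg c" "cinv c x \<in> U" for x
    using assms that by (metis coord_cinv imageI)
  ultimately show ?thesis using assms by (auto simp: cimg_def)
qed

lemma open_coord_image:
  assumes c: "is_chart c" and U: "open U" "U \<subseteq> fst c"
  shows "open (snd c ` U)"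
proof -
  have "continuous_on (cimg c) (cinv c)" "open (cimg c)"
    using c unfolding is_chart_def homeomorphism_def by blast+
  then have "open (cimg c \<inter> cinv c -` U)" by (rule continuous_open_preimage) (rule U(1))
  moreover have "cimg c \<inter> cinv c -` U = {x \<in> cimg c. cinv c x \<in> U}" by auto
  ultimately show ?thesis unfolding coord_image[OF c U(2)] by simp
qed

lemma open_coord_overlap: "is_chart c \<Longrightarrow> is_chart c' \<Longrightarrow> open (snd c ` (fst c \<inter> fst c'))"
  by (intro open_coord_image) (auto simp: is_chart_open intro!: open_Int)

section \<open>Transition maps and their Jacobians\<close>

locale oriented_mfd =
  fixes A :: "('m::t2_space, 'd::finite) chart set"
  assumes atlas: "oriented_atlas A"
begin

lemma A_compat: "c \<in> A \<Longrightarrow> compat A c"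
  using atlas unfolding oriented_atlas_def compat_def by (metis inf_commute)

lemma compat_chart [simp]: "compat A c \<Longrightarrow> is_chart c"
  unfolding compat_def by simp

lemma chart_at: "chart_at A p \<in> A" "p \<in> fst (chart_at A p)"
proof -
  have "\<exists>c. c \<in> A \<and> p \<in> fst c" using atlas unfolding oriented_atlas_def by blast
  from someI_ex[OF this] show "chart_at A p \<in> A" "p \<in> fst (chart_at A p)"
    unfolding chart_at_def by auto
qed

lemma chart_at_compat [simp]: "compat A (chart_at A p)" "is_chart (chart_at A p)"
  using A_compat chart_at compat_chart by blast+

text \<open>\<open>compat\<close> compares a chart with the atlas. Two compatible charts are
  compared by factoring their transition map, near each point of the overlap, through an atlas chart
  around that point.\<close>

lemma transition_smooth:
  assumes "compat A ca" "compat A cb"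
  shows "smooth_on (snd ca ` (fst ca \<inter> fst cb)) (snd cb \<circ> cinv ca)"
proof (rule smooth_on_local)
  fix x assume "x \<in> snd ca ` (fst ca \<inter> fst cb)"
  then obtain q where q: "q \<in> fst ca" "q \<in> fst cb" "x = snd ca q" by auto
  define c where "c = chart_at A q"
  have c: "c \<in> A" "q \<in> fst c" using chart_at by (auto simp: c_def)
  note ch = compat_chart[OF assms(1)] compat_chart[OF assms(2)] compat_chart[OF A_compat[OF c(1)]]
  define U where "U = snd ca ` (fst ca \<inter> fst cb \<inter> fst c)"
  have U: "open U" unfolding U_def
    using ch by (intro open_coord_image) (auto simp: is_chart_open intro!: open_Int)
  have V: "open (snd c ` (fst cb \<inter> fst c))"
    using ch by (intro open_coord_image) (auto simp: is_chart_open intro!: open_Int)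
  have 1: "smooth_on U (snd c \<circ> cinv ca)"
    by (rule smooth_on_subset[of "snd ca ` (fst ca \<inter> fst c)"])
      (use assms(1) c in \<open>auto simp: compat_def U_def\<close>)
  have 2: "smooth_on (snd c ` (fst cb \<inter> fst c)) (snd cb \<circ> cinv c)"
    using assms(2) c by (auto simp: compat_def)
  have "smooth_on U (\<lambda>x. (snd cb \<circ> cinv c) ((snd c \<circ> cinv ca) x))"
    by (rule smooth_on_compose[OF 2 1 U V]) (use ch in \<open>auto simp: U_def\<close>)
  then have "smooth_on U (snd cb \<circ> cinv ca)"
    by (rule smooth_on_eq_on[OF _ U]) (use ch in \<open>auto simp: U_def\<close>)
  then show "\<exists>U. open U \<and> x \<in> U \<and> smooth_on U (snd cb \<circ> cinv ca)"
    using U q c by (intro exI[of _ U]) (auto simp: U_def)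
qed

lemma jac_has_derivative:
  assumes "compat A ca" "compat A cb" "p \<in> fst ca" "p \<in> fst cb"
  shows "((snd cb \<circ> cinv ca) has_derivative (\<lambda>h. jac ca cb p *v h)) (at (snd ca p))"
  unfolding jac_def jacobian_works[symmetric]
  by (rule smooth_on_differentiable[OF transition_smooth[OF assms(1,2)]]) (use assms in auto)

lemma jac_comp:
  assumes "compat A ca" "compat A cb" "compat A cc" "p \<in> fst ca" "p \<in> fst cb" "p \<in> fst cc"
  shows "jac cb cc p ** jac ca cb p = jac ca cc p"
proof -
  note ch = compat_chart[OF assms(1)] compat_chart[OF assms(2)] compat_chart[OF assms(3)]
  have "(snd cb \<circ> cinv ca) (snd ca p) = snd cb p" using assms ch by simp
  then have "((\<lambda>x. (snd cc \<circ> cinv cb) ((snd cb \<circ> cinv ca) x)) has_derivative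
    (\<lambda>h. jac cb cc p *v (jac ca cb p *v h))) (at (snd ca p))"
    using has_derivative_compose[OF jac_has_derivative[OF assms(1,2,4,5)], of "snd cc \<circ> cinv cb" "(*v) (jac cb cc p)"]
      jac_has_derivative[OF assms(2,3,5,6)] by metis
  moreover have "open (snd ca ` (fst ca \<inter> fst cb \<inter> fst cc))"
    using ch by (intro open_coord_image) (auto simp: is_chart_open intro!: open_Int)
  ultimately have "((snd cc \<circ> cinv ca) has_derivative
    (\<lambda>h. jac cb cc p *v (jac ca cb p *v h))) (at (snd ca p))"
    by (rule has_derivative_transform_within_open) (use assms ch in auto)
  from has_derivative_unique[OF this jac_has_derivative[OF assms(1,3,4,6)]]
  have "(jac cb cc p ** jac ca cb p) *v h = jac ca cc p *v h" for h
    by (simp add: fun_eq_iff matrix_vector_mul_assoc)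
  then show ?thesis by (simp add: matrix_eq)
qed

lemma jac_self: 
  assumes "compat A c" "p \<in> fst c"
  shows "jac c c p = mat 1"
proof -
  have "((\<lambda>x. x) has_derivative (\<lambda>h. h)) (at (snd c p))" by simp
  moreover have "open (cimg c)" using is_chart_open compat_chart assms by blast
  ultimately have "((snd c \<circ> cinv c) has_derivative (\<lambda>h. h)) (at (snd c p))"
    by (rule has_derivative_transform_within_open) (use assms in auto)
  from has_derivative_unique[OF this jac_has_derivative[OF assms(1,1,2,2)]]
  show ?thesis by (metis matrix_eq matrix_vector_mul_lid)
qed

lemma jac_inv:
  assumes "compat A ca" "compat A cb" "p \<in> fst ca" "p \<in> fst cb"
  shows "jac cb ca p ** jac ca cb p = mat 1"
  using jac_comp[OF assms(1,2,1,3,4,3)] jac_self assms by simp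

lemma to_chart_jac: "to_chart A c p = jac (chart_at A p) c p"
  unfolding to_chart_def jac_def coord_at_def ..

lemma from_chart_jac: "from_chart A c p = jac c (chart_at A p) p"
  unfolding from_chart_def jac_def ..

lemma jac_smooth:
  assumes "compat A ca" "compat A cb"
  shows "smooth_on (snd ca ` (fst ca \<inter> fst cb)) (\<lambda>x. jac ca cb (cinv ca x))"
proof -
  have S: "open (snd ca ` (fst ca \<inter> fst cb))" using assms open_coord_overlap compat_chart by blast
  show ?thesis
    by (rule smooth_on_eq_on[OF smooth_on_jacobian[OF S transition_smooth[OF assms]] S])
      (use assms in \<open>auto simp: jac_def\<close>)
qed

lemma to_chart_trans:
  assumes "compat A ca" "compat A cb" "p \<in> fst ca" "p \<in> fst cb"
  shows "to_chart A cb p = jac ca cb p ** to_chart A ca p"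
    "from_chart A ca p = from_chart A cb p ** jac ca cb p"
  unfolding to_chart_jac from_chart_jac using assms chart_at jac_comp by simp_all

lemma to_from_chart:
  assumes "compat A c" "p \<in> fst c"
  shows "to_chart A c p ** from_chart A c p = mat 1" "from_chart A c p ** to_chart A c p = mat 1"
  unfolding to_chart_jac from_chart_jac using assms chart_at jac_inv by simp_all

lemma to_from_chart_vec:
  assumes "compat A c" "p \<in> fst c"
  shows "to_chart A c p *v (from_chart A c p *v v) = v" "from_chart A c p *v (to_chart A c p *v v) = v"
  using to_from_chart[OF assms] by (simp_all add: matrix_vector_mul_assoc)

lemma to_from_chart_at [simp]:
  "to_chart A (chart_at A p) p = mat 1" "from_chart A (chart_at A p) p = mat 1"
  unfolding to_chart_jac from_chart_jac using jac_self chart_at by simp_all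

subsection \<open>Change of coordinates\<close>

lemma vf_rep_trans:
  assumes "compat A ca" "compat A cb" "q \<in> fst ca" "q \<in> fst cb"
  shows "vf_rep A cb X (snd cb q) = jac ca cb q *v vf_rep A ca X (snd ca q)"
  using assms compat_chart to_chart_trans[OF assms] by (simp add: vf_rep_def matrix_vector_mul_assoc)

lemma endo_rep_trans:
  assumes "compat A ca" "compat A cb" "q \<in> fst ca" "q \<in> fst cb"
  shows "endo_rep A cb B (snd cb q) = jac ca cb q ** endo_rep A ca B (snd ca q) ** jac cb ca q"
  using assms compat_chart to_chart_trans(1)[OF assms] to_chart_trans(2)[OF assms(2,1,4,3)]
  by (simp add: endo_rep_def matrix_mul_assoc)

lemma form_rep_trans:
  assumes "compat A ca" "compat A cb" "q \<in> fst ca" "q \<in> fst cb"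
  shows "form_rep A ca \<omega> (snd ca q) w = form_rep A cb \<omega> (snd cb q) (\<lambda>i. jac ca cb q *v w i)"
  using assms compat_chart to_chart_trans(2)[OF assms]
  by (simp add: form_rep_def matrix_vector_mul_assoc)

section \<open>Transfer of smoothness between charts\<close>

lemma smooth_transfer_gen:
  assumes "compat A ca" "compat A cb" "open U" "U \<subseteq> fst ca" "U \<subseteq> fst cb" "smooth_on (snd ca ` U) f"
  shows "smooth_on (snd cb ` U) (\<lambda>x. f ((snd ca \<circ> cinv cb) x))"
proof -
  note ch = compat_chart[OF assms(1)] compat_chart[OF assms(2)]
  have o: "open (snd ca ` U)" "open (snd cb ` U)" using assms ch by (auto intro!: open_coord_image)
  have t: "smooth_on (snd cb ` U) (snd ca \<circ> cinv cb)"
    by (rule smooth_on_subset[OF transition_smooth[OF assms(2,1)]]) (use assms in auto)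
  have "(snd ca \<circ> cinv cb) x \<in> snd ca ` U" if "x \<in> snd cb ` U" for x
    using that assms by (auto simp: subset_iff)
  from smooth_on_compose[OF assms(6) t o(2,1) this] show ?thesis .
qed

lemma jac_smooth_on:
  assumes "compat A ca" "compat A cb" "U \<subseteq> fst ca" "U \<subseteq> fst cb"
  shows "smooth_on (snd ca ` U) (\<lambda>x. jac ca cb (cinv ca x))"
  by (rule smooth_on_subset[OF jac_smooth[OF assms(1,2)]]) (use assms in auto)

lemma jac_smooth_on':
  assumes "compat A ca" "compat A cb" "open U" "U \<subseteq> fst ca" "U \<subseteq> fst cb"
  shows "smooth_on (snd cb ` U) (\<lambda>x. jac ca cb (cinv cb x))"
proof -
  note ch = compat_chart[OF assms(1)] compat_chart[OF assms(2)]
  show ?thesis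
    by (rule smooth_on_eq_on[OF smooth_transfer_gen[OF assms jac_smooth_on[OF assms(1,2,4,5)]]
          open_coord_image[OF ch(2) assms(3,5)]])
      (use assms ch in \<open>auto simp: subset_iff\<close>)
qed

lemma smooth_transfer_fun:
  assumes "compat A ca" "compat A cb" "open U" "U \<subseteq> fst ca" "U \<subseteq> fst cb" "smooth_on (snd ca ` U) (f \<circ> cinv ca)"
  shows "smooth_on (snd cb ` U) (f \<circ> cinv cb)"
  by (rule smooth_on_eq_on[OF smooth_transfer_gen[OF assms]])
    (use assms open_coord_image[of cb U] in \<open>auto simp: subset_iff\<close>)

lemma smooth_transfer_vf:
  assumes "compat A ca" "compat A cb" "open U" "U \<subseteq> fst ca" "U \<subseteq> fst cb" "smooth_on (snd ca ` U) (vf_rep A ca X)"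
  shows "smooth_on (snd cb ` U) (vf_rep A cb X)"
proof -
  have o: "open (snd cb ` U)" using assms by (intro open_coord_image) auto
  have "smooth_on (snd cb ` U) (\<lambda>x. jac ca cb (cinv cb x) *v vf_rep A ca X ((snd ca \<circ> cinv cb) x))"
    by (intro smooth_intros o jac_smooth_on'[OF assms(1-5)] smooth_transfer_gen[OF assms])
  then show ?thesis
    by (rule smooth_on_eq_on[OF _ o]) (use assms in \<open>auto simp: subset_iff vf_rep_trans[OF assms(1,2)]\<close>)
qed

lemma smooth_transfer_endo:
  assumes "compat A ca" "compat A cb" "open U" "U \<subseteq> fst ca" "U \<subseteq> fst cb" "smooth_on (snd ca ` U) (endo_rep A ca B)"
  shows "smooth_on (snd cb ` U) (endo_rep A cb B)"
proof -
  have o: "open (snd cb ` U)" using assms by (intro open_coord_image) auto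
  have "smooth_on (snd cb ` U) (\<lambda>x. jac ca cb (cinv cb x) ** endo_rep A ca B ((snd ca \<circ> cinv cb) x) ** jac cb ca (cinv cb x))"
    by (intro smooth_intros o jac_smooth_on'[OF assms(1-5)] jac_smooth_on smooth_transfer_gen[OF assms] assms)
  then show ?thesis
    by (rule smooth_on_eq_on[OF _ o]) (use assms in \<open>auto simp: subset_iff endo_rep_trans[OF assms(1,2)]\<close>)
qed

lemma smooth_transfer_form:
  assumes "compat A ca" "compat A cb" "open U" "U \<subseteq> fst ca" "U \<subseteq> fst cb"
    and alt: "\<And>p. alternating_form k (\<omega> p)" and sm: "\<And>w. smooth_on (snd ca ` U) (\<lambda>x. form_rep A ca \<omega> x w)"
  shows "smooth_on (snd cb ` U) (\<lambda>x. form_rep A cb \<omega> x w)"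
proof -
  have o: "open (snd cb ` U)" using assms by (intro open_coord_image) auto
  have a: "alternating_form k (form_rep A ca \<omega> x)" for x
    unfolding form_rep_def[abs_def] by (rule alternating_form_precomp[OF alt])
  have "smooth_on (snd cb ` U) (\<lambda>x. form_rep A ca \<omega> ((snd ca \<circ> cinv cb) x) (\<lambda>i. jac cb ca (cinv cb x) *v w i))"
    by (rule alternating_form_smooth[where k = k and F = "\<lambda>x. form_rep A ca \<omega> ((snd ca \<circ> cinv cb) x)"])
      (intro a o smooth_intros jac_smooth_on smooth_transfer_gen[OF assms(1-5)] assms)+
  then show ?thesis
    by (rule smooth_on_eq_on[OF _ o]) (use assms in \<open>auto simp: subset_iff form_rep_trans[OF assms(2,1)]\<close>)
qed

lemma smooth_on_cover:
  assumes "is_chart c" "\<And>q. q \<in> fst c \<Longrightarrow> \<exists>U. open U \<and> q \<in> U \<and> U \<subseteq> fst c \<and> smooth_on (snd c ` U) f"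
  shows "smooth_on (cimg c) f"
proof (rule smooth_on_local)
  fix x assume x: "x \<in> cimg c"
  then obtain U where U: "open U" "cinv c x \<in> U" "U \<subseteq> fst c" "smooth_on (snd c ` U) f"
    using assms cinv_in by blast
  then show "\<exists>U. open U \<and> x \<in> U \<and> smooth_on U f"
    using open_coord_image[OF assms(1) U(1,3)] coord_image[OF assms(1) U(3)] x by blast
qed

text \<open>Functions, vector fields and endomorphism fields are covered at once by abstracting over
  their component function \<open>rep\<close>. Forms are treated separately, since their transfer
  between charts uses that they are alternating.\<close>

lemma smooth_rep_gluing:
  assumes transfer: "\<And>ca cb U. compat A ca \<Longrightarrow> compat A cb \<Longrightarrow> open U \<Longrightarrow> U \<subseteq> fst ca \<Longrightarrow> U \<subseteq> fst cb \<Longrightarrow>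
      smooth_on (snd ca ` U) (rep ca) \<Longrightarrow> smooth_on (snd cb ` U) (rep cb)"
    and glue: "\<And>q. \<exists>ca U. compat A ca \<and> open U \<and> q \<in> U \<and> U \<subseteq> fst ca \<and> smooth_on (snd ca ` U) (rep ca)"
    and c: "compat A c"
  shows "smooth_on (cimg c) (rep c)"
proof (rule smooth_on_cover[OF compat_chart[OF c]])
  fix q assume q: "q \<in> fst c"
  obtain ca U where U: "compat A ca" "open U" "q \<in> U" "U \<subseteq> fst ca" "smooth_on (snd ca ` U) (rep ca)"
    using glue by blast
  have "smooth_on (snd c ` (U \<inter> fst c)) (rep c)"
    by (rule transfer[OF U(1) c])
      (use U c in \<open>auto intro!: open_Int intro: smooth_on_subset[OF U(5)]\<close>)
  then show "\<exists>U. open U \<and> q \<in> U \<and> U \<subseteq> fst c \<and> smooth_on (snd c ` U) (rep c)"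
    using U q is_chart_open(1)[OF compat_chart[OF c]] by (intro exI[of _ "U \<inter> fst c"]) auto
qed

lemma smooth_rep_chart:
  assumes transfer: "\<And>ca cb U. compat A ca \<Longrightarrow> compat A cb \<Longrightarrow> open U \<Longrightarrow> U \<subseteq> fst ca \<Longrightarrow> U \<subseteq> fst cb \<Longrightarrow>
      smooth_on (snd ca ` U) (rep ca) \<Longrightarrow> smooth_on (snd cb ` U) (rep cb)"
    and smooth: "\<forall>c\<in>A. smooth_on (cimg c) (rep c)" and c: "compat A c"
  shows "smooth_on (cimg c) (rep c)"
proof (rule smooth_rep_gluing[OF transfer _ c])
  fix q
  let ?c = "chart_at A q"
  show "\<exists>ca U. compat A ca \<and> open U \<and> q \<in> U \<and> U \<subseteq> fst ca \<and> smooth_on (snd ca ` U) (rep ca)"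
    using smooth chart_at chart_at_compat by (intro exI[of _ ?c] exI[of _ "fst ?c"]) (simp add: cimg_def)
qed

lemma smooth_vf_chart:
  assumes "smooth_vf A X" "compat A c"
  shows "smooth_on (cimg c) (vf_rep A c X)"
  by (rule smooth_rep_chart[where rep = "\<lambda>c. vf_rep A c X", OF _ assms(1)[unfolded smooth_vf_def] assms(2)])
    (erule (5) smooth_transfer_vf)

lemma smooth_endo_chart:
  assumes "smooth_endo A B" "compat A c"
  shows "smooth_on (cimg c) (endo_rep A c B)"
  by (rule smooth_rep_chart[where rep = "\<lambda>c. endo_rep A c B", OF _ assms(1)[unfolded smooth_endo_def] assms(2)])
    (erule (5) smooth_transfer_endo)

lemma smooth_fun_chart:
  assumes "smooth_fun A f" "compat A c"
  shows "smooth_on (cimg c) (f \<circ> cinv c)"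
  by (rule smooth_rep_chart[where rep = "\<lambda>c. f \<circ> cinv c", OF _ assms(1)[unfolded smooth_fun_def] assms(2)])
    (erule (5) smooth_transfer_fun)

lemma smooth_form_chart:
  assumes "\<omega> \<in> forms A k" "compat A c"
  shows "smooth_on (cimg c) (\<lambda>x. form_rep A c \<omega> x w)"
proof (rule smooth_on_cover[OF compat_chart[OF assms(2)]])
  fix q assume q: "q \<in> fst c"
  let ?c = "chart_at A q" and ?U = "fst c \<inter> fst (chart_at A q)"
  have U: "open ?U" using assms by (intro open_Int) simp_all
  have "smooth_on (snd ?c ` ?U) (\<lambda>x. form_rep A ?c \<omega> x w)" for w
    by (rule smooth_on_subset[of "cimg ?c"]) (use assms chart_at in \<open>auto simp: forms_def\<close>)
  from smooth_transfer_form[OF _ assms(2) U _ _ _ this, of k]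
  show "\<exists>U. open U \<and> q \<in> U \<and> U \<subseteq> fst c \<and> smooth_on (snd c ` U) (\<lambda>x. form_rep A c \<omega> x w)"
    using U q chart_at assms by (intro exI[of _ ?U]) (auto simp: forms_def)
qed

lemma forms_alternating: "\<omega> \<in> forms A k \<Longrightarrow> alternating_form k (\<omega> p)"
  unfolding forms_def by blast

lemma form_rep_alternating: "(\<And>p. alternating_form k (\<omega> p)) \<Longrightarrow> alternating_form k (form_rep A c \<omega> x)"
  unfolding form_rep_def[abs_def] by (rule alternating_form_precomp)

lemma smooth_vfI:
  assumes "\<And>p. \<exists>c U. compat A c \<and> open U \<and> p \<in> U \<and> U \<subseteq> fst c \<and> smooth_on (snd c ` U) (vf_rep A c X)"
  shows "smooth_vf A X"
  unfolding smooth_vf_def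
  by (intro ballI, rule smooth_rep_gluing[where rep = "\<lambda>c. vf_rep A c X", OF _ assms A_compat])
    (erule (5) smooth_transfer_vf)

lemma smooth_endoI:
  assumes "\<And>p. \<exists>c U. compat A c \<and> open U \<and> p \<in> U \<and> U \<subseteq> fst c \<and> smooth_on (snd c ` U) (endo_rep A c X)"
  shows "smooth_endo A X"
  unfolding smooth_endo_def
  by (intro ballI, rule smooth_rep_gluing[where rep = "\<lambda>c. endo_rep A c X", OF _ assms A_compat])
    (erule (5) smooth_transfer_endo)

lemma smooth_funI:
  assumes "\<And>p. \<exists>c U. compat A c \<and> open U \<and> p \<in> U \<and> U \<subseteq> fst c \<and> smooth_on (snd c ` U) (f \<circ> cinv c)"
  shows "smooth_fun A f"
  unfolding smooth_fun_def
  by (intro ballI, rule smooth_rep_gluing[where rep = "\<lambda>c. f \<circ> cinv c", OF _ assms A_compat])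
    (erule (5) smooth_transfer_fun)

lemma formsI:
  assumes alt: "\<And>p. alternating_form k (\<omega> p)"
    and "\<And>p. \<exists>c U. compat A c \<and> open U \<and> p \<in> U \<and> U \<subseteq> fst c \<and> (\<forall>w. smooth_on (snd c ` U) (\<lambda>x. form_rep A c \<omega> x w))"
  shows "\<omega> \<in> forms A k"
  unfolding forms_def
proof (intro CollectI conjI allI ballI alt)
  fix c w assume "c \<in> A"
  then have c: "compat A c" by (rule A_compat)
  show "smooth_on (cimg c) (\<lambda>x. form_rep A c \<omega> x w)"
  proof (rule smooth_on_cover[OF compat_chart[OF c]])
    fix q assume q: "q \<in> fst c"
    obtain ca U where U: "compat A ca" "open U" "q \<in> U" "U \<subseteq> fst ca"
      "\<And>w. smooth_on (snd ca ` U) (\<lambda>x. form_rep A ca \<omega> x w)"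
      using assms by blast
    have "smooth_on (snd c ` (U \<inter> fst c)) (\<lambda>x. form_rep A c \<omega> x w)"
      by (rule smooth_transfer_form[OF U(1) c])
        (use U c alt in \<open>auto intro!: open_Int intro: smooth_on_subset[OF U(5)]\<close>)
    then show "\<exists>U. open U \<and> q \<in> U \<and> U \<subseteq> fst c \<and> smooth_on (snd c ` U) (\<lambda>x. form_rep A c \<omega> x w)"
      using U q is_chart_open(1)[OF compat_chart[OF c]] by (intro exI[of _ "U \<inter> fst c"]) auto
  qed
qed

subsection \<open>Coordinate expressions of natural operations\<close>

lemma dfun_rep:
  assumes "smooth_fun A f" "compat A c" "q \<in> fst c"
  shows "dfun A f q (from_chart A c q *v h) = dd (f \<circ> cinv c) (snd c q) h"
    "dfun A f q z = dd (f \<circ> cinv c) (snd c q) (to_chart A c q *v z)"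
proof -
  let ?c = "chart_at A q"
  have q: "q \<in> fst ?c" "compat A ?c" using chart_at by auto
  note ch = compat_chart[OF assms(2)] compat_chart[OF q(2)]
  have "((f \<circ> cinv c) has_derivative dd (f \<circ> cinv c) (snd c q)) (at ((snd c \<circ> cinv ?c) (snd ?c q)))"
    using smooth_on_has_derivative[OF smooth_fun_chart[OF assms(1,2)]] assms(3) q ch by simp
  from has_derivative_compose[OF jac_has_derivative[OF q(2) assms(2) q(1) assms(3)] this]
  have 1: "((\<lambda>x. (f \<circ> cinv c) ((snd c \<circ> cinv ?c) x)) has_derivative
    (\<lambda>z. dd (f \<circ> cinv c) (snd c q) (to_chart A c q *v z))) (at (snd ?c q))"
    by (simp add: to_chart_jac)
  have "((f \<circ> cinv ?c) has_derivative
    (\<lambda>z. dd (f \<circ> cinv c) (snd c q) (to_chart A c q *v z))) (at (snd ?c q))"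
    by (rule has_derivative_transform_within_open[OF 1 open_coord_overlap[OF ch(2,1)]])
      (use assms q ch in auto)
  from dd_eq[OF this] show 2: "dfun A f q z = dd (f \<circ> cinv c) (snd c q) (to_chart A c q *v z)" for z
    by (simp add: dfun_def coord_at_def)
  show "dfun A f q (from_chart A c q *v h) = dd (f \<circ> cinv c) (snd c q) h"
    unfolding 2 using to_from_chart_vec assms by simp
qed

text \<open>\<open>ext_d\<close> at \<open>q\<close> uses the preferred chart at \<open>q\<close>,
  which changes with the point. Invariance of the exterior derivative under the transition map lets
  a single chart serve a whole neighbourhood, as calculations in coordinates require.\<close>

lemma ext_d_rep:
  assumes "\<omega> \<in> forms A k" "compat A c" "q \<in> fst c"
  shows "ext_d A k \<omega> q w = dloc k (form_rep A c \<omega>) (snd c q) (\<lambda>i. to_chart A c q *v w i)"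
proof -
  let ?c = "chart_at A q" 
  define g where "g = snd c \<circ> cinv ?c"
  have q: "q \<in> fst ?c" "compat A ?c" using chart_at by auto
  note ch = compat_chart[OF assms(2)] compat_chart[OF q(2)]
  define S where "S = snd ?c ` (fst ?c \<inter> fst c)"
  have S: "open S" "snd ?c q \<in> S" "smooth_on S g"
    unfolding S_def g_def
    using open_coord_overlap[OF ch(2,1)] q assms(3) transition_smooth[OF q(2) assms(2)] by auto
  have gq: "g (snd ?c q) = snd c q" using q ch by (simp add: g_def)
  have gder: "dd g y h = jac ?c c (cinv ?c y) *v h" if "y \<in> S" for y h
    using dd_eq[OF jac_has_derivative[OF q(2) assms(2), of "cinv ?c y"]] that ch unfolding S_def g_def by auto
  have alt: "alternating_form k (form_rep A c \<omega> y)" for y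
    using form_rep_alternating forms_alternating[OF assms(1)] by blast
  have "ext_d A k \<omega> q w = dloc k (form_rep A ?c \<omega>) (snd ?c q) w"
    unfolding ext_d_def dloc_def omit_def coord_at_def ..
  also have "\<dots> = dloc k (\<lambda>y w. form_rep A c \<omega> (g y) (\<lambda>i. dd g y (w i))) (snd ?c q) w"
  proof (rule dloc_cong[OF S(1,2)])
    fix y w assume y: "y \<in> S"
    then obtain r where r: "r \<in> fst ?c" "r \<in> fst c" "y = snd ?c r" by (auto simp: S_def)
    then have "g y = snd c r" using ch by (simp add: g_def)
    then show "form_rep A ?c \<omega> y w = form_rep A c \<omega> (g y) (\<lambda>i. dd g y (w i))"
      unfolding gder[OF y] using form_rep_trans[OF q(2) assms(2) r(1,2)] r ch by simp
  qed
  also have "\<dots> = dloc k (form_rep A c \<omega>) (g (snd ?c q)) (\<lambda>i. dd g (snd ?c q) (w i))"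
    by (rule dloc_pullback[OF alt _ S])
      (use smooth_on_differentiable[OF smooth_form_chart[OF assms(1,2)]] gq assms(3) in auto)
  finally show ?thesis
    unfolding gder[OF S(2)] gq to_chart_jac using q ch by simp
qed

lemma ext_d_form_rep:
  assumes "\<omega> \<in> forms A k" "compat A c" "x \<in> cimg c"
  shows "form_rep A c (ext_d A k \<omega>) x w = dloc k (form_rep A c \<omega>) x w"
  using ext_d_rep[OF assms(1,2), of "cinv c x"] assms compat_chart[OF assms(2)]
  by (simp add: form_rep_def to_from_chart_vec)

text \<open>The derivative of each field transforms with a second derivative of the transition map.
  In the commutator these two contributions are equal by symmetry and cancel.\<close>

lemma lie_bracket_rep:
  assumes "smooth_vf A X" "smooth_vf A Y" "compat A c" "q \<in> fst c"
  shows "to_chart A c q *v lie_bracket A X Y q =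
    dd (vf_rep A c Y) (snd c q) (vf_rep A c X (snd c q)) - dd (vf_rep A c X) (snd c q) (vf_rep A c Y (snd c q))"
proof -
  let ?c = "chart_at A q" 
  define g where "g = snd c \<circ> cinv ?c"
  have q: "q \<in> fst ?c" "compat A ?c" using chart_at by auto
  note ch = compat_chart[OF assms(3)] compat_chart[OF q(2)]
  define S where "S = snd ?c ` (fst ?c \<inter> fst c)"
  have S: "open S" "snd ?c q \<in> S" "smooth_on S g"
    unfolding S_def g_def
    using open_coord_overlap[OF ch(2,1)] q assms(4) transition_smooth[OF q(2) assms(3)] by auto
  have gq: "g (snd ?c q) = snd c q" using q ch by (simp add: g_def)
  have gder: "dd g y h = jac ?c c (cinv ?c y) *v h" if "y \<in> S" for y h
    using dd_eq[OF jac_has_derivative[OF q(2) assms(3), of "cinv ?c y"]] that ch unfolding S_def g_def by auto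
  have S': "y \<in> cimg ?c" if "y \<in> S" for y using that by (auto simp: S_def)
  \<comment> \<open>Derivative of the transformed field at the base point: the extra term is the
    second derivative of the transition map in the directions of \<open>Z\<close> and
    \<open>z\<close>.\<close>
  have key: "to_chart A c q *v dd (vf_rep A ?c Z) (snd ?c q) z + dd (\<lambda>y. dd g y (vf_rep A ?c Z (snd ?c q))) (snd ?c q) z
     = dd (vf_rep A c Z) (snd c q) (to_chart A c q *v z)"
    if Z: "smooth_vf A Z" for Z z
  proof -
    have Zs: "smooth_on S (vf_rep A ?c Z)"
      using smooth_on_subset[OF smooth_vf_chart[OF Z q(2)]] S' by blast
    have "((vf_rep A c Z) has_derivative dd (vf_rep A c Z) (snd c q)) (at (g (snd ?c q)))"
      unfolding gq using smooth_on_has_derivative[OF smooth_vf_chart[OF Z assms(3)]] assms(4) by simp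
    from has_derivative_compose[OF smooth_on_has_derivative[OF S(3,2)] this]
    have 1: "((\<lambda>y. vf_rep A c Z (g y)) has_derivative (\<lambda>z. dd (vf_rep A c Z) (snd c q) (dd g (snd ?c q) z))) (at (snd ?c q))" .
    have J: "smooth_on S (\<lambda>y. matrix (dd g y))" by (rule smooth_on_matrix_dd[OF S(1,3)])
    have mat: "matrix (dd g y) *v v = dd g y v" if "y \<in> S" for y v
      using dd_linear[OF smooth_on_differentiable[OF S(3) that]] by (simp add: matrix_works)
    have eq: "vf_rep A c Z (g y) = matrix (dd g y) *v vf_rep A ?c Z y" if y: "y \<in> S" for y
    proof -
      from y obtain r where r: "r \<in> fst ?c" "r \<in> fst c" "y = snd ?c r" by (auto simp: S_def)
      then have "g y = snd c r" using ch by (simp add: g_def)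
      then show ?thesis
        unfolding mat[OF y] gder[OF y] using vf_rep_trans[OF q(2) assms(3) r(1,2)] r ch by simp
    qed
    have "((\<lambda>y. matrix (dd g y) *v vf_rep A ?c Z y) has_derivative
      (\<lambda>z. matrix (dd g (snd ?c q)) *v dd (vf_rep A ?c Z) (snd ?c q) z
        + dd (\<lambda>y. matrix (dd g y)) (snd ?c q) z *v vf_rep A ?c Z (snd ?c q))) (at (snd ?c q))"
      by (rule bounded_bilinear.FDERIV[OF bounded_bilinear_matrix_vector_mult])
        (use smooth_on_has_derivative S J Zs in blast)+
    then have 2: "((\<lambda>y. vf_rep A c Z (g y)) has_derivative
      (\<lambda>z. matrix (dd g (snd ?c q)) *v dd (vf_rep A ?c Z) (snd ?c q) z
        + dd (\<lambda>y. matrix (dd g y)) (snd ?c q) z *v vf_rep A ?c Z (snd ?c q))) (at (snd ?c q))"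
      by (rule has_derivative_transform_within_open[OF _ S(1,2)]) (simp add: eq)
    have "((\<lambda>y. matrix (dd g y) *v v) has_derivative (\<lambda>z. dd (\<lambda>y. matrix (dd g y)) (snd ?c q) z *v v)) (at (snd ?c q))" for v
      by (rule bounded_linear.has_derivative[OF bounded_bilinear.bounded_linear_left[OF bounded_bilinear_matrix_vector_mult]])
        (rule smooth_on_has_derivative[OF J S(2)])
    then have "((\<lambda>y. dd g y v) has_derivative (\<lambda>z. dd (\<lambda>y. matrix (dd g y)) (snd ?c q) z *v v)) (at (snd ?c q))" for v
      by (rule has_derivative_transform_within_open[OF _ S(1,2)]) (simp add: mat)
    from dd_eq[OF this] has_derivative_unique[OF 1 2] show ?thesis
      by (simp add: fun_eq_iff mat[OF S(2)] gder[OF S(2)] to_chart_jac q)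
  qed
  have id: "vf_rep A ?c Z (snd ?c q) = Z q" for Z using q by (simp add: vf_rep_def)
  have id': "vf_rep A c Z (snd c q) = to_chart A c q *v Z q" for Z using assms(4) ch by (simp add: vf_rep_def)
  have sym: "dd (\<lambda>y. dd g y (X q)) (snd ?c q) (Y q) = dd (\<lambda>y. dd g y (Y q)) (snd ?c q) (X q)"
    by (rule dd_symmetric[OF S(1,3,2)])
  show ?thesis
    unfolding lie_bracket_def coord_at_def matrix_vector_mult_diff_distrib id'
      key[OF assms(1), of "Y q", symmetric] key[OF assms(2), of "X q", symmetric] id sym by simp
qed

end

section \<open>Bump functions and partitions of unity\<close>

text \<open>The whole family is introduced because the derivative of a member is a combination of
  two members, which makes smoothness an induction on the order.\<close>

definition flat_fun :: "nat \<Rightarrow> real \<Rightarrow> real" where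
  "flat_fun n t = (if t > 0 then (1 / t) ^ n * exp (- (1 / t)) else 0)"

lemma flat_fun_has_derivative:
  "(flat_fun n has_real_derivative flat_fun (n + 2) t - real n * flat_fun (n + 1) t) (at t)"
proof -
  consider "t > 0" | "t < 0" | "t = 0" by linarith
  then show ?thesis
  proof cases
    case 1
    have u: "((\<lambda>t. 1 / t) has_real_derivative - ((1 / t) ^ 2)) (at t)"
      using 1 by (auto intro!: derivative_eq_intros simp: power2_eq_square)
    have "((\<lambda>u. u ^ n * exp (- u)) has_real_derivative (real n * u ^ (n - 1) - u ^ n) * exp (- u)) (at u)" for u :: real
      by (auto intro!: derivative_eq_intros simp: algebra_simps)
    from DERIV_chain'[OF u this] have "((\<lambda>t. (1 / t) ^ n * exp (- (1 / t))) has_real_derivative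
       flat_fun (n + 2) t - real n * flat_fun (n + 1) t) (at t)"
      by (rule DERIV_cong) (use 1 in \<open>cases n; simp add: flat_fun_def power2_eq_square algebra_simps add_divide_distrib\<close>)
    then show ?thesis
      by (rule has_field_derivative_transform_within_open[of _ _ _ "{0<..}"])
        (use 1 in \<open>auto simp: flat_fun_def\<close>)
  next
    case 2
    have "((\<lambda>t. 0) has_real_derivative 0) (at t)" by simp
    then have "(flat_fun n has_real_derivative 0) (at t)"
      by (rule has_field_derivative_transform_within_open[of _ _ _ "{..<0}"])
        (use 2 in \<open>auto simp: flat_fun_def\<close>)
    then show ?thesis using 2 by (simp add: flat_fun_def)
  next
    case 3
    \<comment> \<open>With \<open>y = 1 / h\<close> the difference quotient at 0 from the right is
      \<open>y ^ Suc n / exp y\<close>.\<close>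
    have "((\<lambda>y. y ^ Suc n / exp y) \<longlongrightarrow> (0::real)) at_top" by (rule tendsto_power_div_exp_0)
    then have "((\<lambda>h. (inverse h) ^ Suc n / exp (inverse h)) \<longlongrightarrow> (0::real)) (at_right 0)"
      by (rule filterlim_compose[OF _ filterlim_inverse_at_top_right])
    then have "((\<lambda>h. flat_fun n h / h) \<longlongrightarrow> 0) (at_right 0)"
      by (rule Lim_transform_eventually)
        (auto simp: eventually_at_filter flat_fun_def exp_minus field_simps)
    moreover have "((\<lambda>h. flat_fun n h / h) \<longlongrightarrow> 0) (at_left 0)"
      by (rule tendsto_eventually) (auto simp: eventually_at_filter flat_fun_def)
    ultimately have "((\<lambda>h. flat_fun n h / h) \<longlongrightarrow> 0) (at 0)" by (rule filterlim_split_at[rotated])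
    then show ?thesis using 3 by (simp add: DERIV_def flat_fun_def)
  qed
qed

lemma flat_fun_smooth: "smooth_on UNIV (flat_fun n)"
proof -
  have "ck_on k UNIV (flat_fun n)" for k
  proof (induction k arbitrary: n)
    case 0
    then show ?case
      using flat_fun_has_derivative by (auto intro!: continuous_at_imp_continuous_on DERIV_isCont)
  next
    case (Suc k)
    have der: "(flat_fun n has_derivative (\<lambda>v. v * (flat_fun (n + 2) t - real n * flat_fun (n + 1) t))) (at t)" for t
      using flat_fun_has_derivative[of n t] by (simp add: has_field_derivative_def mult.commute[of _ "_ - _"])
    have "ck_on k UNIV (\<lambda>t. v * (flat_fun (n + 2) t + (- real n) * flat_fun (n + 1) t))" for v
      by (intro ck_on_comp_linear[OF bounded_linear_mult_right] ck_on_add Suc.IH open_UNIV)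
    then show ?case
      using differentiableI[OF der] by (simp add: dd_eq[OF der])
  qed
  then show ?thesis by (simp add: smooth_on_def)
qed

text \<open>The squared distance is polynomial, whereas the norm itself is not smooth at the
  centre.\<close>

definition ball_bump :: "'a::euclidean_space \<Rightarrow> real \<Rightarrow> 'a \<Rightarrow> real" where
  "ball_bump a r x = flat_fun 0 (r\<^sup>2 - (x - a) \<bullet> (x - a))"

lemma ball_bump_smooth: "smooth_on UNIV (ball_bump a r)"
proof -
  have "smooth_on UNIV (\<lambda>x. r\<^sup>2 - (x - a) \<bullet> (x - a))"
    by (intro smooth_intros smooth_on_bilinear[OF bounded_bilinear_inner] open_UNIV)
  from smooth_on_compose[OF flat_fun_smooth[of 0] this] show ?thesis
    unfolding ball_bump_def[abs_def] by simp
qed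

lemma ball_bump_nonneg: "ball_bump a r x \<ge> 0"
  by (simp add: ball_bump_def flat_fun_def)

lemma ball_bump_pos: "r > 0 \<Longrightarrow> ball_bump a r a > 0"
  by (simp add: ball_bump_def flat_fun_def)

lemma ball_bump_support: "r > 0 \<Longrightarrow> ball_bump a r x \<noteq> 0 \<Longrightarrow> x \<in> cball a r"
  using power2_less_imp_less[of "norm (x - a)" r]
  by (auto simp: ball_bump_def flat_fun_def dot_square_norm dist_norm norm_minus_commute split: if_splits)

lemma smooth_on_zero: "open S \<Longrightarrow> (\<And>x. x \<in> S \<Longrightarrow> f x = 0) \<Longrightarrow> smooth_on S f"
  by (rule smooth_on_eq_on[OF smooth_on_const[of _ 0]])

context oriented_mfd begin

lemma smooth_fun_const [smooth_intros]: "smooth_fun A (\<lambda>q. a)"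
  by (auto simp: smooth_fun_def o_def intro: smooth_on_const)

lemma smooth_fun_add [smooth_intros]: "smooth_fun A f \<Longrightarrow> smooth_fun A g \<Longrightarrow> smooth_fun A (\<lambda>q. f q + g q)"
  using compat_chart A_compat by (auto simp: smooth_fun_def o_def intro!: smooth_intros)

lemma smooth_fun_mult [smooth_intros]: "smooth_fun A f \<Longrightarrow> smooth_fun A g \<Longrightarrow> smooth_fun A (\<lambda>q. f q * g q)"
  using compat_chart A_compat by (auto simp: smooth_fun_def o_def intro!: smooth_intros)

lemma smooth_fun_divide [smooth_intros]:
  "smooth_fun A f \<Longrightarrow> smooth_fun A g \<Longrightarrow> (\<And>q. g q \<noteq> 0) \<Longrightarrow> smooth_fun A (\<lambda>q. f q / g q)"
  using compat_chart A_compat by (auto simp: smooth_fun_def o_def intro!: smooth_intros)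

lemma smooth_fun_exp [smooth_intros]: "smooth_fun A f \<Longrightarrow> smooth_fun A (\<lambda>q. exp (f q))"
  using compat_chart A_compat by (auto simp: smooth_fun_def o_def intro!: smooth_intros)

lemma smooth_fun_sum [smooth_intros]:
  "(\<And>i. i \<in> I \<Longrightarrow> smooth_fun A (f i)) \<Longrightarrow> smooth_fun A (\<lambda>q. \<Sum>i\<in>I. f i q)"
  by (induction I rule: infinite_finite_induct) (auto intro: smooth_intros)

lemma smooth_fun_continuous:
  assumes "smooth_fun A f"
  shows "continuous_on UNIV f"
proof (rule continuous_at_imp_continuous_on, rule ballI)
  fix q
  let ?c = "chart_at A q"
  have c: "is_chart ?c" "q \<in> fst ?c" using chart_at by auto
  have "continuous_on (cimg ?c) (f \<circ> cinv ?c)"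
    using smooth_on_imp_continuous_on[OF smooth_fun_chart[OF assms chart_at_compat(1)]] .
  moreover have "continuous_on (fst ?c) (snd ?c)" using c unfolding is_chart_def homeomorphism_def by blast
  ultimately have "continuous_on (fst ?c) (\<lambda>q. (f \<circ> cinv ?c) (snd ?c q))"
    by (rule continuous_on_compose2) auto
  then have "continuous_on (fst ?c) f"
    by (rule continuous_on_eq) (use c in simp)
  then show "isCont f q" using c is_chart_open(1) continuous_on_eq_continuous_at by blast
qed

text \<open>The bump lives on a closed ball in coordinates, whose image \<open>K\<close> in the
  manifold is compact. In a Hausdorff space \<open>K\<close> is closed, so the extension by zero is
  smooth on the open complement, and the closure of the support stays inside the chart.\<close>

lemma smooth_fun_bump:
  assumes c: "compat A c" and p: "p \<in> fst c" and U: "open U" "p \<in> U"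
  obtains f where "smooth_fun A f" "f p > 0" "\<And>q. f q \<ge> 0" "closure {q. f q \<noteq> 0} \<subseteq> U \<inter> fst c"
proof -
  have ch: "is_chart c" using c by simp
  have "open (snd c ` (U \<inter> fst c))" using ch U by (intro open_coord_image) (auto intro!: open_Int)
  moreover have "snd c p \<in> snd c ` (U \<inter> fst c)" using p U by auto
  ultimately obtain r where r: "r > 0" "cball (snd c p) r \<subseteq> snd c ` (U \<inter> fst c)"
    using open_contains_cball by metis
  define f where "f = (\<lambda>q. if q \<in> fst c then ball_bump (snd c p) r (snd c q) else 0)"
  define K where "K = cinv c ` cball (snd c p) r"
  have sub: "cball (snd c p) r \<subseteq> cimg c" using r by (auto simp: cimg_def)
  have "continuous_on (cimg c) (cinv c)" using ch unfolding is_chart_def homeomorphism_def by blast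
  then have K: "compact K" unfolding K_def
    by (intro compact_continuous_image continuous_on_subset[OF _ sub]) auto
  have KU: "K \<subseteq> U \<inter> fst c" using r(2) ch unfolding K_def by fastforce
  have fK: "f q = 0" if "q \<notin> K" for q
  proof (rule ccontr)
    assume "f q \<noteq> 0"
    then have "q \<in> fst c" "snd c q \<in> cball (snd c p) r"
      using ball_bump_support[OF r(1)] by (auto simp: f_def split: if_splits)
    then show False using that ch unfolding K_def by (metis cinv_coord imageI)
  qed
  show ?thesis
  proof (rule that)
    show "f p > 0" using p ball_bump_pos[OF r(1)] by (simp add: f_def)
    show "f q \<ge> 0" for q by (simp add: f_def ball_bump_nonneg)
    have "closure {q. f q \<noteq> 0} \<subseteq> K"
      by (rule closure_minimal) (use fK K compact_imp_closed in auto)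
    then show "closure {q. f q \<noteq> 0} \<subseteq> U \<inter> fst c" using KU by blast
    show "smooth_fun A f"
    proof (rule smooth_funI)
      fix q
      show "\<exists>c U. compat A c \<and> open U \<and> q \<in> U \<and> U \<subseteq> fst c \<and> smooth_on (snd c ` U) (f \<circ> cinv c)"
      proof (cases "q \<in> fst c")
        case True
        have "smooth_on (cimg c) (f \<circ> cinv c)"
          by (rule smooth_on_eq_on[OF smooth_on_subset[OF ball_bump_smooth[of "snd c p" r]]])
            (use ch in \<open>auto simp: f_def\<close>)
        then show ?thesis using True c ch by (intro exI[of _ c] exI[of _ "fst c"]) (auto simp: cimg_def)
      next
        case False
        let ?c = "chart_at A q"
        have o: "open (- K \<inter> fst ?c)" using K compact_imp_closed by (auto intro!: open_Int)
        have "smooth_on (snd ?c ` (- K \<inter> fst ?c)) (f \<circ> cinv ?c)"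
          by (rule smooth_on_zero[OF open_coord_image[OF chart_at_compat(2) o Int_lower2]]) (use fK in auto)
        moreover have "q \<notin> K" using False KU by blast
        ultimately show ?thesis using o chart_at by (intro exI[of _ ?c] exI[of _ "- K \<inter> fst ?c"]) auto
      qed
    qed
  qed
qed

lemma smooth_fun_cutoff:
  assumes c: "compat A c" and f: "smooth_fun A f" "closure {q. f q \<noteq> 0} \<subseteq> fst c" and Y: "smooth_on (cimg c) Y"
  shows "smooth_fun A (\<lambda>q. if q \<in> fst c then f q * Y (snd c q) else 0)"
proof (rule smooth_funI)
  fix q
  let ?X = "\<lambda>q. if q \<in> fst c then f q * Y (snd c q) else 0"
  show "\<exists>c U. compat A c \<and> open U \<and> q \<in> U \<and> U \<subseteq> fst c \<and> smooth_on (snd c ` U) (?X \<circ> cinv c)"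
  proof (cases "q \<in> fst c")
    case True
    have "smooth_on (cimg c) (\<lambda>x. (f \<circ> cinv c) x * Y x)"
      using c by (intro smooth_intros Y smooth_fun_chart[OF f(1) c]) auto
    then have "smooth_on (cimg c) (?X \<circ> cinv c)"
      by (rule smooth_on_eq_on) (use c in auto)
    then show ?thesis using True c by (intro exI[of _ c] exI[of _ "fst c"]) (auto simp: cimg_def)
  next
    case False
    let ?c = "chart_at A q" and ?U = "- closure {q. f q \<noteq> 0} \<inter> fst (chart_at A q)"
    have o: "open ?U" by (auto intro!: open_Int)
    have Z: "f (cinv ?c x) = 0" if x: "x \<in> snd ?c ` ?U" for x
    proof -
      obtain r where r: "r \<in> ?U" "x = snd ?c r" using x by blast
      then have "f r = 0" using closure_subset[of "{q. f q \<noteq> 0}"] by blast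
      moreover have "cinv ?c x = r" using r by (metis IntD2 chart_at_compat(2) cinv_coord)
      ultimately show ?thesis by simp
    qed
    have "smooth_on (snd ?c ` ?U) (?X \<circ> cinv ?c)"
      by (rule smooth_on_zero[OF open_coord_image[OF chart_at_compat(2) o Int_lower2]]) (simp add: Z)
    then show ?thesis using o chart_at False f(2) by (intro exI[of _ ?c] exI[of _ ?U]) auto
  qed
qed

lemma smooth_vf_cutoff:
  assumes c: "compat A c" and f: "smooth_fun A f" "closure {q. f q \<noteq> 0} \<subseteq> fst c" and Y: "smooth_on (cimg c) Y"
  shows "smooth_vf A (\<lambda>q. if q \<in> fst c then f q *\<^sub>R (from_chart A c q *v Y (snd c q)) else 0)" (is "smooth_vf A ?X")
proof (rule smooth_vfI)
  fix q
  show "\<exists>c U. compat A c \<and> open U \<and> q \<in> U \<and> U \<subseteq> fst c \<and> smooth_on (snd c ` U) (vf_rep A c ?X)"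
  proof (cases "q \<in> fst c")
    case True
    have "smooth_on (cimg c) (\<lambda>x. (f \<circ> cinv c) x *\<^sub>R Y x)"
      using c by (intro smooth_intros Y smooth_fun_chart[OF f(1) c]) auto
    then have "smooth_on (cimg c) (vf_rep A c ?X)"
      by (rule smooth_on_eq_on)
        (use c in \<open>auto simp: vf_rep_def to_from_chart_vec matrix_vector_mult_scaleR\<close>)
    then show ?thesis using True c by (intro exI[of _ c] exI[of _ "fst c"]) (auto simp: cimg_def)
  next
    case False
    let ?c = "chart_at A q" and ?U = "- closure {q. f q \<noteq> 0} \<inter> fst (chart_at A q)"
    have o: "open ?U" by (auto intro!: open_Int)
    have Z: "f (cinv ?c x) = 0" if x: "x \<in> snd ?c ` ?U" for x
    proof -
      obtain r where r: "r \<in> ?U" "x = snd ?c r" using x by blast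
      then have "f r = 0" using closure_subset[of "{q. f q \<noteq> 0}"] by blast
      moreover have "cinv ?c x = r" using r by (metis IntD2 chart_at_compat(2) cinv_coord)
      ultimately show ?thesis by simp
    qed
    have "smooth_on (snd ?c ` ?U) (vf_rep A ?c ?X)"
      by (rule smooth_on_zero[OF open_coord_image[OF chart_at_compat(2) o Int_lower2]]) (simp add: Z vf_rep_def)
    then show ?thesis using o chart_at False f(2) by (intro exI[of _ ?c] exI[of _ ?U]) auto
  qed
qed

text \<open>This gives meaning to the choice in \<open>vf_ext\<close>. The field is constant in a
  chart, cut off by a bump and rescaled by the value of the bump at \<open>p\<close>.\<close>

lemma smooth_vf_exists: "\<exists>X. smooth_vf A X \<and> X p = z"
proof -
  let ?c = "chart_at A p"
  obtain f where f: "smooth_fun A f" "f p > 0" "closure {q. f q \<noteq> 0} \<subseteq> fst ?c"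
    by (rule smooth_fun_bump[OF chart_at_compat(1) chart_at(2) open_UNIV UNIV_I]) blast
  let ?X = "\<lambda>q. if q \<in> fst ?c then f q *\<^sub>R (from_chart A ?c q *v ((1 / f p) *\<^sub>R z)) else 0"
  have "smooth_vf A ?X"
    by (rule smooth_vf_cutoff[OF _ f(1,3), of "\<lambda>_. (1 / f p) *\<^sub>R z"]) (auto intro: smooth_on_const)
  moreover have "?X p = z" using f chart_at by (simp add: matrix_vector_mult_scaleR)
  ultimately show ?thesis by blast
qed

lemma vf_ext: "smooth_vf A (vf_ext A p z)" "vf_ext A p z p = z"
  using someI_ex[OF smooth_vf_exists[of p z]] unfolding vf_ext_def by auto

section \<open>Algebraic operations on smooth fields\<close>

lemma vf_rep_add: "vf_rep A c (\<lambda>q. X q + Y q) x = vf_rep A c X x + vf_rep A c Y x"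
  by (simp add: vf_rep_def matrix_vector_right_distrib)

lemma vf_rep_scale: "vf_rep A c (\<lambda>q. f q *\<^sub>R X q) x = f (cinv c x) *\<^sub>R vf_rep A c X x"
  by (simp add: vf_rep_def matrix_vector_mult_scaleR)

lemma smooth_vf_add [smooth_intros]: "smooth_vf A X \<Longrightarrow> smooth_vf A Y \<Longrightarrow> smooth_vf A (\<lambda>q. X q + Y q)"
  using A_compat by (auto simp: smooth_vf_def vf_rep_add[abs_def] intro!: smooth_intros)

lemma smooth_vf_scale [smooth_intros]: "smooth_fun A f \<Longrightarrow> smooth_vf A X \<Longrightarrow> smooth_vf A (\<lambda>q. f q *\<^sub>R X q)"
  using A_compat by (auto simp: smooth_fun_def o_def smooth_vf_def vf_rep_scale[abs_def] intro!: smooth_intros)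

lemma smooth_vf_zero [smooth_intros]: "smooth_vf A (\<lambda>q. 0)"
  by (auto simp: smooth_vf_def vf_rep_def[abs_def] intro!: smooth_on_const)

lemma smooth_vf_sum [smooth_intros]:
  "(\<And>i. i \<in> I \<Longrightarrow> smooth_vf A (X i)) \<Longrightarrow> smooth_vf A (\<lambda>q. \<Sum>i\<in>I. X i q)"
  by (induction I rule: infinite_finite_induct) (auto intro: smooth_intros)

lemma vf_rep_app:
  assumes "compat A c" "x \<in> cimg c"
  shows "vf_rep A c (app B X) x = endo_rep A c B x *v vf_rep A c X x"
  using to_from_chart_vec[OF assms(1) cinv_in[OF _ assms(2)]] assms
  by (simp add: vf_rep_def app_def endo_rep_def matrix_vector_mul_assoc[symmetric])

lemma smooth_vf_app [smooth_intros]: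
  assumes "smooth_endo A B" "smooth_vf A X"
  shows "smooth_vf A (app B X)"
  unfolding smooth_vf_def
proof
  fix c assume "c \<in> A"
  then have c: "compat A c" by (rule A_compat)
  have "smooth_on (cimg c) (\<lambda>x. endo_rep A c B x *v vf_rep A c X x)"
    using c by (intro smooth_intros smooth_endo_chart[OF assms(1)] smooth_vf_chart[OF assms(2)]) auto
  then show "smooth_on (cimg c) (vf_rep A c (app B X))"
    by (rule smooth_on_eq_on) (use c vf_rep_app in auto)
qed

lemma to_from_chart_cancel:
  assumes "compat A c" "q \<in> fst c"
  shows "to_chart A c q ** (from_chart A c q ** Z) = Z" "from_chart A c q ** (to_chart A c q ** Z) = Z"
  using to_from_chart[OF assms] by (simp_all add: matrix_mul_assoc)

lemma endo_rep_mult: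
  assumes "compat A c" "x \<in> cimg c"
  shows "endo_rep A c (\<lambda>q. B q ** D q) x = endo_rep A c B x ** endo_rep A c D x"
  using assms cinv_in[OF compat_chart[OF assms(1)] assms(2)]
  by (simp add: endo_rep_def matrix_mul_assoc[symmetric] to_from_chart_cancel)

lemma endo_rep_conj: 
  assumes "compat A c" "q \<in> fst c"
  shows "endo_rep A c B (snd c q) = to_chart A c q ** B q ** from_chart A c q"
    "B q = from_chart A c q ** endo_rep A c B (snd c q) ** to_chart A c q"
proof -
  show 1: "endo_rep A c B (snd c q) = to_chart A c q ** B q ** from_chart A c q"
    using assms by (simp add: endo_rep_def)
  show "B q = from_chart A c q ** endo_rep A c B (snd c q) ** to_chart A c q"
    unfolding 1 using assms
    by (simp add: matrix_mul_assoc[symmetric] to_from_chart_cancel to_from_chart)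
qed

lemma trace_mult_commute: "trace (M ** N) = trace (N ** (M :: real^'n^'n))"
  by (rule trace_mul_sym)

lemma trace_endo_rep:
  assumes "compat A c" "q \<in> fst c"
  shows "trace (endo_rep A c B (snd c q)) = trace (B q)"
  unfolding endo_rep_conj(1)[OF assms] trace_mult_commute[of _ "from_chart A c q"]
  using to_from_chart[OF assms] by (simp add: matrix_mul_assoc)

end

locale closed_mfd = oriented_mfd A for A :: "('m::t2_space, 'd::finite) chart set" +
  assumes compact_UNIV: "compact (UNIV :: 'm set)"
begin

lemma partition_of_unity_exists: "\<exists>C \<theta>. partition_of_unity A C \<theta>"
proof -
  have "\<exists>f. smooth_fun A f \<and> f p > 0 \<and> (\<forall>q. f q \<ge> 0) \<and> closure {q. f q \<noteq> 0} \<subseteq> fst (chart_at A p)" for p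
    by (rule smooth_fun_bump[OF chart_at_compat(1) chart_at(2) open_UNIV UNIV_I]) blast
  then obtain f where f: "\<And>p. smooth_fun A (f p)" "\<And>p. f p p > 0" "\<And>p q. f p q \<ge> 0"
    "\<And>p. closure {q. f p q \<noteq> 0} \<subseteq> fst (chart_at A p)"
    by metis
  have "open {q. f p q > 0}" for p
    using open_Collect_less[OF continuous_on_const smooth_fun_continuous[OF f(1)]] .
  then obtain D where D: "finite D" "UNIV \<subseteq> (\<Union>p\<in>D. {q. f p q > 0})"
    by (rule compactE_image[OF compact_UNIV, of UNIV "\<lambda>p. {q. f p q > 0}"]) (use f(2) in auto)
  define S where "S = (\<lambda>q. \<Sum>p\<in>D. f p q)"
  have S: "S q > 0" for q
  proof -
    obtain p where "p \<in> D" "f p q > 0" using D by blast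
    then show ?thesis unfolding S_def using D(1) f(3) by (intro sum_pos2[of D p]) auto
  qed
  \<comment> \<open>Partitions are indexed by charts, while several of the finitely many bumps may
    use the same chart; these are added up before normalising.\<close>
  define \<theta> where "\<theta> = (\<lambda>c q. (\<Sum>p\<in>{p\<in>D. chart_at A p = c}. f p q) / S q)"
  have "partition_of_unity A (chart_at A ` D) \<theta>"
    unfolding partition_of_unity_def
  proof (intro conjI ballI allI)
    show "finite (chart_at A ` D)" "chart_at A ` D \<subseteq> A" using D chart_at by auto
    fix c
    have "smooth_fun A S" unfolding S_def by (intro smooth_intros f)
    moreover have "S q \<noteq> 0" for q using S[of q] by simp
    ultimately show "smooth_fun A (\<theta> c)" unfolding \<theta>_def
      by (intro smooth_fun_divide smooth_fun_sum f)
    show "\<theta> c q \<ge> 0" for q unfolding \<theta>_def using S[of q] f(3) by (intro divide_nonneg_pos sum_nonneg) auto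
    let ?K = "\<Union>p\<in>{p\<in>D. chart_at A p = c}. closure {q. f p q \<noteq> 0}"
    have "{q. \<theta> c q \<noteq> 0} \<subseteq> ?K"
    proof
      fix q assume "q \<in> {q. \<theta> c q \<noteq> 0}"
      then have "(\<Sum>p\<in>{p\<in>D. chart_at A p = c}. f p q) \<noteq> 0" by (auto simp: \<theta>_def)
      then obtain p where "p \<in> D" "chart_at A p = c" "f p q \<noteq> 0" by (metis (mono_tags, lifting) mem_Collect_eq sum.neutral)
      then show "q \<in> ?K" using closure_subset[of "{q. f p q \<noteq> 0}"] by blast
    qed
    moreover have "closed ?K" using D by auto
    ultimately have "closure {q. \<theta> c q \<noteq> 0} \<subseteq> ?K" by (rule closure_minimal)
    then show "closure {q. \<theta> c q \<noteq> 0} \<subseteq> fst c" using f(4) by blast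
  next
    fix q
    have "(\<Sum>c\<in>chart_at A ` D. \<Sum>p\<in>{p\<in>D. chart_at A p = c}. f p q) = S q"
      unfolding S_def using D(1) by (rule sum.image_gen[symmetric])
    then show "(\<Sum>c\<in>chart_at A ` D. \<theta> c q) = 1"
      unfolding \<theta>_def using S[of q] by (simp add: sum_divide_distrib[symmetric])
  qed
  then show ?thesis by blast
qed

end

section \<open>Forms of top degree\<close>

lemma bij_index: "bij_betw (\<lambda>b::'d::{finite,wellorder}. card {..<b}) UNIV {..<CARD('d)}"
proof -
  have lt: "card {..<a} < card {..<b}" if "a < b" for a b :: 'd
    using that by (intro psubset_card_mono) auto
  have inj: "inj (\<lambda>b::'d. card {..<b})"
  proof (rule injI)
    fix a b :: 'd assume "card {..<a} = card {..<b}"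
    then show "a = b" using lt[of a b] lt[of b a] by (cases a b rule: linorder_cases) auto
  qed
  have "card {..<b} < CARD('d)" for b :: 'd
    by (intro psubset_card_mono) auto
  then have "range (\<lambda>b::'d. card {..<b}) \<subseteq> {..<CARD('d)}" by auto
  then have "range (\<lambda>b::'d. card {..<b}) = {..<CARD('d)}"
    by (intro card_subset_eq) (auto simp: card_image[OF inj])
  then show ?thesis using inj by (simp add: bij_betw_def)
qed

lemma index_less: "card {..<b::'d::{finite,wellorder}} < CARD('d)"
  using bij_index by (auto simp: bij_betw_def)

lemma index_inj: "card {..<a::'d::{finite,wellorder}} = card {..<b} \<longleftrightarrow> a = b"
  using bij_index[where 'd = 'd] by (auto simp: bij_betw_def inj_def)

lemma index_surj: "i < CARD('d::{finite,wellorder}) \<Longrightarrow> \<exists>b::'d. i = card {..<b}"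
  using bij_index[where 'd = 'd] unfolding bij_betw_def by (metis imageE lessThan_iff)

lemma std_frame_index: "std_frame (card {..<b::'d::{finite,wellorder}}) = axis b 1"
  by (simp add: std_frame_def axis_def vec_eq_iff index_inj)

lemma frame_det_rows:
  fixes w :: "nat \<Rightarrow> real^'d::{finite,wellorder}"
  shows "frame_det w = det (\<chi> b::'d. w (card {..<b}))"
proof -
  have "(\<chi> a b. w (card {..<b}) $ a) = transpose (\<chi> b::'d. w (card {..<b}))"
    by (simp add: transpose_def)
  then show ?thesis by (simp add: frame_det_def det_transpose)
qed

lemma frame_det_alternating: "alternating_form CARD('d) (frame_det :: (nat \<Rightarrow> real^'d::{finite,wellorder}) \<Rightarrow> real)"
  unfolding alternating_form_def
proof (intro conjI allI impI)
  fix w w' :: "nat \<Rightarrow> (real, 'd) vec" assume "\<forall>i<CARD('d). w i = w' i"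
  then show "frame_det w = frame_det w'" using index_less[where 'd = 'd] by (simp add: frame_det_def)
next
  fix w :: "nat \<Rightarrow> (real, 'd) vec" and i assume "i < CARD('d)"
  then obtain k :: 'd where k: "i = card {..<k}" using index_surj by blast
  have *: "(\<chi> b::'d. (w(i := x)) (card {..<b})) = (\<chi> b. if b = k then x else w (card {..<b}))" for x
    by (auto simp: vec_eq_iff k index_inj)
  show "linear (\<lambda>x. frame_det (w(i := x)))"
    unfolding frame_det_rows *
  proof (rule linearI)
    fix x y :: "(real, 'd) vec" and a :: real
    show "det (\<chi> b. if b = k then x + y else w (card {..<b})) =
      det (\<chi> b. if b = k then x else w (card {..<b})) + det (\<chi> b. if b = k then y else w (card {..<b}))"
      by (rule det_row_add)
    show "det (\<chi> b. if b = k then a *\<^sub>R x else w (card {..<b})) =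
      a *\<^sub>R det (\<chi> b. if b = k then x else w (card {..<b}))"
      using det_row_mul[of k a "\<lambda>_. x" "\<lambda>b. w (card {..<b})"]
      by (simp add: scalar_mult_eq_scaleR cong: if_cong)
  qed
next
  fix w :: "nat \<Rightarrow> (real, 'd) vec" and i j assume "i < CARD('d)" "j < CARD('d)" "i \<noteq> j \<and> w i = w j"
  moreover obtain k :: 'd where k: "i = card {..<k}" using index_surj calculation by blast
  moreover obtain l :: 'd where l: "j = card {..<l}" using index_surj calculation by blast
  ultimately show "frame_det w = 0"
    unfolding frame_det_rows by (intro det_identical_rows[of k l]) (auto simp: row_def vec_eq_iff)
qed

lemma frame_det_std: "frame_det (std_frame :: nat \<Rightarrow> real^'d::{finite,wellorder}) = 1"
proof -
  have "(\<chi> b::'d. (std_frame (card {..<b}) :: (real, 'd) vec)) = mat 1"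
    by (auto simp: std_frame_index mat_def axis_def vec_eq_iff)
  then show ?thesis unfolding frame_det_rows by simp
qed

lemma frame_det_matrix: "frame_det (\<lambda>i. M *v w i) = det M * frame_det (w :: nat \<Rightarrow> real^'d::{finite,wellorder})"
proof -
  have "(\<chi> a. \<chi> b::'d. (M *v w (card {..<b})) $ a) = M ** (\<chi> a. \<chi> b::'d. w (card {..<b}) $ a)"
    by (simp add: vec_eq_iff matrix_vector_mult_def matrix_matrix_mult_def)
  then show ?thesis by (simp add: frame_det_def det_mul)
qed

text \<open>Induction on the number \<open>m\<close> of leading slots that may hold arbitrary
  vectors; the later slots below \<open>k\<close> already hold basis vectors. Expanding the last
  arbitrary slot reduces \<open>m\<close>.\<close>

lemma alternating_form_eqI:
  fixes g h :: "(nat \<Rightarrow> real^'d::finite) \<Rightarrow> real"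
  assumes g: "alternating_form k g" and h: "alternating_form k h"
    and eq: "\<And>s. g (\<lambda>i. axis (s i) 1) = h (\<lambda>i. axis (s i) 1)"
  shows "g w = h w"
proof -
  have "g w = h w" if "m \<le> k" "\<And>i. i < k \<Longrightarrow> m \<le> i \<Longrightarrow> w i \<in> Basis" for m w
    using that
  proof (induction m arbitrary: w)
    case 0
    then have "\<forall>i. \<exists>a. i < k \<longrightarrow> w i = axis a 1" by (auto simp: Basis_vec_def)
    then obtain s where "\<And>i. i < k \<Longrightarrow> w i = axis (s i) 1" by metis
    then show ?case using alternating_form_cong[OF g, of w] alternating_form_cong[OF h, of w] eq by metis
  next
    case (Suc m)
    have "g (w(m := b)) = h (w(m := b))" if "b \<in> Basis" for b
      using Suc.prems that by (intro Suc.IH) auto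
    then have "g (w(m := w m)) = h (w(m := w m))"
      unfolding alternating_form_expand[OF g Suc_le_lessD[OF Suc.prems(1)], of w "w m"]
        alternating_form_expand[OF h Suc_le_lessD[OF Suc.prems(1)], of w "w m"] by simp
    then show ?case by simp
  qed
  from this[of k] show ?thesis by simp
qed

text \<open>A repeated index makes both sides vanish. Otherwise the indices define a permutation of
  the standard frame, and both sides carry its sign.\<close>

lemma top_form_basis:
  fixes s :: "nat \<Rightarrow> 'd::{finite,wellorder}"
  assumes g: "alternating_form CARD('d) g"
  shows "g (\<lambda>i. axis (s i) 1) = frame_det (\<lambda>i. axis (s i) 1) * g std_frame"
proof (cases "inj_on s {..<CARD('d)}")
  case False
  then obtain i j where "i < CARD('d)" "j < CARD('d)" "i \<noteq> j" "s i = s j" by (auto simp: inj_on_def)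
  then have "g (\<lambda>i. axis (s i) 1) = 0" "frame_det (\<lambda>i. axis (s i) 1 :: (real, 'd) vec) = 0"
    by (intro alternating_form_repeat[OF g, of i j] alternating_form_repeat[OF frame_det_alternating, of i j]; simp)+
  then show ?thesis by simp
next
  case True
  define \<sigma> where "\<sigma> = (\<lambda>i. if i < CARD('d) then card {..<s i} else i)"
  have "inj_on \<sigma> {..<CARD('d)}"
    using True by (auto simp: inj_on_def \<sigma>_def index_inj)
  moreover have "\<sigma> ` {..<CARD('d)} \<subseteq> {..<CARD('d)}" using index_less by (auto simp: \<sigma>_def)
  ultimately have "bij_betw \<sigma> {..<CARD('d)} {..<CARD('d)}"
    by (simp add: bij_betw_def endo_inj_surj)
  then have \<sigma>: "\<sigma> permutes {..<CARD('d)}"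
    by (rule bij_imp_permutes) (simp add: \<sigma>_def)
  have std: "axis (s i) 1 = std_frame (\<sigma> i)" if "i < CARD('d)" for i
    using that by (simp add: \<sigma>_def std_frame_index)
  have "g (\<lambda>i. axis (s i) 1) = of_int (sign \<sigma>) * g std_frame"
    using alternating_form_cong[OF g, of "\<lambda>i. axis (s i) 1" "\<lambda>i. std_frame (\<sigma> i)"] std
      alternating_form_permutes[OF g \<sigma>, of std_frame] by simp
  moreover have "frame_det (\<lambda>i. axis (s i) 1) = of_int (sign \<sigma>)"
    using alternating_form_cong[OF frame_det_alternating, of "\<lambda>i. axis (s i) 1" "\<lambda>i. std_frame (\<sigma> i)"] std
      alternating_form_permutes[OF frame_det_alternating \<sigma>, of std_frame] by (simp add: frame_det_std)
  ultimately show ?thesis by simp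
qed

lemma alternating_form_scale: "alternating_form k g \<Longrightarrow> alternating_form k (\<lambda>w. g w * a)"
  unfolding alternating_form_def
  by (auto simp: linear_iff algebra_simps)

lemma top_form_det:
  fixes w :: "nat \<Rightarrow> real^'d::{finite,wellorder}"
  assumes g: "alternating_form CARD('d) g"
  shows "g w = frame_det w * g std_frame"
  by (rule alternating_form_eqI[OF g alternating_form_scale[OF frame_det_alternating] top_form_basis[OF g]])

lemma top_form_upd_std:
  assumes g: "alternating_form CARD('d) g"
  shows "g (std_frame(card {..<b::'d::{finite,wellorder}} := v)) = v $ b * g std_frame"
proof -
  have v0: "g (std_frame(card {..<b} := axis a 1)) = (if a = b then g std_frame else 0)" for a
  proof (cases "a = b")
    case True
    then show ?thesis using std_frame_index[of b] by (simp add: fun_upd_idem)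
  next
    case False
    then show ?thesis
      using alternating_form_repeat[OF g index_less[of a] index_less[of b], of "std_frame(card {..<b} := axis a 1)"]
      by (simp add: index_inj std_frame_index)
  qed
  have e2: "(\<Sum>u\<in>Basis. (v \<bullet> u) * g (std_frame(card {..<b} := u)))
     = (\<Sum>a\<in>UNIV. v $ a * g (std_frame(card {..<b} := axis a 1)))"
  proof -
    have B: "(Basis :: (real, 'd) vec set) = range (\<lambda>a. axis a 1)" by (auto simp: Basis_vec_def)
    have "inj (\<lambda>a::'d. axis a (1::real))" by (auto simp: inj_def axis_eq_axis)
    then show ?thesis unfolding B by (simp add: sum.reindex inner_axis)
  qed
  have "(\<Sum>u\<in>Basis. (v \<bullet> u) * g (std_frame(card {..<b} := u)))
     = (\<Sum>a\<in>UNIV. v $ a * (if a = b then g std_frame else 0))" by (simp only: e2 v0)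
  also have "\<dots> = v $ b * g std_frame" by (simp add: if_distrib cong: if_cong)
  finally have "(\<Sum>u\<in>Basis. (v \<bullet> u) * g (std_frame(card {..<b} := u))) = v $ b * g std_frame" .
  then show ?thesis using alternating_form_expand[OF g index_less[of b], of std_frame v] by simp
qed

text \<open>The left-hand side is the action of \<open>B\<close> as a derivation on top forms. It is
  again alternating of top degree, hence a multiple of \<open>g\<close>, and the standard frame
  reads off the factor as the sum of the diagonal entries.\<close>

lemma top_form_trace:
  fixes B :: "real^'d::{finite,wellorder}^'d::{finite,wellorder}"
  assumes g: "alternating_form CARD('d) g"
  shows "(\<Sum>i<CARD('d). g (w(i := B *v w i))) = trace B * g w"
proof -
  let ?n = "CARD('d)"
  define h where "h = (\<lambda>w. \<Sum>i<?n. g (w(i := B *v w i)))"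
  have h: "alternating_form ?n h"
    unfolding alternating_form_def
  proof (intro conjI allI impI)
    fix w w' :: "nat \<Rightarrow> (real, 'd) vec" assume "\<forall>i<?n. w i = w' i"
    then show "h w = h w'" unfolding h_def
      by (intro sum.cong refl alternating_form_cong[OF g]) auto
  next
    fix w :: "nat \<Rightarrow> (real, 'd) vec" and j assume j: "j < ?n"
    have "linear (\<lambda>x. g ((w(j := x))(i := B *v (w(j := x)) i)))" if "i < ?n" for i
    proof (cases "i = j")
      case True
      then show ?thesis
        using linear_compose[OF matrix_vector_mul_linear[of B] alternating_form_linear[OF g j, of w]] by (simp add: o_def)
    next
      case False
      then show ?thesis
        using alternating_form_linear[OF g j, of "w(i := B *v w i)"] by (simp add: fun_upd_twist)
    qed
    then show "linear (\<lambda>x. h (w(j := x)))"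
      unfolding h_def by (intro linear_compose_sum ballI) auto
  next
    fix w :: "nat \<Rightarrow> (real, 'd) vec" and a b assume ab: "a < ?n" "b < ?n" "a \<noteq> b \<and> w a = w b"
    \<comment> \<open>A term that modifies another slot still contains both equal arguments and
      vanishes. The remaining two differ by a swap.\<close>
    have "h w = (\<Sum>i\<in>{a, b}. g (w(i := B *v w i)))"
      unfolding h_def
      by (rule sum.mono_neutral_right) (use ab in \<open>auto intro!: alternating_form_repeat[OF g, of a b]\<close>)
    also have "\<dots> = g (w(a := B *v w a, b := w a)) + g (w(a := w a, b := B *v w a))"
    proof -
      have "w(a := B *v w a) = w(a := B *v w a, b := w a)" "w(b := B *v w b) = w(a := w a, b := B *v w a)"
        using ab by (auto simp: fun_eq_iff)
      then show ?thesis using ab by simp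
    qed
    also have "\<dots> = 0"
      using alternating_form_swap[OF g, of a b w "B *v w a" "w a"] ab by simp
    finally show "h w = 0" .
  qed
  have "h std_frame = (\<Sum>b\<in>(UNIV :: 'd set). g (std_frame(card {..<b} := B *v std_frame (card {..<b}))))"
    unfolding h_def using sum.reindex_bij_betw[OF bij_index[where 'd = 'd], of "\<lambda>i. g (std_frame(i := B *v std_frame i))"] by simp
  also have "\<dots> = (\<Sum>b\<in>UNIV. B $ b $ b * g std_frame)"
    by (simp add: top_form_upd_std[OF g] std_frame_index matrix_vector_mul_component inner_axis)
  finally have "h std_frame = trace B * g std_frame" by (simp add: trace_def sum_distrib_right)
  then show ?thesis
    using top_form_det[OF h, of w] top_form_det[OF g, of w] by (simp add: h_def)
qed

section \<open>Connections in coordinates\<close>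

text \<open>\<open>G x v *v z\<close> is the Christoffel term of the covariant derivative of \<open>v\<close> in the direction \<open>z\<close>.\<close>

definition local_conn ::
  "('m::t2_space, 'd::finite) chart set \<Rightarrow> ('m, 'd) conn \<Rightarrow> ('m, 'd) chart \<Rightarrow> (real^'d) set
    \<Rightarrow> (real^'d \<Rightarrow> real^'d \<Rightarrow> real^'d^'d) \<Rightarrow> bool" where
  "local_conn A nab c S G \<longleftrightarrow> open S \<and> S \<subseteq> cimg c \<and> (\<forall>v. smooth_on S (\<lambda>x. G x v)) \<and> (\<forall>x. linear (G x)) \<and>
     (\<forall>X. smooth_vf A X \<longrightarrow> (\<forall>x\<in>S. endo_rep A c (nab X) x = matrix (dd (vf_rep A c X) x) + G x (vf_rep A c X x)))"

lemma matrix_vector_sum_left: "(\<Sum>i\<in>I. M i) *v z = (\<Sum>i\<in>I. M i *v (z :: real^'n))"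
  using bounded_linear.linear[OF bounded_bilinear.bounded_linear_left[OF bounded_bilinear_matrix_vector_mult, of z]]
  by (rule linear_sum)

lemma matrix_apply: "linear f \<Longrightarrow> matrix f *v x = f (x :: real^'n)"
  by (simp add: matrix_works)

context oriented_mfd begin

lemma conn_scale:
  "connection A nab \<Longrightarrow> smooth_fun A f \<Longrightarrow> smooth_vf A X \<Longrightarrow>
    nab (\<lambda>q. f q *\<^sub>R X q) p *v z = dfun A f p z *\<^sub>R X p + f p *\<^sub>R (nab X p *v z)"
  unfolding connection_def by blast

lemma conn_add:
  "connection A nab \<Longrightarrow> smooth_vf A X \<Longrightarrow> smooth_vf A Y \<Longrightarrow> nab (\<lambda>q. X q + Y q) p = nab X p + nab Y p"
  unfolding connection_def by blast

lemma dfun_const: "dfun A (\<lambda>q. a) p z = 0"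
  by (simp add: dfun_def o_def)

lemma conn_cmult:
  "connection A nab \<Longrightarrow> smooth_vf A X \<Longrightarrow> nab (\<lambda>q. a *\<^sub>R X q) p = a *\<^sub>R nab X p"
  using conn_scale[OF _ smooth_fun_const[of a]] 
  by (simp add: matrix_eq dfun_const scaleR_matrix_vector_assoc)

lemma conn_zero: "connection A nab \<Longrightarrow> nab (\<lambda>q. 0) p = 0"
  using conn_cmult[of nab "\<lambda>q. 0" 0 p] smooth_vf_zero by simp

lemma conn_sum:
  assumes "connection A nab" "\<And>i. i \<in> I \<Longrightarrow> smooth_vf A (X i)"
  shows "nab (\<lambda>q. \<Sum>i\<in>I. X i q) p = (\<Sum>i\<in>I. nab (X i) p)"
  using assms(2)
  by (induction I rule: infinite_finite_induct)
    (auto simp: conn_zero[OF assms(1)] conn_add[OF assms(1)] smooth_vf_sum)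

lemma endo_rep_vec:
  assumes "compat A c" "x \<in> cimg c"
  shows "endo_rep A c B x *v h = to_chart A c (cinv c x) *v (B (cinv c x) *v (from_chart A c (cinv c x) *v h))"
  by (simp add: endo_rep_def matrix_vector_mul_assoc matrix_mul_assoc)

text \<open>A connection is given on global vector fields, while a chart provides coordinate fields
  only locally. Cutting off gives global fields \<open>E a\<close>, and \<open>f\<^sup>2 X\<close>
  is a combination of them with globally smooth coefficients. Applying \<open>nab\<close> to both
  sides and dividing by \<open>f\<^sup>2\<close> near \<open>p\<close> isolates the covariant
  derivative of \<open>X\<close>.\<close>

lemma local_conn_exists:
  assumes nab: "connection A nab" and c: "compat A c" and p: "p \<in> fst c"
  obtains S G where "snd c p \<in> S" "local_conn A nab c S G"
proof -
  obtain f where f: "smooth_fun A f" "f p > 0" "\<And>q. f q \<ge> 0" "closure {q. f q \<noteq> 0} \<subseteq> fst c"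
    by (rule smooth_fun_bump[OF c p open_UNIV UNIV_I]) blast
  have f0: "f q = 0" if "q \<notin> fst c" for q
    using f(4) closure_subset[of "{q. f q \<noteq> 0}"] that by blast
  define \<phi> where "\<phi> = f \<circ> cinv c"
  have \<phi>: "smooth_on (cimg c) \<phi>" unfolding \<phi>_def by (rule smooth_fun_chart[OF f(1) c])
  define S where "S = {x \<in> cimg c. \<phi> x > 0}"
  have oc: "open (cimg c)" using c by simp
  have S: "open S" "S \<subseteq> cimg c"
    unfolding S_def using continuous_open_preimage[OF smooth_on_imp_continuous_on[OF \<phi>] oc, of "{0<..}"]
    by (auto simp: Int_def vimage_def)
  define E where "E = (\<lambda>a q. if q \<in> fst c then f q *\<^sub>R (from_chart A c q *v axis a 1) else 0)"
  have E: "smooth_vf A (E a)" for a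
    unfolding E_def by (rule smooth_vf_cutoff[OF c f(1,4), of "\<lambda>_. axis a 1"]) (rule smooth_on_const)
  have nE: "smooth_endo A (nab (E a))" for a using nab E by (auto simp: connection_def)
  \<comment> \<open>In the chart \<open>E a\<close> is \<phi> times a coordinate vector; the
    subtracted matrix is the part of its covariant derivative that comes from differentiating
    \<phi>.\<close>
  define G where "G = (\<lambda>x v. \<Sum>a\<in>UNIV. (v $ a / \<phi> x) *\<^sub>R
      (endo_rep A c (nab (E a)) x - matrix (\<lambda>h. dd \<phi> x h *\<^sub>R axis a 1)))"
  have "local_conn A nab c S G"
    unfolding local_conn_def
  proof (intro conjI allI impI ballI S)
    fix v
    have nz: "\<phi> x \<noteq> 0" if "x \<in> S" for x using that by (auto simp: S_def)
    have "smooth_on S \<phi>" "smooth_on S (endo_rep A c (nab (E a)))" for a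
      using smooth_on_subset[OF _ S(2)] \<phi> smooth_endo_chart[OF nE c] by blast+
    then show "smooth_on S (\<lambda>x. G x v)"
      unfolding G_def matrix_def using S(1) nz by (auto intro!: smooth_intros)
    \<comment> \<open>This holds at every \<open>x\<close>, also where \<phi> vanishes, because
      division by zero yields zero there.\<close>
    show "linear (G x)" for x
      unfolding G_def by (intro linear_compose_sum ballI linearI) (auto simp: add_divide_distrib algebra_simps)
  next
    fix X x assume X: "smooth_vf A X" and xS: "x \<in> S"
    define q where "q = cinv c x"
    have x: "x \<in> cimg c" "\<phi> x > 0" using xS by (auto simp: S_def)
    have q: "q \<in> fst c" "snd c q = x" using x c by (auto simp: q_def)
    have fq: "f q = \<phi> x" by (simp add: \<phi>_def q_def)
    define g where "g = (\<lambda>a q. if q \<in> fst c then f q * (vf_rep A c X (snd c q) $ a) else 0)"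
    have g: "smooth_fun A (g a)" for a
      unfolding g_def using c
      by (intro smooth_fun_cutoff[OF c f(1,4)] smooth_intros smooth_vf_chart[OF X c]) auto
    \<comment> \<open>One factor \<open>f\<close> extends the components of \<open>X\<close> to the
      manifold, the other extends the coordinate fields.\<close>
    have id: "(f r * f r) *\<^sub>R X r = (\<Sum>a\<in>UNIV. g a r *\<^sub>R E a r)" for r
    proof (cases "r \<in> fst c")
      case True
      have "(\<Sum>a\<in>UNIV. g a r *\<^sub>R E a r) = (f r * f r) *\<^sub>R (from_chart A c r *v (\<Sum>a\<in>UNIV. vf_rep A c X (snd c r) $ a *\<^sub>R axis a 1))"
        using True by (simp add: g_def E_def scaleR_sum_right matrix_vector_mult_scaleR mult_ac
            linear_sum[OF matrix_vector_mul_linear])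
      also have "(\<Sum>a\<in>UNIV. vf_rep A c X (snd c r) $ a *\<^sub>R axis a 1) = vf_rep A c X (snd c r)"
        using basis_expansion[of "vf_rep A c X (snd c r)"] by (simp add: scalar_mult_eq_scaleR)
      finally show ?thesis using True c by (simp add: vf_rep_def to_from_chart_vec)
    qed (simp add: f0 g_def)
    have ff: "smooth_fun A (\<lambda>q. f q * f q)" by (intro smooth_intros f)
    have "(\<lambda>r. (f r * f r) *\<^sub>R X r) = (\<lambda>r. \<Sum>a\<in>UNIV. g a r *\<^sub>R E a r)" using id by (rule ext)
    then have "nab (\<lambda>r. (f r * f r) *\<^sub>R X r) q = (\<Sum>a\<in>UNIV. nab (\<lambda>r. g a r *\<^sub>R E a r) q)"
      using conn_sum[OF nab, of UNIV "\<lambda>a r. g a r *\<^sub>R E a r" q] smooth_vf_scale[OF g E] by simp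
    then have "nab (\<lambda>r. (f r * f r) *\<^sub>R X r) q *v z = (\<Sum>a\<in>UNIV. nab (\<lambda>r. g a r *\<^sub>R E a r) q *v z)" for z
      by (simp add: matrix_vector_sum_left)
    then have main: "dfun A (\<lambda>q. f q * f q) q z *\<^sub>R X q + (f q * f q) *\<^sub>R (nab X q *v z)
      = (\<Sum>a\<in>UNIV. dfun A (g a) q z *\<^sub>R E a q + g a q *\<^sub>R (nab (E a) q *v z))" for z
      using conn_scale[OF nab ff X] conn_scale[OF nab g E] by simp
    show "endo_rep A c (nab X) x = matrix (dd (vf_rep A c X) x) + G x (vf_rep A c X x)"
      unfolding matrix_eq
    proof
      fix h
      define T where "T = (\<lambda>v. to_chart A c q *v v)"
      have T: "linear T" unfolding T_def by (rule matrix_vector_mul_linear)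
      have TX: "T (X q) = vf_rep A c X x" by (simp add: T_def vf_rep_def q_def)
      have TE: "T (E a q) = \<phi> x *\<^sub>R axis a 1" for a
        using q c by (simp add: T_def E_def matrix_vector_mult_scaleR to_from_chart_vec fq)
      have d\<phi>: "(\<phi> has_derivative dd \<phi> x) (at x)" using smooth_on_has_derivative[OF \<phi> x(1)] .
      have dX: "(vf_rep A c X has_derivative dd (vf_rep A c X) x) (at x)"
        using smooth_on_has_derivative[OF smooth_vf_chart[OF X c] x(1)] .
      have d1: "dfun A (\<lambda>q. f q * f q) q (from_chart A c q *v h) = 2 * \<phi> x * dd \<phi> x h"
      proof -
        have "((\<lambda>q. f q * f q) \<circ> cinv c) = (\<lambda>x. \<phi> x * \<phi> x)" by (auto simp: \<phi>_def)
        then show ?thesis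
          using dfun_rep(1)[OF ff c q(1)] dd_eq[OF has_derivative_mult[OF d\<phi> d\<phi>]] q(2) by simp
      qed
      have d2: "dfun A (g a) q (from_chart A c q *v h)
         = \<phi> x * (dd (vf_rep A c X) x h $ a) + dd \<phi> x h * (vf_rep A c X x $ a)" for a
      proof -
        have "dd (g a \<circ> cinv c) x = dd (\<lambda>x. \<phi> x * (vf_rep A c X x $ a)) x"
          by (rule dd_cong[OF oc x(1)]) (use c in \<open>simp add: g_def \<phi>_def\<close>)
        also have "\<dots> = (\<lambda>h. \<phi> x * (dd (vf_rep A c X) x h $ a) + dd \<phi> x h * (vf_rep A c X x $ a))"
          by (rule dd_eq[OF has_derivative_mult[OF d\<phi> bounded_linear.has_derivative[OF bounded_linear_vec_nth dX]]])
        finally show ?thesis using dfun_rep(1)[OF g c q(1)] q(2) by simp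
      qed
      have ga: "g a q = \<phi> x * (vf_rep A c X x $ a)" for a using q by (simp add: g_def fq)
      have er: "T (nab Z q *v (from_chart A c q *v h)) = endo_rep A c (nab Z) x *v h" for Z
        using endo_rep_vec[OF c x(1)] by (simp add: T_def q_def)
      have "(2 * \<phi> x * dd \<phi> x h) *\<^sub>R vf_rep A c X x + (\<phi> x * \<phi> x) *\<^sub>R (endo_rep A c (nab X) x *v h)
        = (\<Sum>a\<in>UNIV. ((\<phi> x * (dd (vf_rep A c X) x h $ a) + dd \<phi> x h * (vf_rep A c X x $ a)) * \<phi> x) *\<^sub>R axis a 1
            + (\<phi> x * (vf_rep A c X x $ a)) *\<^sub>R (endo_rep A c (nab (E a)) x *v h))"
        using arg_cong[OF main[of "from_chart A c q *v h"], of T]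
        by (simp add: linear_add[OF T] linear_scale[OF T] linear_sum[OF T] TX TE d1 d2 ga er fq)
      also have "\<dots> = (\<phi> x * \<phi> x) *\<^sub>R (\<Sum>a\<in>UNIV. (dd (vf_rep A c X) x h $ a) *\<^sub>R axis a 1)
         + (\<phi> x * dd \<phi> x h) *\<^sub>R (\<Sum>a\<in>UNIV. (vf_rep A c X x $ a) *\<^sub>R axis a 1)
         + (\<Sum>a\<in>UNIV. (\<phi> x * (vf_rep A c X x $ a)) *\<^sub>R (endo_rep A c (nab (E a)) x *v h))"
        by (simp add: sum.distrib scaleR_sum_right algebra_simps)
      also have "(\<Sum>a\<in>UNIV. (dd (vf_rep A c X) x h $ a) *\<^sub>R axis a 1) = dd (vf_rep A c X) x h"
        using basis_expansion[of "dd (vf_rep A c X) x h"] by (simp add: scalar_mult_eq_scaleR)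
      finally have eq1: "(2 * \<phi> x * dd \<phi> x h) *\<^sub>R vf_rep A c X x + (\<phi> x * \<phi> x) *\<^sub>R (endo_rep A c (nab X) x *v h)
        = (\<phi> x * \<phi> x) *\<^sub>R dd (vf_rep A c X) x h + (\<phi> x * dd \<phi> x h) *\<^sub>R (\<Sum>a\<in>UNIV. (vf_rep A c X x $ a) *\<^sub>R axis a 1)
         + (\<Sum>a\<in>UNIV. (\<phi> x * (vf_rep A c X x $ a)) *\<^sub>R (endo_rep A c (nab (E a)) x *v h))" .
      have bX: "(\<Sum>a\<in>UNIV. (vf_rep A c X x $ a) *\<^sub>R axis a 1) = vf_rep A c X x"
        using basis_expansion[of "vf_rep A c X x"] by (simp add: scalar_mult_eq_scaleR)
      have linM: "linear (\<lambda>h. dd \<phi> x h *\<^sub>R axis a (1::real))" for a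
        using dd_linear[OF smooth_on_differentiable[OF \<phi> x(1)]]
        by (auto intro!: linearI simp: linear_add linear_scale algebra_simps)
      have "G x (vf_rep A c X x) *v h = (\<Sum>a\<in>UNIV. (vf_rep A c X x $ a / \<phi> x) *\<^sub>R
          (endo_rep A c (nab (E a)) x *v h - dd \<phi> x h *\<^sub>R axis a 1))"
        unfolding G_def
        by (simp add: matrix_vector_sum_left matrix_vector_mult_diff_rdistrib matrix_apply[OF linM]
            scaleR_matrix_vector_assoc[symmetric])
      then have "(\<phi> x * \<phi> x) *\<^sub>R (G x (vf_rep A c X x) *v h) = (\<Sum>a\<in>UNIV. (\<phi> x * \<phi> x * (vf_rep A c X x $ a / \<phi> x)) *\<^sub>R
          (endo_rep A c (nab (E a)) x *v h - dd \<phi> x h *\<^sub>R axis a 1))"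
        by (simp add: scaleR_sum_right)
      also have "\<dots> = (\<Sum>a\<in>UNIV. (\<phi> x * (vf_rep A c X x $ a)) *\<^sub>R (endo_rep A c (nab (E a)) x *v h)
          - (\<phi> x * dd \<phi> x h) *\<^sub>R ((vf_rep A c X x $ a) *\<^sub>R axis a 1))"
        using x(2) by (intro sum.cong refl) (simp add: scaleR_diff_right mult_ac)
      finally have "(\<phi> x * \<phi> x) *\<^sub>R (G x (vf_rep A c X x) *v h) =
         (\<Sum>a\<in>UNIV. (\<phi> x * (vf_rep A c X x $ a)) *\<^sub>R (endo_rep A c (nab (E a)) x *v h))
         - (\<phi> x * dd \<phi> x h) *\<^sub>R (\<Sum>a\<in>UNIV. (vf_rep A c X x $ a) *\<^sub>R axis a 1)"
        by (simp add: scaleR_sum_right sum_subtractf)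
      then have eq2: "(\<phi> x * \<phi> x) *\<^sub>R (G x (vf_rep A c X x) *v h) =
         (\<Sum>a\<in>UNIV. (\<phi> x * (vf_rep A c X x $ a)) *\<^sub>R (endo_rep A c (nab (E a)) x *v h))
         - (\<phi> x * dd \<phi> x h) *\<^sub>R vf_rep A c X x" unfolding bX .
      have gen: "p = d + (s - q)" if "q + q + p = d + q + s" for p q d s :: "real^'d"
      proof -
        have "q + p = d + s" using that by simp
        then show ?thesis by (simp add: algebra_simps)
      qed
      have dbl: "(2 * \<phi> x * dd \<phi> x h) *\<^sub>R vf_rep A c X x
         = (\<phi> x * dd \<phi> x h) *\<^sub>R vf_rep A c X x + (\<phi> x * dd \<phi> x h) *\<^sub>R vf_rep A c X x"
        by (simp add: scaleR_left_distrib[symmetric])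
      have "(\<phi> x * \<phi> x) *\<^sub>R (endo_rep A c (nab X) x *v h)
        = (\<phi> x * \<phi> x) *\<^sub>R (dd (vf_rep A c X) x h + G x (vf_rep A c X x) *v h)"
        unfolding scaleR_add_right eq2
      proof (rule gen)
        show "(\<phi> x * dd \<phi> x h) *\<^sub>R vf_rep A c X x + (\<phi> x * dd \<phi> x h) *\<^sub>R vf_rep A c X x
            + (\<phi> x * \<phi> x) *\<^sub>R (endo_rep A c (nab X) x *v h)
          = (\<phi> x * \<phi> x) *\<^sub>R dd (vf_rep A c X) x h + (\<phi> x * dd \<phi> x h) *\<^sub>R vf_rep A c X x
            + (\<Sum>a\<in>UNIV. (\<phi> x * (vf_rep A c X x $ a)) *\<^sub>R (endo_rep A c (nab (E a)) x *v h))"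
          using eq1 unfolding bX dbl .
      qed
      then have "endo_rep A c (nab X) x *v h = dd (vf_rep A c X) x h + G x (vf_rep A c X x) *v h"
        using x(2) by simp
      then show "endo_rep A c (nab X) x *v h = (matrix (dd (vf_rep A c X) x) + G x (vf_rep A c X x)) *v h"
        using dX by (simp add: matrix_vector_mult_add_rdistrib matrix_apply has_derivative_linear)
    qed
  qed
  moreover have "snd c p \<in> S" using p c f(2) by (simp add: S_def \<phi>_def)
  ultimately show ?thesis using that by blast
qed

end

section \<open>Existence of torsion-free volume preserving connections\<close>

lemmas mm_bilinear = bounded_bilinear.add_left[OF bounded_bilinear_matrix_mult]
  bounded_bilinear.add_right[OF bounded_bilinear_matrix_mult]
  bounded_bilinear.diff_left[OF bounded_bilinear_matrix_mult]
  bounded_bilinear.diff_right[OF bounded_bilinear_matrix_mult]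
  bounded_bilinear.minus_left[OF bounded_bilinear_matrix_mult]
  bounded_bilinear.minus_right[OF bounded_bilinear_matrix_mult]
  bounded_bilinear.scaleR_left[OF bounded_bilinear_matrix_mult]
  bounded_bilinear.scaleR_right[OF bounded_bilinear_matrix_mult]
  bounded_bilinear.zero_left[OF bounded_bilinear_matrix_mult]
  bounded_bilinear.zero_right[OF bounded_bilinear_matrix_mult]

lemmas mv_bilinear = bounded_bilinear.add_left[OF bounded_bilinear_matrix_vector_mult]
  bounded_bilinear.add_right[OF bounded_bilinear_matrix_vector_mult]
  bounded_bilinear.diff_left[OF bounded_bilinear_matrix_vector_mult]
  bounded_bilinear.diff_right[OF bounded_bilinear_matrix_vector_mult]
  bounded_bilinear.minus_left[OF bounded_bilinear_matrix_vector_mult]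
  bounded_bilinear.minus_right[OF bounded_bilinear_matrix_vector_mult]
  bounded_bilinear.scaleR_left[OF bounded_bilinear_matrix_vector_mult]
  bounded_bilinear.scaleR_right[OF bounded_bilinear_matrix_vector_mult]
  bounded_bilinear.zero_left[OF bounded_bilinear_matrix_vector_mult]
  bounded_bilinear.zero_right[OF bounded_bilinear_matrix_vector_mult]

lemmas trace_linear = linear_add[OF bounded_linear.linear[OF bounded_linear_trace]]
  linear_diff[OF bounded_linear.linear[OF bounded_linear_trace]]
  linear_neg[OF bounded_linear.linear[OF bounded_linear_trace]]
  linear_scale[OF bounded_linear.linear[OF bounded_linear_trace]]

context oriented_mfd begin

lemma endo_rep_add: "endo_rep A c (\<lambda>q. B q + D q) x = endo_rep A c B x + endo_rep A c D x"
  by (simp add: endo_rep_def mm_bilinear)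

lemma endo_rep_scale: "endo_rep A c (\<lambda>q. f q *\<^sub>R D q) x = f (cinv c x) *\<^sub>R endo_rep A c D x"
  by (simp add: endo_rep_def mm_bilinear)

lemma smooth_endo_add [smooth_intros]: "smooth_endo A B \<Longrightarrow> smooth_endo A D \<Longrightarrow> smooth_endo A (\<lambda>q. B q + D q)"
  using A_compat by (auto simp: smooth_endo_def endo_rep_add[abs_def] intro!: smooth_intros)

lemma smooth_endo_scale [smooth_intros]: "smooth_fun A f \<Longrightarrow> smooth_endo A D \<Longrightarrow> smooth_endo A (\<lambda>q. f q *\<^sub>R D q)"
  using A_compat by (auto simp: smooth_fun_def o_def smooth_endo_def endo_rep_scale[abs_def] intro!: smooth_intros)

lemma smooth_endo_cmult [smooth_intros]: "smooth_endo A D \<Longrightarrow> smooth_endo A (\<lambda>q. a *\<^sub>R D q)"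
  by (intro smooth_intros)

lemma smooth_endo_diff [smooth_intros]: "smooth_endo A B \<Longrightarrow> smooth_endo A D \<Longrightarrow> smooth_endo A (\<lambda>q. B q - D q)"
  using smooth_endo_add[OF _ smooth_endo_cmult[of D "-1"], of B] by simp

lemma smooth_endo_zero [smooth_intros]: "smooth_endo A (\<lambda>q. 0)"
  by (auto simp: smooth_endo_def endo_rep_def[abs_def] mm_bilinear intro!: smooth_on_const)

lemma smooth_endo_sum [smooth_intros]:
  "(\<And>i. i \<in> I \<Longrightarrow> smooth_endo A (X i)) \<Longrightarrow> smooth_endo A (\<lambda>q. \<Sum>i\<in>I. X i q)"
  by (induction I rule: infinite_finite_induct) (auto intro: smooth_intros)

lemma smooth_endo_mult [smooth_intros]:
  assumes "smooth_endo A B" "smooth_endo A D"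
  shows "smooth_endo A (\<lambda>q. B q ** D q)"
  unfolding smooth_endo_def
proof
  fix c assume "c \<in> A"
  then have c: "compat A c" by (rule A_compat)
  have "smooth_on (cimg c) (\<lambda>x. endo_rep A c B x ** endo_rep A c D x)"
    using c by (intro smooth_intros smooth_endo_chart[OF assms(1)] smooth_endo_chart[OF assms(2)]) auto
  then show "smooth_on (cimg c) (endo_rep A c (\<lambda>q. B q ** D q))"
    by (rule smooth_on_eq_on) (use c endo_rep_mult in auto)
qed

lemma smooth_endo_cutoff:
  assumes c: "compat A c" and f: "smooth_fun A f" "closure {q. f q \<noteq> 0} \<subseteq> fst c" and Y: "smooth_on (cimg c) Y"
  shows "smooth_endo A (\<lambda>q. if q \<in> fst c then f q *\<^sub>R (from_chart A c q ** Y (snd c q) ** to_chart A c q) else 0)"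
    (is "smooth_endo A ?X")
proof (rule smooth_endoI)
  fix q
  show "\<exists>c U. compat A c \<and> open U \<and> q \<in> U \<and> U \<subseteq> fst c \<and> smooth_on (snd c ` U) (endo_rep A c ?X)"
  proof (cases "q \<in> fst c")
    case True
    have "smooth_on (cimg c) (\<lambda>x. (f \<circ> cinv c) x *\<^sub>R Y x)"
      using c by (intro smooth_intros Y smooth_fun_chart[OF f(1) c]) auto
    then have "smooth_on (cimg c) (endo_rep A c ?X)"
      by (rule smooth_on_eq_on)
        (use c in \<open>auto simp: endo_rep_def to_from_chart_cancel to_from_chart mm_bilinear matrix_mul_assoc[symmetric]\<close>)
    then show ?thesis using True c by (intro exI[of _ c] exI[of _ "fst c"]) (auto simp: cimg_def)
  next
    case False
    let ?c = "chart_at A q" and ?U = "- closure {q. f q \<noteq> 0} \<inter> fst (chart_at A q)"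
    have o: "open ?U" by (auto intro!: open_Int)
    have Z: "f (cinv ?c x) = 0" if x: "x \<in> snd ?c ` ?U" for x
    proof -
      obtain r where r: "r \<in> ?U" "x = snd ?c r" using x by blast
      then have "f r = 0" using closure_subset[of "{q. f q \<noteq> 0}"] by blast
      moreover have "cinv ?c x = r" using r by (metis IntD2 chart_at_compat(2) cinv_coord)
      ultimately show ?thesis by simp
    qed
    have "smooth_on (snd ?c ` ?U) (endo_rep A ?c ?X)"
      by (rule smooth_on_zero[OF open_coord_image[OF chart_at_compat(2) o Int_lower2]])
        (simp add: Z endo_rep_def mm_bilinear)
    then show ?thesis using o chart_at False f(2) by (intro exI[of _ ?c] exI[of _ ?U]) auto
  qed
qed

lemma form_vf_rep:
  assumes "compat A c" "q \<in> fst c"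
  shows "\<omega> q (\<lambda>i. X i q) = form_rep A c \<omega> (snd c q) (\<lambda>i. vf_rep A c (X i) (snd c q))"
  using assms by (simp add: form_rep_def vf_rep_def to_from_chart_vec)

lemma form_of_chart:
  assumes "compat A c" "q \<in> fst c"
  shows "\<omega> q w = form_rep A c \<omega> (snd c q) (\<lambda>i. to_chart A c q *v w i)"
  using assms by (simp add: form_rep_def to_from_chart_vec)

lemma smooth_form_apply:
  assumes \<omega>: "\<omega> \<in> forms A k" and X: "\<And>i. smooth_vf A (X i)"
  shows "smooth_fun A (\<lambda>q. \<omega> q (\<lambda>i. X i q))"
  unfolding smooth_fun_def
proof
  fix c assume "c \<in> A"
  then have c: "compat A c" by (rule A_compat)
  have "smooth_on (cimg c) (\<lambda>x. form_rep A c \<omega> x (\<lambda>i. vf_rep A c (X i) x))"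
    by (rule alternating_form_smooth[OF form_rep_alternating[OF forms_alternating[OF \<omega>]]])
      (use c smooth_form_chart[OF \<omega> c] smooth_vf_chart[OF X c] in auto)
  then show "smooth_on (cimg c) ((\<lambda>q. \<omega> q (\<lambda>i. X i q)) \<circ> cinv c)"
    by (rule smooth_on_eq_on) (use c in \<open>auto simp: form_vf_rep\<close>)
qed

lemma dfun_form_apply:
  assumes \<omega>: "\<omega> \<in> forms A k" and X: "\<And>i. smooth_vf A (X i)" and c: "compat A c" and q: "q \<in> fst c"
  shows "dfun A (\<lambda>q. \<omega> q (\<lambda>i. X i q)) q z =
    dd (\<lambda>x. form_rep A c \<omega> x (\<lambda>i. vf_rep A c (X i) (snd c q))) (snd c q) (to_chart A c q *v z)
    + (\<Sum>i<k. form_rep A c \<omega> (snd c q) ((\<lambda>j. vf_rep A c (X j) (snd c q))(i := dd (vf_rep A c (X i)) (snd c q) (to_chart A c q *v z))))"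
proof -
  have x: "snd c q \<in> cimg c" "open (cimg c)" using c q by auto
  have "((\<lambda>x. form_rep A c \<omega> x (\<lambda>i. vf_rep A c (X i) x)) has_derivative
     (\<lambda>h. dd (\<lambda>x. form_rep A c \<omega> x (\<lambda>i. vf_rep A c (X i) (snd c q))) (snd c q) h
    + (\<Sum>i<k. form_rep A c \<omega> (snd c q) ((\<lambda>j. vf_rep A c (X j) (snd c q))(i := dd (vf_rep A c (X i)) (snd c q) h)))))
    (at (snd c q))"
    by (rule alternating_form_has_derivative[OF form_rep_alternating[OF forms_alternating[OF \<omega>]]])
      (use smooth_on_differentiable[OF smooth_form_chart[OF \<omega> c] x(1)] smooth_on_has_derivative[OF smooth_vf_chart[OF X c] x(1)] in auto)
  moreover have "dd ((\<lambda>q. \<omega> q (\<lambda>i. X i q)) \<circ> cinv c) (snd c q) = dd (\<lambda>x. form_rep A c \<omega> x (\<lambda>i. vf_rep A c (X i) x)) (snd c q)"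
    by (rule dd_cong[OF x(2,1)]) (use c in \<open>auto simp: form_vf_rep\<close>)
  ultimately show ?thesis
    using dfun_rep(2)[OF smooth_form_apply[OF \<omega> X] c q, where z = z] by (simp add: dd_eq)
qed

end

locale vol_mfd = closed_mfd A for A :: "('m::t2_space, 'd::{finite,wellorder}) chart set" +
  fixes \<rho> :: "('m, 'd) form"
  assumes vol: "volume_form A \<rho>"
begin

definition dens :: "('m, 'd) chart \<Rightarrow> (real, 'd) vec \<Rightarrow> real" where
  "dens c x = form_rep A c \<rho> x std_frame"

lemma rho_form: "\<rho> \<in> forms A CARD('d)"
  using vol by (simp add: volume_form_def)

lemma rho_alt: "alternating_form CARD('d) (\<rho> p)"
  by (rule forms_alternating[OF rho_form])

lemma rho_rep: "form_rep A c \<rho> x w = frame_det w * dens c x"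
  unfolding dens_def by (rule top_form_det[OF form_rep_alternating[OF rho_alt]])

lemma dens_smooth: "compat A c \<Longrightarrow> smooth_on (cimg c) (dens c)"
  unfolding dens_def[abs_def] by (rule smooth_form_chart[OF rho_form])

lemma dens_nonzero:
  assumes "compat A c" "x \<in> cimg c"
  shows "dens c x \<noteq> 0"
proof
  assume 0: "dens c x = 0"
  obtain w where "\<rho> (cinv c x) w \<noteq> 0" using vol unfolding volume_form_def by blast
  moreover have "\<rho> (cinv c x) w = form_rep A c \<rho> x (\<lambda>i. to_chart A c (cinv c x) *v w i)"
    using form_of_chart[OF assms(1), of "cinv c x"] assms by simp
  ultimately show False by (simp add: rho_rep 0)
qed

text \<open>The differential of the logarithm of the absolute value of the density, written as a
  quotient because the density may be negative.\<close>

definition logdens :: "('m, 'd) chart \<Rightarrow> (real, 'd) vec \<Rightarrow> (real, 'd) vec \<Rightarrow> real" where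
  "logdens c x z = dd (dens c) x z / dens c x"

lemma linear_logdens: "compat A c \<Longrightarrow> x \<in> cimg c \<Longrightarrow> linear (logdens c x)"
  using dd_linear[OF smooth_on_differentiable[OF dens_smooth]]
  by (auto simp: linear_iff logdens_def[abs_def] add_divide_distrib)

lemma dd_rho_rep:
  assumes "compat A c" "x \<in> cimg c"
  shows "dd (\<lambda>x. form_rep A c \<rho> x w) x h = logdens c x h * form_rep A c \<rho> x w"
proof -
  have "((\<lambda>x. form_rep A c \<rho> x w) has_derivative (\<lambda>h. frame_det w * dd (dens c) x h)) (at x)"
    unfolding rho_rep by (intro has_derivative_mult_right smooth_on_has_derivative[OF dens_smooth] assms)
  from dd_eq[OF this] show ?thesis using dens_nonzero[OF assms] by (simp add: logdens_def rho_rep)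
qed

text \<open>In a chart the flat connection is corrected by a symmetric term so that it becomes compatible
  with the density.\<close>

definition chart_conn :: "('m, 'd) chart \<Rightarrow> ('m, 'd) vfield \<Rightarrow> (real, 'd) vec \<Rightarrow> ((real, 'd) vec, 'd) vec" where
  "chart_conn c X x = matrix (dd (vf_rep A c X) x) + (1 / (real CARD('d) + 1)) *\<^sub>R
     matrix (\<lambda>z. logdens c x (vf_rep A c X x) *\<^sub>R z + logdens c x z *\<^sub>R vf_rep A c X x)"

lemma chart_conn_apply:
  assumes "compat A c" "x \<in> cimg c" "smooth_vf A X"
  shows "chart_conn c X x *v h = dd (vf_rep A c X) x h + (1 / (real CARD('d) + 1)) *\<^sub>R
     (logdens c x (vf_rep A c X x) *\<^sub>R h + logdens c x h *\<^sub>R vf_rep A c X x)"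
proof -
  have 1: "linear (dd (vf_rep A c X) x)"
    using dd_linear[OF smooth_on_differentiable[OF smooth_vf_chart[OF assms(3,1)] assms(2)]] .
  have 2: "linear (\<lambda>z. logdens c x (vf_rep A c X x) *\<^sub>R z + logdens c x z *\<^sub>R vf_rep A c X x)"
    using linear_logdens[OF assms(1,2)] by (auto simp: linear_iff algebra_simps)
  show ?thesis unfolding chart_conn_def mv_bilinear matrix_apply[OF 1] matrix_apply[OF 2] ..
qed

lemma chart_conn_smooth:
  assumes "compat A c" "smooth_vf A X"
  shows "smooth_on (cimg c) (chart_conn c X)"
proof -
  note X = smooth_vf_chart[OF assms(2,1)] and o = is_chart_open(2)[OF compat_chart[OF assms(1)]]
  have L: "smooth_on (cimg c) (\<lambda>x. logdens c x (f x))" if "smooth_on (cimg c) f" for f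
    unfolding logdens_def using o dens_smooth dens_nonzero assms that
    by (intro smooth_on_divide smooth_on_dd_dir) auto
  show ?thesis
    unfolding chart_conn_def[abs_def] matrix_def
    by (intro smooth_on_add smooth_on_scaleR smooth_on_vec_lambda smooth_on_vec_nth smooth_on_dd smooth_on_const
        o X L)
qed

lemma chart_conn_add:
  assumes "compat A c" "x \<in> cimg c" "smooth_vf A X" "smooth_vf A Y"
  shows "chart_conn c (\<lambda>q. X q + Y q) x = chart_conn c X x + chart_conn c Y x"
  unfolding matrix_eq
proof
  fix h
  have "dd (\<lambda>x. vf_rep A c X x + vf_rep A c Y x) x h = dd (vf_rep A c X) x h + dd (vf_rep A c Y) x h"
    by (simp add: dd_eq[OF has_derivative_add[OF smooth_on_has_derivative[OF smooth_vf_chart[OF assms(3,1)] assms(2)]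
      smooth_on_has_derivative[OF smooth_vf_chart[OF assms(4,1)] assms(2)]]])
  then show "chart_conn c (\<lambda>q. X q + Y q) x *v h = (chart_conn c X x + chart_conn c Y x) *v h"
    using assms linear_add[OF linear_logdens[OF assms(1,2)]]
    by (simp add: chart_conn_apply smooth_vf_add mv_bilinear vf_rep_add[abs_def] algebra_simps)
qed

lemma chart_conn_scale:
  assumes "compat A c" "x \<in> cimg c" "smooth_vf A X" "smooth_fun A f"
  shows "chart_conn c (\<lambda>q. f q *\<^sub>R X q) x *v h =
     dd (f \<circ> cinv c) x h *\<^sub>R vf_rep A c X x + f (cinv c x) *\<^sub>R (chart_conn c X x *v h)"
proof -
  have "dd (\<lambda>x. (f \<circ> cinv c) x *\<^sub>R vf_rep A c X x) x h
     = (f \<circ> cinv c) x *\<^sub>R dd (vf_rep A c X) x h + dd (f \<circ> cinv c) x h *\<^sub>R vf_rep A c X x"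
    using dd_eq[OF has_derivative_scaleR[OF smooth_on_has_derivative[OF smooth_fun_chart[OF assms(4,1)] assms(2)]
      smooth_on_has_derivative[OF smooth_vf_chart[OF assms(3,1)] assms(2)]]]
    by (simp add: o_def)
  then show ?thesis
    using assms linear_scale[OF linear_logdens[OF assms(1,2)]]
    by (simp add: chart_conn_apply smooth_vf_scale mv_bilinear vf_rep_scale[abs_def] algebra_simps)
qed

lemma chart_conn_rho:
  assumes c: "compat A c" and q: "q \<in> fst c" and X: "\<And>i. smooth_vf A (X i)"
  shows "(\<Sum>i<CARD('d). \<rho> q ((\<lambda>j. X j q)(i := from_chart A c q *v (chart_conn c (X i) (snd c q) *v (to_chart A c q *v z)))))
    = dfun A (\<lambda>q. \<rho> q (\<lambda>i. X i q)) q z"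
proof -
  let ?x = "snd c q" and ?n = "real CARD('d)"
  define h where "h = to_chart A c q *v z"
  define W where "W = (\<lambda>i. vf_rep A c (X i) ?x)"
  have x: "?x \<in> cimg c" using q by simp
  have alt: "alternating_form CARD('d) (form_rep A c \<rho> ?x)" by (rule form_rep_alternating[OF rho_alt])
  define B where "B = matrix (\<lambda>v. (1 / (?n + 1)) *\<^sub>R (logdens c ?x v *\<^sub>R h + logdens c ?x h *\<^sub>R v))"
  have lin: "linear (\<lambda>v. (1 / (?n + 1)) *\<^sub>R (logdens c ?x v *\<^sub>R h + logdens c ?x h *\<^sub>R v))"
    using linear_logdens[OF c x] by (auto simp: linear_iff algebra_simps add_divide_distrib)
  have cc: "chart_conn c (X i) ?x *v h = dd (vf_rep A c (X i)) ?x h + B *v W i" for i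
    unfolding chart_conn_apply[OF c x X] B_def matrix_apply[OF lin] W_def ..
  \<comment> \<open>The endomorphism that sends \<open>v\<close> to
    \<open>logdens(v) h + logdens(h) v\<close> has trace \<open>(n + 1) logdens(h)\<close> in
    dimension \<open>n\<close>; this fixes the factor \<open>1 / (n + 1)\<close> in
    \<open>chart_conn\<close>.\<close>
  have tr: "trace B = logdens c ?x h"
  proof -
    have "trace B = (\<Sum>a\<in>UNIV. (1 / (?n + 1)) * (logdens c ?x (axis a 1) * h $ a + logdens c ?x h))"
      by (simp add: trace_def B_def matrix_def axis_def)
    also have "\<dots> = (1 / (?n + 1)) * ((\<Sum>a\<in>UNIV. h $ a * logdens c ?x (axis a 1)) + ?n * logdens c ?x h)"
      by (simp add: sum_distrib_left[symmetric] sum_divide_distrib[symmetric] sum.distrib mult.commute)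
    also have "(\<Sum>a\<in>UNIV. h $ a * logdens c ?x (axis a 1)) = logdens c ?x (\<Sum>a\<in>UNIV. h $ a *\<^sub>R axis a 1)"
      by (simp add: linear_sum[OF linear_logdens[OF c x]] linear_scale[OF linear_logdens[OF c x]])
    also have "(\<Sum>a\<in>UNIV. h $ a *\<^sub>R axis a 1) = h"
      using basis_expansion[of h] by (simp add: scalar_mult_eq_scaleR)
    finally have "trace B = (1 / (?n + 1)) * ((?n + 1) * logdens c ?x h)" by (simp add: distrib_right)
    moreover have "?n + 1 \<noteq> 0" using of_nat_0_le_iff[of "CARD('d)", where 'a = real] by linarith
    ultimately show ?thesis by simp
  qed
  have "\<rho> q ((\<lambda>j. X j q)(i := from_chart A c q *v v)) = form_rep A c \<rho> ?x (W(i := v))" for i v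
  proof -
    have "(\<lambda>j. to_chart A c q *v ((\<lambda>j. X j q)(i := from_chart A c q *v v)) j) = W(i := v)"
      using c q by (auto simp: fun_eq_iff W_def vf_rep_def to_from_chart_vec)
    then show ?thesis using form_of_chart[OF c q] by metis
  qed
  then have "(\<Sum>i<CARD('d). \<rho> q ((\<lambda>j. X j q)(i := from_chart A c q *v (chart_conn c (X i) ?x *v h))))
     = (\<Sum>i<CARD('d). form_rep A c \<rho> ?x (W(i := dd (vf_rep A c (X i)) ?x h)) + form_rep A c \<rho> ?x (W(i := B *v W i)))"
    unfolding cc using linear_add[OF alternating_form_linear[OF alt]] by simp
  also have "\<dots> = (\<Sum>i<CARD('d). form_rep A c \<rho> ?x (W(i := dd (vf_rep A c (X i)) ?x h))) + logdens c ?x h * form_rep A c \<rho> ?x W"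
    by (simp add: sum.distrib top_form_trace[OF alt] tr)
  also have "\<dots> = dfun A (\<lambda>q. \<rho> q (\<lambda>i. X i q)) q z"
    unfolding dfun_form_apply[OF rho_form X c q] dd_rho_rep[OF c x] h_def W_def by simp
  finally show ?thesis unfolding h_def .
qed

text \<open>The Leibniz rule, torsion-freeness and preservation of \<rho> are affine conditions on
  the connection, so they survive averaging the chart connections with weights that sum to
  1.\<close>

lemma torsion_free_rho_connection_exists: "\<exists>nab. torsion_free_rho_connection A \<rho> nab"
proof -
  obtain C \<theta> where "partition_of_unity A C \<theta>" using partition_of_unity_exists by blast
  then have C: "finite C" "C \<subseteq> A" and \<theta>: "\<And>c. c \<in> C \<Longrightarrow> smooth_fun A (\<theta> c)"
    "\<And>c. c \<in> C \<Longrightarrow> closure {p. \<theta> c p \<noteq> 0} \<subseteq> fst c" and \<theta>1: "\<And>p. (\<Sum>c\<in>C. \<theta> c p) = 1"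
    unfolding partition_of_unity_def by blast+
  have Cc: "compat A c" if "c \<in> C" for c using that C A_compat by blast
  have \<theta>0: "\<theta> c p = 0" if "c \<in> C" "p \<notin> fst c" for c p
    using \<theta>(2)[OF that(1)] closure_subset[of "{p. \<theta> c p \<noteq> 0}"] that(2) by blast
  define nab where "nab = (\<lambda>X q. \<Sum>c\<in>C. (if q \<in> fst c then
      \<theta> c q *\<^sub>R (from_chart A c q ** chart_conn c X (snd c q) ** to_chart A c q) else 0))"
  have app: "nab X q *v z = (\<Sum>c\<in>C. \<theta> c q *\<^sub>R (from_chart A c q *v (chart_conn c X (snd c q) *v (to_chart A c q *v z))))"
    for X q z
    unfolding nab_def matrix_vector_sum_left
    by (intro sum.cong refl) (auto simp: \<theta>0 mv_bilinear matrix_vector_mul_assoc matrix_mul_assoc)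
  \<comment> \<open>Local expressions that agree on all charts around \<open>q\<close> average to
    their common value; outside a chart its weight is zero.\<close>
  have part: "(\<Sum>c\<in>C. \<theta> c q *\<^sub>R F c) = v" if "\<And>c. c \<in> C \<Longrightarrow> q \<in> fst c \<Longrightarrow> F c = v" for F and v :: "'b::real_vector" and q
  proof -
    have "(\<Sum>c\<in>C. \<theta> c q *\<^sub>R F c) = (\<Sum>c\<in>C. \<theta> c q *\<^sub>R v)"
      using that \<theta>0 by (intro sum.cong refl) (metis scaleR_zero_left)
    then show ?thesis by (simp add: scaleR_left.sum[symmetric] \<theta>1)
  qed
  have "connection A nab"
    unfolding connection_def
  proof (intro conjI allI impI)
    fix X assume "smooth_vf A X"
    then show "smooth_endo A (nab X)"
      unfolding nab_def using C \<theta> Cc by (intro smooth_endo_sum smooth_endo_cutoff chart_conn_smooth) auto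
  next
    fix X Y p assume XY: "smooth_vf A X \<and> smooth_vf A Y"
    show "nab (\<lambda>q. X q + Y q) p = nab X p + nab Y p"
      unfolding nab_def sum.distrib[symmetric]
      by (intro sum.cong refl) (use XY Cc in \<open>auto simp: chart_conn_add mm_bilinear scaleR_add_right\<close>)
  next
    fix f X p z assume fX: "smooth_fun A f \<and> smooth_vf A X"
    have "nab (\<lambda>q. f q *\<^sub>R X q) p *v z = (\<Sum>c\<in>C. \<theta> c p *\<^sub>R
      (dfun A f p z *\<^sub>R X p + f p *\<^sub>R (from_chart A c p *v (chart_conn c X (snd c p) *v (to_chart A c p *v z)))))"
      unfolding app
    proof (intro sum.cong refl)
      fix c assume c: "c \<in> C"
      show "\<theta> c p *\<^sub>R (from_chart A c p *v (chart_conn c (\<lambda>q. f q *\<^sub>R X q) (snd c p) *v (to_chart A c p *v z)))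
        = \<theta> c p *\<^sub>R (dfun A f p z *\<^sub>R X p + f p *\<^sub>R (from_chart A c p *v (chart_conn c X (snd c p) *v (to_chart A c p *v z))))"
      proof (cases "p \<in> fst c")
        case True
        then show ?thesis
          using fX Cc[OF c] dfun_rep(2)[of f c p z]
          by (simp add: chart_conn_scale mv_bilinear vf_rep_def to_from_chart_vec)
      qed (simp add: \<theta>0[OF c])
    qed
    also have "\<dots> = dfun A f p z *\<^sub>R X p + f p *\<^sub>R (nab X p *v z)"
    proof -
      have "(\<Sum>c\<in>C. \<theta> c p *\<^sub>R (dfun A f p z *\<^sub>R X p)) = dfun A f p z *\<^sub>R X p" by (rule part) simp
      then show ?thesis
        unfolding scaleR_add_right sum.distrib app by (simp add: scaleR_sum_right mult.commute)
    qed
    finally show "nab (\<lambda>q. f q *\<^sub>R X q) p *v z = dfun A f p z *\<^sub>R X p + f p *\<^sub>R (nab X p *v z)" .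
  qed
  moreover have "torsion_free A nab"
    unfolding torsion_free_def
  proof (intro allI impI)
    fix X Y p assume XY: "smooth_vf A X \<and> smooth_vf A Y"
    have "cov nab X Y p - cov nab Y X p = (\<Sum>c\<in>C. \<theta> c p *\<^sub>R
      (from_chart A c p *v (chart_conn c Y (snd c p) *v (to_chart A c p *v X p) - chart_conn c X (snd c p) *v (to_chart A c p *v Y p))))"
      unfolding cov_def app by (simp add: mv_bilinear scaleR_diff_right sum_subtractf)
    also have "\<dots> = lie_bracket A X Y p"
    proof (rule part)
      fix c assume c: "c \<in> C" "p \<in> fst c"
      have e: "chart_conn c Y (snd c p) *v (to_chart A c p *v X p) - chart_conn c X (snd c p) *v (to_chart A c p *v Y p)
        = to_chart A c p *v lie_bracket A X Y p"
        using XY Cc[OF c(1)] c(2) by (simp add: lie_bracket_rep chart_conn_apply vf_rep_def algebra_simps)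
      show "from_chart A c p *v (chart_conn c Y (snd c p) *v (to_chart A c p *v X p) - chart_conn c X (snd c p) *v (to_chart A c p *v Y p))
        = lie_bracket A X Y p"
        unfolding e using to_from_chart_vec Cc c by simp
    qed
    finally show "cov nab X Y p - cov nab Y X p = lie_bracket A X Y p" .
  qed
  moreover have "preserves_form A CARD('d) \<rho> nab"
    unfolding preserves_form_def
  proof (intro allI impI)
    fix u p and X :: "nat \<Rightarrow> ('m, 'd) vfield" assume uX: "smooth_vf A u \<and> (\<forall>i. smooth_vf A (X i))"
    have "(\<Sum>i<CARD('d). \<rho> p ((\<lambda>j. X j p)(i := cov nab u (X i) p)))
      = (\<Sum>i<CARD('d). \<Sum>c\<in>C. \<theta> c p * \<rho> p ((\<lambda>j. X j p)(i := from_chart A c p *v (chart_conn c (X i) (snd c p) *v (to_chart A c p *v u p)))))"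
    proof (intro sum.cong refl)
      fix i assume "i \<in> {..<CARD('d)}"
      then have lin: "linear (\<lambda>v. \<rho> p ((\<lambda>j. X j p)(i := v)))" by (intro alternating_form_linear[OF rho_alt]) simp
      show "\<rho> p ((\<lambda>j. X j p)(i := cov nab u (X i) p)) = (\<Sum>c\<in>C. \<theta> c p * \<rho> p ((\<lambda>j. X j p)(i := from_chart A c p *v (chart_conn c (X i) (snd c p) *v (to_chart A c p *v u p)))))"
        unfolding cov_def app linear_sum[OF lin] linear_scale[OF lin] by simp
    qed
    also have "\<dots> = (\<Sum>c\<in>C. \<theta> c p *\<^sub>R (\<Sum>i<CARD('d). \<rho> p ((\<lambda>j. X j p)(i := from_chart A c p *v (chart_conn c (X i) (snd c p) *v (to_chart A c p *v u p))))))"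
      by (subst sum.swap) (simp add: sum_distrib_left)
    also have "\<dots> = dfun A (\<lambda>q. \<rho> q (\<lambda>i. X i q)) p (u p)"
      by (rule part) (use chart_conn_rho uX Cc in auto)
    finally show "dfun A (\<lambda>q. \<rho> q (\<lambda>i. X i q)) p (u p) - (\<Sum>i<CARD('d). \<rho> p ((\<lambda>j. X j p)(i := cov nab u (X i) p))) = 0"
      by simp
  qed
  ultimately show ?thesis unfolding torsion_free_rho_connection_def by blast
qed

text \<open>Averaging a connection with its conjugate by \<open>J\<close> gives one that commutes
  with \<open>J\<close>; the sign in the formula comes from the inverse of \<open>J\<close> being
  \<open>- J\<close>. The choice of a connection in \<open>c1\<close> relies on this.\<close>

lemma complex_connection_exists:
  assumes J: "almost_complex A J"
  shows "\<exists>nab. complex_connection A J nab"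
proof -
  obtain nab0 where "torsion_free_rho_connection A \<rho> nab0" using torsion_free_rho_connection_exists by blast
  then have n0: "connection A nab0" by (simp add: torsion_free_rho_connection_def)
  have Js: "smooth_endo A J" and J2: "J p ** J p = - mat 1" for p using J by (auto simp: almost_complex_def)
  have J2': "J p ** (J p ** M) = - M" for p and M :: "(real^'n, 'd) vec"
    unfolding matrix_mul_assoc J2 by (simp add: mm_bilinear)
  have J2v: "J p *v (J p *v v) = - v" for p v
    unfolding matrix_vector_mul_assoc J2 by (simp add: mv_bilinear)
  define nab where "nab = (\<lambda>X p. (1/2) *\<^sub>R (nab0 X p - J p ** nab0 (app J X) p))"
  have JJ: "app J (app J X) = (\<lambda>q. (-1) *\<^sub>R X q)" for X by (auto simp: app_def J2v)
  have "connection A nab"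
    unfolding connection_def
  proof (intro conjI allI impI)
    fix X assume X: "smooth_vf A X"
    show "smooth_endo A (nab X)"
      unfolding nab_def using n0 X Js unfolding connection_def by (intro smooth_intros) (auto intro: smooth_intros)
  next
    fix X Y p assume XY: "smooth_vf A X \<and> smooth_vf A Y"
    have "app J (\<lambda>q. X q + Y q) = (\<lambda>q. app J X q + app J Y q)" by (auto simp: app_def mv_bilinear)
    then show "nab (\<lambda>q. X q + Y q) p = nab X p + nab Y p"
      unfolding nab_def using XY Js by (simp add: conn_add[OF n0] smooth_vf_app mm_bilinear algebra_simps)
  next
    fix f X p z assume fX: "smooth_fun A f \<and> smooth_vf A X"
    have "app J (\<lambda>q. f q *\<^sub>R X q) = (\<lambda>q. f q *\<^sub>R app J X q)" by (auto simp: app_def mv_bilinear)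
    then show "nab (\<lambda>q. f q *\<^sub>R X q) p *v z = dfun A f p z *\<^sub>R X p + f p *\<^sub>R (nab X p *v z)"
      unfolding nab_def using fX Js
      by (simp add: mv_bilinear matrix_vector_mul_assoc[symmetric] conn_scale[OF n0] smooth_vf_app app_def[of J X p] J2v
          scaleR_add_right scaleR_diff_right) (simp add: vec_eq_iff algebra_simps)
  qed
  moreover have "nab (app J X) p = J p ** nab X p" if "smooth_vf A X" for X p
    unfolding nab_def JJ conn_cmult[OF n0 that] by (simp add: mm_bilinear J2' algebra_simps)
  ultimately show ?thesis unfolding complex_connection_def by blast
qed

end

section \<open>Curvature and covariant derivatives in coordinates\<close>

text \<open>\<open>F\<close> is known to be differentiable for each fixed vector. Linearity allows
  expanding the moving argument in the basis, after which the product rule applies.\<close>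

lemma linear_family_has_derivative:
  fixes F :: "'a::euclidean_space \<Rightarrow> 'b::euclidean_space \<Rightarrow> 'c::euclidean_space"
  assumes S: "open S" "x \<in> S" and lin: "\<And>y. y \<in> S \<Longrightarrow> linear (F y)"
    and F: "\<And>v. (\<lambda>y. F y v) differentiable (at x)" and X: "(X has_derivative X') (at x)"
  shows "((\<lambda>y. F y (X y)) has_derivative (\<lambda>h. dd (\<lambda>y. F y (X x)) x h + F x (X' h))) (at x)"
proof -
  have 1: "((\<lambda>y. F y v) has_derivative (\<lambda>h. \<Sum>b\<in>Basis. (v \<bullet> b) *\<^sub>R dd (\<lambda>y. F y b) x h)) (at x)" for v
  proof (rule has_derivative_transform_within_open[OF _ S])
    show "((\<lambda>y. \<Sum>b\<in>Basis. (v \<bullet> b) *\<^sub>R F y b) has_derivative (\<lambda>h. \<Sum>b\<in>Basis. (v \<bullet> b) *\<^sub>R dd (\<lambda>y. F y b) x h)) (at x)"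
      by (intro has_derivative_sum has_derivative_scaleR_right dd_works F)
    show "(\<Sum>b\<in>Basis. (v \<bullet> b) *\<^sub>R F y b) = F y v" if "y \<in> S" for y
      using linear_basis_expand[OF lin[OF that], of v] by simp
  qed
  have 2: "((\<lambda>y. \<Sum>b\<in>Basis. (X y \<bullet> b) *\<^sub>R F y b) has_derivative
     (\<lambda>h. \<Sum>b\<in>Basis. (X x \<bullet> b) *\<^sub>R dd (\<lambda>y. F y b) x h + (X' h \<bullet> b) *\<^sub>R F x b)) (at x)"
    by (intro has_derivative_sum has_derivative_scaleR has_derivative_inner_left X dd_works F)
  have d: "((\<lambda>y. F y (X y)) has_derivative
     (\<lambda>h. \<Sum>b\<in>Basis. (X x \<bullet> b) *\<^sub>R dd (\<lambda>y. F y b) x h + (X' h \<bullet> b) *\<^sub>R F x b)) (at x)"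
  proof (rule has_derivative_transform_within_open[OF 2 S])
    show "(\<Sum>b\<in>Basis. (X y \<bullet> b) *\<^sub>R F y b) = F y (X y)" if "y \<in> S" for y
      using linear_basis_expand[OF lin[OF that], of "X y"] by simp
  qed
  have "(\<Sum>b\<in>Basis. (X x \<bullet> b) *\<^sub>R dd (\<lambda>y. F y b) x h + (X' h \<bullet> b) *\<^sub>R F x b)
     = dd (\<lambda>y. F y (X x)) x h + F x (X' h)" for h
    unfolding dd_eq[OF 1[of "X x"]] sum.distrib linear_basis_expand[OF lin[OF S(2)], of "X' h", symmetric] ..
  then show ?thesis using has_derivative_eq_rhs[OF d ext] by simp
qed

lemma dd_dir_has_derivative:
  fixes f :: "'a::euclidean_space \<Rightarrow> 'b::euclidean_space"
  assumes S: "open S" "x \<in> S" and f: "smooth_on S f" and X: "(X has_derivative X') (at x)"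
  shows "((\<lambda>y. dd f y (X y)) has_derivative (\<lambda>h. dd (\<lambda>y. dd f y (X x)) x h + dd f x (X' h))) (at x)"
  by (rule linear_family_has_derivative[OF S _ _ X])
    (use dd_linear[OF smooth_on_differentiable[OF f]] smooth_on_differentiable[OF smooth_on_dd[OF f] S(2)] in auto)

text \<open>The Christoffel endomorphism in the direction \<open>z\<close>. In \<open>G x v\<close>
  the differentiated vector is fixed instead, so the two differ by exchanging the lower indices and
  agree for a torsion-free connection.\<close>

definition chr :: "(real^'d \<Rightarrow> real^'d \<Rightarrow> real^'d^'d) \<Rightarrow> real^'d \<Rightarrow> real^'d \<Rightarrow> real^'d^'d" where
  "chr G x z = matrix (\<lambda>v. G x v *v z)"

lemma chr_apply: "linear (G x) \<Longrightarrow> chr G x z *v v = G x v *v z"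
  unfolding chr_def by (rule matrix_apply) (auto simp: linear_iff mv_bilinear)

lemma linear_chr: "linear (chr G x)"
  by (auto simp: linear_iff chr_def matrix_def vec_eq_iff mv_bilinear)

text \<open>The algebraic core: with \<open>a = D\<^sub>u J\<close>, \<open>b = D\<^sub>v J\<close> and Christoffel matrices \<open>P\<close>, \<open>Q\<close>, the
  terms quadratic in the Christoffel matrices cancel.\<close>

lemma ricci_trace_identity:
  fixes J a b P Q :: "real^'n^'n"
  assumes J: "J ** J = - mat 1" and a: "a ** J = - (J ** a)" and b: "b ** J = - (J ** b)"
  shows "1/4 * trace ((a + P ** J - J ** P) ** J ** (b + Q ** J - J ** Q)) + 1/2 * trace (J ** (P ** Q - Q ** P))
    = 1/4 * trace (a ** J ** b) + 1/2 * trace (a ** Q) - 1/2 * trace (b ** P)"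
proof -
  have J': "J ** (J ** M) = - M" "J ** J = - mat 1" for M :: "real^'n^'n"
    using J by (simp_all add: matrix_mul_assoc mm_bilinear)
  have t1: "trace (a ** J ** (Q ** J - J ** Q)) = 2 * trace (a ** Q)"
  proof -
    have "trace (a ** J ** (Q ** J)) = trace (J ** (a ** J) ** Q)"
      by (metis matrix_mul_assoc trace_mul_sym)
    also have "J ** (a ** J) = a" unfolding a by (simp add: mm_bilinear J')
    finally have 1: "trace (a ** J ** (Q ** J)) = trace (a ** Q)" .
    have 2: "a ** J ** (J ** Q) = - (a ** Q)" by (simp add: matrix_mul_assoc[symmetric] J' mm_bilinear)
    show ?thesis unfolding mm_bilinear trace_linear 1 2 by simp
  qed
  have t2: "trace ((P ** J - J ** P) ** J ** b) = - 2 * trace (b ** P)"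
  proof -
    have 1: "P ** J ** J ** b = - (P ** b)" by (simp add: matrix_mul_assoc[symmetric] J' mm_bilinear)
    have "trace (J ** P ** J ** b) = trace (P ** (J ** (b ** J)))"
      by (metis matrix_mul_assoc trace_mul_sym)
    also have "J ** (b ** J) = b" unfolding b by (simp add: mm_bilinear J')
    finally have 2: "trace (J ** P ** J ** b) = trace (b ** P)" by (simp add: trace_mul_sym[of P])
    show ?thesis unfolding mm_bilinear trace_linear 1 2 by (simp add: trace_mul_sym[of P])
  qed
  have t3: "trace ((P ** J - J ** P) ** J ** (Q ** J - J ** Q)) = - 2 * trace (J ** (P ** Q - Q ** P))"
  proof -
    have 1: "trace (P ** J ** J ** (Q ** J)) = - trace (J ** (P ** Q))"
    proof -
      have "P ** J ** J ** (Q ** J) = - (P ** Q ** J)" by (simp add: matrix_mul_assoc[symmetric] J' mm_bilinear)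
      then show ?thesis by (simp add: trace_linear trace_mul_sym[of _ J])
    qed
    have 2: "trace (P ** J ** J ** (J ** Q)) = - trace (J ** (Q ** P))"
    proof -
      have "P ** J ** J ** (J ** Q) = - (P ** (J ** Q))" by (simp add: matrix_mul_assoc[symmetric] J' mm_bilinear)
      moreover have "trace (P ** (J ** Q)) = trace (J ** (Q ** P))" by (metis matrix_mul_assoc trace_mul_sym)
      ultimately show ?thesis by (simp add: trace_linear)
    qed
    have 3: "trace (J ** P ** J ** (Q ** J)) = - trace (J ** (Q ** P))"
    proof -
      have "trace (J ** P ** J ** (Q ** J)) = trace (J ** (J ** (P ** (J ** Q))))" by (metis matrix_mul_assoc trace_mul_sym)
      also have "\<dots> = - trace (P ** (J ** Q))" by (simp add: J' trace_linear)
      also have "trace (P ** (J ** Q)) = trace (J ** (Q ** P))" by (metis matrix_mul_assoc trace_mul_sym)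
      finally show ?thesis .
    qed
    have 4: "trace (J ** P ** J ** (J ** Q)) = - trace (J ** (P ** Q))"
      by (simp add: matrix_mul_assoc[symmetric] J' mm_bilinear trace_linear)
    show ?thesis unfolding mm_bilinear trace_linear 1 2 3 4 by simp
  qed
  have "trace ((a + P ** J - J ** P) ** J ** (b + Q ** J - J ** Q)) =
    trace (a ** J ** b) + trace (a ** J ** (Q ** J - J ** Q)) + trace ((P ** J - J ** P) ** J ** b)
     + trace ((P ** J - J ** P) ** J ** (Q ** J - J ** Q))"
    unfolding mm_bilinear trace_linear by simp
  then show ?thesis unfolding t1 t2 t3 by (simp add: field_simps)
qed

text \<open>A product of three matrices that anticommute with \<open>J\<close> anticommutes with
  \<open>J\<close> as well. Conjugation by \<open>J\<close> therefore reverses the sign of the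
  product while preserving its trace.\<close>

lemma trace_triple_anticommuting:
  fixes J a b d :: "real^'n^'n"
  assumes J: "J ** J = - mat 1" and "a ** J = - (J ** a)" "b ** J = - (J ** b)" "d ** J = - (J ** d)"
  shows "trace (a ** b ** d) = 0"
proof -
  have 1: "a ** b ** d ** J = - (J ** (a ** b ** d))"
    using assms by (metis (no_types, lifting) matrix_mul_assoc mm_bilinear(5,6) minus_minus)
  have "trace (a ** b ** d) = - trace (a ** b ** d ** J ** J)"
    by (simp add: matrix_mul_assoc[symmetric] J mm_bilinear trace_linear)
  also have "\<dots> = trace (J ** (a ** b ** d) ** J)" unfolding 1 by (simp add: mm_bilinear trace_linear)
  also have "\<dots> = trace (J ** J ** (a ** b ** d))" by (metis matrix_mul_assoc trace_mul_sym)
  also have "\<dots> = - trace (a ** b ** d)" by (simp add: J mm_bilinear trace_linear)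
  finally show ?thesis by simp
qed

context oriented_mfd begin

lemma matrix_conj_chart:
  assumes "\<And>z. f z = from_chart A c q *v (N *v (to_chart A c q *v z))"
  shows "matrix f = from_chart A c q ** N ** to_chart A c q"
proof -
  have "f = (\<lambda>z. (from_chart A c q ** N ** to_chart A c q) *v z)"
    using assms by (simp add: fun_eq_iff matrix_vector_mul_assoc matrix_mul_assoc)
  then show ?thesis by simp
qed

lemma endo_rep_of_conj:
  assumes "compat A c" "q \<in> fst c" "B q = from_chart A c q ** N ** to_chart A c q"
  shows "endo_rep A c B (snd c q) = N"
  using assms by (simp add: endo_rep_conj(1) to_from_chart to_from_chart_cancel matrix_mul_assoc[symmetric])

lemma from_to_eqI:
  assumes "compat A c" "q \<in> fst c" "to_chart A c q *v v = w"
  shows "v = from_chart A c q *v w"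
  using assms to_from_chart_vec by metis

lemma vf_rep_at: "compat A c \<Longrightarrow> q \<in> fst c \<Longrightarrow> vf_rep A c X (snd c q) = to_chart A c q *v X q"
  by (simp add: vf_rep_def)

section \<open>Covariant derivatives and curvature near a point, in terms of Christoffel
  matrices\<close>

context
  fixes nab c S G
  assumes lc: "local_conn A nab c S G" and c: "compat A c"
begin

lemma G_lin: "linear (G x)" and S_open: "open S" and S_sub: "x \<in> S \<Longrightarrow> x \<in> cimg c"
  and G_smooth: "smooth_on S (\<lambda>y. G y v)"
  using lc by (auto simp: local_conn_def)

lemma G_bilin: "G x (v + w) = G x v + G x w" "G x (r *\<^sub>R v) = r *\<^sub>R G x v" "G x (v - w) = G x v - G x w"
  using G_lin[of x] by (simp_all add: linear_add linear_scale linear_diff)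

lemma nab_rep:
  "smooth_vf A X \<Longrightarrow> x \<in> S \<Longrightarrow> endo_rep A c (nab X) x = matrix (dd (vf_rep A c X) x) + G x (vf_rep A c X x)"
  using lc by (auto simp: local_conn_def)

lemma nab_apply:
  assumes "smooth_vf A X" "snd c q \<in> S" "q \<in> fst c"
  shows "to_chart A c q *v (nab X q *v z) =
    dd (vf_rep A c X) (snd c q) (to_chart A c q *v z) + G (snd c q) (vf_rep A c X (snd c q)) *v (to_chart A c q *v z)"
proof -
  have "linear (dd (vf_rep A c X) (snd c q))"
    using dd_linear[OF smooth_on_differentiable[OF smooth_vf_chart[OF assms(1) c]]] S_sub assms by blast
  moreover have "to_chart A c q *v (nab X q *v z) = endo_rep A c (nab X) (snd c q) *v (to_chart A c q *v z)"
    using assms c by (simp add: endo_rep_vec to_from_chart_vec)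
  ultimately show ?thesis using nab_rep[OF assms(1,2)] by (simp add: mv_bilinear matrix_apply)
qed

lemma cov_rep:
  assumes "smooth_vf A X" "x \<in> S"
  shows "vf_rep A c (cov nab u X) x = dd (vf_rep A c X) x (vf_rep A c u x) + G x (vf_rep A c X x) *v vf_rep A c u x"
  using nab_apply[OF assms(1), of "cinv c x" "u (cinv c x)"] assms S_sub[OF assms(2)] c
  by (simp add: vf_rep_def cov_def)

text \<open>The derivative of the auxiliary extension of \<open>z\<close> appears in both terms of
  the definition and cancels, which leaves a commutator with the Christoffel matrix.\<close>

lemma cov_endo_rep:
  assumes B: "smooth_endo A B" and q: "q \<in> fst c" "snd c q \<in> S"
  shows "cov_endo A nab u B q = from_chart A c q ** (dd (endo_rep A c B) (snd c q) (vf_rep A c u (snd c q))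
      + chr G (snd c q) (vf_rep A c u (snd c q)) ** endo_rep A c B (snd c q)
      - endo_rep A c B (snd c q) ** chr G (snd c q) (vf_rep A c u (snd c q))) ** to_chart A c q"
  unfolding cov_endo_def
proof (rule matrix_conj_chart, rule from_to_eqI[OF c q(1)])
  fix z
  let ?x = "snd c q" and ?X = "vf_ext A q z" and ?B = "endo_rep A c B" and ?u = "vf_rep A c u (snd c q)"
  have X: "smooth_vf A ?X" "?X q = z" by (rule vf_ext)+
  have x: "?x \<in> cimg c" "open (cimg c)" using q c by auto
  have dB: "(?B has_derivative dd ?B ?x) (at ?x)" using smooth_on_has_derivative[OF smooth_endo_chart[OF B c] x(1)] .
  have dX: "(vf_rep A c ?X has_derivative dd (vf_rep A c ?X) ?x) (at ?x)"
    using smooth_on_has_derivative[OF smooth_vf_chart[OF X(1) c] x(1)] .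
  have "dd (vf_rep A c (app B ?X)) ?x = dd (\<lambda>x. ?B x *v vf_rep A c ?X x) ?x"
    by (rule dd_cong[OF x(2,1)]) (rule vf_rep_app[OF c])
  also have "\<dots> = (\<lambda>h. ?B ?x *v dd (vf_rep A c ?X) ?x h + dd ?B ?x h *v vf_rep A c ?X ?x)"
    by (rule dd_eq[OF bounded_bilinear.FDERIV[OF bounded_bilinear_matrix_vector_mult dB dX]])
  finally have 1: "dd (vf_rep A c (app B ?X)) ?x h = ?B ?x *v dd (vf_rep A c ?X) ?x h + dd ?B ?x h *v vf_rep A c ?X ?x" for h
    by simp
  have 2: "to_chart A c q *v (B q *v v) = ?B ?x *v (to_chart A c q *v v)" for v
    using q c by (simp add: endo_rep_vec to_from_chart_vec)
  have 3: "vf_rep A c (cov nab u Y) ?x = to_chart A c q *v cov nab u Y q" for Y by (rule vf_rep_at[OF c q(1)])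
  have Xz: "vf_rep A c ?X ?x = to_chart A c q *v z" using vf_rep_at[OF c q(1)] X by simp
  show "to_chart A c q *v (cov nab u (app B ?X) q - B q *v cov nab u ?X q) =
    (dd ?B ?x ?u + chr G ?x ?u ** ?B ?x - ?B ?x ** chr G ?x ?u) *v (to_chart A c q *v z)"
    unfolding mv_bilinear 2 3[symmetric] cov_rep[OF X(1) q(2)] cov_rep[OF smooth_vf_app[OF B X(1)] q(2)] 1
      vf_rep_app[OF c x(1)] Xz matrix_vector_mul_assoc[symmetric] chr_apply[OF G_lin]
    by (simp add: algebra_simps)
qed

lemma chr_smooth: "smooth_on S (\<lambda>y. chr G y v)"
  unfolding chr_def matrix_def by (intro smooth_intros S_open G_smooth)

text \<open>The curvature expression \<open>d\<Gamma> + \<Gamma> \<and> \<Gamma>\<close> in the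
  constant directions \<open>u\<close> and \<open>v\<close>.\<close>

definition curv_loc where
  "curv_loc x u v = dd (\<lambda>y. chr G y v) x u - dd (\<lambda>y. chr G y u) x v + chr G x u ** chr G x v - chr G x v ** chr G x u"

lemma dd_chr:
  assumes "x \<in> S"
  shows "dd (\<lambda>y. G y w *v v) x h = dd (\<lambda>y. chr G y v) x h *v w"
proof -
  have "((\<lambda>y. chr G y v *v w) has_derivative (\<lambda>h. dd (\<lambda>y. chr G y v) x h *v w)) (at x)"
    by (rule bounded_linear.has_derivative[OF bounded_bilinear.bounded_linear_left[OF bounded_bilinear_matrix_vector_mult]])
      (rule smooth_on_has_derivative[OF chr_smooth assms])
  from dd_eq[OF this] show ?thesis by (simp add: chr_apply[OF G_lin])
qed

text \<open>The derivatives of the fields disappear: second derivatives of \<open>X\<close> by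
  symmetry, first derivatives of \<open>X\<close> between the two orders of differentiation, and
  first derivatives of \<open>u\<close> and \<open>v\<close> against the bracket term.\<close>

lemma curv_rep:
  assumes u: "smooth_vf A u" and v: "smooth_vf A v" and X: "smooth_vf A X" and nab: "connection A nab"
    and q: "q \<in> fst c" "snd c q \<in> S"
  shows "to_chart A c q *v curv A nab u v X q
     = curv_loc (snd c q) (vf_rep A c u (snd c q)) (vf_rep A c v (snd c q)) *v (to_chart A c q *v X q)"
proof -
  let ?x = "snd c q"
  define X' u' v' where "X' = vf_rep A c X" and "u' = vf_rep A c u" and "v' = vf_rep A c v"
  note x = S_open q(2)
  have xc: "?x \<in> cimg c" using q by simp
  have sm: "smooth_on S (vf_rep A c Z)" if "smooth_vf A Z" for Z
    using smooth_on_subset[OF smooth_vf_chart[OF that c]] S_sub by blast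
  have der: "(vf_rep A c Z has_derivative dd (vf_rep A c Z) ?x) (at ?x)" if "smooth_vf A Z" for Z
    using smooth_on_has_derivative[OF sm[OF that] q(2)] .
  have covs: "smooth_vf A (cov nab w X)" if "smooth_vf A w" for w
  proof -
    have "cov nab w X = app (nab X) w" by (auto simp: cov_def app_def)
    then show ?thesis using nab X that smooth_vf_app unfolding connection_def by metis
  qed
  have key: "dd (vf_rep A c (cov nab w X)) ?x h = dd (\<lambda>y. dd X' y (vf_rep A c w ?x)) ?x h + dd X' ?x (dd (vf_rep A c w) ?x h)
      + dd (\<lambda>y. chr G y (vf_rep A c w ?x)) ?x h *v X' ?x + G ?x (dd X' ?x h) *v vf_rep A c w ?x
      + G ?x (X' ?x) *v dd (vf_rep A c w) ?x h" if w: "smooth_vf A w" for w h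
  proof -
    have "dd (vf_rep A c (cov nab w X)) ?x = dd (\<lambda>y. dd X' y (vf_rep A c w y) + G y (X' y) *v vf_rep A c w y) ?x"
      by (rule dd_cong[OF x]) (simp add: cov_rep[OF X] X'_def)
    moreover have g: "((\<lambda>y. G y (X' y)) has_derivative (\<lambda>h. dd (\<lambda>y. G y (X' ?x)) ?x h + G ?x (dd X' ?x h))) (at ?x)"
      by (rule linear_family_has_derivative[OF x])
        (use G_lin smooth_on_differentiable[OF G_smooth q(2)] der[OF X] in \<open>auto simp: X'_def\<close>)
    have "((\<lambda>y. dd X' y (vf_rep A c w y) + G y (X' y) *v vf_rep A c w y) has_derivative
      (\<lambda>h. (dd (\<lambda>y. dd X' y (vf_rep A c w ?x)) ?x h + dd X' ?x (dd (vf_rep A c w) ?x h))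
        + (G ?x (X' ?x) *v dd (vf_rep A c w) ?x h + (dd (\<lambda>y. G y (X' ?x)) ?x h + G ?x (dd X' ?x h)) *v vf_rep A c w ?x))) (at ?x)"
      by (intro has_derivative_add bounded_bilinear.FDERIV[OF bounded_bilinear_matrix_vector_mult]
          dd_dir_has_derivative[OF x] g der[OF w]) (simp add: X'_def sm[OF X])
    moreover have "dd (\<lambda>y. G y (X' ?x)) ?x h *v vf_rep A c w ?x = dd (\<lambda>y. chr G y (vf_rep A c w ?x)) ?x h *v X' ?x"
    proof -
      have "((\<lambda>y. G y (X' ?x) *v vf_rep A c w ?x) has_derivative (\<lambda>h. dd (\<lambda>y. G y (X' ?x)) ?x h *v vf_rep A c w ?x)) (at ?x)"
        by (rule bounded_linear.has_derivative[OF bounded_bilinear.bounded_linear_left[OF bounded_bilinear_matrix_vector_mult]])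
          (rule smooth_on_has_derivative[OF G_smooth q(2)])
      from dd_eq[OF this] dd_chr[OF q(2)] show ?thesis by metis
    qed
    ultimately show ?thesis by (simp add: dd_eq mv_bilinear algebra_simps)
  qed
  have at: "to_chart A c q *v Z q = vf_rep A c Z ?x" for Z using vf_rep_at[OF c q(1)] by simp
  have sym: "dd (\<lambda>y. dd X' y (u' ?x)) ?x (v' ?x) = dd (\<lambda>y. dd X' y (v' ?x)) ?x (u' ?x)"
    by (rule dd_symmetric[OF S_open _ q(2)]) (simp add: X'_def sm[OF X])
  have X'lin: "dd X' ?x (a - b) = dd X' ?x a - dd X' ?x b" for a b
    using linear_diff[OF dd_linear[OF differentiableI[OF der[OF X]]]] by (simp add: X'_def)
  have br: "to_chart A c q *v cov nab (lie_bracket A u v) X q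
     = dd X' ?x (dd v' ?x (u' ?x) - dd u' ?x (v' ?x)) + G ?x (X' ?x) *v (dd v' ?x (u' ?x) - dd u' ?x (v' ?x))"
    using cov_rep[OF X q(2), of "lie_bracket A u v"] lie_bracket_rep[OF u v c q(1)]
    by (simp add: at X'_def u'_def v'_def)
  show ?thesis
    unfolding curv_def mv_bilinear br unfolding at cov_rep[OF covs[OF v] q(2)] cov_rep[OF covs[OF u] q(2)]
      key[OF u] key[OF v] cov_rep[OF X q(2)] curv_loc_def
    unfolding X'_def[symmetric] u'_def[symmetric] v'_def[symmetric]
    by (simp add: mv_bilinear G_bilin sym X'lin matrix_vector_mul_assoc[symmetric] chr_apply[OF G_lin] algebra_simps)
qed

lemma curv_endo_rep:
  assumes "smooth_vf A u" "smooth_vf A v" "connection A nab" "q \<in> fst c" "snd c q \<in> S"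
  shows "curv_endo A nab u v q = from_chart A c q **
    curv_loc (snd c q) (vf_rep A c u (snd c q)) (vf_rep A c v (snd c q)) ** to_chart A c q"
  unfolding curv_endo_def
  by (rule matrix_conj_chart, rule from_to_eqI[OF c assms(4)])
    (use curv_rep[OF assms(1,2) vf_ext(1) assms(3-5)] vf_ext(2) in simp)

end

text \<open>The divergence of the endomorphism field in coordinates, contracted with a vector: the
  flat part of \<open>lambda_form\<close>.\<close>

definition div_endo :: "('m, 'd) chart \<Rightarrow> ('m, 'd) endo \<Rightarrow> real^'d \<Rightarrow> real^'d \<Rightarrow> real" where
  "div_endo c J x u = trace (matrix (\<lambda>h. dd (endo_rep A c J) x h *v u))"

lemma lambda_rep:
  assumes lc: "local_conn A nab c S G" and c: "compat A c" and q: "q \<in> fst c" "snd c q \<in> S" and J: "smooth_endo A J"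
  shows "lambda_form A nab J q w = div_endo c J (snd c q) (to_chart A c q *v w 0)
     + trace (G (snd c q) (endo_rep A c J (snd c q) *v (to_chart A c q *v w 0)))
     - trace (endo_rep A c J (snd c q) ** G (snd c q) (to_chart A c q *v w 0))"
proof -
  let ?x = "snd c q" and ?X = "vf_ext A q (w 0)" and ?B = "endo_rep A c J"
  have X: "smooth_vf A ?X" "?X q = w 0" by (rule vf_ext)+
  have x: "?x \<in> cimg c" "open (cimg c)" using q c by auto
  have dB: "(?B has_derivative dd ?B ?x) (at ?x)" using smooth_on_has_derivative[OF smooth_endo_chart[OF J c] x(1)] .
  have dX: "(vf_rep A c ?X has_derivative dd (vf_rep A c ?X) ?x) (at ?x)"
    using smooth_on_has_derivative[OF smooth_vf_chart[OF X(1) c] x(1)] .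
  have Xz: "vf_rep A c ?X ?x = to_chart A c q *v w 0" using vf_rep_at[OF c q(1)] X by simp
  have "dd (vf_rep A c (app J ?X)) ?x = dd (\<lambda>x. ?B x *v vf_rep A c ?X x) ?x"
    by (rule dd_cong[OF x(2,1)]) (rule vf_rep_app[OF c])
  also have "\<dots> = (\<lambda>h. ?B ?x *v dd (vf_rep A c ?X) ?x h + dd ?B ?x h *v vf_rep A c ?X ?x)"
    by (rule dd_eq[OF bounded_bilinear.FDERIV[OF bounded_bilinear_matrix_vector_mult dB dX]])
  finally have e: "dd (vf_rep A c (app J ?X)) ?x = (\<lambda>h. ?B ?x *v dd (vf_rep A c ?X) ?x h + dd ?B ?x h *v vf_rep A c ?X ?x)" .
  have l1: "linear (dd (vf_rep A c ?X) ?x)" using has_derivative_linear[OF dX] .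
  have l2: "linear (\<lambda>h. dd ?B ?x h *v (to_chart A c q *v w 0))"
    using has_derivative_linear[OF dB] by (auto simp: linear_iff mv_bilinear)
  have l3: "linear (\<lambda>h. ?B ?x *v dd (vf_rep A c ?X) ?x h + dd ?B ?x h *v (to_chart A c q *v w 0))"
    using l1 l2 by (auto simp: linear_iff mv_bilinear algebra_simps)
  have "matrix (dd (vf_rep A c (app J ?X)) ?x)
    = ?B ?x ** matrix (dd (vf_rep A c ?X) ?x) + matrix (\<lambda>h. dd ?B ?x h *v (to_chart A c q *v w 0))"
    unfolding e Xz matrix_eq
    by (simp add: mv_bilinear matrix_apply[OF l1] matrix_apply[OF l2] matrix_apply[OF l3] matrix_vector_mul_assoc[symmetric])
  then have "endo_rep A c (cov_endo_vf nab J ?X) ?x = matrix (\<lambda>h. dd ?B ?x h *v (to_chart A c q *v w 0))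
     + G ?x (?B ?x *v (to_chart A c q *v w 0)) - ?B ?x ** G ?x (to_chart A c q *v w 0)"
    using nab_rep[OF lc c X(1) q(2)] nab_rep[OF lc c smooth_vf_app[OF J X(1)] q(2)] endo_rep_mult[OF c x(1), of J "nab ?X"]
      vf_rep_app[OF c x(1), of J ?X] Xz
    by (simp add: cov_endo_vf_def[abs_def] endo_rep_def mm_bilinear algebra_simps)
  then show ?thesis
    unfolding lambda_form_def trace_endo_rep[OF c q(1), symmetric] div_endo_def by (simp add: trace_linear)
qed

end

section \<open>The Ricci form in coordinates\<close>

text \<open>Coordinate expression of the Ricci form without reference to a connection: \<open>Jh\<close> is the matrix of
  \<open>J\<close> and \<open>r\<close> the density of \<open>\<rho>\<close>.\<close>

definition lam_loc :: "(real^'d \<Rightarrow> real^'d^'d) \<Rightarrow> (real^'d \<Rightarrow> real) \<Rightarrow> real^'d \<Rightarrow> real^'d \<Rightarrow> real" where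
  "lam_loc Jh r x u = trace (matrix (\<lambda>h. dd Jh x h *v u)) + dd r x (Jh x *v u) / r x"

definition ric_loc :: "(real^'d \<Rightarrow> real^'d^'d) \<Rightarrow> (real^'d \<Rightarrow> real) \<Rightarrow> real^'d \<Rightarrow> real^'d \<Rightarrow> real^'d \<Rightarrow> real" where
  "ric_loc Jh r x u v = 1/4 * trace (dd Jh x u ** Jh x ** dd Jh x v)
     + 1/2 * (dd (\<lambda>y. lam_loc Jh r y v) x u - dd (\<lambda>y. lam_loc Jh r y u) x v)"

lemma lam_loc_cong:
  assumes "open S" "x \<in> S" "\<And>y. y \<in> S \<Longrightarrow> Jh y = Jh' y" "\<And>y. y \<in> S \<Longrightarrow> r y = r' y"
  shows "lam_loc Jh r x u = lam_loc Jh' r' x u"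
  using dd_cong[OF assms(1-3)] dd_cong[OF assms(1,2,4)] assms(2-4) by (simp add: lam_loc_def)

lemma ric_loc_cong:
  assumes "open S" "x \<in> S" "\<And>y. y \<in> S \<Longrightarrow> Jh y = Jh' y" "\<And>y. y \<in> S \<Longrightarrow> r y = r' y"
  shows "ric_loc Jh r x u v = ric_loc Jh' r' x u v"
proof -
  have "dd (\<lambda>y. lam_loc Jh r y w) x = dd (\<lambda>y. lam_loc Jh' r' y w) x" for w
    using lam_loc_cong[OF assms(1) _ assms(3,4)] by (intro dd_cong[OF assms(1,2)]) auto
  then show ?thesis using dd_cong[OF assms(1-3)] assms(2,3) by (simp add: ric_loc_def)
qed

lemma dloc_one:
  assumes "open S" "x \<in> S" "\<And>y w. y \<in> S \<Longrightarrow> F y w = f y (w 0)"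
  shows "dloc 1 F x w = dd (\<lambda>y. f y (w 1)) x (w 0) - dd (\<lambda>y. f y (w 0)) x (w 1)"
proof -
  have "dloc 1 F x w = dloc 1 (\<lambda>y w. f y (w 0)) x w"
    by (rule dloc_cong[OF assms])
  then show ?thesis by (simp add: dloc_def omit_def)
qed

lemma linear_div_trace:
  fixes F :: "real^'n \<Rightarrow> real^'n^'n"
  shows "linear (\<lambda>u. trace (matrix (\<lambda>h. F h *v u)))"
  by (auto simp: linear_iff trace_def matrix_def mv_bilinear sum.distrib sum_distrib_left)

locale ric_data =
  fixes S :: "(real^'d) set" and Jh :: "real^'d \<Rightarrow> real^'d^'d" and r :: "real^'d \<Rightarrow> real"
  assumes S: "open S" and Js: "smooth_on S Jh" and J2: "\<And>x. x \<in> S \<Longrightarrow> Jh x ** Jh x = - mat 1"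
    and rs: "smooth_on S r" and rnz: "\<And>x. x \<in> S \<Longrightarrow> r x \<noteq> 0"
begin

lemma lam_smooth: "smooth_on S (\<lambda>y. lam_loc Jh r y u)"
  unfolding lam_loc_def matrix_def by (intro smooth_intros S Js rs rnz)

lemma lam_linear: "x \<in> S \<Longrightarrow> linear (lam_loc Jh r x)"
  using linear_div_trace[of "dd Jh x"] dd_linear[OF smooth_on_differentiable[OF rs]]
  by (auto simp: linear_iff lam_loc_def mv_bilinear add_divide_distrib algebra_simps)

lemma dd_lam_linear:
  assumes "x \<in> S"
  shows "linear (\<lambda>u. dd (\<lambda>y. lam_loc Jh r y u) x h)"
proof (rule linearI)
  fix u v and a :: real
  have d: "((\<lambda>y. lam_loc Jh r y u) has_derivative dd (\<lambda>y. lam_loc Jh r y u) x) (at x)" for u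
    by (rule smooth_on_has_derivative[OF lam_smooth assms])
  have "dd (\<lambda>y. lam_loc Jh r y (u + v)) x = dd (\<lambda>y. lam_loc Jh r y u + lam_loc Jh r y v) x"
    by (rule dd_cong[OF S assms]) (simp add: linear_add[OF lam_linear])
  then show "dd (\<lambda>y. lam_loc Jh r y (u + v)) x h = dd (\<lambda>y. lam_loc Jh r y u) x h + dd (\<lambda>y. lam_loc Jh r y v) x h"
    by (simp add: dd_eq[OF has_derivative_add[OF d d]])
  have "dd (\<lambda>y. lam_loc Jh r y (a *\<^sub>R u)) x = dd (\<lambda>y. a * lam_loc Jh r y u) x"
    by (rule dd_cong[OF S assms]) (simp add: linear_scale[OF lam_linear])
  then show "dd (\<lambda>y. lam_loc Jh r y (a *\<^sub>R u)) x h = a *\<^sub>R dd (\<lambda>y. lam_loc Jh r y u) x h"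
    by (simp add: dd_eq[OF has_derivative_mult_right[OF d]])
qed

lemma ric_smooth: "smooth_on S (\<lambda>y. ric_loc Jh r y u v)"
  unfolding ric_loc_def by (intro smooth_intros S Js lam_smooth)

lemma ric_linear:
  assumes "x \<in> S"
  shows "linear (\<lambda>u. ric_loc Jh r x u v)" "linear (\<lambda>v. ric_loc Jh r x u v)"
  using dd_lam_linear[OF assms] dd_linear[OF smooth_on_differentiable[OF lam_smooth assms]]
    dd_linear[OF smooth_on_differentiable[OF Js assms]]
  by (auto simp: linear_iff ric_loc_def mm_bilinear trace_linear algebra_simps add_divide_distrib)

lemma dJ_anti:
  assumes "x \<in> S"
  shows "dd Jh x u ** Jh x = - (Jh x ** dd Jh x u)"
proof -
  have J: "(Jh has_derivative dd Jh x) (at x)" by (rule smooth_on_has_derivative[OF Js assms])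
  have d1: "((\<lambda>y. - mat 1) has_derivative (\<lambda>h. Jh x ** dd Jh x h + dd Jh x h ** Jh x)) (at x)"
    by (rule has_derivative_transform_within_open[OF bounded_bilinear.FDERIV[OF bounded_bilinear_matrix_mult J J] S assms])
      (rule J2)
  have d0: "((\<lambda>y. - mat 1 :: real^'d^'d) has_derivative (\<lambda>h. 0)) (at x)" by (rule has_derivative_const)
  have "Jh x ** dd Jh x u + dd Jh x u ** Jh x = 0"
    using fun_cong[OF has_derivative_unique[OF d1 d0], of u] by simp
  then show ?thesis by (simp add: eq_neg_iff_add_eq_0 add.commute)
qed

text \<open>Second derivative of the relation \<open>J\<^sup>2 = -1\<close>: it trades
  \<open>J\<close> times a second derivative for products of first derivatives.\<close>

lemma ddJ_anti:
  assumes "x \<in> S"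
  shows "Jh x ** dd (\<lambda>y. dd Jh y u) x v + dd (\<lambda>y. dd Jh y u) x v ** Jh x = - (dd Jh x v ** dd Jh x u + dd Jh x u ** dd Jh x v)"
proof -
  have J: "(Jh has_derivative dd Jh x) (at x)" by (rule smooth_on_has_derivative[OF Js assms])
  have Ju: "((\<lambda>y. dd Jh y u) has_derivative dd (\<lambda>y. dd Jh y u) x) (at x)"
    by (rule smooth_on_has_derivative[OF smooth_on_dd[OF Js] assms])
  have d1: "((\<lambda>y. 0) has_derivative (\<lambda>h. (Jh x ** dd (\<lambda>y. dd Jh y u) x h + dd Jh x h ** dd Jh x u)
      + (dd Jh x u ** dd Jh x h + dd (\<lambda>y. dd Jh y u) x h ** Jh x))) (at x)"
    by (rule has_derivative_transform_within_open[OF has_derivative_add[OF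
      bounded_bilinear.FDERIV[OF bounded_bilinear_matrix_mult J Ju] bounded_bilinear.FDERIV[OF bounded_bilinear_matrix_mult Ju J]] S assms])
      (simp add: dJ_anti)
  have d0: "((\<lambda>y. 0 :: real^'d^'d) has_derivative (\<lambda>h. 0)) (at x)" by (rule has_derivative_const)
  have "(Jh x ** dd (\<lambda>y. dd Jh y u) x v + dd Jh x v ** dd Jh x u)
      + (dd Jh x u ** dd Jh x v + dd (\<lambda>y. dd Jh y u) x v ** Jh x) = 0"
    using fun_cong[OF has_derivative_unique[OF d1 d0], of v] by simp
  then show ?thesis by (simp add: eq_neg_iff_add_eq_0 algebra_simps)
qed

lemma ric_alternating: "x \<in> S \<Longrightarrow> ric_loc Jh r x u u = 0"
proof -
  assume x: "x \<in> S"
  have "trace (dd Jh x u ** Jh x ** dd Jh x u) = trace (dd Jh x u ** dd Jh x u ** Jh x)"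
    by (metis matrix_mul_assoc trace_mul_sym)
  also have "dd Jh x u ** dd Jh x u ** Jh x = - (dd Jh x u ** Jh x ** dd Jh x u)"
    unfolding matrix_mul_assoc[symmetric] by (simp add: dJ_anti[OF x] mm_bilinear)
  finally have "trace (dd Jh x u ** Jh x ** dd Jh x u) = 0" by (simp add: trace_linear)
  then show ?thesis by (simp add: ric_loc_def)
qed

text \<open>The part with \<open>lam_loc\<close> is exact and drops out by symmetry of second
  derivatives. In the quadratic part every cubic trace vanishes by
  \<open>trace_triple_anticommuting\<close>, and the second derivatives combine through
  \<open>ddJ_anti\<close> into cubic traces again.\<close>

lemma ric_closed:
  assumes x: "x \<in> S"
  shows "dd (\<lambda>y. ric_loc Jh r y v w) x u - dd (\<lambda>y. ric_loc Jh r y u w) x v + dd (\<lambda>y. ric_loc Jh r y u v) x w = 0"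
proof -
  define J2 where "J2 = (\<lambda>u v. dd (\<lambda>y. dd Jh y u) x v)"
  define L2 where "L2 = (\<lambda>u v w. dd (\<lambda>y. dd (\<lambda>z. lam_loc Jh r z u) y v) x w)"
  have J2s: "J2 u v = J2 v u" for u v unfolding J2_def by (rule dd_symmetric[OF S Js x])
  have L2s: "L2 u v w = L2 u w v" for u v w unfolding L2_def by (rule dd_symmetric[OF S lam_smooth x])
  have d: "dd (\<lambda>y. ric_loc Jh r y u v) x w = 1/4 * (trace (J2 u w ** Jh x ** dd Jh x v) + trace (dd Jh x u ** dd Jh x w ** dd Jh x v)
      + trace (dd Jh x u ** Jh x ** J2 v w)) + 1/2 * (L2 v u w - L2 u v w)" for u v w
  proof -
    have J: "(Jh has_derivative dd Jh x) (at x)" by (rule smooth_on_has_derivative[OF Js x])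
    have Ju: "((\<lambda>y. dd Jh y u) has_derivative J2 u) (at x)" for u
      unfolding J2_def by (rule smooth_on_has_derivative[OF smooth_on_dd[OF Js] x])
    have Lu: "((\<lambda>y. dd (\<lambda>z. lam_loc Jh r z u) y v) has_derivative L2 u v) (at x)" for u v
      unfolding L2_def by (rule smooth_on_has_derivative[OF smooth_on_dd[OF lam_smooth] x])
    have "((\<lambda>y. ric_loc Jh r y u v) has_derivative (\<lambda>w. 1/4 * trace ((dd Jh x u ** Jh x) ** J2 v w +
       (dd Jh x u ** dd Jh x w + J2 u w ** Jh x) ** dd Jh x v) + 1/2 * (L2 v u w - L2 u v w))) (at x)"
      unfolding ric_loc_def
      by (intro has_derivative_add has_derivative_mult_right has_derivative_diff Lu
        bounded_linear.has_derivative[OF bounded_linear_trace] bounded_bilinear.FDERIV[OF bounded_bilinear_matrix_mult] J Ju)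
    from dd_eq[OF this] show ?thesis by (simp add: mm_bilinear trace_linear algebra_simps)
  qed
  note tri = trace_triple_anticommuting[OF local.J2[OF x] dJ_anti[OF x] dJ_anti[OF x] dJ_anti[OF x]]
  have "trace (dd Jh x v ** Jh x ** J2 w u) + trace (J2 u w ** Jh x ** dd Jh x v)
     = trace (dd Jh x v ** (Jh x ** J2 u w + J2 u w ** Jh x))"
    unfolding mm_bilinear trace_linear J2s[of w u] trace_mul_sym[of "J2 u w ** Jh x"]
    by (simp add: matrix_mul_assoc)
  also have "\<dots> = - (trace (dd Jh x v ** dd Jh x w ** dd Jh x u) + trace (dd Jh x v ** dd Jh x u ** dd Jh x w))"
    unfolding J2_def ddJ_anti[OF x] by (simp add: mm_bilinear trace_linear matrix_mul_assoc)
  finally have "trace (dd Jh x v ** Jh x ** J2 w u) + trace (J2 u w ** Jh x ** dd Jh x v) = 0"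
    unfolding tri by simp
  then show ?thesis unfolding d tri using J2s[of v u] J2s[of w v] L2s[of w v u] L2s[of v w u] L2s[of u w v]
    by (simp add: algebra_simps)
qed

end

section \<open>Comparison of the local formula with a connection\<close>

context oriented_mfd begin

lemma trace_conj3:
  assumes "compat A c" "q \<in> fst c" "B q = from_chart A c q ** N ** to_chart A c q"
    "D q = from_chart A c q ** M ** to_chart A c q"
  shows "trace (B q ** J q ** D q) = trace (N ** endo_rep A c J (snd c q) ** M)"
    "trace (J q ** D q) = trace (endo_rep A c J (snd c q) ** M)"
proof -
  have x: "snd c q \<in> cimg c" using assms by simp
  have 1: "endo_rep A c (\<lambda>q. B q ** J q ** D q) (snd c q) = N ** endo_rep A c J (snd c q) ** M"
    unfolding endo_rep_mult[OF assms(1) x] endo_rep_of_conj[OF assms(1,2), of B, OF assms(3)]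
      endo_rep_of_conj[OF assms(1,2), of D, OF assms(4)] ..
  show "trace (B q ** J q ** D q) = trace (N ** endo_rep A c J (snd c q) ** M)"
    using trace_endo_rep[OF assms(1,2), of "\<lambda>q. B q ** J q ** D q"] unfolding 1 by simp
  have 2: "endo_rep A c (\<lambda>q. J q ** D q) (snd c q) = endo_rep A c J (snd c q) ** M"
    unfolding endo_rep_mult[OF assms(1) x] endo_rep_of_conj[OF assms(1,2), of D, OF assms(4)] ..
  show "trace (J q ** D q) = trace (endo_rep A c J (snd c q) ** M)"
    using trace_endo_rep[OF assms(1,2), of "\<lambda>q. J q ** D q"] unfolding 2 by simp
qed

lemma almost_complex_rep:
  assumes "almost_complex A J" "compat A c" "x \<in> cimg c"
  shows "endo_rep A c J x ** endo_rep A c J x = - mat 1"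
proof -
  have "(\<lambda>q. J q ** J q) = (\<lambda>q. - mat 1)" using assms(1) by (auto simp: almost_complex_def)
  then have "endo_rep A c J x ** endo_rep A c J x = endo_rep A c (\<lambda>q. - mat 1) x"
    using endo_rep_mult[OF assms(2,3), of J J] by simp
  also have "\<dots> = - mat 1"
    using assms to_from_chart[of c "cinv c x"] by (simp add: endo_rep_def mm_bilinear)
  finally show ?thesis .
qed

text \<open>This holds for any connection; for a complex one the first term vanishes.\<close>

lemma ricci_curvature_part:
  assumes lc: "local_conn A nab c S G" and c: "compat A c" and nab: "connection A nab" and J: "almost_complex A J"
    and u: "smooth_vf A u" and v: "smooth_vf A v" and q: "q \<in> fst c" "snd c q \<in> S"
  shows "1/4 * trace (cov_endo A nab u J q ** J q ** cov_endo A nab v J q) + 1/2 * trace (J q ** curv_endo A nab u v q)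
    = 1/4 * trace (dd (endo_rep A c J) (snd c q) (to_chart A c q *v u q) ** endo_rep A c J (snd c q)
        ** dd (endo_rep A c J) (snd c q) (to_chart A c q *v v q))
      + 1/2 * (dd (\<lambda>y. trace (endo_rep A c J y ** chr G y (to_chart A c q *v v q))) (snd c q) (to_chart A c q *v u q)
        - dd (\<lambda>y. trace (endo_rep A c J y ** chr G y (to_chart A c q *v u q))) (snd c q) (to_chart A c q *v v q))"
proof -
  let ?x = "snd c q" and ?J = "endo_rep A c J"
  define u' v' where "u' = to_chart A c q *v u q" and "v' = to_chart A c q *v v q"
  have sJ: "smooth_endo A J" using J by (simp add: almost_complex_def)
  have x: "?x \<in> cimg c" using q by simp
  have Jd: "(?J has_derivative dd ?J ?x) (at ?x)" by (rule smooth_on_has_derivative[OF smooth_endo_chart[OF sJ c] x])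
  have o: "open (cimg c)" using c by simp
  interpret ric_data "cimg c" ?J "\<lambda>_. 1"
    by unfold_locales (use o smooth_endo_chart[OF sJ c] almost_complex_rep[OF J c] smooth_on_const in auto)
  have d: "dd (\<lambda>y. trace (?J y ** chr G y w)) ?x h = trace (?J ?x ** dd (\<lambda>y. chr G y w) ?x h) + trace (dd ?J ?x h ** chr G ?x w)" for w h
  proof -
    have "((\<lambda>y. trace (?J y ** chr G y w)) has_derivative
       (\<lambda>h. trace (?J ?x ** dd (\<lambda>y. chr G y w) ?x h + dd ?J ?x h ** chr G ?x w))) (at ?x)"
      by (intro bounded_linear.has_derivative[OF bounded_linear_trace] bounded_bilinear.FDERIV[OF bounded_bilinear_matrix_mult]
        Jd smooth_on_has_derivative[OF chr_smooth[OF lc c] q(2)])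
    from dd_eq[OF this] show ?thesis by (simp add: trace_linear)
  qed
  have "1/4 * trace (cov_endo A nab u J q ** J q ** cov_endo A nab v J q) + 1/2 * trace (J q ** curv_endo A nab u v q)
    = 1/4 * trace ((dd ?J ?x u' + chr G ?x u' ** ?J ?x - ?J ?x ** chr G ?x u') ** ?J ?x **
         (dd ?J ?x v' + chr G ?x v' ** ?J ?x - ?J ?x ** chr G ?x v')) + 1/2 * trace (?J ?x ** curv_loc G ?x u' v')"
    using trace_conj3[OF c q(1), of "cov_endo A nab u J" _ "cov_endo A nab v J", OF cov_endo_rep[OF lc c sJ q] cov_endo_rep[OF lc c sJ q], of J]
      trace_conj3(2)[OF c q(1), of "curv_endo A nab u v" _ "curv_endo A nab u v", OF curv_endo_rep[OF lc c u v nab q] curv_endo_rep[OF lc c u v nab q], of J]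
    unfolding vf_rep_at[OF c q(1)] u'_def v'_def by simp
  also have "trace (?J ?x ** curv_loc G ?x u' v') = trace (?J ?x ** dd (\<lambda>y. chr G y v') ?x u')
     - trace (?J ?x ** dd (\<lambda>y. chr G y u') ?x v') + trace (?J ?x ** (chr G ?x u' ** chr G ?x v' - chr G ?x v' ** chr G ?x u'))"
    unfolding curv_loc_def[OF lc c] mm_bilinear trace_linear by simp
  finally show ?thesis
    using ricci_trace_identity[OF J2[OF x] dJ_anti[OF x, of u'] dJ_anti[OF x, of v'], of "chr G ?x u'" "chr G ?x v'"]
    unfolding d u'_def[symmetric] v'_def[symmetric] by (simp add: algebra_simps)
qed

text \<open>Tested on extensions of two vectors, the bracket removes the derivatives of the fields
  and the Christoffel terms remain.\<close>

lemma torsion_free_symmetric: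
  assumes lc: "local_conn A nab c S G" and c: "compat A c" and tf: "torsion_free A nab" and x: "x \<in> S"
  shows "G x v *v z = G x z *v v" "chr G x z = G x z"
proof -
  define q where "q = cinv c x"
  have q: "q \<in> fst c" "snd c q = x" using S_sub[OF lc c x] c by (auto simp: q_def)
  have *: "G x v *v z = G x z *v v" for v z
  proof -
    define X where "X = vf_ext A q (from_chart A c q *v v)"
    define Y where "Y = vf_ext A q (from_chart A c q *v z)"
    have XY: "smooth_vf A X" "smooth_vf A Y" unfolding X_def Y_def by (rule vf_ext)+
    have r: "vf_rep A c X x = v" "vf_rep A c Y x = z"
      using q c vf_rep_at[OF c q(1)] by (simp_all add: X_def Y_def vf_ext to_from_chart_vec)
    have "cov nab X Y q - cov nab Y X q = lie_bracket A X Y q" using tf XY by (simp add: torsion_free_def)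
    then have "to_chart A c q *v cov nab X Y q - to_chart A c q *v cov nab Y X q = to_chart A c q *v lie_bracket A X Y q"
      by (metis mv_bilinear(4))
    then show ?thesis
      unfolding lie_bracket_rep[OF XY c q(1)] unfolding vf_rep_at[OF c q(1), symmetric]
      unfolding q(2) cov_rep[OF lc c XY(1) x] cov_rep[OF lc c XY(2) x] unfolding r by (simp add: algebra_simps)
  qed
  then show "G x v *v z = G x z *v v" .
  show "chr G x z = G x z" unfolding matrix_eq chr_apply[of G, OF G_lin[OF lc c]] using * by blast
qed

end

context vol_mfd begin

text \<open>The condition is tested on extensions of the standard frame. Their derivatives cancel,
  and the Christoffel matrix acts on the density as a derivation of top forms, that is, through its
  trace.\<close>

lemma trace_chr:
  assumes lc: "local_conn A nab c S G" and c: "compat A c" and pf: "preserves_form A CARD('d) \<rho> nab" and x: "x \<in> S"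
  shows "trace (chr G x z) = logdens c x z"
proof -
  define q where "q = cinv c x"
  have xc: "x \<in> cimg c" using S_sub[OF lc c x] .
  have q: "q \<in> fst c" "snd c q = x" using xc c by (auto simp: q_def)
  define X where "X = (\<lambda>i. vf_ext A q (from_chart A c q *v std_frame i))"
  define u where "u = vf_ext A q (from_chart A c q *v z)"
  have X: "smooth_vf A (X i)" and u: "smooth_vf A u" for i unfolding X_def u_def by (rule vf_ext)+
  have r: "vf_rep A c (X i) x = std_frame i" "vf_rep A c u x = z" "to_chart A c q *v u q = z" for i
    using q c vf_rep_at[OF c q(1)] by (simp_all add: X_def u_def vf_ext to_from_chart_vec)
  have alt: "alternating_form CARD('d) (form_rep A c \<rho> x)" by (rule form_rep_alternating[OF rho_alt])
  have e: "\<rho> q ((\<lambda>j. X j q)(i := cov nab u (X i) q)) = form_rep A c \<rho> x (std_frame(i := dd (vf_rep A c (X i)) x z))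
     + form_rep A c \<rho> x (std_frame(i := chr G x z *v std_frame i))" if "i < CARD('d)" for i
  proof -
    have t: "to_chart A c q *v cov nab u (X i) q = dd (vf_rep A c (X i)) x z + chr G x z *v std_frame i"
      using cov_rep[OF lc c X x, of u i] vf_rep_at[OF c q(1), of "cov nab u (X i)"]
      by (simp add: q r chr_apply[of G, OF G_lin[OF lc c]])
    have "(\<lambda>j. to_chart A c q *v (((\<lambda>j. X j q)(i := cov nab u (X i) q)) j))
       = std_frame(i := dd (vf_rep A c (X i)) x z + chr G x z *v std_frame i)"
      using vf_rep_at[OF c q(1), symmetric] r(1) t q(2) by (auto simp: fun_eq_iff)
    then have "\<rho> q ((\<lambda>j. X j q)(i := cov nab u (X i) q))
      = form_rep A c \<rho> x (std_frame(i := dd (vf_rep A c (X i)) x z + chr G x z *v std_frame i))"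
      using form_of_chart[OF c q(1), of \<rho> "(\<lambda>j. X j q)(i := cov nab u (X i) q)"] q(2) by simp
    then show ?thesis using linear_add[OF alternating_form_linear[OF alt that]] by simp
  qed
  have "dfun A (\<lambda>q. \<rho> q (\<lambda>i. X i q)) q (u q) = (\<Sum>i<CARD('d). \<rho> q ((\<lambda>j. X j q)(i := cov nab u (X i) q)))"
    using pf X u unfolding preserves_form_def by (simp add: right_minus_eq)
  also have "\<dots> = (\<Sum>i<CARD('d). form_rep A c \<rho> x (std_frame(i := dd (vf_rep A c (X i)) x z)))
    + trace (chr G x z) * form_rep A c \<rho> x std_frame"
    using e by (simp add: sum.distrib top_form_trace[OF alt])
  finally have "logdens c x z * form_rep A c \<rho> x std_frame = trace (chr G x z) * form_rep A c \<rho> x std_frame"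
    unfolding dfun_form_apply[OF rho_form X c q(1)] q(2) r dd_rho_rep[OF c xc] by simp
  then show ?thesis using dens_nonzero[OF c xc] by (simp add: dens_def)
qed

end

section \<open>Properties of the Ricci form\<close>

context oriented_mfd begin

lemma chart_nbhd:
  assumes "compat A c" "open S" "p \<in> fst c" "snd c p \<in> S"
  shows "open {q \<in> fst c. snd c q \<in> S}" "p \<in> {q \<in> fst c. snd c q \<in> S}" "snd c ` {q \<in> fst c. snd c q \<in> S} = S \<inter> cimg c"
proof -
  have "continuous_on (fst c) (snd c)"
    using compat_chart[OF assms(1)] unfolding is_chart_def homeomorphism_def by blast
  then have "open (fst c \<inter> snd c -` S)"
    by (rule continuous_open_preimage) (use assms in auto)
  moreover have "fst c \<inter> snd c -` S = {q \<in> fst c. snd c q \<in> S}" by auto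
  ultimately show "open {q \<in> fst c. snd c q \<in> S}" by simp
  show "p \<in> {q \<in> fst c. snd c q \<in> S}" using assms by simp
  show "snd c ` {q \<in> fst c. snd c q \<in> S} = S \<inter> cimg c" by (auto simp: cimg_def)
qed

text \<open>The local model is required on an open part \<open>S\<close> of a chart, since
  Christoffel matrices are available only near a point. Two-forms are described on whole
  charts.\<close>

lemma one_formI:
  assumes "\<And>p. \<exists>c S f. compat A c \<and> open S \<and> S \<subseteq> cimg c \<and> p \<in> fst c \<and> snd c p \<in> S \<and>
    (\<forall>q w. q \<in> fst c \<longrightarrow> snd c q \<in> S \<longrightarrow> \<omega> q w = f (snd c q) (to_chart A c q *v w 0)) \<and>
    (\<forall>x\<in>S. linear (f x)) \<and> (\<forall>v. smooth_on S (\<lambda>x. f x v))"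
  shows "\<omega> \<in> forms A 1"
proof (rule formsI)
  fix p
  obtain c S f where c: "compat A c" "open S" "S \<subseteq> cimg c" "p \<in> fst c" "snd c p \<in> S"
    and f: "\<And>q w. q \<in> fst c \<Longrightarrow> snd c q \<in> S \<Longrightarrow> \<omega> q w = f (snd c q) (to_chart A c q *v w 0)"
    and fl: "\<And>x. x \<in> S \<Longrightarrow> linear (f x)" and fs: "\<And>v. smooth_on S (\<lambda>x. f x v)"
    using assms[of p] by blast
  show "alternating_form 1 (\<omega> p)"
    unfolding alternating_form_def f[OF c(4,5)] using fl[OF c(5)] by (auto simp: linear_iff mv_bilinear)
  have "form_rep A c \<omega> x w = f x (w 0)" if "x \<in> S" for x w
    using f[of "cinv c x"] that c(1,3) by (auto simp: form_rep_def to_from_chart_vec)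
  then have "smooth_on S (\<lambda>x. form_rep A c \<omega> x w)" for w
    using smooth_on_eq_on[OF fs[of "w 0"] c(2)] by simp
  moreover have "S \<inter> cimg c = S" using c(3) by blast
  ultimately show "\<exists>c U. compat A c \<and> open U \<and> p \<in> U \<and> U \<subseteq> fst c \<and> (\<forall>w. smooth_on (snd c ` U) (\<lambda>x. form_rep A c \<omega> x w))"
    using chart_nbhd[OF c(1,2,4,5)] c(1)
    by (intro exI[of _ c] exI[of _ "{q \<in> fst c. snd c q \<in> S}"]) auto
qed

lemma two_formI:
  assumes "\<And>p. \<exists>c f. compat A c \<and> p \<in> fst c \<and>
    (\<forall>q w. q \<in> fst c \<longrightarrow> \<omega> q w = f (snd c q) (to_chart A c q *v w 0) (to_chart A c q *v w 1)) \<and>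
    (\<forall>x\<in>cimg c. (\<forall>v. linear (\<lambda>u. f x u v)) \<and> (\<forall>u. linear (f x u)) \<and> (\<forall>u. f x u u = 0)) \<and>
    (\<forall>u v. smooth_on (cimg c) (\<lambda>x. f x u v))"
  shows "\<omega> \<in> forms A 2"
proof (rule formsI)
  fix p
  obtain c f where c: "compat A c" "p \<in> fst c"
    and f: "\<And>q w. q \<in> fst c \<Longrightarrow> \<omega> q w = f (snd c q) (to_chart A c q *v w 0) (to_chart A c q *v w 1)"
    and fl: "\<And>x v. x \<in> cimg c \<Longrightarrow> linear (\<lambda>u. f x u v)" "\<And>x u. x \<in> cimg c \<Longrightarrow> linear (f x u)"
      "\<And>x u. x \<in> cimg c \<Longrightarrow> f x u u = 0"
    and fs: "\<And>u v. smooth_on (cimg c) (\<lambda>x. f x u v)"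
    using assms[of p] by blast
  have two: "i = 0 \<or> i = Suc 0" if "i < 2" for i :: nat using that by linarith
  show "alternating_form 2 (\<omega> p)"
    unfolding alternating_form_def f[OF c(2)] using fl[OF coord_in[OF c(2)]]
    by (auto simp: linear_iff mv_bilinear dest!: two)
  have "form_rep A c \<omega> x w = f x (w 0) (w 1)" if "x \<in> cimg c" for x w
    using f[of "cinv c x"] that c(1) by (auto simp: form_rep_def to_from_chart_vec)
  then have "smooth_on (cimg c) (\<lambda>x. form_rep A c \<omega> x w)" for w
    using smooth_on_eq_on[OF fs[of "w 0" "w 1"]] c(1) by simp
  then show "\<exists>c U. compat A c \<and> open U \<and> p \<in> U \<and> U \<subseteq> fst c \<and> (\<forall>w. smooth_on (snd c ` U) (\<lambda>x. form_rep A c \<omega> x w))"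
    using c by (intro exI[of _ c] exI[of _ "fst c"]) (auto simp: cimg_def)
qed

lemma ext_d_one:
  assumes \<omega>: "\<omega> \<in> forms A 1" and c: "compat A c" and S: "open S" "S \<subseteq> cimg c" and q: "q \<in> fst c" "snd c q \<in> S"
    and f: "\<And>q w. q \<in> fst c \<Longrightarrow> snd c q \<in> S \<Longrightarrow> \<omega> q w = f (snd c q) (to_chart A c q *v w 0)"
  shows "ext_d A 1 \<omega> q w = dd (\<lambda>y. f y (to_chart A c q *v w 1)) (snd c q) (to_chart A c q *v w 0)
    - dd (\<lambda>y. f y (to_chart A c q *v w 0)) (snd c q) (to_chart A c q *v w 1)"
proof -
  have "form_rep A c \<omega> x w = f x (w 0)" if "x \<in> S" for x w
    using f[of "cinv c x"] that c S(2) by (auto simp: form_rep_def to_from_chart_vec)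
  from dloc_one[OF S(1) q(2) this] show ?thesis unfolding ext_d_rep[OF \<omega> c q(1)] .
qed

lemma forms_add: "\<omega> \<in> forms A k \<Longrightarrow> \<eta> \<in> forms A k \<Longrightarrow> (\<lambda>p w. \<omega> p w + \<eta> p w) \<in> forms A k"
  using A_compat by (auto simp: forms_def form_rep_def[abs_def] alternating_form_def linear_iff algebra_simps intro!: smooth_on_add) metis

lemma forms_scale: "\<omega> \<in> forms A k \<Longrightarrow> smooth_fun A f \<Longrightarrow> (\<lambda>p w. f p * \<omega> p w) \<in> forms A k"
  using A_compat by (auto simp: forms_def form_rep_def[abs_def] alternating_form_def linear_iff algebra_simps smooth_fun_def o_def intro!: smooth_on_mult)

lemma forms_cmult: "\<omega> \<in> forms A k \<Longrightarrow> (\<lambda>p w. a * \<omega> p w) \<in> forms A k"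
  by (rule forms_scale[OF _ smooth_fun_const])

lemma dloc_linear:
  assumes "\<And>w. (\<lambda>y. F y w) differentiable (at x)" "\<And>w. (\<lambda>y. G y w) differentiable (at x)"
  shows "dloc k (\<lambda>y w. a * F y w + b * G y w) x w = a * dloc k F x w + b * dloc k G x w"
proof -
  have "dd (\<lambda>y. a * F y w + b * G y w) x = (\<lambda>h. a * dd (\<lambda>y. F y w) x h + b * dd (\<lambda>y. G y w) x h)" for w
    by (intro dd_eq has_derivative_add has_derivative_mult_right dd_works assms)
  then show ?thesis
    by (simp add: dloc_def sum.distrib sum_distrib_left algebra_simps)
qed

lemma ext_d_linear:
  assumes "\<omega> \<in> forms A k" "\<eta> \<in> forms A k"
  shows "ext_d A k (\<lambda>p w. a * \<omega> p w + b * \<eta> p w) p w = a * ext_d A k \<omega> p w + b * ext_d A k \<eta> p w"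
proof -
  let ?c = "chart_at A p"
  have c: "compat A ?c" "p \<in> fst ?c" using chart_at by auto
  note d = smooth_on_differentiable[OF smooth_form_chart[OF _ c(1)] coord_in[OF c(2)]]
  have "form_rep A ?c (\<lambda>p w. a * \<omega> p w + b * \<eta> p w) = (\<lambda>y w. a * form_rep A ?c \<omega> y w + b * form_rep A ?c \<eta> y w)"
    by (auto simp: form_rep_def fun_eq_iff)
  then show ?thesis
    unfolding ext_d_rep[OF assms(1) c] ext_d_rep[OF assms(2) c] ext_d_rep[OF forms_add[OF forms_cmult[OF assms(1)] forms_cmult[OF assms(2)]] c]
    by (simp only: dloc_linear[OF d[OF assms(1)] d[OF assms(2)]])
qed

lemma exact_form_linear:
  assumes "exact_form A k \<omega>" "exact_form A k \<eta>"
  shows "exact_form A k (\<lambda>p w. a * \<omega> p w + b * \<eta> p w)"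
proof -
  obtain \<alpha> \<beta> where ab: "\<alpha> \<in> forms A (k - 1)" "\<omega> = ext_d A (k - 1) \<alpha>" "\<beta> \<in> forms A (k - 1)" "\<eta> = ext_d A (k - 1) \<beta>"
    using assms unfolding exact_form_def by blast
  have "(\<lambda>p w. a * \<omega> p w + b * \<eta> p w) = ext_d A (k - 1) (\<lambda>p w. a * \<alpha> p w + b * \<beta> p w)"
    using ext_d_linear[OF ab(1,3), of a b] ab by (simp add: fun_eq_iff)
  moreover have "(\<lambda>p w. a * \<alpha> p w + b * \<beta> p w) \<in> forms A (k - 1)"
    using ab by (intro forms_add forms_cmult)
  ultimately show ?thesis using assms unfolding exact_form_def by blast
qed

lemma chern_form_trace:
  "chern_form A J nab p w = trace (J p ** curv_endo A nab (vf_ext A p (w 0)) (vf_ext A p (w 1)) p) / (4 * pi)"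
proof -
  have "Re (\<i> / (2 * of_real pi) * Complex a b) = - b / (2 * pi)" for a b
    by (simp add: Re_divide Im_divide complex_eq_iff field_simps power2_eq_square)
  then show ?thesis unfolding chern_form_def complex_trace_def by simp
qed

end

section \<open>The Ricci form of a torsion-free volume preserving connection\<close>

context vol_mfd begin

lemma ric_data_chart:
  assumes "almost_complex A J" "compat A c"
  shows "ric_data (cimg c) (endo_rep A c J) (dens c)"
proof
  show "open (cimg c)" using assms by simp
  show "smooth_on (cimg c) (endo_rep A c J)"
    using assms smooth_endo_chart unfolding almost_complex_def by blast
qed (use assms almost_complex_rep dens_smooth dens_nonzero in auto)

text \<open>Torsion-freeness turns the Christoffel terms of \<open>lambda_rep\<close> into
  \<open>chr\<close>, and preservation of the volume form evaluates one of the traces as a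
  logarithmic derivative of the density. The trace against \<open>J\<close> is all that still
  depends on the connection.\<close>

lemma lambda_rho_rep:
  assumes nab: "torsion_free_rho_connection A \<rho> nab" and lc: "local_conn A nab c S G" and c: "compat A c"
    and J: "almost_complex A J" and q: "q \<in> fst c" "snd c q \<in> S"
  shows "lambda_form A nab J q w = lam_loc (endo_rep A c J) (dens c) (snd c q) (to_chart A c q *v w 0)
    - trace (endo_rep A c J (snd c q) ** chr G (snd c q) (to_chart A c q *v w 0))"
proof -
  have tf: "torsion_free A nab" "preserves_form A CARD('d) \<rho> nab" and Js: "smooth_endo A J"
    using nab J by (auto simp: torsion_free_rho_connection_def almost_complex_def)
  note sym = torsion_free_symmetric(2)[OF lc c tf(1) q(2)]
  show ?thesis
    unfolding lambda_rep[OF lc c q Js] lam_loc_def div_endo_def[symmetric] sym[symmetric] trace_chr[OF lc c tf(2) q(2)]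
    by (simp add: logdens_def)
qed

lemma trace_chr_smooth:
  assumes lc: "local_conn A nab c S G" and c: "compat A c" and J: "smooth_endo A J"
  shows "smooth_on S (\<lambda>x. trace (endo_rep A c J x ** chr G x v))" "linear (\<lambda>v. trace (endo_rep A c J x ** chr G x v))"
proof -
  have "S \<subseteq> cimg c" using S_sub[OF lc c] by blast
  then show "smooth_on S (\<lambda>x. trace (endo_rep A c J x ** chr G x v))"
    using smooth_on_subset[OF smooth_endo_chart[OF J c]] S_open[OF lc c]
    by (intro smooth_on_trace smooth_on_matrix_mult chr_smooth[OF lc c]) auto
  show "linear (\<lambda>v. trace (endo_rep A c J x ** chr G x v))"
    using linear_chr[of G x] by (auto simp: linear_iff mm_bilinear trace_linear)
qed

lemma lambda_form_in_forms:
  assumes nab: "torsion_free_rho_connection A \<rho> nab" and J: "almost_complex A J"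
  shows "lambda_form A nab J \<in> forms A 1"
proof (rule one_formI)
  fix p
  let ?c = "chart_at A p"
  have c: "compat A ?c" "p \<in> fst ?c" using chart_at by auto
  have n: "connection A nab" "smooth_endo A J" using nab J by (auto simp: torsion_free_rho_connection_def almost_complex_def)
  obtain S G where Sp: "snd ?c p \<in> S" and lc: "local_conn A nab ?c S G" using local_conn_exists[OF n(1) c] .
  interpret ric_data "cimg ?c" "endo_rep A ?c J" "dens ?c" by (rule ric_data_chart[OF J c(1)])
  have So: "open S" "S \<subseteq> cimg ?c" using S_open[OF lc c(1)] S_sub[OF lc c(1)] by auto
  define f where "f = (\<lambda>y u. lam_loc (endo_rep A ?c J) (dens ?c) y u - trace (endo_rep A ?c J y ** chr G y u))"
  have "linear (f x)" if "x \<in> S" for x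
    unfolding f_def using that So lam_linear[of x] trace_chr_smooth(2)[OF lc c(1) n(2), of x]
    by (intro linear_compose_sub) auto
  moreover have "smooth_on S (\<lambda>x. f x v)" for v
    unfolding f_def using So
    by (intro smooth_on_diff trace_chr_smooth(1)[OF lc c(1) n(2)] smooth_on_subset[OF lam_smooth]) auto
  moreover have "lambda_form A nab J q w = f (snd ?c q) (to_chart A ?c q *v w 0)" if "q \<in> fst ?c" "snd ?c q \<in> S" for q w
    using lambda_rho_rep[OF nab lc c(1) J that] by (simp add: f_def)
  ultimately show "\<exists>c S f. compat A c \<and> open S \<and> S \<subseteq> cimg c \<and> p \<in> fst c \<and> snd c p \<in> S \<and>
    (\<forall>q w. q \<in> fst c \<longrightarrow> snd c q \<in> S \<longrightarrow> lambda_form A nab J q w = f (snd c q) (to_chart A c q *v w 0)) \<and>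
    (\<forall>x\<in>S. linear (f x)) \<and> (\<forall>v. smooth_on S (\<lambda>x. f x v))"
    using c Sp So by (intro exI[of _ ?c] exI[of _ S] exI[of _ f]) auto
qed

text \<open>The trace of \<open>J\<close> against the Christoffel matrix enters once through the
  curvature part and once, with the opposite sign, through \<open>lambda_form\<close>.\<close>

lemma ricci_local:
  assumes nab: "torsion_free_rho_connection A \<rho> nab" and J: "almost_complex A J" and c: "compat A c" and q: "q \<in> fst c"
    and u: "smooth_vf A u" and v: "smooth_vf A v"
  shows "ricci A nab J u v q = ric_loc (endo_rep A c J) (dens c) (snd c q) (to_chart A c q *v u q) (to_chart A c q *v v q)"
proof -
  have n: "connection A nab" "smooth_endo A J" using nab J by (auto simp: torsion_free_rho_connection_def almost_complex_def)
  obtain S G where Sp: "snd c q \<in> S" and lc: "local_conn A nab c S G" using local_conn_exists[OF n(1) c q] .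
  interpret ric_data "cimg c" "endo_rep A c J" "dens c" by (rule ric_data_chart[OF J c])
  have So: "open S" "S \<subseteq> cimg c" using S_open[OF lc c] S_sub[OF lc c] by auto
  have d: "dd (\<lambda>y. lam_loc (endo_rep A c J) (dens c) y z - trace (endo_rep A c J y ** chr G y z)) (snd c q) h
    = dd (\<lambda>y. lam_loc (endo_rep A c J) (dens c) y z) (snd c q) h - dd (\<lambda>y. trace (endo_rep A c J y ** chr G y z)) (snd c q) h" for z h
    by (simp add: dd_eq[OF has_derivative_diff[OF smooth_on_has_derivative[OF lam_smooth coord_in[OF q]]
      smooth_on_has_derivative[OF trace_chr_smooth(1)[OF lc c n(2)] Sp]]])
  have e: "ext_d A 1 (lambda_form A nab J) q (\<lambda>i. if i = 0 then u q else v q) =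
     dd (\<lambda>y. lam_loc (endo_rep A c J) (dens c) y (to_chart A c q *v v q) - trace (endo_rep A c J y ** chr G y (to_chart A c q *v v q))) (snd c q) (to_chart A c q *v u q)
     - dd (\<lambda>y. lam_loc (endo_rep A c J) (dens c) y (to_chart A c q *v u q) - trace (endo_rep A c J y ** chr G y (to_chart A c q *v u q))) (snd c q) (to_chart A c q *v v q)"
    using ext_d_one[OF lambda_form_in_forms[OF nab J] c So q Sp, of "\<lambda>y u. lam_loc (endo_rep A c J) (dens c) y u - trace (endo_rep A c J y ** chr G y u)"
        "\<lambda>i. if i = 0 then u q else v q", OF lambda_rho_rep[OF nab lc c J]] by simp
  show ?thesis
    unfolding ricci_def ricci_curvature_part[OF lc c n(1) J u v q Sp] e d ric_loc_def by (simp add: algebra_simps)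
qed

lemma some_rho_connection: "torsion_free_rho_connection A \<rho> (SOME nab. torsion_free_rho_connection A \<rho> nab)"
  using torsion_free_rho_connection_exists by (rule someI_ex)

lemma ricci_form_local:
  assumes J: "almost_complex A J" and c: "compat A c" and q: "q \<in> fst c"
  shows "ricci_form A \<rho> J q w = ric_loc (endo_rep A c J) (dens c) (snd c q) (to_chart A c q *v w 0) (to_chart A c q *v w 1)"
  unfolding ricci_form_def ricci_local[OF some_rho_connection J c q vf_ext(1) vf_ext(1)] vf_ext(2) ..

lemma ricci_independent:
  assumes "torsion_free_rho_connection A \<rho> nab" "almost_complex A J" "smooth_vf A u" "smooth_vf A v"
  shows "ricci A nab J u v p = ricci_form A \<rho> J p (\<lambda>i. if i = 0 then u p else v p)"
  using ricci_local[OF assms(1,2) chart_at_compat(1) chart_at(2)[of p] assms(3,4)]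
    ricci_form_local[OF assms(2) chart_at_compat(1) chart_at(2)[of p]] by simp

lemma ricci_form_in_forms:
  assumes J: "almost_complex A J"
  shows "ricci_form A \<rho> J \<in> forms A 2"
proof (rule two_formI)
  fix p
  let ?c = "chart_at A p"
  have c: "compat A ?c" "p \<in> fst ?c" using chart_at by auto
  interpret ric_data "cimg ?c" "endo_rep A ?c J" "dens ?c" by (rule ric_data_chart[OF J c(1)])
  show "\<exists>c f. compat A c \<and> p \<in> fst c \<and>
    (\<forall>q w. q \<in> fst c \<longrightarrow> ricci_form A \<rho> J q w = f (snd c q) (to_chart A c q *v w 0) (to_chart A c q *v w 1)) \<and>
    (\<forall>x\<in>cimg c. (\<forall>v. linear (\<lambda>u. f x u v)) \<and> (\<forall>u. linear (f x u)) \<and> (\<forall>u. f x u u = 0)) \<and>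
    (\<forall>u v. smooth_on (cimg c) (\<lambda>x. f x u v))"
    using c ricci_form_local[OF J c(1)] ric_linear ric_alternating ric_smooth
    by (intro exI[of _ ?c] exI[of _ "ric_loc (endo_rep A ?c J) (dens ?c)"]) auto
qed

lemma ricci_form_rep:
  assumes "almost_complex A J" "compat A c" "x \<in> cimg c"
  shows "form_rep A c (ricci_form A \<rho> J) x w = ric_loc (endo_rep A c J) (dens c) x (w 0) (w 1)"
  using ricci_form_local[OF assms(1,2), of "cinv c x"] assms by (simp add: form_rep_def to_from_chart_vec)

lemma ricci_form_closed:
  assumes J: "almost_complex A J"
  shows "closed_form A 2 (ricci_form A \<rho> J)"
  unfolding closed_form_def
proof (intro conjI allI ricci_form_in_forms[OF J])
  fix p w
  let ?c = "chart_at A p"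
  have c: "compat A ?c" "p \<in> fst ?c" using chart_at by auto
  interpret ric_data "cimg ?c" "endo_rep A ?c J" "dens ?c" by (rule ric_data_chart[OF J c(1)])
  have "ext_d A 2 (ricci_form A \<rho> J) p w = dloc 2 (form_rep A ?c (ricci_form A \<rho> J)) (snd ?c p) w"
    unfolding ext_d_rep[OF ricci_form_in_forms[OF J] c] by simp
  also have "\<dots> = dloc 2 (\<lambda>x w. ric_loc (endo_rep A ?c J) (dens ?c) x (w 0) (w 1)) (snd ?c p) w"
    by (rule dloc_cong[OF S]) (use c ricci_form_rep[OF J c(1)] in auto)
  also have "\<dots> = 0"
    using ric_closed[OF coord_in[OF c(2)], of "w 1" "w 2" "w 0"]
    by (simp add: dloc_def omit_def numeral_2_eq_2)
  finally show "ext_d A 2 (ricci_form A \<rho> J) p w = 0" .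
qed

text \<open>Since \<open>nab'\<close> commutes with \<open>J\<close>, its Chern form is covered by
  the formula for the curvature part and differs from the Ricci form by an exact expression in each
  chart. The local primitives contain Christoffel matrices; \<beta> shows that they fit together to
  one global form, because the difference of two connections is a tensor.\<close>

lemma ricci_chern_exact:
  assumes J: "almost_complex A J" and nab': "complex_connection A J nab'"
  shows "exact_form A 2 (\<lambda>p w. ricci_form A \<rho> J p w - 2 * pi * chern_form A J nab' p w)"
proof -
  obtain nab where nab: "torsion_free_rho_connection A \<rho> nab" using torsion_free_rho_connection_exists by blast
  have n: "connection A nab" "smooth_endo A J" using nab J by (auto simp: torsion_free_rho_connection_def almost_complex_def)
  have n': "connection A nab'" and nJ: "\<And>X p. smooth_vf A X \<Longrightarrow> nab' (app J X) p = J p ** nab' X p"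
    using nab' by (auto simp: complex_connection_def)
  \<comment> \<open>For a complex connection \<open>J\<close> is parallel, so the quadratic term of
    the curvature part vanishes.\<close>
  have cov0: "cov_endo A nab' u J p = 0" for u p
  proof -
    have "cov_endo A nab' u J p = matrix (\<lambda>z. 0)"
      unfolding cov_endo_def cov_def by (simp add: nJ vf_ext matrix_vector_mul_assoc)
    then show ?thesis by (simp add: matrix_def vec_eq_iff)
  qed
  \<comment> \<open>\<open>lambda_form\<close> contributes the Christoffel matrices of
    \<open>nab\<close>, and the difference term exchanges them for those of
    \<open>nab'\<close>.\<close>
  define \<beta> where "\<beta> = (\<lambda>p w. 1/2 * (lambda_form A nab J p w
     - trace (J p ** matrix (\<lambda>\<xi>. (nab' (vf_ext A p \<xi>) p - nab (vf_ext A p \<xi>) p) *v w 0))))"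
  have local: "\<exists>S f. open S \<and> S \<subseteq> cimg c \<and> snd c p \<in> S \<and>
    (\<forall>q w. q \<in> fst c \<longrightarrow> snd c q \<in> S \<longrightarrow> \<beta> q w = f (snd c q) (to_chart A c q *v w 0)) \<and>
    (\<forall>x\<in>S. linear (f x)) \<and> (\<forall>v. smooth_on S (\<lambda>x. f x v)) \<and>
    (\<forall>w. dd (\<lambda>y. f y (to_chart A c p *v w 1)) (snd c p) (to_chart A c p *v w 0)
     - dd (\<lambda>y. f y (to_chart A c p *v w 0)) (snd c p) (to_chart A c p *v w 1)
     = ricci_form A \<rho> J p w - 2 * pi * chern_form A J nab' p w)"
    if c: "compat A c" and p: "p \<in> fst c" for c p
  proof -
    obtain S1 G1 where S1: "snd c p \<in> S1" and lc1: "local_conn A nab c S1 G1" using local_conn_exists[OF n(1) c p] .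
    obtain S2 G2 where S2: "snd c p \<in> S2" and lc2: "local_conn A nab' c S2 G2" using local_conn_exists[OF n' c p] .
    interpret ric_data "cimg c" "endo_rep A c J" "dens c" by (rule ric_data_chart[OF J c])
    define S where "S = S1 \<inter> S2"
    have S: "open S" "S \<subseteq> cimg c" "snd c p \<in> S" "S \<subseteq> S1" "S \<subseteq> S2"
      using S_open[OF lc1 c] S_open[OF lc2 c] S_sub[OF lc1 c] S1 S2 by (auto simp: S_def)
    define f where "f = (\<lambda>y u. 1/2 * (lam_loc (endo_rep A c J) (dens c) y u - trace (endo_rep A c J y ** chr G2 y u)))"
    have ts: "smooth_on S (\<lambda>x. trace (endo_rep A c J x ** chr G2 x v))" for v
      using smooth_on_subset[OF trace_chr_smooth(1)[OF lc2 c n(2)] S(5)] .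
    have ls: "smooth_on S (\<lambda>x. lam_loc (endo_rep A c J) (dens c) x v)" for v
      using smooth_on_subset[OF lam_smooth S(2)] .
    have fl: "linear (f x)" if "x \<in> S" for x
    proof -
      have "linear (lam_loc (endo_rep A c J) (dens c) x)" using lam_linear that S(2) by blast
      then show ?thesis
        using trace_chr_smooth(2)[OF lc2 c n(2), of x]
        unfolding f_def by (auto simp: linear_iff algebra_simps add_divide_distrib)
    qed
    have fs: "smooth_on S (\<lambda>x. f x v)" for v
      unfolding f_def by (intro smooth_on_mult smooth_on_const smooth_on_diff S(1) ts ls)
    have fe: "\<beta> q w = f (snd c q) (to_chart A c q *v w 0)" if q: "q \<in> fst c" "snd c q \<in> S" for q w
    proof -
      let ?x = "snd c q" and ?w = "to_chart A c q *v w 0"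
      have q1: "?x \<in> S1" and q2: "?x \<in> S2" using q S by auto
      have "matrix (\<lambda>\<xi>. (nab' (vf_ext A q \<xi>) q - nab (vf_ext A q \<xi>) q) *v w 0)
        = from_chart A c q ** (chr G2 ?x ?w - chr G1 ?x ?w) ** to_chart A c q"
        by (rule matrix_conj_chart, rule from_to_eqI[OF c q(1)])
          (simp add: mv_bilinear nab_apply[OF lc1 c vf_ext(1) q1 q(1)] nab_apply[OF lc2 c vf_ext(1) q2 q(1)]
            chr_apply[of G1, OF G_lin[OF lc1 c]] chr_apply[of G2, OF G_lin[OF lc2 c]] vf_rep_at[OF c q(1)] vf_ext(2))
      from trace_conj3(2)[OF c q(1), of "\<lambda>_. matrix (\<lambda>\<xi>. (nab' (vf_ext A q \<xi>) q - nab (vf_ext A q \<xi>) q) *v w 0)" _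
          "\<lambda>_. matrix (\<lambda>\<xi>. (nab' (vf_ext A q \<xi>) q - nab (vf_ext A q \<xi>) q) *v w 0)", OF this this, of J]
      show ?thesis
        unfolding \<beta>_def lambda_rho_rep[OF nab lc1 c J q(1) q1] f_def by (simp add: mm_bilinear trace_linear)
    qed
    have df: "dd (\<lambda>y. f y u) (snd c p) h = 1/2 * (dd (\<lambda>y. lam_loc (endo_rep A c J) (dens c) y u) (snd c p) h
       - dd (\<lambda>y. trace (endo_rep A c J y ** chr G2 y u)) (snd c p) h)" for u h
      unfolding f_def
      by (subst dd_eq[OF has_derivative_mult_right[OF has_derivative_diff[OF smooth_on_has_derivative[OF ls S(3)] smooth_on_has_derivative[OF ts S(3)]]]]) (rule refl)
    have h: "2 * pi * chern_form A J nab' p w = 1/2 * trace (J p ** curv_endo A nab' (vf_ext A p (w 0)) (vf_ext A p (w 1)) p)" for w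
      unfolding chern_form_trace by simp
    have ch: "2 * pi * chern_form A J nab' p w
      = 1/4 * trace (dd (endo_rep A c J) (snd c p) (to_chart A c p *v w 0) ** endo_rep A c J (snd c p)
        ** dd (endo_rep A c J) (snd c p) (to_chart A c p *v w 1))
      + 1/2 * (dd (\<lambda>y. trace (endo_rep A c J y ** chr G2 y (to_chart A c p *v w 1))) (snd c p) (to_chart A c p *v w 0)
        - dd (\<lambda>y. trace (endo_rep A c J y ** chr G2 y (to_chart A c p *v w 0))) (snd c p) (to_chart A c p *v w 1))" for w
      using ricci_curvature_part[OF lc2 c n' J vf_ext(1) vf_ext(1) p S2, of p "w 0" p "w 1"]
      unfolding h cov0 mm_bilinear vf_ext(2) by (simp add: linear_0[OF bounded_linear.linear[OF bounded_linear_trace]])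
    have fin: "dd (\<lambda>y. f y (to_chart A c p *v w 1)) (snd c p) (to_chart A c p *v w 0)
       - dd (\<lambda>y. f y (to_chart A c p *v w 0)) (snd c p) (to_chart A c p *v w 1)
       = ricci_form A \<rho> J p w - 2 * pi * chern_form A J nab' p w" for w
      unfolding df ricci_form_local[OF J c p] ric_loc_def ch by (simp add: algebra_simps)
    show ?thesis
      by (intro exI[of _ S] exI[of _ f] conjI allI ballI impI S fl fs fe fin)
  qed
  have \<beta>1: "\<beta> \<in> forms A 1"
  proof (rule one_formI)
    fix p
    show "\<exists>c S f. compat A c \<and> open S \<and> S \<subseteq> cimg c \<and> p \<in> fst c \<and> snd c p \<in> S \<and>
      (\<forall>q w. q \<in> fst c \<longrightarrow> snd c q \<in> S \<longrightarrow> \<beta> q w = f (snd c q) (to_chart A c q *v w 0)) \<and>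
      (\<forall>x\<in>S. linear (f x)) \<and> (\<forall>v. smooth_on S (\<lambda>x. f x v))"
      using local[OF chart_at_compat(1) chart_at(2)[of p]] chart_at[of p] chart_at_compat(1)[of p] by blast
  qed
  have "ext_d A 1 \<beta> p w = ricci_form A \<rho> J p w - 2 * pi * chern_form A J nab' p w" for p w
  proof -
    let ?c = "chart_at A p"
    have c: "compat A ?c" "p \<in> fst ?c" using chart_at by auto
    obtain S f where S: "open S" "S \<subseteq> cimg ?c" "snd ?c p \<in> S"
      and f: "\<And>q w. q \<in> fst ?c \<Longrightarrow> snd ?c q \<in> S \<Longrightarrow> \<beta> q w = f (snd ?c q) (to_chart A ?c q *v w 0)"
      and e: "\<And>w. dd (\<lambda>y. f y (to_chart A ?c p *v w 1)) (snd ?c p) (to_chart A ?c p *v w 0)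
         - dd (\<lambda>y. f y (to_chart A ?c p *v w 0)) (snd ?c p) (to_chart A ?c p *v w 1)
        = ricci_form A \<rho> J p w - 2 * pi * chern_form A J nab' p w"
      using local[OF c] by blast
    show ?thesis using ext_d_one[OF \<beta>1 c(1) S(1,2) c(2) S(3) f] e by simp
  qed
  then have "(\<lambda>p w. ricci_form A \<rho> J p w - 2 * pi * chern_form A J nab' p w) = ext_d A 1 \<beta>" by (simp add: fun_eq_iff)
  then show ?thesis using \<beta>1 unfolding exact_form_def by auto
qed

text \<open>Classes are sets of representatives, so both inclusions are shown: representatives are
  rescaled by \<open>2 * pi\<close> and corrected by the exact difference to the Chern form.\<close>

lemma ricci_de_rham_class:
  assumes J: "almost_complex A J"
  shows "de_rham_class A 2 (ricci_form A \<rho> J) = (\<lambda>\<omega> p w. 2 * pi * \<omega> p w) ` c1 A J"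
proof -
  define nab where "nab = (SOME nab. complex_connection A J nab)"
  have "complex_connection A J nab"
    unfolding nab_def using complex_connection_exists[OF J] by (rule someI_ex)
  note ex = ricci_chern_exact[OF J this]
  show ?thesis
    unfolding c1_def nab_def[symmetric] de_rham_class_def
  proof (intro equalityI subsetI)
    fix \<omega> assume "\<omega> \<in> {\<omega>'. \<omega>' \<in> forms A 2 \<and> exact_form A 2 (\<lambda>p w. \<omega>' p w - ricci_form A \<rho> J p w)}"
    then have \<omega>: "\<omega> \<in> forms A 2" "exact_form A 2 (\<lambda>p w. \<omega> p w - ricci_form A \<rho> J p w)" by auto
    define \<eta> where "\<eta> = (\<lambda>p w. 1 / (2 * pi) * \<omega> p w)"
    have "(\<lambda>p w. \<eta> p w - chern_form A J nab p w) = (\<lambda>p w. 1 / (2 * pi) * (\<omega> p w - ricci_form A \<rho> J p w)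
        + 1 / (2 * pi) * (ricci_form A \<rho> J p w - 2 * pi * chern_form A J nab p w))"
      by (simp add: \<eta>_def fun_eq_iff field_simps)
    then have "exact_form A 2 (\<lambda>p w. \<eta> p w - chern_form A J nab p w)"
      using exact_form_linear[OF \<omega>(2) ex, of "1 / (2 * pi)" "1 / (2 * pi)"] by simp
    moreover have "\<eta> \<in> forms A 2" unfolding \<eta>_def using \<omega>(1) by (rule forms_cmult)
    moreover have "\<omega> = (\<lambda>p w. 2 * pi * \<eta> p w)" by (simp add: \<eta>_def fun_eq_iff)
    ultimately show "\<omega> \<in> (\<lambda>\<omega> p w. 2 * pi * \<omega> p w) ` {\<omega>'. \<omega>' \<in> forms A 2 \<and> exact_form A 2 (\<lambda>p w. \<omega>' p w - chern_form A J nab p w)}"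
      by blast
  next
    fix \<omega> assume "\<omega> \<in> (\<lambda>\<omega> p w. 2 * pi * \<omega> p w) ` {\<omega>'. \<omega>' \<in> forms A 2 \<and> exact_form A 2 (\<lambda>p w. \<omega>' p w - chern_form A J nab p w)}"
    then obtain \<eta> where \<eta>: "\<omega> = (\<lambda>p w. 2 * pi * \<eta> p w)" "\<eta> \<in> forms A 2" "exact_form A 2 (\<lambda>p w. \<eta> p w - chern_form A J nab p w)"
      by blast
    have "(\<lambda>p w. \<omega> p w - ricci_form A \<rho> J p w) = (\<lambda>p w. 2 * pi * (\<eta> p w - chern_form A J nab p w)
      + (-1) * (ricci_form A \<rho> J p w - 2 * pi * chern_form A J nab p w))"
      by (simp add: \<eta>(1) fun_eq_iff algebra_simps)
    then show "\<omega> \<in> {\<omega>'. \<omega>' \<in> forms A 2 \<and> exact_form A 2 (\<lambda>p w. \<omega>' p w - ricci_form A \<rho> J p w)}"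
      using exact_form_linear[OF \<eta>(3) ex, of "2 * pi" "-1"] forms_cmult[OF \<eta>(2)] \<eta>(1) by simp
  qed
qed

end

subsection \<open>Change of the volume form\<close>

context vol_mfd begin

lemma volume_form_exp_scale:
  assumes "smooth_fun A f"
  shows "volume_form A (\<lambda>p w. exp (f p) * \<rho> p w)"
  using forms_scale[OF rho_form smooth_fun_exp[OF assms]] vol by (auto simp: volume_form_def)

lemma dfun_J_form:
  assumes f: "smooth_fun A f" and J: "smooth_endo A J"
  shows "(\<lambda>q v. dfun A f q (J q *v v 0)) \<in> forms A 1"
    "\<And>c q w. compat A c \<Longrightarrow> q \<in> fst c \<Longrightarrow>
      dfun A f q (J q *v w) = dd (f \<circ> cinv c) (snd c q) (endo_rep A c J (snd c q) *v (to_chart A c q *v w))"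
proof -
  show rep: "dfun A f q (J q *v w) = dd (f \<circ> cinv c) (snd c q) (endo_rep A c J (snd c q) *v (to_chart A c q *v w))"
    if c: "compat A c" "q \<in> fst c" for c q w
    using c by (simp add: dfun_rep(2)[OF f c] endo_rep_vec to_from_chart_vec)
  show "(\<lambda>q v. dfun A f q (J q *v v 0)) \<in> forms A 1"
  proof (rule one_formI)
    fix p
    let ?c = "chart_at A p"
    have c: "compat A ?c" "p \<in> fst ?c" using chart_at by auto
    have o: "open (cimg ?c)" by simp
    have "smooth_on (cimg ?c) (\<lambda>x. dd (f \<circ> cinv ?c) x (endo_rep A ?c J x *v v))" for v
      by (intro smooth_intros o smooth_fun_chart[OF f c(1)] smooth_endo_chart[OF J c(1)])
    moreover have "linear (\<lambda>v. dd (f \<circ> cinv ?c) x (endo_rep A ?c J x *v v))" if "x \<in> cimg ?c" for x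
      using linear_compose[OF matrix_vector_mul_linear dd_linear[OF smooth_on_differentiable[OF smooth_fun_chart[OF f c(1)] that]]]
      by (simp add: o_def)
    ultimately show "\<exists>c S g. compat A c \<and> open S \<and> S \<subseteq> cimg c \<and> p \<in> fst c \<and> snd c p \<in> S \<and>
      (\<forall>q w. q \<in> fst c \<longrightarrow> snd c q \<in> S \<longrightarrow> dfun A f q (J q *v w 0) = g (snd c q) (to_chart A c q *v w 0)) \<and>
      (\<forall>x\<in>S. linear (g x)) \<and> (\<forall>v. smooth_on S (\<lambda>x. g x v))"
      using c o rep[OF c(1)]
      by (intro exI[of _ ?c] exI[of _ "cimg ?c"] exI[of _ "\<lambda>x v. dd (f \<circ> cinv ?c) x (endo_rep A ?c J x *v v)"]) auto
  qed
qed

text \<open>The volume form enters the local formula through the logarithmic derivative of its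
  density in the direction \<open>J u\<close>; the factor \<open>e\<^sup>f\<close> adds
  \<open>df(J u)\<close> to it.\<close>

lemma ricci_form_exp_scale:
  assumes J: "almost_complex A J" and f: "smooth_fun A f"
  shows "ricci_form A (\<lambda>p w. exp (f p) * \<rho> p w) J =
    (\<lambda>p w. ricci_form A \<rho> J p w + 1/2 * ext_d A 1 (\<lambda>q v. dfun A f q (J q *v v 0)) p w)"
proof (intro ext)
  fix p w
  let ?c = "chart_at A p"
  have c: "compat A ?c" "p \<in> fst ?c" using chart_at by auto
  have Js: "smooth_endo A J" using J by (simp add: almost_complex_def)
  let ?x = "snd ?c p" and ?J = "endo_rep A ?c J" and ?f = "f \<circ> cinv ?c"
  have x: "?x \<in> cimg ?c" "open (cimg ?c)" using c by auto
  interpret V: vol_mfd A "\<lambda>p w. exp (f p) * \<rho> p w" by unfold_locales (rule volume_form_exp_scale[OF f])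
  interpret R: ric_data "cimg ?c" ?J "dens ?c" by (rule ric_data_chart[OF J c(1)])
  have fs: "smooth_on (cimg ?c) ?f" by (rule smooth_fun_chart[OF f c(1)])
  have dens: "V.dens ?c = (\<lambda>x. exp (?f x) * dens ?c x)"
    by (auto simp: V.dens_def dens_def form_rep_def fun_eq_iff)
  have lam: "lam_loc ?J (V.dens ?c) y v = lam_loc ?J (dens ?c) y v + dd ?f y (?J y *v v)" if y: "y \<in> cimg ?c" for y v
  proof -
    have "((\<lambda>x. exp (?f x) * dens ?c x) has_derivative (\<lambda>h. exp (?f y) * dd (dens ?c) y h + (exp (?f y) * dd ?f y h) * dens ?c y)) (at y)"
      using has_derivative_mult[OF has_derivative_compose[OF smooth_on_has_derivative[OF fs y], of exp "\<lambda>h. exp (?f y) * h"]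
          smooth_on_has_derivative[OF dens_smooth[OF c(1)] y]] DERIV_exp[of "?f y"]
      by (simp add: has_field_derivative_def)
    from dd_eq[OF this] show ?thesis
      using dens_nonzero[OF c(1) y] by (simp add: lam_loc_def dens field_simps)
  qed
  have ls: "smooth_on (cimg ?c) (\<lambda>y. dd ?f y (?J y *v v))" for v
    by (intro smooth_intros x fs smooth_endo_chart[OF Js c(1)])
  have dlam: "dd (\<lambda>y. lam_loc ?J (V.dens ?c) y v) ?x h = dd (\<lambda>y. lam_loc ?J (dens ?c) y v) ?x h + dd (\<lambda>y. dd ?f y (?J y *v v)) ?x h" for v h
  proof -
    have "dd (\<lambda>y. lam_loc ?J (V.dens ?c) y v) ?x = dd (\<lambda>y. lam_loc ?J (dens ?c) y v + dd ?f y (?J y *v v)) ?x"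
      by (rule dd_cong[OF x(2,1)]) (rule lam)
    then show ?thesis
      using dd_eq[OF has_derivative_add[OF smooth_on_has_derivative[OF R.lam_smooth x(1), of v] smooth_on_has_derivative[OF ls x(1), of v]]]
      by simp
  qed
  have e: "ext_d A 1 (\<lambda>q v. dfun A f q (J q *v v 0)) p w
    = dd (\<lambda>y. dd ?f y (?J y *v (to_chart A ?c p *v w 1))) ?x (to_chart A ?c p *v w 0)
     - dd (\<lambda>y. dd ?f y (?J y *v (to_chart A ?c p *v w 0))) ?x (to_chart A ?c p *v w 1)"
    using ext_d_one[OF dfun_J_form(1)[OF f Js] c(1) x(2) order_refl c(2) x(1), of "\<lambda>x v. dd ?f x (?J x *v v)" w]
      dfun_J_form(2)[OF f Js c(1)] by simp
  show "ricci_form A (\<lambda>p w. exp (f p) * \<rho> p w) J p w = ricci_form A \<rho> J p w + 1/2 * ext_d A 1 (\<lambda>q v. dfun A f q (J q *v v 0)) p w"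
    unfolding V.ricci_form_local[OF J c] ricci_form_local[OF J c] ric_loc_def dlam e
    by (simp add: algebra_simps)
qed

end

subsection \<open>Naturality under diffeomorphisms\<close>

text \<open>In the coordinates \<open>pull_chart \<phi> c\<close> on the source and \<open>c\<close>
  on the target, \<phi> is the identity, so a pulled back tensor has the components of the original
  one.\<close>

definition pull_chart :: "('m \<Rightarrow> 'm) \<Rightarrow> ('m, 'd::finite) chart \<Rightarrow> ('m, 'd) chart" where
  "pull_chart \<phi> c = (\<phi> -` fst c, snd c \<circ> \<phi>)"

lemma fst_pull_chart [simp]: "fst (pull_chart \<phi> c) = \<phi> -` fst c"
  and snd_pull_chart [simp]: "snd (pull_chart \<phi> c) = snd c \<circ> \<phi>"
  by (simp_all add: pull_chart_def)

lemma matrix_inv_eqI: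
  fixes M N :: "real^'n^'n"
  assumes "M ** N = mat 1" "N ** M = mat 1"
  shows "matrix_inv M = N"
proof -
  have uniq: "N' = N" if "M ** N' = mat 1 \<and> N' ** M = mat 1" for N'
  proof -
    have "N' ** (M ** N) = N" using that by (simp add: matrix_mul_assoc)
    then show ?thesis using assms(1) by simp
  qed
  show ?thesis unfolding matrix_inv_def
    by (rule some_equality[where P = "\<lambda>N. M ** N = mat 1 \<and> N ** M = mat 1", OF conjI[OF assms] uniq])
qed

context oriented_mfd begin

context
  fixes \<phi> assumes \<phi>: "diffeo A \<phi>"
begin

lemma diffeo_bij: "bij \<phi>" and diffeo_smooth: "smooth_map A \<phi>" and diffeo_inv_smooth: "smooth_map A (inv \<phi>)"
  using \<phi> by (auto simp: diffeo_def)

lemma inv_diffeo [simp]: "\<phi> (inv \<phi> q) = q" "inv \<phi> (\<phi> q) = q"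
  using diffeo_bij by (simp_all add: bij_is_surj surj_f_inv_f bij_is_inj)

lemma cimg_pull_chart: "cimg (pull_chart \<phi> c) = cimg c"
proof -
  have "\<phi> ` (\<phi> -` fst c) = fst c" by (auto intro!: image_eqI[of _ \<phi> "inv \<phi> _"])
  moreover have "cimg (pull_chart \<phi> c) = snd c ` (\<phi> ` (\<phi> -` fst c))" by (auto simp: cimg_def)
  ultimately show ?thesis by (simp only: cimg_def)
qed

lemma cinv_pull_chart:
  assumes "is_chart c" "x \<in> cimg c"
  shows "cinv (pull_chart \<phi> c) x = inv \<phi> (cinv c x)"
  unfolding cinv_def[of "pull_chart \<phi> c"]
proof (rule inv_into_f_eq)
  show "inj_on (snd (pull_chart \<phi> c)) (fst (pull_chart \<phi> c))"
  proof (rule inj_onI)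
    fix p q assume pq: "p \<in> fst (pull_chart \<phi> c)" "q \<in> fst (pull_chart \<phi> c)"
      and e: "snd (pull_chart \<phi> c) p = snd (pull_chart \<phi> c) q"
    have "\<phi> p \<in> fst c" "\<phi> q \<in> fst c" "snd c (\<phi> p) = snd c (\<phi> q)" using pq e by auto
    then have "\<phi> p = \<phi> q" using cinv_coord[OF assms(1)] by metis
    then have "inv \<phi> (\<phi> p) = inv \<phi> (\<phi> q)" by (rule arg_cong)
    then show "p = q" by (simp only: inv_diffeo)
  qed
qed (use assms in auto)

lemma is_chart_pull:
  assumes "is_chart c"
  shows "is_chart (pull_chart \<phi> c)"
proof -
  have cont: "continuous_on UNIV \<phi>" "continuous_on UNIV (inv \<phi>)"
    using diffeo_smooth diffeo_inv_smooth by (auto simp: smooth_map_def)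
  have h: "continuous_on (fst c) (snd c)" "continuous_on (cimg c) (cinv c)"
    using assms unfolding is_chart_def homeomorphism_def by blast+
  have "open (\<phi> -` fst c)" using open_vimage[OF is_chart_open(1)[OF assms] cont(1)] .
  moreover have "homeomorphism (\<phi> -` fst c) (cimg c) (snd c \<circ> \<phi>) (cinv (pull_chart \<phi> c))"
    unfolding homeomorphism_def
  proof (intro conjI ballI)
    show "continuous_on (\<phi> -` fst c) (snd c \<circ> \<phi>)"
      by (rule continuous_on_compose[OF continuous_on_subset[OF cont(1)] continuous_on_subset[OF h(1)]]) auto
    have "continuous_on (cimg c) (\<lambda>x. inv \<phi> (cinv c x))"
      by (rule continuous_on_compose2[OF cont(2) h(2)]) auto
    then show "continuous_on (cimg c) (cinv (pull_chart \<phi> c))"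
      by (rule continuous_on_eq) (simp add: cinv_pull_chart[OF assms])
    show "(snd c \<circ> \<phi>) ` (\<phi> -` fst c) = cimg c" using cimg_pull_chart[of c] by (simp add: cimg_def)
    show "cinv (pull_chart \<phi> c) ` cimg c = \<phi> -` fst c"
    proof (intro equalityI subsetI)
      fix p assume "p \<in> cinv (pull_chart \<phi> c) ` cimg c"
      then show "p \<in> \<phi> -` fst c" using assms by (auto simp: cinv_pull_chart)
    next
      fix p assume "p \<in> \<phi> -` fst c"
      then show "p \<in> cinv (pull_chart \<phi> c) ` cimg c"
        using assms by (intro image_eqI[of _ _ "snd c (\<phi> p)"]) (auto simp: cinv_pull_chart)
    qed
  qed (use assms in \<open>auto simp: cinv_pull_chart\<close>)
  ultimately show ?thesis
    unfolding is_chart_def cimg_pull_chart using is_chart_open(2)[OF assms] by simp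
qed

lemma compat_pull:
  assumes "c \<in> A"
  shows "compat A (pull_chart \<phi> c)"
  unfolding compat_def
proof (intro conjI ballI)
  have c: "is_chart c" using A_compat[OF assms] by simp
  show pc: "is_chart (pull_chart \<phi> c)" by (rule is_chart_pull[OF c])
  fix c1 assume c1A: "c1 \<in> A"
  then have c1': "is_chart c1" using A_compat by simp
  note o = open_coord_overlap[OF pc c1'] 
  have o': "open (snd c1 ` (fst (pull_chart \<phi> c) \<inter> fst c1))"
    using open_coord_overlap[OF c1' pc] by (simp add: Int_commute)
  have 1: "smooth_on {x \<in> cimg c. inv \<phi> (cinv c x) \<in> fst c1} (\<lambda>x. snd c1 (inv \<phi> (cinv c x)))"
    using diffeo_inv_smooth assms c1A unfolding smooth_map_def by blast
  have sub: "snd (pull_chart \<phi> c) ` (fst (pull_chart \<phi> c) \<inter> fst c1) \<subseteq> {x \<in> cimg c. inv \<phi> (cinv c x) \<in> fst c1}"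
    using c by auto
  show "smooth_on (snd (pull_chart \<phi> c) ` (fst (pull_chart \<phi> c) \<inter> fst c1)) (snd c1 \<circ> cinv (pull_chart \<phi> c))"
  proof (rule smooth_on_eq_on[OF smooth_on_subset[OF 1 sub] o])
    fix y assume "y \<in> snd (pull_chart \<phi> c) ` (fst (pull_chart \<phi> c) \<inter> fst c1)"
    then have "y \<in> cimg c" using sub by blast
    then show "(snd c1 \<circ> cinv (pull_chart \<phi> c)) y = snd c1 (inv \<phi> (cinv c y))" by (simp add: cinv_pull_chart[OF c])
  qed
  have 2: "smooth_on {x \<in> cimg c1. \<phi> (cinv c1 x) \<in> fst c} (\<lambda>x. snd c (\<phi> (cinv c1 x)))"
    using diffeo_smooth assms c1A unfolding smooth_map_def by blast
  show "smooth_on (snd c1 ` (fst (pull_chart \<phi> c) \<inter> fst c1)) (snd (pull_chart \<phi> c) \<circ> cinv c1)"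
    by (rule smooth_on_eq_on[OF smooth_on_subset[OF 2] o']) (use c1' in auto)
qed

lemma dmap_chart:
  assumes "c \<in> A" "\<phi> p \<in> fst c"
  shows "to_chart A (pull_chart \<phi> c) p = to_chart A c (\<phi> p) ** dmap A \<phi> p"
proof -
  let ?a = "chart_at A p" and ?b = "chart_at A (\<phi> p)"
  have a: "p \<in> fst ?a" "\<phi> p \<in> fst ?b" "?a \<in> A" "?b \<in> A" using chart_at by auto
  have b: "compat A (pull_chart \<phi> ?b)" by (rule compat_pull[OF a(4)])
  \<comment> \<open>The differential of \<phi> between the preferred charts is itself a transition
    Jacobian, into the pullback of the chart at \<open>\<phi> p\<close>.\<close>
  have d: "dmap A \<phi> p = jac ?a (pull_chart \<phi> ?b) p"
    by (simp add: dmap_def jac_def coord_at_def o_def)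
  have "jac (pull_chart \<phi> ?b) (pull_chart \<phi> c) p = jac ?b c (\<phi> p)"
  proof -
    have c: "compat A c" by (rule A_compat[OF assms(1)])
    have o: "open (snd ?b ` (fst ?b \<inter> fst c))" by (rule open_coord_overlap[OF chart_at_compat(2) compat_chart[OF c]])
    have "dd (snd (pull_chart \<phi> c) \<circ> cinv (pull_chart \<phi> ?b)) (snd ?b (\<phi> p)) = dd (snd c \<circ> cinv ?b) (snd ?b (\<phi> p))"
    proof (rule dd_cong[OF o])
      show "snd ?b (\<phi> p) \<in> snd ?b ` (fst ?b \<inter> fst c)" using a assms by auto
      fix y assume "y \<in> snd ?b ` (fst ?b \<inter> fst c)"
      then have "y \<in> cimg ?b" by auto
      then show "(snd (pull_chart \<phi> c) \<circ> cinv (pull_chart \<phi> ?b)) y = (snd c \<circ> cinv ?b) y"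
        by (simp add: cinv_pull_chart)
    qed
    then show ?thesis by (simp add: jac_def jacobian_def)
  qed
  then show ?thesis
    unfolding to_chart_jac d using jac_comp[OF chart_at_compat(1) b compat_pull[OF assms(1)] a(1)] a assms by simp
qed

lemma dmap_eq:
  assumes "c \<in> A" "\<phi> p \<in> fst c"
  shows "dmap A \<phi> p = from_chart A c (\<phi> p) ** to_chart A (pull_chart \<phi> c) p"
    "matrix_inv (dmap A \<phi> p) = from_chart A (pull_chart \<phi> c) p ** to_chart A c (\<phi> p)"
proof -
  note c = A_compat[OF assms(1)] and pc = compat_pull[OF assms(1)]
  have p: "p \<in> fst (pull_chart \<phi> c)" using assms by simp
  show 1: "dmap A \<phi> p = from_chart A c (\<phi> p) ** to_chart A (pull_chart \<phi> c) p"
    unfolding dmap_chart[OF assms] by (simp add: to_from_chart_cancel[OF c assms(2)])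
  show "matrix_inv (dmap A \<phi> p) = from_chart A (pull_chart \<phi> c) p ** to_chart A c (\<phi> p)"
    unfolding 1
    by (rule matrix_inv_eqI) (simp_all add: matrix_mul_assoc[symmetric] to_from_chart_cancel[OF c assms(2)]
        to_from_chart_cancel[OF pc p] to_from_chart[OF c assms(2)] to_from_chart[OF pc p])
qed

lemma pull_form_rep:
  assumes "c \<in> A" "x \<in> cimg c"
  shows "form_rep A (pull_chart \<phi> c) (pull_form A \<phi> \<omega>) x w = form_rep A c \<omega> x w"
proof -
  have c: "is_chart c" using A_compat[OF assms(1)] by simp
  have p: "inv \<phi> (cinv c x) \<in> fst (pull_chart \<phi> c)" "\<phi> (inv \<phi> (cinv c x)) \<in> fst c" using c assms by auto
  show ?thesis
    unfolding form_rep_def pull_form_def cinv_pull_chart[OF c assms(2)] dmap_eq(1)[OF assms(1) p(2)] matrix_vector_mul_assoc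
    using to_from_chart[OF compat_pull[OF assms(1)] p(1)] by (simp add: matrix_mul_assoc[symmetric])
qed

lemma pull_endo_rep:
  assumes "c \<in> A" "x \<in> cimg c"
  shows "endo_rep A (pull_chart \<phi> c) (pull_endo A \<phi> B) x = endo_rep A c B x"
proof -
  have c: "is_chart c" using A_compat[OF assms(1)] by simp
  have p: "inv \<phi> (cinv c x) \<in> fst (pull_chart \<phi> c)" "\<phi> (inv \<phi> (cinv c x)) \<in> fst c" using c assms by auto
  show ?thesis
    unfolding endo_rep_def pull_endo_def cinv_pull_chart[OF c assms(2)] dmap_eq(2)[OF assms(1) p(2)]
    unfolding dmap_eq(1)[OF assms(1) p(2)]
    using to_from_chart[OF compat_pull[OF assms(1)] p(1)]
    by (simp add: matrix_mul_assoc[symmetric] to_from_chart_cancel[OF compat_pull[OF assms(1)] p(1)])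
qed

lemma pull_chart_exists: "\<exists>c. c \<in> A \<and> compat A (pull_chart \<phi> c) \<and> p \<in> fst (pull_chart \<phi> c)"
  using chart_at[of "\<phi> p"] compat_pull by (intro exI[of _ "chart_at A (\<phi> p)"]) auto

lemma pull_form_in_forms:
  assumes "\<omega> \<in> forms A k"
  shows "pull_form A \<phi> \<omega> \<in> forms A k"
proof (rule formsI)
  fix p
  show "alternating_form k (pull_form A \<phi> \<omega> p)"
    unfolding pull_form_def[abs_def] by (rule alternating_form_precomp[OF forms_alternating[OF assms]])
  obtain c where c: "c \<in> A" "compat A (pull_chart \<phi> c)" "p \<in> fst (pull_chart \<phi> c)" using pull_chart_exists by blast
  have "smooth_on (cimg c) (\<lambda>x. form_rep A (pull_chart \<phi> c) (pull_form A \<phi> \<omega>) x w)" for w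
    by (rule smooth_on_eq_on[OF smooth_form_chart[OF assms A_compat[OF c(1)], of w]])
      (use A_compat[OF c(1)] pull_form_rep[OF c(1)] in auto)
  moreover have "snd (pull_chart \<phi> c) ` fst (pull_chart \<phi> c) = cimg c"
    using cimg_pull_chart[of c] by (simp add: cimg_def)
  ultimately show "\<exists>c U. compat A c \<and> open U \<and> p \<in> U \<and> U \<subseteq> fst c \<and> (\<forall>w. smooth_on (snd c ` U) (\<lambda>x. form_rep A c (pull_form A \<phi> \<omega>) x w))"
    using c(2,3) is_chart_open(1)[OF compat_chart[OF c(2)]]
    by (intro exI[of _ "pull_chart \<phi> c"] exI[of _ "fst (pull_chart \<phi> c)"]) auto
qed

lemma pull_almost_complex:
  assumes "almost_complex A J"
  shows "almost_complex A (pull_endo A \<phi> J)"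
  unfolding almost_complex_def
proof (intro conjI allI)
  have Js: "smooth_endo A J" using assms by (simp add: almost_complex_def)
  show "smooth_endo A (pull_endo A \<phi> J)"
  proof (rule smooth_endoI)
    fix p
    obtain c where c: "c \<in> A" "compat A (pull_chart \<phi> c)" "p \<in> fst (pull_chart \<phi> c)" using pull_chart_exists by blast
    have "smooth_on (cimg c) (endo_rep A (pull_chart \<phi> c) (pull_endo A \<phi> J))"
      by (rule smooth_on_eq_on[OF smooth_endo_chart[OF Js A_compat[OF c(1)]]])
        (use A_compat[OF c(1)] pull_endo_rep[OF c(1)] in auto)
    moreover have "snd (pull_chart \<phi> c) ` fst (pull_chart \<phi> c) = cimg c"
      using cimg_pull_chart[of c] by (simp add: cimg_def)
    ultimately show "\<exists>c U. compat A c \<and> open U \<and> p \<in> U \<and> U \<subseteq> fst c \<and> smooth_on (snd c ` U) (endo_rep A c (pull_endo A \<phi> J))"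
      using c(2,3) is_chart_open(1)[OF compat_chart[OF c(2)]]
      by (intro exI[of _ "pull_chart \<phi> c"] exI[of _ "fst (pull_chart \<phi> c)"]) auto
  qed
  fix p
  obtain c where c: "c \<in> A" "compat A (pull_chart \<phi> c)" "p \<in> fst (pull_chart \<phi> c)" using pull_chart_exists by blast
  have p: "\<phi> p \<in> fst c" using c(3) by simp
  have JJ: "J (\<phi> p) ** J (\<phi> p) = - mat 1" using assms by (simp add: almost_complex_def)
  have J2: "J (\<phi> p) ** (J (\<phi> p) ** M) = - M" for M :: "real^'d^'d"
    using arg_cong[OF JJ, of "\<lambda>N. N ** M"] by (simp add: matrix_mul_assoc mm_bilinear)
  have c1: "dmap A \<phi> p ** (matrix_inv (dmap A \<phi> p) ** M) = M" for M :: "real^'d^'d"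
    unfolding dmap_eq(2)[OF c(1) p] unfolding dmap_eq(1)[OF c(1) p]
    by (simp add: matrix_mul_assoc[symmetric] to_from_chart_cancel[OF c(2,3)] to_from_chart_cancel[OF A_compat[OF c(1)] p])
  have c2: "matrix_inv (dmap A \<phi> p) ** dmap A \<phi> p = mat 1"
    unfolding dmap_eq(2)[OF c(1) p] unfolding dmap_eq(1)[OF c(1) p]
    by (simp add: matrix_mul_assoc[symmetric] to_from_chart_cancel[OF A_compat[OF c(1)] p] to_from_chart[OF c(2,3)])
  show "pull_endo A \<phi> J p ** pull_endo A \<phi> J p = - mat 1"
    unfolding pull_endo_def by (simp add: matrix_mul_assoc[symmetric] c1 J2 mm_bilinear c2)
qed

end

end

context vol_mfd begin

lemma pull_volume_form:
  assumes "diffeo A \<phi>"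
  shows "volume_form A (pull_form A \<phi> \<rho>)"
  unfolding volume_form_def
proof (intro conjI allI pull_form_in_forms[OF assms rho_form])
  fix p
  obtain c where c: "c \<in> A" "compat A (pull_chart \<phi> c)" "p \<in> fst (pull_chart \<phi> c)" using pull_chart_exists[OF assms] by blast
  let ?p = "pull_chart \<phi> c"
  have x: "snd ?p p \<in> cimg c" using c(3) by simp
  have "form_rep A ?p (pull_form A \<phi> \<rho>) (snd ?p p) std_frame \<noteq> 0"
    using pull_form_rep[OF assms c(1) x] dens_nonzero[OF A_compat[OF c(1)] x] by (simp add: dens_def)
  moreover have "cinv ?p (snd ?p p) = p" using c by (intro cinv_coord compat_chart)
  ultimately show "\<exists>w. pull_form A \<phi> \<rho> p w \<noteq> 0" unfolding form_rep_def by metis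
qed

lemma ricci_form_natural:
  assumes \<phi>: "diffeo A \<phi>" and J: "almost_complex A J"
  shows "pull_form A \<phi> (ricci_form A \<rho> J) = ricci_form A (pull_form A \<phi> \<rho>) (pull_endo A \<phi> J)"
proof (intro ext)
  fix p w
  interpret V: vol_mfd A "pull_form A \<phi> \<rho>" by unfold_locales (rule pull_volume_form[OF \<phi>])
  obtain c where c: "c \<in> A" "compat A (pull_chart \<phi> c)" "p \<in> fst (pull_chart \<phi> c)" using pull_chart_exists[OF \<phi>] by blast
  have p: "\<phi> p \<in> fst c" "snd c (\<phi> p) \<in> cimg c" using c(3) by auto
  have o: "open (cimg c)" using A_compat[OF c(1)] by simp
  have "ricci_form A (pull_form A \<phi> \<rho>) (pull_endo A \<phi> J) p w =
    ric_loc (endo_rep A (pull_chart \<phi> c) (pull_endo A \<phi> J)) (V.dens (pull_chart \<phi> c)) (snd c (\<phi> p))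
       (to_chart A (pull_chart \<phi> c) p *v w 0) (to_chart A (pull_chart \<phi> c) p *v w 1)"
    using V.ricci_form_local[OF pull_almost_complex[OF \<phi> J] c(2,3)] by simp
  also have "\<dots> = ric_loc (endo_rep A c J) (dens c) (snd c (\<phi> p)) (to_chart A (pull_chart \<phi> c) p *v w 0) (to_chart A (pull_chart \<phi> c) p *v w 1)"
    by (rule ric_loc_cong[OF o p(2)]) (simp_all add: pull_endo_rep[OF \<phi> c(1)] V.dens_def dens_def pull_form_rep[OF \<phi> c(1)])
  also have "\<dots> = pull_form A \<phi> (ricci_form A \<rho> J) p w"
    unfolding pull_form_def ricci_form_local[OF J A_compat[OF c(1)] p(1)] dmap_chart[OF \<phi> c(1) p(1)]
    by (simp add: matrix_vector_mul_assoc)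
  finally show "pull_form A \<phi> (ricci_form A \<rho> J) p w = ricci_form A (pull_form A \<phi> \<rho>) (pull_endo A \<phi> J) p w" ..
qed

end

section \<open>Wedge products and exact vector fields\<close>

lemma omit_upd_same: "omit j (w(j := x)) = omit j w"
  by (auto simp: omit_def fun_eq_iff)

lemma omit_upd: "i \<noteq> j \<Longrightarrow> omit i (w(j := x)) = (omit i w)(if j < i then j else j - 1 := x)"
  by (auto simp: omit_def fun_eq_iff)

text \<open>If the arguments \<open>a < b\<close> agree, the surviving terms are the two in which
  one of them has been singled out. Moving the other one to the front gives them the signs
  \<open>(-1) ^ (a + b - 1)\<close> and \<open>(-1) ^ (a + b)\<close>.\<close>

lemma alternating_form_antisymmetrize:
  fixes T :: "real^'d \<Rightarrow> (nat \<Rightarrow> real^'d::finite) \<Rightarrow> real"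
  assumes alt: "\<And>u. alternating_form k (T u)" and lin: "\<And>g. linear (\<lambda>u. T u g)"
  shows "alternating_form (Suc k) (\<lambda>w. \<Sum>i\<le>k. (-1) ^ i * T (w i) (omit i w))"
  unfolding alternating_form_def
proof (intro conjI allI impI)
  fix w w' :: "nat \<Rightarrow> real^'d" assume e: "\<forall>i<Suc k. w i = w' i"
  have "T (w i) (omit i w) = T (w i) (omit i w')" if "i \<le> k" for i
    by (rule alternating_form_cong[OF alt]) (use e in \<open>auto simp: omit_def\<close>)
  then show "(\<Sum>i\<le>k. (-1) ^ i * T (w i) (omit i w)) = (\<Sum>i\<le>k. (-1) ^ i * T (w' i) (omit i w'))"
    using e by (intro sum.cong) (auto simp: less_Suc_eq_le)
next
  fix w :: "nat \<Rightarrow> real^'d" and j assume j: "j < Suc k"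
  have "linear (\<lambda>x. T ((w(j := x)) i) (omit i (w(j := x))))" if i: "i \<le> k" for i
  proof (cases "i = j")
    case True
    then show ?thesis using lin[of "omit j w"] by (simp add: omit_upd_same)
  next
    case False
    then have "(if j < i then j else j - 1) < k" using i j by auto
    from alternating_form_linear[OF alt[of "w i"] this, of "omit i w"] show ?thesis using False by (simp add: omit_upd)
  qed
  then have "linear (\<lambda>x. (-1) ^ i * T ((w(j := x)) i) (omit i (w(j := x))))" if "i \<le> k" for i
    using that by (auto simp: linear_iff algebra_simps)
  then show "linear (\<lambda>x. \<Sum>i\<le>k. (-1) ^ i * T ((w(j := x)) i) (omit i (w(j := x))))"
    by (intro linear_compose_sum ballI) auto
next
  have main: "(\<Sum>i\<le>k. (-1) ^ i * T (w i) (omit i w)) = 0" if ab: "a < b" "b \<le> k" "w a = w b" for a b and w :: "nat \<Rightarrow> real^'d"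
  proof -
    obtain l where k: "k = Suc l" using ab by (cases k) auto
    have "T (w i) (omit i w) = 0" if "i \<le> k" "i \<noteq> a" "i \<noteq> b" for i
      by (rule alternating_form_repeat[OF alt, of "if a < i then a else a - 1" "if b < i then b else b - 1"])
        (use that ab in \<open>auto simp: omit_def\<close>)
    then have "(\<Sum>i\<le>k. (-1) ^ i * T (w i) (omit i w)) = (\<Sum>i\<in>{a, b}. (-1) ^ i * T (w i) (omit i w))"
      using ab by (intro sum.mono_neutral_right) auto
    also have "\<dots> = (-1) ^ a * T (w a) (omit a w) + (-1) ^ b * T (w a) (omit b w)" using ab by simp
    also have "T (w a) (omit a w) = (-1) ^ (b - 1) * T (w a) (case_nat (w a) (omit a (omit b w)))"
    proof -
      have "omit (b - 1) (omit a w) = omit a (omit b w)" "omit a w (b - 1) = w a"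
        using ab by (auto simp: omit_def fun_eq_iff)
      then show ?thesis
        using alternating_form_move_front[of l "T (w a)" "b - 1" "omit a w"] alt[of "w a"] k ab by simp
    qed
    also have "T (w a) (omit b w) = (-1) ^ a * T (w a) (case_nat (w a) (omit a (omit b w)))"
      using alternating_form_move_front[of l "T (w a)" a "omit b w"] alt[of "w a"] k ab by (simp add: omit_def[of b w])
    finally show ?thesis
      using ab by (cases b) (simp_all add: algebra_simps)
  qed
  fix w :: "nat \<Rightarrow> real^'d" and a b assume "a < Suc k" "b < Suc k" "a \<noteq> b \<and> w a = w b"
  then show "(\<Sum>i\<le>k. (-1) ^ i * T (w i) (omit i w)) = 0"
    using main[of a b w] main[of b a w] by (metis less_Suc_eq_le nat_neq_iff)
qed

section \<open>Contraction of top forms and their components\<close>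

lemma alternating_form_interior:
  assumes "alternating_form (Suc k) g"
  shows "alternating_form k (\<lambda>w. g (case_nat v w))"
  unfolding alternating_form_def
proof (intro conjI allI impI)
  fix w w' :: "nat \<Rightarrow> real^'a" assume "\<forall>i<k. w i = w' i"
  then show "g (case_nat v w) = g (case_nat v w')"
    by (intro alternating_form_cong[OF assms]) (auto split: nat.split)
next
  fix w :: "nat \<Rightarrow> real^'a" and i assume "i < k"
  moreover have "case_nat v (w(i := x)) = (case_nat v w)(Suc i := x)" for x by (auto simp: fun_eq_iff split: nat.split)
  ultimately show "linear (\<lambda>x. g (case_nat v (w(i := x))))" using alternating_form_linear[OF assms, of "Suc i"] by simp
next
  fix w :: "nat \<Rightarrow> real^'a" and i j assume "i < k" "j < k" "i \<noteq> j \<and> w i = w j"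
  then show "g (case_nat v w) = 0" using alternating_form_repeat[OF assms, of "Suc i" "Suc j"] by simp
qed

lemma frame_det_basis:
  fixes s :: "nat \<Rightarrow> 'd::{finite,wellorder}"
  assumes "inj_on s {..<CARD('d)}"
  shows "frame_det (\<lambda>i. axis (s i) 1 :: (real, 'd) vec) \<noteq> 0"
proof -
  define \<sigma> where "\<sigma> = (\<lambda>i. if i < CARD('d) then card {..<s i} else i)"
  have "inj_on \<sigma> {..<CARD('d)}"
    using assms by (auto simp: inj_on_def \<sigma>_def index_inj)
  moreover have "\<sigma> ` {..<CARD('d)} \<subseteq> {..<CARD('d)}" using index_less by (auto simp: \<sigma>_def)
  ultimately have "bij_betw \<sigma> {..<CARD('d)} {..<CARD('d)}"
    by (simp add: bij_betw_def endo_inj_surj)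
  then have \<sigma>: "\<sigma> permutes {..<CARD('d)}"
    by (rule bij_imp_permutes) (simp add: \<sigma>_def)
  have "frame_det (\<lambda>i. axis (s i) 1 :: (real, 'd) vec) = frame_det (\<lambda>i. std_frame (\<sigma> i) :: (real, 'd) vec)"
    by (rule alternating_form_cong[OF frame_det_alternating]) (simp add: \<sigma>_def std_frame_index)
  then show ?thesis
    using alternating_form_permutes[OF frame_det_alternating \<sigma>, of std_frame] by (simp add: frame_det_std sign_def)
qed

text \<open>Cramer's rule: \<open>V b\<close> is the wedge of the \<open>b\<close>-th coordinate
  function with \<open>g\<close>, and its quotient by \<open>R\<close> on the standard frame is the
  component \<open>v $ b\<close>. Expanding \<open>frame_det w\<close> times \<open>v\<close> along
  \<open>w\<close> leaves only the coefficient of \<open>w 0\<close>, because \<open>R\<close>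
  vanishes on repeated arguments.\<close>

lemma top_form_interior_exists:
  fixes g :: "(nat \<Rightarrow> (real, 'd::{finite,wellorder}) vec) \<Rightarrow> real"
  assumes R: "alternating_form CARD('d) R" "R std_frame \<noteq> 0" and g: "alternating_form (CARD('d) - 1) g"
  shows "\<exists>v. \<forall>w. R (case_nat v w) = g w"
proof -
  have card: "CARD('d) = Suc (CARD('d) - 1)" using zero_less_card_finite[where 'a = 'd] by linarith
  define V where "V = (\<lambda>b w. \<Sum>i\<le>CARD('d) - 1. (-1) ^ i * (w i $ b * g (omit i w)))"
  have Valt: "alternating_form CARD('d) (V b)" for b
    unfolding V_def card[symmetric]
  proof (subst card, rule alternating_form_antisymmetrize)
    show "alternating_form (CARD('d) - 1) (\<lambda>w. u $ b * g w)" for u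
      using alternating_form_scale[OF g, of "u $ b"] by (simp add: mult.commute)
    show "linear (\<lambda>u. u $ b * g w)" for w by (auto simp: linear_iff algebra_simps)
  qed
  define v where "v = (\<chi> b. V b std_frame / R std_frame)"
  \<comment> \<open>The factor \<open>frame_det w\<close> avoids dividing before \<open>w\<close> is
    known to be a frame.\<close>
  have key: "frame_det w * (R (case_nat v (\<lambda>i. w (Suc i))) - g (\<lambda>i. w (Suc i))) = 0" for w
  proof -
    have w: "case_nat (w 0) (\<lambda>i. w (Suc i)) = w" by (auto simp: fun_eq_iff split: nat.split)
    have lin: "linear (\<lambda>z. R (w(0 := z)))" by (rule alternating_form_linear[OF R(1)]) simp
    have upd: "case_nat z (\<lambda>i. w (Suc i)) = w(0 := z)" for z by (auto simp: fun_eq_iff split: nat.split)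
    have "frame_det w *\<^sub>R v = (1 / R std_frame) *\<^sub>R (\<chi> b. V b w)"
      by (simp add: v_def vec_eq_iff top_form_det[OF Valt, of _ w])
    also have "(\<chi> b. V b w) = (\<Sum>i\<le>CARD('d) - 1. ((-1) ^ i * g (omit i w)) *\<^sub>R w i)"
      by (simp add: vec_eq_iff V_def mult_ac)
    finally have "R (w(0 := frame_det w *\<^sub>R v)) = (1 / R std_frame) * (\<Sum>i\<le>CARD('d) - 1. ((-1) ^ i * g (omit i w)) * R (w(0 := w i)))"
      by (simp add: linear_scale[OF lin] linear_sum[OF lin])
    also have "(\<Sum>i\<le>CARD('d) - 1. ((-1) ^ i * g (omit i w)) * R (w(0 := w i))) = (\<Sum>i\<in>{0}. ((-1) ^ i * g (omit i w)) * R (w(0 := w i)))"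
    proof (rule sum.mono_neutral_right)
      have "R (w(0 := w i)) = 0" if "i \<le> CARD('d) - 1" "i \<noteq> 0" for i
        by (rule alternating_form_repeat[OF R(1), of 0 i]) (use that card in auto)
      then show "\<forall>i\<in>{..CARD('d) - 1} - {0}. (- 1) ^ i * g (omit i w) * R (w(0 := w i)) = 0" by simp
    qed auto
    also have "\<dots> = g (omit 0 w) * (frame_det w * R std_frame)" using top_form_det[OF R(1), of w] by simp
    finally have "R (w(0 := frame_det w *\<^sub>R v)) = frame_det w * g (\<lambda>i. w (Suc i))"
      using R(2) by (simp only: omit_def) simp
    then have "frame_det w * R (w(0 := v)) = frame_det w * g (\<lambda>i. w (Suc i))"
      unfolding linear_scale[OF lin] by simp
    then show ?thesis unfolding upd by (simp add: algebra_simps)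
  qed
  have Ralt: "alternating_form (CARD('d) - 1) (\<lambda>w. R (case_nat v w))"
    by (rule alternating_form_interior) (use R(1) card in simp)
  have "R (case_nat v w) = g w" for w
  proof (rule alternating_form_eqI[OF Ralt g])
    fix s :: "nat \<Rightarrow> 'd"
    show "R (case_nat v (\<lambda>i. axis (s i) 1)) = g (\<lambda>i. axis (s i) 1)"
    proof (cases "inj_on s {..<CARD('d) - 1}")
      case False
      then obtain i j where ij: "i < CARD('d) - 1" "j < CARD('d) - 1" "i \<noteq> j" "s i = s j" by (auto simp: inj_on_def)
      show ?thesis
        using alternating_form_repeat[OF Ralt ij(1-3)] alternating_form_repeat[OF g ij(1-3)] ij(4) by simp
    next
      case True
      then have "card (s ` {..<CARD('d) - 1}) < CARD('d)" using card by (simp add: card_image)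
      \<comment> \<open>The remaining indices miss some \<open>b\<close>; adding that basis vector
        in front gives a frame with nonzero determinant, so the factor in \<open>key\<close> can be
        cancelled.\<close>
      then obtain b where b: "b \<notin> s ` {..<CARD('d) - 1}" by (metis UNIV_I less_irrefl subsetI subset_antisym)
      have "inj_on (case_nat b s) {..<CARD('d)}"
      proof (rule inj_onI)
        fix i j assume ij: "i \<in> {..<CARD('d)}" "j \<in> {..<CARD('d)}" "case_nat b s i = case_nat b s j"
        then show "i = j"
          using True b card by (cases i; cases j) (auto simp: inj_on_def)
      qed
      from frame_det_basis[OF this] key[of "\<lambda>i. axis (case_nat b s i) 1"] show ?thesis by simp
    qed
  qed
  then show ?thesis by blast
qed

lemma top_form_interior_component:
  fixes R :: "(nat \<Rightarrow> (real, 'd::{finite,wellorder}) vec) \<Rightarrow> real"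
  assumes R: "alternating_form CARD('d) R" and \<sigma>: "\<sigma> permutes {..<CARD('d)}" "\<sigma> 0 = card {..<i::'d}"
  shows "of_int (sign \<sigma>) * R (case_nat v (\<lambda>m. std_frame (\<sigma> (Suc m)))) = v $ i * R std_frame"
proof -
  have inj: "inj \<sigma>" using \<sigma>(1) by (rule permutes_inj)
  have e: "case_nat v (\<lambda>m. std_frame (\<sigma> (Suc m))) = (\<lambda>m. (std_frame(card {..<i} := v)) (\<sigma> m))"
  proof
    fix m
    show "case_nat v (\<lambda>m. std_frame (\<sigma> (Suc m))) m = (std_frame(card {..<i} := v)) (\<sigma> m)"
    proof (cases m)
      case (Suc k)
      have "\<sigma> (Suc k) \<noteq> \<sigma> 0" using inj by (auto simp: inj_def)
      then show ?thesis using Suc \<sigma>(2) by simp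
    qed (simp add: \<sigma>(2))
  qed
  show ?thesis
    unfolding e alternating_form_permutes[OF R \<sigma>(1)] top_form_upd_std[OF R] by (simp add: sign_def)
qed

text \<open>Normalised so that \<open>\<beta> \<and> \<alpha>\<close> has the density \<open>1/2 \<Sum>i j. \<beta>(e\<^sub>i, e\<^sub>j) bivec \<alpha> i j\<close>, and so that
  \<open>\<iota>(v)\<rho> = d\<alpha>\<close> means \<open>r v\<^sub>i = \<Sum>j. \<partial>\<^sub>j (bivec \<alpha> i j)\<close> for the density \<open>r\<close> of \<open>\<rho>\<close>.\<close>

definition bivec :: "((nat \<Rightarrow> (real, 'd::{finite,wellorder}) vec) \<Rightarrow> real) \<Rightarrow> 'd \<Rightarrow> 'd \<Rightarrow> real" where
  "bivec g i j = (\<Sum>\<sigma> | \<sigma> permutes {..<CARD('d)}. if \<sigma> 0 = card {..<i} \<and> \<sigma> 1 = card {..<j}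
     then of_int (sign \<sigma>) * g (\<lambda>m. std_frame (\<sigma> (2 + m))) else 0) / fact (CARD('d) - 2)"

lemma bivec_antisym:
  assumes "CARD('d::{finite,wellorder}) \<ge> 2"
  shows "bivec g j i = - bivec g i (j :: 'd)"
proof -
  let ?t = "Transposition.transpose 0 (Suc 0)"
  have t: "?t permutes {..<CARD('d)}" using assms by (intro permutes_swap_id) auto
  have s: "sign (\<sigma> \<circ> ?t) = - sign \<sigma>" if "\<sigma> permutes {..<CARD('d)}" for \<sigma>
    using that by (subst sign_compose) (auto simp: sign_swap_id permutation_swap_id intro: permutation_permutes[THEN iffD2])
  have "(\<Sum>\<sigma> | \<sigma> permutes {..<CARD('d)}. if \<sigma> 0 = card {..<j} \<and> \<sigma> 1 = card {..<i}
     then of_int (sign \<sigma>) * g (\<lambda>m. std_frame (\<sigma> (2 + m))) else 0)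
    = (\<Sum>\<sigma> | \<sigma> permutes {..<CARD('d)}. - (if \<sigma> 0 = card {..<i} \<and> \<sigma> 1 = card {..<j}
     then of_int (sign \<sigma>) * g (\<lambda>m. std_frame (\<sigma> (2 + m))) else 0))"
    by (subst sum_permutations_compose_right[OF t], intro sum.cong refl) (auto simp: s)
  then show ?thesis by (simp add: bivec_def sum_negf)
qed

lemma sum_over_index:
  assumes "k < CARD('d::{finite,wellorder})"
  shows "(\<Sum>i\<in>(UNIV :: 'd set). if k = card {..<i} then F i else 0) = F (THE i. k = card {..<i})"
proof -
  obtain b :: 'd where b: "k = card {..<b}" using index_surj[OF assms] by blast
  have "(THE i. k = card {..<i}) = b" using b by (auto simp: index_inj)
  moreover have "(\<Sum>i\<in>(UNIV :: 'd set). if k = card {..<i} then F i else 0) = (\<Sum>i\<in>UNIV. if b = i then F i else 0)"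
    unfolding b by (simp add: index_inj)
  ultimately show ?thesis by simp
qed

lemma std_frame_axis: "k < CARD('d::{finite,wellorder}) \<Longrightarrow> std_frame k = axis (THE i::'d. k = card {..<i}) 1"
proof -
  assume "k < CARD('d)"
  then obtain b :: 'd where b: "k = card {..<b}" using index_surj by blast
  then have "(THE i. k = card {..<i}) = b" by (auto simp: index_inj)
  then show ?thesis using b by (simp add: std_frame_index)
qed

text \<open>Permutations are grouped by their first two values. The normalisation of
  \<open>bivec\<close> absorbs \<open>fact (CARD('d) - 2)\<close>, and \<open>fact 2\<close> leaves
  the factor 1/2.\<close>

lemma wedge_two_bivec:
  fixes B :: "(real, 'd::{finite,wellorder}) vec \<Rightarrow> (real, 'd) vec \<Rightarrow> real"
  assumes "CARD('d) \<ge> 2"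
  shows "(\<Sum>\<sigma> | \<sigma> permutes {..<CARD('d)}. of_int (sign \<sigma>) * B (std_frame (\<sigma> 0)) (std_frame (\<sigma> 1)) * g (\<lambda>m. std_frame (\<sigma> (2 + m))))
     / (fact 2 * fact (CARD('d) - 2)) = 1/2 * (\<Sum>i\<in>UNIV. \<Sum>j\<in>UNIV. B (axis i 1) (axis j 1) * bivec g i j)"
proof -
  let ?P = "{\<sigma>. \<sigma> permutes {..<CARD('d)}}"
  define F where "F = (\<lambda>\<sigma>. of_int (sign \<sigma>) * g (\<lambda>m. std_frame (\<sigma> (2 + m))) :: real)"
  have "(\<Sum>\<sigma>\<in>?P. of_int (sign \<sigma>) * B (std_frame (\<sigma> 0)) (std_frame (\<sigma> 1)) * g (\<lambda>m. std_frame (\<sigma> (2 + m))))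
    = (\<Sum>\<sigma>\<in>?P. \<Sum>i\<in>UNIV. \<Sum>j\<in>UNIV. B (axis i 1) (axis j 1) * (if \<sigma> 0 = card {..<i} \<and> \<sigma> 1 = card {..<j} then F \<sigma> else 0))"
  proof (intro sum.cong refl)
    fix \<sigma> assume "\<sigma> \<in> ?P"
    then have "\<sigma> 0 \<in> {..<CARD('d)}" "\<sigma> 1 \<in> {..<CARD('d)}"
      using assms permutes_in_image[of \<sigma> "{..<CARD('d)}"] by auto
    then have l: "\<sigma> 0 < CARD('d)" "\<sigma> 1 < CARD('d)" by auto
    have "(\<Sum>i\<in>UNIV. \<Sum>j\<in>UNIV. B (axis i 1) (axis j 1) * (if \<sigma> 0 = card {..<i} \<and> \<sigma> 1 = card {..<j} then F \<sigma> else 0))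
      = (\<Sum>i\<in>UNIV. if \<sigma> 0 = card {..<i} then (\<Sum>j\<in>UNIV. if \<sigma> 1 = card {..<j} then B (axis i 1) (axis j 1) * F \<sigma> else 0) else 0)"
      by (intro sum.cong refl) (auto intro!: sum.cong sum.neutral)
    also have "\<dots> = B (std_frame (\<sigma> 0)) (std_frame (\<sigma> 1)) * F \<sigma>"
      unfolding sum_over_index[OF l(1)] sum_over_index[OF l(2)] std_frame_axis[OF l(1)] std_frame_axis[OF l(2)] ..
    finally show "of_int (sign \<sigma>) * B (std_frame (\<sigma> 0)) (std_frame (\<sigma> 1)) * g (\<lambda>m. std_frame (\<sigma> (2 + m))) =
      (\<Sum>i\<in>UNIV. \<Sum>j\<in>UNIV. B (axis i 1) (axis j 1) * (if \<sigma> 0 = card {..<i} \<and> \<sigma> 1 = card {..<j} then F \<sigma> else 0))"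
      by (simp add: F_def mult_ac)
  qed
  also have "\<dots> = (\<Sum>i\<in>UNIV. \<Sum>j\<in>UNIV. \<Sum>\<sigma>\<in>?P. B (axis i 1) (axis j 1) * (if \<sigma> 0 = card {..<i} \<and> \<sigma> 1 = card {..<j} then F \<sigma> else 0))"
    by (subst sum.swap, rule sum.cong[OF refl], rule sum.swap)
  also have "\<dots> = (\<Sum>i\<in>UNIV. \<Sum>j\<in>UNIV. B (axis i 1) (axis j 1) * (fact (CARD('d) - 2) * bivec g i j))"
    unfolding F_def by (simp add: sum_distrib_left[symmetric] bivec_def)
  also have "\<dots> = fact (CARD('d) - 2) * (\<Sum>i\<in>UNIV. \<Sum>j\<in>UNIV. B (axis i 1) (axis j 1) * bivec g i j)"
    by (simp add: sum_distrib_left mult_ac)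
  finally show ?thesis by simp
qed

text \<open>The cycle that fixes 0, sends 1 to \<open>Suc m\<close> and lowers 2 up to
  \<open>Suc m\<close> by one. It moves the slot differentiated in the \<open>m\<close>-th term of
  the exterior derivative to position 1.\<close>

primrec front_cycle :: "nat \<Rightarrow> nat \<Rightarrow> nat" where
  "front_cycle 0 = id"
| "front_cycle (Suc m) = Transposition.transpose (Suc m) (Suc (Suc m)) \<circ> front_cycle m"

lemma front_cycle_values:
  "front_cycle m 0 = 0" "front_cycle m (Suc 0) = Suc m"
  "front_cycle m (Suc (Suc k)) = (if k < m then Suc k else Suc (Suc k))"
  by (induction m) (auto simp: Transposition.transpose_def)

lemma front_cycle_permutes: "Suc m < n \<Longrightarrow> front_cycle m permutes {..<n}"
  by (induction m) (auto intro!: permutes_compose permutes_swap_id simp: permutes_id)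

lemma front_cycle_sign: "sign (front_cycle m) = (-1) ^ m"
proof (induction m)
  case (Suc m)
  have "permutation (front_cycle m)"
    using front_cycle_permutes[of m "Suc (Suc m)"] permutation_permutes by blast
  then show ?case
    by (simp only: front_cycle.simps sign_compose[OF permutation_swap_id] Suc sign_swap_id) simp
qed (simp add: sign_id)

text \<open>Composing with a transposition is a bijection between the permutations with two
  different first values, so the \<open>n\<close> classes have equal size.\<close>

lemma card_permutes_first:
  assumes "a < n"
  shows "card {\<sigma>. \<sigma> permutes {..<n} \<and> \<sigma> 0 = a} = fact (n - 1)"
proof -
  have eq: "card {\<sigma>. \<sigma> permutes {..<n} \<and> \<sigma> 0 = b} = card {\<sigma>. \<sigma> permutes {..<n} \<and> \<sigma> 0 = a}" if b: "b < n" for b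
  proof (rule bij_betw_same_card[of "\<lambda>\<sigma>. Transposition.transpose a b \<circ> \<sigma>"])
    have t: "Transposition.transpose a b permutes {..<n}" using assms b by (intro permutes_swap_id) auto
    have tt: "Transposition.transpose a b \<circ> (Transposition.transpose a b \<circ> \<sigma>) = \<sigma>" for \<sigma> :: "nat \<Rightarrow> nat"
      by (simp add: o_assoc)
    show "bij_betw (\<lambda>\<sigma>. Transposition.transpose a b \<circ> \<sigma>) {\<sigma>. \<sigma> permutes {..<n} \<and> \<sigma> 0 = b} {\<sigma>. \<sigma> permutes {..<n} \<and> \<sigma> 0 = a}"
    proof (rule bij_betw_byWitness[where f' = "\<lambda>\<sigma>. Transposition.transpose a b \<circ> \<sigma>"])
      show "(\<lambda>\<sigma>. Transposition.transpose a b \<circ> \<sigma>) ` {\<sigma>. \<sigma> permutes {..<n} \<and> \<sigma> 0 = b} \<subseteq> {\<sigma>. \<sigma> permutes {..<n} \<and> \<sigma> 0 = a}"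
        "(\<lambda>\<sigma>. Transposition.transpose a b \<circ> \<sigma>) ` {\<sigma>. \<sigma> permutes {..<n} \<and> \<sigma> 0 = a} \<subseteq> {\<sigma>. \<sigma> permutes {..<n} \<and> \<sigma> 0 = b}"
        using permutes_compose[OF _ t] by (auto simp: comp_def)
    qed (simp_all add: tt)
  qed
  have fin: "finite {\<sigma>. \<sigma> permutes {..<n}}" by (rule finite_permutations) simp
  have "{\<sigma>. \<sigma> permutes {..<n}} = (\<Union>b<n. {\<sigma>. \<sigma> permutes {..<n} \<and> \<sigma> 0 = b})"
    using assms permutes_in_image[of _ "{..<n}" 0] by auto
  then have "card {\<sigma>. \<sigma> permutes {..<n}} = (\<Sum>b<n. card {\<sigma>. \<sigma> permutes {..<n} \<and> \<sigma> 0 = b})"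
    using fin by (simp only:) (intro card_UN_disjoint; auto)
  also have "\<dots> = n * card {\<sigma>. \<sigma> permutes {..<n} \<and> \<sigma> 0 = a}" using eq by simp
  finally have "fact n = n * card {\<sigma>. \<sigma> permutes {..<n} \<and> \<sigma> 0 = a}"
    using card_permutations[of "{..<n}" n] by simp
  moreover have "fact n = n * (fact (n - 1) :: nat)" using assms by (metis fact_reduce less_nat_zero_code of_nat_id not_gr_zero)
  ultimately show ?thesis using assms by simp
qed

text \<open>The identity is evaluated on \<open>std_frame (\<sigma> 1)\<close>,
  \<open>std_frame (\<sigma> 2)\<close> and so on, and summed with signs over all \<sigma> with
  \<open>\<sigma> 0\<close> at the position of \<open>i\<close>. On the left all
  \<open>(n - 1)!\<close> terms are equal; on the right the \<open>n - 1\<close> terms of the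
  exterior derivative contribute equally after composition with \<open>front_cycle\<close>. The
  quotient \<open>(n - 2)!\<close> is the normalisation of \<open>bivec\<close>.\<close>

lemma interior_eq_dloc_component:
  fixes F :: "(real, 'd::{finite,wellorder}) vec \<Rightarrow> (nat \<Rightarrow> (real, 'd) vec) \<Rightarrow> real"
  assumes card: "CARD('d) \<ge> 2" and R: "alternating_form CARD('d) R"
    and F: "\<And>w. (\<lambda>y. F y w) differentiable (at x)"
    and eq: "\<And>w. R (case_nat v w) = dloc (CARD('d) - 2) F x w"
  shows "v $ i * R std_frame = (\<Sum>j\<in>UNIV. dd (\<lambda>y. bivec (F y) i j) x (axis j 1))"
proof -
  let ?n = "CARD('d)" and ?P = "{\<sigma>. \<sigma> permutes {..<CARD('d)}}"
  define h where "h = (\<lambda>\<sigma>. if \<sigma> 0 = card {..<i} then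
    of_int (sign \<sigma>) * dd (\<lambda>y. F y (\<lambda>m. std_frame (\<sigma> (2 + m)))) x (std_frame (\<sigma> 1)) else 0 :: real)"
  have fin: "finite ?P" by (rule finite_permutations) simp
  have 1: "(\<Sum>\<sigma>\<in>?P. if \<sigma> 0 = card {..<i} then of_int (sign \<sigma>) * R (case_nat v (\<lambda>m. std_frame (\<sigma> (Suc m)))) else 0)
    = fact (?n - 1) * (v $ i * R std_frame)"
  proof -
    have "(\<Sum>\<sigma>\<in>?P. if \<sigma> 0 = card {..<i} then of_int (sign \<sigma>) * R (case_nat v (\<lambda>m. std_frame (\<sigma> (Suc m)))) else 0)
      = (\<Sum>\<sigma>\<in>?P. if \<sigma> 0 = card {..<i} then v $ i * R std_frame else 0)"
      by (intro sum.cong refl) (auto simp: top_form_interior_component[OF R])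
    also have "\<dots> = (\<Sum>\<sigma>\<in>{\<sigma>. \<sigma> permutes {..<?n} \<and> \<sigma> 0 = card {..<i}}. v $ i * R std_frame)"
      using fin by (simp add: sum.inter_filter[symmetric])
    finally show ?thesis using card_permutes_first[OF index_less[of i]] by simp
  qed
  have 2: "(\<Sum>\<sigma>\<in>?P. if \<sigma> 0 = card {..<i} then of_int (sign \<sigma>) * dloc (?n - 2) F x (\<lambda>m. std_frame (\<sigma> (Suc m))) else 0)
     = real (?n - 1) * (\<Sum>\<sigma>\<in>?P. h \<sigma>)"
  proof -
    \<comment> \<open>Reindexing by the cycle contributes \<open>(-1) ^ m\<close>, which is exactly
      the sign of the \<open>m\<close>-th term of \<open>dloc\<close>.\<close>
    have t: "(\<Sum>\<sigma>\<in>?P. if \<sigma> 0 = card {..<i} then of_int (sign \<sigma>) * ((-1) ^ m *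
        dd (\<lambda>y. F y (omit m (\<lambda>m. std_frame (\<sigma> (Suc m))))) x (std_frame (\<sigma> (Suc m)))) else 0) = (\<Sum>\<sigma>\<in>?P. h \<sigma>)"
      if m: "m \<le> ?n - 2" for m
    proof -
      have c: "front_cycle m permutes {..<?n}" using m card by (intro front_cycle_permutes) auto
      have "(\<Sum>\<sigma>\<in>?P. h \<sigma>) = (\<Sum>\<sigma>\<in>?P. h (\<sigma> \<circ> front_cycle m))"
        by (rule sum_permutations_compose_right[OF c])
      also have "\<dots> = (\<Sum>\<sigma>\<in>?P. if \<sigma> 0 = card {..<i} then of_int (sign \<sigma>) * ((-1) ^ m *
        dd (\<lambda>y. F y (omit m (\<lambda>m. std_frame (\<sigma> (Suc m))))) x (std_frame (\<sigma> (Suc m)))) else 0)"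
      proof (intro sum.cong refl)
        fix \<sigma> assume "\<sigma> \<in> ?P"
        then have "permutation \<sigma>" "permutation (front_cycle m)" using c permutation_permutes by blast+
        then have s: "sign (\<sigma> \<circ> front_cycle m) = sign \<sigma> * (-1) ^ m" by (simp add: sign_compose front_cycle_sign)
        have o: "(\<lambda>k. std_frame ((\<sigma> \<circ> front_cycle m) (2 + k))) = omit m (\<lambda>m. std_frame (\<sigma> (Suc m)))"
          by (auto simp: omit_def fun_eq_iff front_cycle_values)
        show "h (\<sigma> \<circ> front_cycle m) = (if \<sigma> 0 = card {..<i} then of_int (sign \<sigma>) * ((-1) ^ m *
          dd (\<lambda>y. F y (omit m (\<lambda>m. std_frame (\<sigma> (Suc m))))) x (std_frame (\<sigma> (Suc m)))) else 0)"
          unfolding h_def o s by (simp add: front_cycle_values)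
      qed
      finally show ?thesis by simp
    qed
    have "(\<Sum>\<sigma>\<in>?P. if \<sigma> 0 = card {..<i} then of_int (sign \<sigma>) * dloc (?n - 2) F x (\<lambda>m. std_frame (\<sigma> (Suc m))) else 0)
      = (\<Sum>\<sigma>\<in>?P. \<Sum>m\<le>?n - 2. if \<sigma> 0 = card {..<i} then of_int (sign \<sigma>) * ((-1) ^ m *
        dd (\<lambda>y. F y (omit m (\<lambda>m. std_frame (\<sigma> (Suc m))))) x (std_frame (\<sigma> (Suc m)))) else 0)"
      by (intro sum.cong refl) (auto simp: dloc_def sum_distrib_left)
    also have "\<dots> = (\<Sum>m\<le>?n - 2. \<Sum>\<sigma>\<in>?P. h \<sigma>)"
      by (subst sum.swap) (simp add: t)
    also have "\<dots> = real (?n - 1) * (\<Sum>\<sigma>\<in>?P. h \<sigma>)" using card by (simp add: Suc_diff_Suc numeral_2_eq_2)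
    finally show ?thesis .
  qed
  have 3: "dd (\<lambda>y. bivec (F y) i j) x (axis j 1) = (\<Sum>\<sigma>\<in>?P. if \<sigma> 0 = card {..<i} \<and> \<sigma> 1 = card {..<j}
     then of_int (sign \<sigma>) * dd (\<lambda>y. F y (\<lambda>m. std_frame (\<sigma> (2 + m)))) x (axis j 1) else 0) / fact (?n - 2)" for j
  proof -
    have "((\<lambda>y. bivec (F y) i j) has_derivative (\<lambda>z. (\<Sum>\<sigma>\<in>?P. if \<sigma> 0 = card {..<i} \<and> \<sigma> 1 = card {..<j}
     then of_int (sign \<sigma>) * dd (\<lambda>y. F y (\<lambda>m. std_frame (\<sigma> (2 + m)))) x z else 0) / fact (?n - 2))) (at x)"
      unfolding bivec_def divide_inverse
    proof (intro has_derivative_mult_left has_derivative_sum)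
      fix \<sigma>
      show "((\<lambda>y. if \<sigma> 0 = card {..<i} \<and> \<sigma> 1 = card {..<j} then of_int (sign \<sigma>) * F y (\<lambda>m. std_frame (\<sigma> (2 + m))) else 0) has_derivative
        (\<lambda>z. if \<sigma> 0 = card {..<i} \<and> \<sigma> 1 = card {..<j} then of_int (sign \<sigma>) * dd (\<lambda>y. F y (\<lambda>m. std_frame (\<sigma> (2 + m)))) x z else 0)) (at x)"
        by (cases "\<sigma> 0 = card {..<i} \<and> \<sigma> 1 = card {..<j}") (auto intro!: has_derivative_mult_right dd_works F)
    qed
    from dd_eq[OF this] show ?thesis by simp
  qed
  have "(\<Sum>j\<in>UNIV. dd (\<lambda>y. bivec (F y) i j) x (axis j 1)) = (\<Sum>\<sigma>\<in>?P. h \<sigma>) / fact (?n - 2)"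
  proof -
    have "(\<Sum>j\<in>UNIV. \<Sum>\<sigma>\<in>?P. if \<sigma> 0 = card {..<i} \<and> \<sigma> 1 = card {..<j}
      then of_int (sign \<sigma>) * dd (\<lambda>y. F y (\<lambda>m. std_frame (\<sigma> (2 + m)))) x (axis j 1) else 0) = (\<Sum>\<sigma>\<in>?P. h \<sigma>)"
    proof (subst sum.swap, intro sum.cong refl)
      fix \<sigma> assume "\<sigma> \<in> ?P"
      then have "\<sigma> 1 \<in> {..<?n}" using card permutes_in_image[of \<sigma> "{..<?n}" 1] by auto
      then have l: "\<sigma> 1 < ?n" by simp
      have "(\<Sum>j\<in>UNIV. if \<sigma> 0 = card {..<i} \<and> \<sigma> 1 = card {..<j}
        then of_int (sign \<sigma>) * dd (\<lambda>y. F y (\<lambda>m. std_frame (\<sigma> (2 + m)))) x (axis j 1) else 0)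
        = (\<Sum>j\<in>UNIV. if \<sigma> 1 = card {..<j} then (if \<sigma> 0 = card {..<i} then
            of_int (sign \<sigma>) * dd (\<lambda>y. F y (\<lambda>m. std_frame (\<sigma> (2 + m)))) x (axis j 1) else 0) else 0)"
        by (intro sum.cong) auto
      also have "\<dots> = h \<sigma>" unfolding sum_over_index[OF l] h_def std_frame_axis[OF l] ..
      finally show "(\<Sum>j\<in>UNIV. if \<sigma> 0 = card {..<i} \<and> \<sigma> 1 = card {..<j}
        then of_int (sign \<sigma>) * dd (\<lambda>y. F y (\<lambda>m. std_frame (\<sigma> (2 + m)))) x (axis j 1) else 0) = h \<sigma>" .
    qed
    then show ?thesis unfolding 3 sum_divide_distrib[symmetric] by simp
  qed
  moreover have "v $ i * R std_frame = (\<Sum>\<sigma>\<in>?P. h \<sigma>) / fact (?n - 2)"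
  proof -
    obtain k where k: "?n = Suc (Suc k)" using card by (metis add_2_eq_Suc le_Suc_ex)
    have "fact (Suc k) * (v $ i * R std_frame) = real (Suc k) * (\<Sum>\<sigma>\<in>?P. h \<sigma>)"
      using trans[OF 1[symmetric] 2[unfolded eq[symmetric]]] k by simp
    then have "real (Suc k) * (fact k * (v $ i * R std_frame)) = real (Suc k) * (\<Sum>\<sigma>\<in>?P. h \<sigma>)"
      by (simp only: fact_Suc mult.assoc)
    then have "fact k * (v $ i * R std_frame) = (\<Sum>\<sigma>\<in>?P. h \<sigma>)"
      using of_nat_neq_0 mult_left_cancel by blast
    then show ?thesis using k by (simp add: field_simps)
  qed
  ultimately show ?thesis by simp
qed

lemma wedge_alternating:
  fixes \<omega> \<eta> :: "('m, 'd::finite) form"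
  assumes \<omega>: "alternating_form k (\<omega> p)" and \<eta>: "alternating_form l (\<eta> p)"
  shows "alternating_form (k + l) (wedge k l \<omega> \<eta> p)"
  unfolding alternating_form_def
proof (intro conjI allI impI)
  let ?P = "{\<sigma>. \<sigma> permutes {..<k + l}}"
  have im: "\<sigma> i < k + l" if "\<sigma> \<in> ?P" "i < k + l" for \<sigma> i
    using that permutes_in_image[of \<sigma> "{..<k + l}" i] by auto
  {
    fix w w' :: "nat \<Rightarrow> real^'d" assume e: "\<forall>i<k + l. w i = w' i"
    have "\<omega> p (\<lambda>i. w (\<sigma> i)) = \<omega> p (\<lambda>i. w' (\<sigma> i))" "\<eta> p (\<lambda>i. w (\<sigma> (k + i))) = \<eta> p (\<lambda>i. w' (\<sigma> (k + i)))" if "\<sigma> \<in> ?P" for \<sigma>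
      using e im[OF that] by (auto intro!: alternating_form_cong[OF \<omega>] alternating_form_cong[OF \<eta>])
    then have "(\<Sum>\<sigma>\<in>?P. of_int (sign \<sigma>) * \<omega> p (\<lambda>i. w (\<sigma> i)) * \<eta> p (\<lambda>i. w (\<sigma> (k + i))))
      = (\<Sum>\<sigma>\<in>?P. of_int (sign \<sigma>) * \<omega> p (\<lambda>i. w' (\<sigma> i)) * \<eta> p (\<lambda>i. w' (\<sigma> (k + i))))"
      by (intro sum.cong refl) simp
    then show "wedge k l \<omega> \<eta> p w = wedge k l \<omega> \<eta> p w'" unfolding wedge_def by (simp only:)
  next
    fix w :: "nat \<Rightarrow> real^'d" and j assume j: "j < k + l"
    have "linear (\<lambda>x. of_int (sign \<sigma>) * \<omega> p (\<lambda>i. (w(j := x)) (\<sigma> i)) * \<eta> p (\<lambda>i. (w(j := x)) (\<sigma> (k + i))))" if \<sigma>: "\<sigma> \<in> ?P" for \<sigma>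
    proof -
      have inj: "\<sigma> a = \<sigma> b \<longleftrightarrow> a = b" for a b using \<sigma> permutes_inj by (auto simp: inj_def)
      \<comment> \<open>The argument \<open>j\<close> occurs at exactly one position
        \<open>m\<close>, hence in exactly one of the two factors.\<close>
      obtain m where m: "\<sigma> m = j" "m < k + l"
        using \<sigma> j permutes_inverses(1)[of \<sigma> "{..<k+l}" j] permutes_in_image[OF permutes_inv[of \<sigma> "{..<k+l}"], of j] by auto
      show ?thesis
      proof (cases "m < k")
        case True
        have a: "(\<lambda>i. (w(j := x)) (\<sigma> i)) = (\<lambda>i. w (\<sigma> i))(m := x)" for x using m inj by (auto simp: fun_eq_iff)
        have b: "(\<lambda>i. (w(j := x)) (\<sigma> (k + i))) = (\<lambda>i. w (\<sigma> (k + i)))" for x using True inj m by (auto simp: fun_eq_iff)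
        show ?thesis
          unfolding a b using alternating_form_linear[OF \<omega> True, of "\<lambda>i. w (\<sigma> i)"] by (auto simp: linear_iff algebra_simps)
      next
        case False
        have a: "\<omega> p (\<lambda>i. (w(j := x)) (\<sigma> i)) = \<omega> p (\<lambda>i. w (\<sigma> i))" for x
          by (rule alternating_form_cong[OF \<omega>]) (use False inj m in auto)
        have b: "(\<lambda>i. (w(j := x)) (\<sigma> (k + i))) = (\<lambda>i. w (\<sigma> (k + i)))(m - k := x)" for x
          using False inj m by (auto simp: fun_eq_iff)
        have "m - k < l" using m False by simp
        then show ?thesis
          unfolding a b using alternating_form_linear[OF \<eta>, of "m - k" "\<lambda>i. w (\<sigma> (k + i))"] by (auto simp: linear_iff algebra_simps)
      qed
    qed
    then have "linear (\<lambda>x. \<Sum>\<sigma>\<in>?P. of_int (sign \<sigma>) * \<omega> p (\<lambda>i. (w(j := x)) (\<sigma> i)) * \<eta> p (\<lambda>i. (w(j := x)) (\<sigma> (k + i))))"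
      by (intro linear_compose_sum ballI)
    then show "linear (\<lambda>x. wedge k l \<omega> \<eta> p (w(j := x)))"
      unfolding wedge_def by (auto simp: linear_iff add_divide_distrib)
  next
    fix w :: "nat \<Rightarrow> real^'d" and a b assume ab: "a < k + l" "b < k + l" "a \<noteq> b \<and> w a = w b"
    let ?t = "Transposition.transpose a b"
    have t: "?t permutes {..<k + l}" using ab by (intro permutes_swap_id) auto
    have wt: "w (?t i) = w i" for i using ab by (auto simp: Transposition.transpose_def)
    let ?f = "\<lambda>\<sigma>. of_int (sign \<sigma>) * \<omega> p (\<lambda>i. w (\<sigma> i)) * \<eta> p (\<lambda>i. w (\<sigma> (k + i)))"
    have tt: "?t \<circ> (?t \<circ> \<sigma>) = \<sigma>" for \<sigma> :: "nat \<Rightarrow> nat" by (simp add: o_assoc)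
    \<comment> \<open>Composition with the transposition of \<open>a\<close> and \<open>b\<close>
      leaves the arguments unchanged and reverses the sign.\<close>
    have "sum ?f ?P = (\<Sum>\<sigma>\<in>?P. ?f (?t \<circ> \<sigma>))"
      by (rule sum.reindex_bij_witness[of _ "\<lambda>\<sigma>. ?t \<circ> \<sigma>" "\<lambda>\<sigma>. ?t \<circ> \<sigma>"])
        (use permutes_compose[OF _ t] tt in auto)
    also have "\<dots> = (\<Sum>\<sigma>\<in>?P. - ?f \<sigma>)"
    proof (intro sum.cong refl)
      fix \<sigma> assume "\<sigma> \<in> ?P"
      then have "permutation \<sigma>" using permutation_permutes by blast
      then have "sign (?t \<circ> \<sigma>) = - sign \<sigma>" using ab by (simp add: sign_compose permutation_swap_id sign_swap_id)
      then show "?f (?t \<circ> \<sigma>) = - ?f \<sigma>" by (simp add: wt)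
    qed
    finally have "sum ?f ?P = 0" by (simp add: sum_negf)
    then show "wedge k l \<omega> \<eta> p w = 0" unfolding wedge_def by simp
  }
qed

section \<open>Exact vector fields\<close>

context vol_mfd begin

lemma ext_d_alternating:
  assumes \<alpha>: "\<alpha> \<in> forms A k"
  shows "alternating_form (Suc k) (ext_d A k \<alpha> p)"
proof -
  let ?c = "chart_at A p"
  define T where "T = (\<lambda>u g. dd (\<lambda>y. form_rep A ?c \<alpha> y g) (coord_at A p) u)"
  have x: "coord_at A p \<in> cimg ?c" using chart_at by (simp add: coord_at_def)
  note d = smooth_on_has_derivative[OF smooth_form_chart[OF \<alpha> chart_at_compat(1)] x]
  have alt: "alternating_form k (form_rep A ?c \<alpha> y)" for y
    by (rule form_rep_alternating[OF forms_alternating[OF \<alpha>]])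
  have "alternating_form k (T u)" for u
    unfolding alternating_form_def
  proof (intro conjI allI impI)
    fix w w' :: "nat \<Rightarrow> (real, 'd) vec" assume e: "\<forall>i<k. w i = w' i"
    have "(\<lambda>y. form_rep A ?c \<alpha> y w) = (\<lambda>y. form_rep A ?c \<alpha> y w')"
      using e by (intro ext alternating_form_cong[OF alt]) auto
    then show "T u w = T u w'" by (simp add: T_def)
  next
    fix w :: "nat \<Rightarrow> (real, 'd) vec" and i assume i: "i < k"
    note l = alternating_form_linear[OF alt i]
    show "linear (\<lambda>z. T u (w(i := z)))"
    proof (rule linearI)
      fix a b and s :: real
      have "dd (\<lambda>y. form_rep A ?c \<alpha> y (w(i := a)) + form_rep A ?c \<alpha> y (w(i := b))) (coord_at A p) u = T u (w(i := a)) + T u (w(i := b))"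
        unfolding T_def by (subst dd_eq[OF has_derivative_add[OF d d]]) simp
      then show "T u (w(i := a + b)) = T u (w(i := a)) + T u (w(i := b))"
        unfolding T_def linear_add[OF l] .
      have "dd (\<lambda>y. s * form_rep A ?c \<alpha> y (w(i := a))) (coord_at A p) u = s * T u (w(i := a))"
        unfolding T_def by (subst dd_eq[OF has_derivative_mult_right[OF d]]) simp
      then show "T u (w(i := s *\<^sub>R a)) = s *\<^sub>R T u (w(i := a))"
        unfolding T_def linear_scale[OF l] by simp
    qed
  next
    fix w :: "nat \<Rightarrow> (real, 'd) vec" and i j assume ij: "i < k" "j < k" "i \<noteq> j \<and> w i = w j"
    have "form_rep A ?c \<alpha> y w = 0" for y by (rule alternating_form_repeat[OF alt ij(1,2)]) (use ij in auto)
    then show "T u w = 0" by (simp add: T_def)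
  qed
  moreover have "linear (\<lambda>u. T u g)" for g
    unfolding T_def by (rule has_derivative_linear[OF d])
  ultimately have "alternating_form (Suc k) (\<lambda>w. \<Sum>i\<le>k. (-1) ^ i * T (w i) (omit i w))"
    by (rule alternating_form_antisymmetrize)
  then show ?thesis
    by (simp add: T_def ext_d_def[abs_def] omit_def)
qed

context
  assumes dim: "CARD('d) \<ge> 2"
begin

lemma interior_component:
  assumes \<alpha>: "\<alpha> \<in> forms A (CARD('d) - 2)" and v: "interior_prod v \<rho> = ext_d A (CARD('d) - 2) \<alpha>"
    and c: "compat A c" and x: "x \<in> cimg c"
  shows "vf_rep A c v x $ i * dens c x = (\<Sum>j\<in>UNIV. dd (\<lambda>y. bivec (form_rep A c \<alpha> y) i j) x (axis j 1))"
  unfolding dens_def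
proof (rule interior_eq_dloc_component[OF dim form_rep_alternating[OF rho_alt]])
  show "(\<lambda>y. form_rep A c \<alpha> y w) differentiable at x" for w
    by (rule smooth_on_differentiable[OF smooth_form_chart[OF \<alpha> c] x])
  fix w :: "nat \<Rightarrow> (real, 'd) vec"
  let ?q = "cinv c x"
  have q: "?q \<in> fst c" using c x by simp
  have "form_rep A c \<rho> x (case_nat (vf_rep A c v x) w) = \<rho> ?q (case_nat (v ?q) (\<lambda>i. from_chart A c ?q *v w i))"
    unfolding form_rep_def vf_rep_def using to_from_chart_vec[OF c q]
    by (intro arg_cong[of _ _ "\<rho> ?q"]) (auto split: nat.split)
  also have "\<dots> = form_rep A c (ext_d A (CARD('d) - 2) \<alpha>) x w"
    using fun_cong[OF fun_cong[OF v, of ?q], of "\<lambda>i. from_chart A c ?q *v w i"] by (simp add: interior_prod_def form_rep_def)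
  also have "\<dots> = dloc (CARD('d) - 2) (form_rep A c \<alpha>) x w" by (rule ext_d_form_rep[OF \<alpha> c x])
  finally show "form_rep A c \<rho> x (case_nat (vf_rep A c v x) w) = dloc (CARD('d) - 2) (form_rep A c \<alpha>) x w" .
qed

text \<open>This justifies the definite description in \<open>exact_vf\<close>. Existence is linear
  algebra at each point; uniqueness follows because \<open>interior_component\<close> determines
  every component through the nonzero density.\<close>

lemma exact_vf_interior:
  assumes \<alpha>: "\<alpha> \<in> forms A (CARD('d) - 2)"
  shows "interior_prod (exact_vf A \<rho> \<alpha>) \<rho> = ext_d A (CARD('d) - 2) \<alpha>"
  unfolding exact_vf_def
proof (rule theI'[of "\<lambda>v. interior_prod v \<rho> = ext_d A (CARD('d) - 2) \<alpha>"])
  have "\<exists>v. \<forall>w. \<rho> p (case_nat v w) = ext_d A (CARD('d) - 2) \<alpha> p w" for p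
  proof (rule top_form_interior_exists[OF rho_alt])
    obtain w where "\<rho> p w \<noteq> 0" using vol unfolding volume_form_def by blast
    then show "\<rho> p std_frame \<noteq> 0" using top_form_det[OF rho_alt, of p w] by auto
    show "alternating_form (CARD('d) - 1) (ext_d A (CARD('d) - 2) \<alpha> p)"
    proof -
      have "Suc (CARD('d) - 2) = CARD('d) - 1" using dim by arith
      then show ?thesis using ext_d_alternating[OF \<alpha>, of p] by simp
    qed
  qed
  then obtain v where v: "\<And>p w. \<rho> p (case_nat (v p) w) = ext_d A (CARD('d) - 2) \<alpha> p w" by metis
  have "v' = v''" if e: "interior_prod v' \<rho> = ext_d A (CARD('d) - 2) \<alpha>" "interior_prod v'' \<rho> = ext_d A (CARD('d) - 2) \<alpha>" for v' v''
  proof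
    fix p
    let ?c = "chart_at A p"
    have c: "p \<in> fst ?c" "snd ?c p \<in> cimg ?c" using chart_at by auto
    have "vf_rep A ?c v' (snd ?c p) $ i * dens ?c (snd ?c p) = vf_rep A ?c v'' (snd ?c p) $ i * dens ?c (snd ?c p)" for i
      unfolding interior_component[OF \<alpha> e(1) chart_at_compat(1) c(2)] interior_component[OF \<alpha> e(2) chart_at_compat(1) c(2)] ..
    then have "vf_rep A ?c v' (snd ?c p) = vf_rep A ?c v'' (snd ?c p)"
      using dens_nonzero[OF chart_at_compat(1) c(2)] by (simp add: vec_eq_iff)
    then show "v' p = v'' p" using c by (simp add: vf_rep_at[OF chart_at_compat(1)])
  qed
  moreover have "interior_prod v \<rho> = ext_d A (CARD('d) - 2) \<alpha>" using v by (auto simp: fun_eq_iff interior_prod_def)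
  ultimately show "\<exists>!v. interior_prod v \<rho> = ext_d A (CARD('d) - 2) \<alpha>" by blast
qed

lemma exact_vf_rep:
  assumes \<alpha>: "\<alpha> \<in> forms A (CARD('d) - 2)" and c: "compat A c" and x: "x \<in> cimg c"
  shows "vf_rep A c (exact_vf A \<rho> \<alpha>) x = (\<chi> i. (\<Sum>j\<in>UNIV. dd (\<lambda>y. bivec (form_rep A c \<alpha> y) i j) x (axis j 1)) / dens c x)"
  using interior_component[OF \<alpha> exact_vf_interior[OF \<alpha>] c x] dens_nonzero[OF c x]
  by (simp add: vec_eq_iff divide_eq_eq eq_divide_eq)

lemma bivec_smooth:
  assumes "\<alpha> \<in> forms A (CARD('d) - 2)" "compat A c"
  shows "smooth_on (cimg c) (\<lambda>y. bivec (form_rep A c \<alpha> y) i j)"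
proof -
  have "smooth_on (cimg c) (\<lambda>y. if b then a * form_rep A c \<alpha> y w else 0)" for a w b
    using smooth_form_chart[OF assms] assms(2) by (cases b) (auto intro!: smooth_intros)
  then show ?thesis
    unfolding bivec_def using assms(2) by (auto intro!: smooth_intros)
qed

lemma exact_vf_smooth:
  assumes \<alpha>: "\<alpha> \<in> forms A (CARD('d) - 2)"
  shows "smooth_vf A (exact_vf A \<rho> \<alpha>)"
  unfolding smooth_vf_def
proof
  fix c assume "c \<in> A"
  then have c: "compat A c" by (rule A_compat)
  have "smooth_on (cimg c) (\<lambda>x. \<chi> i. (\<Sum>j\<in>UNIV. dd (\<lambda>y. bivec (form_rep A c \<alpha> y) i j) x (axis j 1)) / dens c x)"
    using c dens_nonzero[OF c] by (intro smooth_intros bivec_smooth[OF \<alpha> c] dens_smooth) auto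
  then show "smooth_on (cimg c) (vf_rep A c (exact_vf A \<rho> \<alpha>))"
    by (rule smooth_on_eq_on) (use c exact_vf_rep[OF \<alpha> c] in auto)
qed

lemma exact_vf_sum:
  assumes \<alpha>: "\<And>a. a \<in> I \<Longrightarrow> \<beta> a \<in> forms A (CARD('d) - 2)" and I: "finite I"
  shows "(\<lambda>p w. \<Sum>a\<in>I. \<beta> a p w) \<in> forms A (CARD('d) - 2)"
    "exact_vf A \<rho> (\<lambda>p w. \<Sum>a\<in>I. \<beta> a p w) p = (\<Sum>a\<in>I. exact_vf A \<rho> (\<beta> a) p)"
proof -
  let ?c = "chart_at A p"
  have sumI: "(\<lambda>p w. \<Sum>a\<in>I'. \<beta> a p w) \<in> forms A (CARD('d) - 2)" if "finite I'" "I' \<subseteq> I" for I'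
    using that
  proof (induction I')
    case empty
    then show ?case by (auto simp: forms_def alternating_form_def form_rep_def linear_iff intro!: smooth_on_const)
  next
    case (insert a F)
    then show ?case using forms_add[of "\<beta> a" _ "\<lambda>p w. \<Sum>a\<in>F. \<beta> a p w"] \<alpha> by simp
  qed
  then show *: "(\<lambda>p w. \<Sum>a\<in>I. \<beta> a p w) \<in> forms A (CARD('d) - 2)" using I by blast
  have c: "p \<in> fst ?c" "snd ?c p \<in> cimg ?c" using chart_at by auto
  let ?x = "snd ?c p"
  have rep: "vf_rep A ?c X ?x = X p" for X using c by (simp add: vf_rep_at[OF chart_at_compat(1)])
  have "bivec (form_rep A ?c (\<lambda>p w. \<Sum>a\<in>I. \<beta> a p w) y) i j = (\<Sum>a\<in>I. bivec (form_rep A ?c (\<beta> a) y) i j)" for y i j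
  proof -
    have e: "(if b then s * form_rep A ?c (\<lambda>p w. \<Sum>a\<in>I. \<beta> a p w) y w else 0) = (\<Sum>a\<in>I. if b then s * form_rep A ?c (\<beta> a) y w else 0)" for b s w
      by (auto simp: form_rep_def sum_distrib_left)
    show ?thesis unfolding bivec_def e sum_divide_distrib[symmetric] by (subst sum.swap) simp
  qed
  moreover have "dd (\<lambda>y. \<Sum>a\<in>I. bivec (form_rep A ?c (\<beta> a) y) i j) ?x h = (\<Sum>a\<in>I. dd (\<lambda>y. bivec (form_rep A ?c (\<beta> a) y) i j) ?x h)" for i j h
    by (subst dd_eq[OF has_derivative_sum]) (auto intro!: smooth_on_has_derivative[OF bivec_smooth[OF \<alpha> chart_at_compat(1)]] c(2))
  ultimately have "(\<Sum>j\<in>UNIV. dd (\<lambda>y. bivec (form_rep A ?c (\<lambda>p w. \<Sum>a\<in>I. \<beta> a p w) y) i j) ?x (axis j 1)) / dens ?c ?x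
     = (\<Sum>a\<in>I. (\<Sum>j\<in>UNIV. dd (\<lambda>y. bivec (form_rep A ?c (\<beta> a) y) i j) ?x (axis j 1)) / dens ?c ?x)" for i
    by (simp add: sum_divide_distrib[symmetric]) (subst sum.swap, simp)
  then have "vf_rep A ?c (exact_vf A \<rho> (\<lambda>p w. \<Sum>a\<in>I. \<beta> a p w)) ?x = (\<Sum>a\<in>I. vf_rep A ?c (exact_vf A \<rho> (\<beta> a)) ?x)"
    unfolding exact_vf_rep[OF * chart_at_compat(1) c(2)] 
    by (simp add: vec_eq_iff exact_vf_rep[OF \<alpha> chart_at_compat(1) c(2)])
  then show "exact_vf A \<rho> (\<lambda>p w. \<Sum>a\<in>I. \<beta> a p w) p = (\<Sum>a\<in>I. exact_vf A \<rho> (\<beta> a) p)"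
    unfolding rep .
qed

end

end

context oriented_mfd begin

text \<open>The derivatives of the auxiliary extension cancel, and the derivative of
  \<open>v\<close> enters as a commutator with the components of \<open>B\<close>.\<close>

lemma lie_endo_rep:
  assumes B: "smooth_endo A B" and v: "smooth_vf A v" and c: "compat A c" and q: "q \<in> fst c"
  shows "lie_endo A v B q = from_chart A c q ** (dd (endo_rep A c B) (snd c q) (vf_rep A c v (snd c q))
      - matrix (dd (vf_rep A c v) (snd c q)) ** endo_rep A c B (snd c q)
      + endo_rep A c B (snd c q) ** matrix (dd (vf_rep A c v) (snd c q))) ** to_chart A c q"
  unfolding lie_endo_def
proof (rule matrix_conj_chart, rule from_to_eqI[OF c q(1)])
  fix z
  let ?x = "snd c q" and ?X = "vf_ext A q z" and ?B = "endo_rep A c B" and ?v = "vf_rep A c v"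
  have X: "smooth_vf A ?X" "?X q = z" by (rule vf_ext)+
  have x: "?x \<in> cimg c" "open (cimg c)" using q c by auto
  have dB: "(?B has_derivative dd ?B ?x) (at ?x)" using smooth_on_has_derivative[OF smooth_endo_chart[OF B c] x(1)] .
  have dX: "(vf_rep A c ?X has_derivative dd (vf_rep A c ?X) ?x) (at ?x)"
    using smooth_on_has_derivative[OF smooth_vf_chart[OF X(1) c] x(1)] .
  have "dd (vf_rep A c (app B ?X)) ?x = dd (\<lambda>x. ?B x *v vf_rep A c ?X x) ?x"
    by (rule dd_cong[OF x(2,1)]) (rule vf_rep_app[OF c])
  also have "\<dots> = (\<lambda>h. ?B ?x *v dd (vf_rep A c ?X) ?x h + dd ?B ?x h *v vf_rep A c ?X ?x)"
    by (rule dd_eq[OF bounded_bilinear.FDERIV[OF bounded_bilinear_matrix_vector_mult dB dX]])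
  finally have 1: "dd (vf_rep A c (app B ?X)) ?x h = ?B ?x *v dd (vf_rep A c ?X) ?x h + dd ?B ?x h *v vf_rep A c ?X ?x" for h
    by simp
  have 2: "to_chart A c q *v (B q *v w) = ?B ?x *v (to_chart A c q *v w)" for w
    using q c by (simp add: endo_rep_vec to_from_chart_vec)
  have Xz: "vf_rep A c ?X ?x = to_chart A c q *v z" using vf_rep_at[OF c q(1)] X by simp
  have m: "matrix (dd ?v ?x) *v w = dd ?v ?x w" for w
    by (rule matrix_apply[OF dd_linear[OF smooth_on_differentiable[OF smooth_vf_chart[OF v c] x(1)]]])
  show "to_chart A c q *v (lie_bracket A v (app B ?X) q - B q *v lie_bracket A v ?X q) =
    (dd ?B ?x (?v ?x) - matrix (dd ?v ?x) ** ?B ?x + ?B ?x ** matrix (dd ?v ?x)) *v (to_chart A c q *v z)"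
    unfolding mv_bilinear 2 lie_bracket_rep[OF v X(1) c q] lie_bracket_rep[OF v smooth_vf_app[OF B X(1)] c q] 1
      vf_rep_app[OF c x(1)] Xz matrix_vector_mul_assoc[symmetric] m
    by (simp add: algebra_simps)
qed

end

section \<open>Integration\<close>

lemma smooth_on_extend_zero:
  assumes "open S" "closed K" "K \<subseteq> S" "smooth_on S F" "\<And>x. x \<in> S \<Longrightarrow> x \<notin> K \<Longrightarrow> F x = 0"
  shows "smooth_on UNIV (\<lambda>x. if x \<in> S then F x else 0)"
proof -
  have "smooth_on (S \<union> - K) (\<lambda>x. if x \<in> S then F x else 0)"
  proof (rule smooth_on_Un[OF assms(1)])
    show "open (- K)" using assms(2) by blast
    then show "smooth_on (- K) (\<lambda>x. if x \<in> S then F x else 0)"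
      by (rule smooth_on_zero) (use assms in auto)
  qed (rule smooth_on_eq_on[OF assms(4,1)], simp)
  moreover have "S \<union> - K = UNIV" using assms(3) by blast
  ultimately show ?thesis by simp
qed

lemma dd_zero_open:
  assumes "open S" "x \<in> S" "\<And>y. y \<in> S \<Longrightarrow> f y = 0"
  shows "dd f x h = 0"
  using dd_cong[OF assms(1,2), of f "\<lambda>_. 0"] assms(3) by simp

lemma integral_eq_off:
  fixes f :: "'a::euclidean_space \<Rightarrow> 'b::banach"
  assumes "\<And>x. x \<notin> T \<Longrightarrow> f x = 0"
  shows "integral UNIV f = integral T f"
proof -
  have "(\<lambda>x. if x \<in> T then f x else 0) = f" using assms by auto
  then show ?thesis using integral_restrict_UNIV[of T f] by simp
qed

lemma absolutely_integrable_compact_support: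
  fixes f :: "'a::euclidean_space \<Rightarrow> real"
  assumes f: "continuous_on UNIV f" and K: "compact K" "\<And>x. x \<notin> K \<Longrightarrow> f x = 0" and T: "K \<subseteq> T"
  shows "f absolutely_integrable_on T"
proof -
  obtain a b where ab: "K \<subseteq> cbox a b" using compact_imp_bounded[OF K(1)] bounded_subset_cbox_symmetric by blast
  have "f absolutely_integrable_on cbox a b"
    by (rule absolutely_integrable_continuous[OF continuous_on_subset[OF f]]) simp
  moreover have "(\<lambda>x. if x \<in> B then f x else 0) = f" if "K \<subseteq> B" for B
    using that K(2) by (auto simp: fun_eq_iff)
  from this[OF ab] this[OF T]
  have "(\<lambda>x. if x \<in> cbox a b then f x else 0) = f" "(\<lambda>x. if x \<in> T then f x else 0) = f" by blast+
  ultimately show ?thesis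
    using absolutely_integrable_restrict_UNIV[of "cbox a b" f] absolutely_integrable_restrict_UNIV[of T f] by simp
qed

lemma parametric_integral_derivative:
  fixes g :: "real \<times> 'a::euclidean_space \<Rightarrow> real"
  assumes g: "smooth_on UNIV g"
  shows "((\<lambda>s. integral (cbox a b) (\<lambda>x. g (s, x))) has_real_derivative integral (cbox a b) (\<lambda>x. dd g (t, x) (1, 0))) (at t)"
proof -
  have d: "((\<lambda>s. g (s, x)) has_vector_derivative dd g (s, x) (1, 0)) (at s)" for s x
  proof -
    have "((\<lambda>s. (s, x)) has_derivative (\<lambda>h. (h, 0))) (at s)"
      by (intro has_derivative_Pair has_derivative_ident has_derivative_const)
    from has_derivative_compose[OF this smooth_on_has_derivative[OF g]]
    have 1: "((\<lambda>s. g (s, x)) has_derivative (\<lambda>h. dd g (s, x) (h, 0))) (at s)" by simp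
    have "dd g (s, x) (h, 0) = h *\<^sub>R dd g (s, x) (1, 0)" for h
      using linear_scale[OF dd_linear[OF smooth_on_differentiable[OF g UNIV_I]], of "(s, x)" h "(1, 0)"] by simp
    then have "(\<lambda>h. dd g (s, x) (h, 0)) = (\<lambda>h. h *\<^sub>R dd g (s, x) (1, 0))" by (rule ext)
    with 1 show ?thesis unfolding has_vector_derivative_def by (simp only:)
  qed
  have c: "continuous_on UNIV (\<lambda>z. dd g z (1, 0))" "continuous_on UNIV g"
    using smooth_on_imp_continuous_on[OF smooth_on_dd[OF g]] smooth_on_imp_continuous_on[OF g] .
  have "((\<lambda>s. integral (cbox a b) (\<lambda>x. g (s, x))) has_vector_derivative integral (cbox a b) (\<lambda>x. dd g (t, x) (1, 0))) (at t within UNIV)"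
  proof (rule leibniz_rule_vector_derivative)
    show "(\<lambda>x. g (s, x)) integrable_on cbox a b" for s
      by (intro integrable_continuous continuous_on_compose2[OF c(2)] continuous_intros) auto
    have "(\<lambda>(s, x). dd g (s, x) (1, 0)) = (\<lambda>z. dd g z (1, 0))" by (auto simp: fun_eq_iff)
    then show "continuous_on (UNIV \<times> cbox a b) (\<lambda>(s, x). dd g (s, x) (1, 0))"
      using continuous_on_subset[OF c(1)] by simp
  qed (use d in auto)
  then show ?thesis by (simp add: has_real_derivative_iff_has_vector_derivative)
qed

text \<open>By translation invariance the integral of \<open>W (x + s *\<^sub>R b)\<close> does not
  depend on \<open>s\<close>, and its derivative at 0 is the integral in question. The box is large
  enough to contain the translated supports for all \<open>s\<close> between -1 and 1, so that
  differentiation under the integral takes place on a fixed compact set.\<close>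

lemma integral_directional_derivative_zero:
  fixes W :: "'a::euclidean_space \<Rightarrow> real"
  assumes W: "smooth_on UNIV W" and K: "compact K" "\<And>x. x \<notin> K \<Longrightarrow> W x = 0"
  shows "integral UNIV (\<lambda>x. dd W x b) = 0"
proof -
  obtain B where B: "\<And>x. x \<in> K \<Longrightarrow> norm x \<le> B" using compact_imp_bounded[OF K(1)] by (auto simp: bounded_iff)
  obtain a where a: "cball 0 (B + norm b) \<subseteq> cbox (- a) (a :: 'a)"
    using bounded_subset_cbox_symmetric[OF bounded_cball] .
  have sub: "x - s *\<^sub>R b \<in> cbox (- a) a" if "x \<in> K" "\<bar>s\<bar> < 1" for s x
  proof -
    have "norm (x - s *\<^sub>R b) \<le> norm x + \<bar>s\<bar> * norm b" by (metis norm_scaleR norm_triangle_ineq4)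
    also have "\<dots> \<le> B + norm b" using B[OF that(1)] that(2) by (simp add: add_mono mult_left_le_one_le)
    finally show ?thesis using a by auto
  qed
  define g where "g = (\<lambda>z. W (snd z + fst z *\<^sub>R b))"
  have lin: "((\<lambda>z. snd z + fst z *\<^sub>R b) has_derivative (\<lambda>h. snd h + fst h *\<^sub>R b)) (at z)" for z :: "real \<times> 'a"
    by (intro has_derivative_add bounded_linear.has_derivative[OF bounded_linear_scaleR_left] has_derivative_fst has_derivative_snd has_derivative_ident)
  have "smooth_on UNIV g"
    unfolding g_def by (rule smooth_on_compose[OF W]) (auto intro!: smooth_intros)
  from parametric_integral_derivative[OF this, of "- a" a 0]
  have 1: "((\<lambda>s. integral (cbox (- a) a) (\<lambda>x. g (s, x))) has_real_derivative integral (cbox (- a) a) (\<lambda>x. dd g (0, x) (1, 0))) (at 0)" .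
  have "dd g (0, x) (1, 0) = dd W x b" for x
  proof -
    have "(g has_derivative (\<lambda>h. dd W x (snd h + fst h *\<^sub>R b))) (at (0, x))"
      unfolding g_def using has_derivative_compose[OF lin[of "(0, x)"], of W] smooth_on_has_derivative[OF W] by simp
    from dd_eq[OF this] show ?thesis by simp
  qed
  moreover have "integral (cbox (- a) a) (\<lambda>x. g (s, x)) = integral UNIV W" if "\<bar>s\<bar> < 1" for s
  proof -
    have "integral (cbox (- a) a) (\<lambda>x. g (s, x)) = integral (cbox (- a) a) (W \<circ> (+) (s *\<^sub>R b))"
      by (simp add: g_def o_def add.commute)
    also have "\<dots> = integral (cbox (- a + s *\<^sub>R b) (a + s *\<^sub>R b)) W" by (rule integral_shift_cbox_plus)
    also have "\<dots> = integral UNIV W"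
    proof (rule integral_eq_off[symmetric])
      fix x assume x: "x \<notin> cbox (- a + s *\<^sub>R b) (a + s *\<^sub>R b)"
      have "cbox (- a + s *\<^sub>R b) (a + s *\<^sub>R b) = (\<lambda>x. s *\<^sub>R b + x) ` cbox (- a) a"
        using cbox_translation[of "s *\<^sub>R b" "-a" a] by (simp add: add.commute)
      with x have "x - s *\<^sub>R b \<notin> cbox (- a) a" by (metis add_diff_cancel_left' diff_add_cancel image_eqI add.commute)
      then show "W x = 0" using sub[of x s] K(2) that by blast
    qed
    finally show ?thesis .
  qed
  then have "((\<lambda>s. integral (cbox (- a) a) (\<lambda>x. g (s, x))) has_real_derivative 0) (at 0)"
    by (intro DERIV_cong_ev[THEN iffD2, OF refl _ refl DERIV_const[of "integral UNIV W"]])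
      (auto simp: eventually_nhds_metric dist_real_def intro!: exI[of _ 1])
  ultimately have "integral (cbox (- a) a) (\<lambda>x. dd W x b) = 0"
    using DERIV_unique[OF 1] by simp
  moreover have "integral UNIV (\<lambda>x. dd W x b) = integral (cbox (- a) a) (\<lambda>x. dd W x b)"
  proof (rule integral_eq_off)
    fix x assume "x \<notin> cbox (- a) a"
    then have "x \<in> - K" using sub[of x 0] by auto
    then show "dd W x b = 0" using K by (intro dd_zero_open[of "- K"]) (auto simp: compact_imp_closed)
  qed
  ultimately show ?thesis by simp
qed

text \<open>Real values are encoded as vectors of length one, to match the vector-valued change of
  variables.\<close>

lemma integral_change_of_variables_real:
  fixes f :: "real^'m::{finite,wellorder} \<Rightarrow> real" and g :: "real^'m::_ \<Rightarrow> real^'m::_"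
  assumes "open S" "\<And>x. x \<in> S \<Longrightarrow> (g has_derivative g' x) (at x)" "inj_on g S" "f absolutely_integrable_on (g ` S)"
  shows "integral (g ` S) f = integral S (\<lambda>x. \<bar>det (matrix (g' x))\<bar> * f (g x))"
proof -
  have "(\<lambda>x. vec (f x) :: real^1) absolutely_integrable_on (g ` S)"
    unfolding absolutely_integrable_on_1_iff using assms(4) by simp
  then have "integral (g ` S) (\<lambda>x. vec (f x) :: real^1) = integral S (\<lambda>x. \<bar>det (matrix (g' x))\<bar> *\<^sub>R vec (f (g x)))"
    by (intro integral_change_of_variables) (use assms in \<open>auto intro: has_derivative_at_withinI\<close>)
  then have "vec (integral (g ` S) f) = (vec (integral S (\<lambda>x. \<bar>det (matrix (g' x))\<bar> * f (g x))) :: real^1)"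
    unfolding integral_on_1_eq by simp
  then show ?thesis by (simp add: vec_eq_iff)
qed

section \<open>Integration of forms over the manifold\<close>

context oriented_mfd begin

lemma coord_image_compact:
  assumes c: "compat A c" and K: "compact K" "K \<subseteq> fst c"
  shows "compact (snd c ` K)" "snd c ` K \<subseteq> cimg c"
proof -
  have "continuous_on (fst c) (snd c)"
    using compat_chart[OF c] unfolding is_chart_def homeomorphism_def by blast
  then show "compact (snd c ` K)" using compact_continuous_image[OF continuous_on_subset K(1)] K(2) by blast
  show "snd c ` K \<subseteq> cimg c" using K by (auto simp: cimg_def)
qed

end

definition chart_integral ::
  "('m::t2_space, 'd::{finite,wellorder}) chart set \<Rightarrow> ('m, 'd) chart \<Rightarrow> ('m, 'd) form \<Rightarrow> real" where
  "chart_integral A c \<omega> = integral (cimg c) (\<lambda>x. form_rep A c \<omega> x std_frame)"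

locale framed_mfd = closed_mfd A for A :: "('m::t2_space, 'd::{finite,wellorder}) chart set"
begin

lemma chart_extension:
  fixes w :: "nat \<Rightarrow> (real, 'd) vec"
  assumes \<omega>: "\<omega> \<in> forms A k" and c: "compat A c" and K: "closed K" "K \<subseteq> fst c" "\<forall>p w. p \<notin> K \<longrightarrow> \<omega> p w = 0"
  defines "f \<equiv> (\<lambda>x. if x \<in> cimg c then form_rep A c \<omega> x w else 0)"
  shows "smooth_on UNIV f" "compact (snd c ` K)" "snd c ` K \<subseteq> cimg c" "\<And>x. x \<notin> snd c ` K \<Longrightarrow> f x = 0"
proof -
  have K': "compact K" using compact_UNIV K(1) by (metis compact_Int_closed inf_top_left)
  show k: "compact (snd c ` K)" "snd c ` K \<subseteq> cimg c" using coord_image_compact[OF c K' K(2)] .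
  have z: "form_rep A c \<omega> x w = 0" if "x \<in> cimg c" "x \<notin> snd c ` K" for x
  proof -
    have "cinv c x \<notin> K" using that c by (metis compat_chart coord_cinv imageI)
    then show ?thesis by (simp add: form_rep_def K(3))
  qed
  then show "\<And>x. x \<notin> snd c ` K \<Longrightarrow> f x = 0" by (simp add: f_def)
  show "smooth_on UNIV f"
    unfolding f_def by (rule smooth_on_extend_zero[OF _ compact_imp_closed[OF k(1)] k(2) smooth_form_chart[OF \<omega> c] z]) (use c in auto)
qed

lemma chart_integrable:
  assumes \<omega>: "\<omega> \<in> forms A k" and c: "compat A c" and K: "closed K" "K \<subseteq> fst c" "\<forall>p w. p \<notin> K \<longrightarrow> \<omega> p w = 0"
    and T: "snd c ` K \<subseteq> T" "T \<subseteq> cimg c"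
  shows "(\<lambda>x. form_rep A c \<omega> x w) absolutely_integrable_on T"
proof -
  note e = chart_extension[OF \<omega> c K]
  have "(\<lambda>x. if x \<in> cimg c then form_rep A c \<omega> x w else 0) absolutely_integrable_on T"
    by (rule absolutely_integrable_compact_support[OF smooth_on_imp_continuous_on[OF e(1)] e(2) _ T(1)]) (rule e(4))
  moreover have "(\<lambda>x. if x \<in> T then (if x \<in> cimg c then form_rep A c \<omega> x w else 0) else 0) = (\<lambda>x. if x \<in> T then form_rep A c \<omega> x w else 0)"
    using T(2) by (auto simp: fun_eq_iff)
  ultimately show ?thesis
    using absolutely_integrable_restrict_UNIV[of T "\<lambda>x. form_rep A c \<omega> x w"]
      absolutely_integrable_restrict_UNIV[of T "\<lambda>x. if x \<in> cimg c then form_rep A c \<omega> x w else 0"] by simp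
qed

lemma chart_integral_subset:
  assumes c: "compat A c" and K: "K \<subseteq> U" "U \<subseteq> fst c" "\<forall>p w. p \<notin> K \<longrightarrow> \<omega> p w = 0"
  shows "chart_integral A c \<omega> = integral (snd c ` U) (\<lambda>x. form_rep A c \<omega> x std_frame)"
proof -
  let ?f = "\<lambda>x. form_rep A c \<omega> x std_frame"
  have "(if x \<in> cimg c then ?f x else 0) = (if x \<in> snd c ` U then ?f x else 0)" for x
  proof -
    have "?f x = 0" if "x \<in> cimg c" "x \<notin> snd c ` U"
    proof -
      have "cinv c x \<notin> K" using that c K by (metis compat_chart coord_cinv imageI subsetD)
      then show ?thesis by (simp add: form_rep_def K(3))
    qed
    moreover have "snd c ` U \<subseteq> cimg c" using K by (auto simp: cimg_def)
    ultimately show ?thesis by auto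
  qed
  then show ?thesis
    unfolding chart_integral_def using integral_restrict_UNIV[of "cimg c" ?f] integral_restrict_UNIV[of "snd c ` U" ?f] by simp
qed

text \<open>The only place where the orientation of the atlas matters: the Jacobians have positive determinant.\<close>

lemma chart_integral_indep:
  assumes \<omega>: "\<omega> \<in> forms A CARD('d)" and cA: "ca \<in> A" "cb \<in> A"
    and K: "closed K" "K \<subseteq> fst ca \<inter> fst cb" "\<forall>p w. p \<notin> K \<longrightarrow> \<omega> p w = 0"
  shows "chart_integral A ca \<omega> = chart_integral A cb \<omega>"
proof -
  let ?U = "fst ca \<inter> fst cb"
  define g where "g = snd cb \<circ> cinv ca"
  note c = A_compat[OF cA(1)] A_compat[OF cA(2)]
  define S where "S = snd ca ` ?U"
  have S: "open S" unfolding S_def using c by (intro open_coord_overlap) auto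
  have gp: "g (snd ca p) = snd cb p" if "p \<in> ?U" for p using that c by (simp add: g_def)
  have gS: "g ` S = snd cb ` ?U" unfolding S_def image_image using gp by (intro image_cong) auto
  have inj: "inj_on g S"
  proof (rule inj_onI)
    fix x y assume "x \<in> S" "y \<in> S" "g x = g y"
    then obtain p q where pq: "p \<in> ?U" "q \<in> ?U" "x = snd ca p" "y = snd ca q" "snd cb p = snd cb q"
      using gp by (auto simp: S_def)
    then have "p = q" using cinv_coord[OF compat_chart[OF c(2)]] by (metis IntD2)
    then show "x = y" using pq by simp
  qed
  have der: "(g has_derivative (\<lambda>h. jac ca cb (cinv ca x) *v h)) (at x)" if "x \<in> S" for x
  proof -
    from that obtain p where p: "p \<in> fst ca" "p \<in> fst cb" "x = snd ca p" by (auto simp: S_def)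
    then show ?thesis using jac_has_derivative[OF c p(1,2)] c by (simp add: g_def)
  qed
  have det: "det (jac ca cb (cinv ca x)) > 0" if "x \<in> S" for x
  proof -
    from that obtain p where p: "p \<in> fst ca" "p \<in> fst cb" "x = snd ca p" by (auto simp: S_def)
    have "det (jacobian (snd cb \<circ> cinv ca) (at x)) > 0"
      using atlas cA that unfolding oriented_atlas_def S_def by blast
    then show ?thesis using p c by (simp add: jac_def)
  qed
  have "chart_integral A cb \<omega> = integral (snd cb ` ?U) (\<lambda>x. form_rep A cb \<omega> x std_frame)"
    by (rule chart_integral_subset[OF c(2) K(2) _ K(3)]) auto
  also have "\<dots> = integral S (\<lambda>x. \<bar>det (matrix (\<lambda>h. jac ca cb (cinv ca x) *v h))\<bar> * form_rep A cb \<omega> (g x) std_frame)"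
    unfolding gS[symmetric]
  proof (rule integral_change_of_variables_real[OF S der inj])
    show "(\<lambda>x. form_rep A cb \<omega> x std_frame) absolutely_integrable_on (g ` S)"
      unfolding gS by (rule chart_integrable[OF \<omega> c(2) K(1) _ K(3)]) (use K(2) in auto)
  qed
  also have "\<dots> = integral S (\<lambda>x. form_rep A ca \<omega> x std_frame)"
  proof (rule Henstock_Kurzweil_Integration.integral_cong)
    fix x assume x: "x \<in> S"
    then obtain p where p: "p \<in> fst ca" "p \<in> fst cb" "x = snd ca p" by (auto simp: S_def)
    have alt: "alternating_form CARD('d) (form_rep A cb \<omega> y)" for y
      by (rule form_rep_alternating[OF forms_alternating[OF \<omega>]])
    have "form_rep A ca \<omega> x std_frame = form_rep A cb \<omega> (snd cb p) (\<lambda>i. jac ca cb p *v std_frame i)"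
      unfolding p(3) by (rule form_rep_trans[OF c p(1,2)])
    also have "\<dots> = det (jac ca cb p) * form_rep A cb \<omega> (snd cb p) std_frame"
      using top_form_det[OF alt, of _ "\<lambda>i. jac ca cb p *v std_frame i"] by (simp add: frame_det_matrix frame_det_std)
    finally show "\<bar>det (matrix (\<lambda>h. jac ca cb (cinv ca x) *v h))\<bar> * form_rep A cb \<omega> (g x) std_frame = form_rep A ca \<omega> x std_frame"
      using det[OF x] p c gp[of p] by simp
  qed
  also have "\<dots> = chart_integral A ca \<omega>"
    unfolding S_def by (rule chart_integral_subset[OF c(1) K(2) _ K(3), symmetric]) auto
  finally show ?thesis by simp
qed

text \<open>The partition hidden in \<open>form_integral\<close> does not depend on the form, so it
  can be fixed once for all forms.\<close>

lemma form_integral_partition: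
  "\<exists>C \<theta>. partition_of_unity A C \<theta> \<and>
    (\<forall>\<omega>. form_integral A \<omega> = (\<Sum>c\<in>C. chart_integral A c (\<lambda>p w. \<theta> c p * \<omega> p w)))"
proof -
  obtain C \<theta> where s: "(C, \<theta>) = (SOME (C, \<theta>). partition_of_unity A C \<theta>)" by (metis surj_pair)
  have "\<exists>z. case z of (C, \<theta>) \<Rightarrow> partition_of_unity A C \<theta>" using partition_of_unity_exists by auto
  from someI_ex[OF this] have p: "partition_of_unity A C \<theta>" unfolding s[symmetric] by simp
  have "form_integral A \<omega> = (\<Sum>c\<in>C. chart_integral A c (\<lambda>p w. \<theta> c p * \<omega> p w))" for \<omega>
    unfolding form_integral_def s[symmetric] chart_integral_def by (simp add: form_rep_def)
  with p show ?thesis by blast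
qed

lemma partition_facts:
  assumes "partition_of_unity A C \<theta>"
  shows "finite C" "C \<subseteq> A" "\<And>c. c \<in> C \<Longrightarrow> smooth_fun A (\<theta> c)" "\<And>p. (\<Sum>c\<in>C. \<theta> c p) = 1"
    "\<And>c. c \<in> C \<Longrightarrow> \<exists>K. closed K \<and> K \<subseteq> fst c \<and> (\<forall>p. p \<notin> K \<longrightarrow> \<theta> c p = 0)"
proof -
  show "\<exists>K. closed K \<and> K \<subseteq> fst c \<and> (\<forall>p. p \<notin> K \<longrightarrow> \<theta> c p = 0)" if "c \<in> C" for c
    using assms that closure_subset[of "{p. \<theta> c p \<noteq> 0}"] unfolding partition_of_unity_def
    by (intro exI[of _ "closure {p. \<theta> c p \<noteq> 0}"]) blast
qed (use assms in \<open>auto simp: partition_of_unity_def\<close>)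

text \<open>Each piece weighted by the partition is supported in the overlap of its own chart with
  \<open>c\<close> and may be moved to \<open>c\<close>; there the weights add up to 1.\<close>

lemma form_integral_chart:
  assumes \<omega>: "\<omega> \<in> forms A CARD('d)" and c: "c \<in> A"
    and K: "closed K" "K \<subseteq> fst c" "\<forall>p w. p \<notin> K \<longrightarrow> \<omega> p w = 0"
  shows "form_integral A \<omega> = chart_integral A c \<omega>"
proof -
  obtain C \<theta> where p: "partition_of_unity A C \<theta>"
    and f: "\<And>\<omega>. form_integral A \<omega> = (\<Sum>c\<in>C. chart_integral A c (\<lambda>p w. \<theta> c p * \<omega> p w))"
    using form_integral_partition by blast
  note \<theta> = partition_facts[OF p]
  have \<theta>\<omega>: "(\<lambda>p w. \<theta> b p * \<omega> p w) \<in> forms A CARD('d)" if "b \<in> C" for b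
    using forms_scale[OF \<omega> \<theta>(3)[OF that]] .
  have "form_integral A \<omega> = (\<Sum>b\<in>C. chart_integral A c (\<lambda>p w. \<theta> b p * \<omega> p w))"
    unfolding f
  proof (intro sum.cong refl)
    fix b assume b: "b \<in> C"
    show "chart_integral A b (\<lambda>p w. \<theta> b p * \<omega> p w) = chart_integral A c (\<lambda>p w. \<theta> b p * \<omega> p w)"
    proof -
      obtain L where L: "closed L" "L \<subseteq> fst b" "\<And>p. p \<notin> L \<Longrightarrow> \<theta> b p = 0" using \<theta>(5)[OF b] by blast
      show ?thesis
        by (rule chart_integral_indep[OF \<theta>\<omega>[OF b] _ c, of _ "L \<inter> K"])
          (use b \<theta>(2) L K in \<open>auto simp: closed_Int\<close>)
    qed
  qed
  also have "\<dots> = integral (cimg c) (\<lambda>x. \<Sum>b\<in>C. form_rep A c (\<lambda>p w. \<theta> b p * \<omega> p w) x std_frame)"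
    unfolding chart_integral_def
  proof (rule Henstock_Kurzweil_Integration.integral_sum[symmetric, OF \<theta>(1)])
    fix b assume b: "b \<in> C"
    have "(\<lambda>x. form_rep A c (\<lambda>p w. \<theta> b p * \<omega> p w) x std_frame) absolutely_integrable_on (cimg c)"
      by (rule chart_integrable[OF \<theta>\<omega>[OF b] A_compat[OF c] K(1,2)])
        (use K coord_in in auto)
    then show "(\<lambda>x. form_rep A c (\<lambda>p w. \<theta> b p * \<omega> p w) x std_frame) integrable_on cimg c"
      by (rule set_lebesgue_integral_eq_integral(1))
  qed
  also have "\<dots> = chart_integral A c \<omega>"
    unfolding chart_integral_def form_rep_def sum_distrib_right[symmetric] \<theta>(4) by simp
  finally show ?thesis .
qed

lemma form_integral_sum:
  assumes \<omega>: "\<And>a. a \<in> I \<Longrightarrow> \<omega> a \<in> forms A CARD('d)" and I: "finite I"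
  shows "form_integral A (\<lambda>p w. \<Sum>a\<in>I. \<omega> a p w) = (\<Sum>a\<in>I. form_integral A (\<omega> a))"
proof -
  obtain C \<theta> where p: "partition_of_unity A C \<theta>"
    and f: "\<And>\<omega>. form_integral A \<omega> = (\<Sum>c\<in>C. chart_integral A c (\<lambda>p w. \<theta> c p * \<omega> p w))"
    using form_integral_partition by blast
  note \<theta> = partition_facts[OF p]
  have "chart_integral A c (\<lambda>p w. \<theta> c p * (\<Sum>a\<in>I. \<omega> a p w)) = (\<Sum>a\<in>I. chart_integral A c (\<lambda>p w. \<theta> c p * \<omega> a p w))"
    if c: "c \<in> C" for c
  proof -
    have cA: "compat A c" using c \<theta>(2) A_compat by blast
    obtain L where L: "closed L" "L \<subseteq> fst c" "\<And>p. p \<notin> L \<Longrightarrow> \<theta> c p = 0" using \<theta>(5)[OF c] by blast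
    have "(\<lambda>x. form_rep A c (\<lambda>p w. \<theta> c p * \<omega> a p w) x std_frame) absolutely_integrable_on (cimg c)" if "a \<in> I" for a
      by (rule chart_integrable[OF forms_scale[OF \<omega>[OF that] \<theta>(3)[OF c]] cA L(1,2)])
        (use L coord_in in auto)
    then have "integral (cimg c) (\<lambda>x. \<Sum>a\<in>I. form_rep A c (\<lambda>p w. \<theta> c p * \<omega> a p w) x std_frame)
      = (\<Sum>a\<in>I. integral (cimg c) (\<lambda>x. form_rep A c (\<lambda>p w. \<theta> c p * \<omega> a p w) x std_frame))"
      by (intro Henstock_Kurzweil_Integration.integral_sum[OF I] set_lebesgue_integral_eq_integral(1))
    then show ?thesis by (simp add: chart_integral_def form_rep_def sum_distrib_left)
  qed
  then show ?thesis unfolding f by (simp add: sum.swap[of _ C I])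
qed

end

section \<open>Variation of the Ricci form\<close>

lemma open_slab: "open S \<Longrightarrow> open (UNIV \<times> S :: (real \<times> 'a::euclidean_space) set)"
  by (simp add: open_Times)

section \<open>Functions of time and space, and their mixed derivatives\<close>

context
  fixes g :: "real \<times> 'a::euclidean_space \<Rightarrow> 'b::euclidean_space" and U :: "(real \<times> 'a) set"
  assumes U: "open U" and g: "smooth_on U g"
begin

lemma slice_dd:
  assumes "(s, x) \<in> U"
  shows "dd (\<lambda>y. g (s, y)) x h = dd g (s, x) (0, h)"
proof -
  have "((\<lambda>y. (s, y)) has_derivative (\<lambda>h. (0, h))) (at x)"
    by (intro has_derivative_Pair has_derivative_ident has_derivative_const)
  from has_derivative_compose[OF this smooth_on_has_derivative[OF g]] assms
  have "((\<lambda>y. g (s, y)) has_derivative (\<lambda>h. dd g (s, x) (0, h))) (at x)" by simp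
  from dd_eq[OF this] show ?thesis by simp
qed

lemma slice_smooth: "open S \<Longrightarrow> (\<And>y. y \<in> S \<Longrightarrow> (s, y) \<in> U) \<Longrightarrow> smooth_on S (\<lambda>y. g (s, y))"
  by (rule smooth_on_compose[OF g _ _ U]) (auto intro!: smooth_intros)

lemma time_derivative:
  assumes "(t, x) \<in> U"
  shows "((\<lambda>s. g (s, x)) has_vector_derivative dd g (t, x) (1, 0)) (at t)"
proof -
  have "((\<lambda>s. (s, x)) has_derivative (\<lambda>h. (h, 0))) (at t)"
    by (intro has_derivative_Pair has_derivative_ident has_derivative_const)
  from has_derivative_compose[OF this smooth_on_has_derivative[OF g]] assms
  have 1: "((\<lambda>s. g (s, x)) has_derivative (\<lambda>h. dd g (t, x) (h, 0))) (at t)" by simp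
  have "g differentiable at (t, x)" by (rule smooth_on_differentiable[OF g]) (use assms in simp)
  from linear_scale[OF dd_linear[OF this], of _ "(1, 0)"]
  have "dd g (t, x) (h, 0) = h *\<^sub>R dd g (t, x) (1, 0)" for h by (metis mult.right_neutral real_scaleR_def scaleR_Pair scaleR_zero_right)
  then have "(\<lambda>h. dd g (t, x) (h, 0)) = (\<lambda>h. h *\<^sub>R dd g (t, x) (1, 0))" by (rule ext)
  with 1 show ?thesis unfolding has_vector_derivative_def by (simp only:)
qed

end

lemma mixed_derivative:
  fixes g :: "real \<times> 'a::euclidean_space \<Rightarrow> 'b::euclidean_space"
  assumes U: "open U" and g: "smooth_on U g" and x: "(t, x) \<in> U"
  shows "((\<lambda>s. dd g (s, x) (0, h)) has_vector_derivative dd (\<lambda>y. dd g (t, y) (1, 0)) x h) (at t)"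
proof -
  have "((\<lambda>s. dd g (s, x) (0, h)) has_vector_derivative dd (\<lambda>z. dd g z (0, h)) (t, x) (1, 0)) (at t)"
    by (rule time_derivative[OF U smooth_on_dd[OF g] x])
  also have "dd (\<lambda>z. dd g z (0, h)) (t, x) (1, 0) = dd (\<lambda>z. dd g z (1, 0)) (t, x) (0, h)"
    by (rule dd_symmetric[OF U g x])
  also have "\<dots> = dd (\<lambda>y. dd g (t, y) (1, 0)) x h"
    by (rule slice_dd[OF U smooth_on_dd[OF g] x, symmetric])
  finally show ?thesis .
qed

context
  fixes g :: "real \<times> 'a::euclidean_space \<Rightarrow> 'b::euclidean_space" and S :: "'a set"
  assumes S: "open S" and g: "smooth_on (UNIV \<times> S) g"
begin

lemma slab_smooth: "smooth_on S (\<lambda>y. g (s, y))"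
  by (rule slice_smooth[OF open_slab[OF S] g S]) simp

lemma slab_dd: "x \<in> S \<Longrightarrow> dd (\<lambda>y. g (s, y)) x h = dd g (s, x) (0, h)"
  by (rule slice_dd[OF open_slab[OF S] g]) simp

lemma slab_time_derivative:
  "x \<in> S \<Longrightarrow> ((\<lambda>s. g (s, x)) has_vector_derivative dd g (t, x) (1, 0)) (at t)"
  by (rule time_derivative[OF open_slab[OF S] g]) simp

lemma slab_mixed_derivative:
  assumes x: "x \<in> S"
  shows "((\<lambda>s. dd (\<lambda>y. g (s, y)) x h) has_vector_derivative dd (\<lambda>y. dd g (t, y) (1, 0)) x h) (at t)"
  unfolding slab_dd[OF x] by (rule mixed_derivative[OF open_slab[OF S] g]) (use x in simp)

end

lemma trace_matrix_sum: "trace (matrix F) = (\<Sum>i\<in>UNIV. F (axis i 1) $ i)" for F :: "real^'n \<Rightarrow> real^'n"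
  by (simp add: trace_def matrix_def)

lemma linear_axis_expand:
  fixes F :: "real^'n \<Rightarrow> real"
  assumes "linear F"
  shows "F v = (\<Sum>j\<in>UNIV. v $ j * F (axis j 1))"
proof -
  have "F v = F (\<Sum>j\<in>UNIV. v $ j *\<^sub>R axis j 1)" using basis_expansion[of v] by (simp add: scalar_mult_eq_scaleR)
  then show ?thesis by (simp add: linear_sum[OF assms] linear_scale[OF assms])
qed

text \<open>\<open>f\<close> collects the components of a path of almost complex structures in one
  chart; \<open>t\<close> is the time at which derivatives are taken.\<close>

locale ric_path =
  fixes S :: "(real^'d) set" and f :: "real \<times> (real^'d) \<Rightarrow> real^'d^'d" and r :: "real^'d \<Rightarrow> real" and t :: real
  assumes openS: "open S" and f_smooth: "smooth_on (UNIV \<times> S) f"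
    and f2: "\<And>s x. x \<in> S \<Longrightarrow> f (s, x) ** f (s, x) = - mat 1"
    and r_smooth: "smooth_on S r" and r_nonzero: "\<And>x. x \<in> S \<Longrightarrow> r x \<noteq> 0"
begin

definition J :: "real^'d \<Rightarrow> real^'d^'d" where "J x = f (t, x)"

definition K :: "real^'d \<Rightarrow> real^'d^'d" where "K x = dd f (t, x) (1, 0)"

lemma rd: "ric_data S (\<lambda>y. f (s, y)) r"
  by unfold_locales (use openS slab_smooth[OF openS f_smooth] f2 r_smooth r_nonzero in auto)

lemma rdJ: "ric_data S J r"
  using rd[of t] by (simp add: J_def[abs_def])

lemmas J_smooth = ric_data.Js[OF rdJ]

lemma K_smooth: "smooth_on S K"
  unfolding K_def[abs_def] by (rule slab_smooth[OF openS smooth_on_dd[OF f_smooth]])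

lemma K_anti:
  assumes x: "x \<in> S"
  shows "K x ** J x = - (J x ** K x)"
proof -
  note d = slab_time_derivative[OF openS f_smooth x, of t, folded K_def]
  have "((\<lambda>s. f (s, x) ** f (s, x)) has_vector_derivative (f (t, x) ** K x + K x ** f (t, x))) (at t)"
    by (rule bounded_bilinear.has_vector_derivative[OF bounded_bilinear_matrix_mult d d])
  then have "((\<lambda>s. - mat 1) has_vector_derivative (J x ** K x + K x ** J x)) (at t)"
    by (simp add: f2[OF x] J_def)
  then have "J x ** K x + K x ** J x = 0"
    using vector_derivative_unique_at[OF _ has_vector_derivative_const] by blast
  then show ?thesis by (simp add: eq_neg_iff_add_eq_0 add.commute)
qed

abbreviation L :: "real^'d \<Rightarrow> real \<times> (real^'d) \<Rightarrow> real" where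
  "L u z \<equiv> lam_loc (\<lambda>y. f (fst z, y)) r (snd z) u"

lemma L_smooth: "smooth_on (UNIV \<times> S) (L u)"
proof -
  \<comment> \<open>The density is regarded as a function on the slab, so that joint smoothness in
    time and space follows from the closure rules.\<close>
  define r' where "r' = (\<lambda>z :: real \<times> (real^'d). r (snd z))"
  have o: "open (UNIV \<times> S :: (real \<times> (real^'d)) set)" by (rule open_slab[OF openS])
  have r': "smooth_on (UNIV \<times> S) r'"
    unfolding r'_def by (rule smooth_on_compose[OF r_smooth _ o openS]) (auto intro!: smooth_intros o)
  have "smooth_on (UNIV \<times> S) (\<lambda>z. trace (matrix (\<lambda>h. dd f z (0, h) *v u)) + dd r' z (0, f z *v u) / r' z)"
    unfolding matrix_def by (intro smooth_intros o f_smooth r') (use r_nonzero in \<open>auto simp: r'_def\<close>)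
  then show ?thesis
  proof (rule smooth_on_eq_on[OF _ o])
    fix z :: "real \<times> (real^'d)" assume z: "z \<in> UNIV \<times> S"
    then have x: "snd z \<in> S" by auto
    have "dd r' z (0, w) = dd r (snd z) w" for w
    proof -
      have "(r' has_derivative (\<lambda>h. dd r (snd z) (snd h))) (at z)"
        unfolding r'_def
        by (rule has_derivative_compose[OF has_derivative_snd[OF has_derivative_ident] smooth_on_has_derivative[OF r_smooth x]])
      from dd_eq[OF this] show ?thesis by simp
    qed
    then show "L u z = trace (matrix (\<lambda>h. dd f z (0, h) *v u)) + dd r' z (0, f z *v u) / r' z"
      unfolding lam_loc_def slab_dd[OF openS f_smooth x] by (simp add: r'_def)
  qed
qed

definition Lam' :: "real^'d \<Rightarrow> real^'d \<Rightarrow> real" where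
  "Lam' y u = trace (matrix (\<lambda>h. dd K y h *v u)) + dd r y (K y *v u) / r y"

text \<open>Half the exterior derivative of this one-form is the variation of the Ricci form.\<close>

definition Lam :: "real^'d \<Rightarrow> real^'d \<Rightarrow> real" where
  "Lam y u = Lam' y u + 1/2 * trace (K y ** J y ** dd J y u)"

text \<open>For fixed \<open>r\<close> the expression \<open>lam_loc\<close> is linear in
  \<open>J\<close>, so its variation is the same expression in \<open>K\<close>.\<close>

lemma L_time_derivative:
  assumes x: "x \<in> S"
  shows "dd (L u) (t, x) (1, 0) = Lam' x u"
proof -
  have b1: "bounded_linear (\<lambda>M :: real^'d^'d. (M *v u) $ i)" for i
    by (rule bounded_linear_compose[OF bounded_linear_vec_nth bounded_bilinear.bounded_linear_left[OF bounded_bilinear_matrix_vector_mult]])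
  have "linear (dd r x)" by (rule dd_linear[OF smooth_on_differentiable[OF r_smooth x]])
  then have b2: "bounded_linear (\<lambda>M :: real^'d^'d. dd r x (M *v u) / r x)"
    unfolding linear_conv_bounded_linear[symmetric] by (auto simp: linear_iff mv_bilinear add_divide_distrib)
  have "((\<lambda>s. (\<Sum>i\<in>UNIV. (dd (\<lambda>y. f (s, y)) x (axis i 1) *v u) $ i) + dd r x (f (s, x) *v u) / r x)
    has_vector_derivative (\<Sum>i\<in>UNIV. (dd K x (axis i 1) *v u) $ i) + dd r x (K x *v u) / r x) (at t)"
    unfolding K_def[abs_def]
    by (intro has_vector_derivative_add has_vector_derivative_sum bounded_linear.has_vector_derivative[OF b1]
      bounded_linear.has_vector_derivative[OF b2] slab_mixed_derivative[OF openS f_smooth x] slab_time_derivative[OF openS f_smooth x])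
  then have "((\<lambda>s. L u (s, x)) has_vector_derivative Lam' x u) (at t)"
    by (simp add: lam_loc_def Lam'_def trace_matrix_sum)
  from vector_derivative_unique_at[OF slab_time_derivative[OF openS L_smooth x] this] show ?thesis .
qed

lemma Lam'_smooth: "smooth_on S (\<lambda>y. Lam' y u)"
  by (rule smooth_on_eq_on[OF slab_smooth[OF openS smooth_on_dd[OF L_smooth]] openS L_time_derivative[symmetric]])

lemma dd_L_time_derivative:
  assumes x: "x \<in> S"
  shows "((\<lambda>s. dd (\<lambda>y. lam_loc (\<lambda>y. f (s, y)) r y u) x h) has_vector_derivative dd (\<lambda>y. Lam' y u) x h) (at t)"
proof -
  have "dd (\<lambda>y. dd (L u) (t, y) (1, 0)) x h = dd (\<lambda>y. Lam' y u) x h"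
    using dd_cong[OF openS x L_time_derivative] by simp
  then show ?thesis using slab_mixed_derivative[OF openS L_smooth[of u] x, of h t] by simp
qed

lemma KJD_has_derivative:
  assumes x: "x \<in> S"
  shows "((\<lambda>y. trace (K y ** J y ** dd J y u)) has_derivative (\<lambda>h. trace (dd K x h ** J x ** dd J x u)
    + trace (K x ** dd J x h ** dd J x u) + trace (K x ** J x ** dd (\<lambda>y. dd J y u) x h))) (at x)"
proof -
  note d = smooth_on_has_derivative[OF K_smooth x] smooth_on_has_derivative[OF J_smooth x]
    smooth_on_has_derivative[OF smooth_on_dd[OF J_smooth] x]
  have "((\<lambda>y. trace (K y ** J y ** dd J y u)) has_derivative (\<lambda>h. trace ((K x ** J x) ** dd (\<lambda>y. dd J y u) x h
     + (K x ** dd J x h + dd K x h ** J x) ** dd J x u))) (at x)"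
    by (intro bounded_linear.has_derivative[OF bounded_linear_trace] bounded_bilinear.FDERIV[OF bounded_bilinear_matrix_mult] d)
  then show ?thesis by (simp add: mm_bilinear trace_linear algebra_simps)
qed

lemma Lam_smooth: "smooth_on S (\<lambda>y. Lam y u)"
  unfolding Lam_def by (intro smooth_intros openS Lam'_smooth K_smooth J_smooth)

lemma dd_Lam:
  assumes x: "x \<in> S"
  shows "dd (\<lambda>y. Lam y u) x h = dd (\<lambda>y. Lam' y u) x h + 1/2 * (trace (dd K x h ** J x ** dd J x u)
    + trace (K x ** dd J x h ** dd J x u) + trace (K x ** J x ** dd (\<lambda>y. dd J y u) x h))"
  unfolding Lam_def
  by (subst dd_eq[OF has_derivative_add[OF smooth_on_has_derivative[OF Lam'_smooth x] has_derivative_mult_right[OF KJD_has_derivative[OF x]]]])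
    (rule refl)

lemma triple: "x \<in> S \<Longrightarrow> trace (K x ** dd J x u ** dd J x v) = 0"
  using trace_triple_anticommuting[OF ric_data.J2[OF rdJ] K_anti ric_data.dJ_anti[OF rdJ] ric_data.dJ_anti[OF rdJ]] by blast

text \<open>The trace with \<open>K\<close> in the middle vanishes, so the quadratic term varies by
  \<open>1/4 (tr (D\<^sub>u K J D\<^sub>v J) - tr (D\<^sub>v K J D\<^sub>u J))\<close>. This is a
  quarter of the differential of \<open>u \<mapsto> tr (K J D\<^sub>u J)\<close>, because the cubic
  traces vanish and second derivatives are symmetric; hence the last summand of
  \<open>Lam\<close>.\<close>

lemma ric_time_derivative:
  assumes x: "x \<in> S"
  shows "((\<lambda>s. ric_loc (\<lambda>y. f (s, y)) r x u v) has_vector_derivative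
    1/2 * (dd (\<lambda>y. Lam y v) x u - dd (\<lambda>y. Lam y u) x v)) (at t)"
proof -
  note df = slab_mixed_derivative[OF openS f_smooth x, of _ t]
  note K = K_def[abs_def, symmetric] and Js = J_def[abs_def, symmetric]
  have "((\<lambda>s. ric_loc (\<lambda>y. f (s, y)) r x u v) has_vector_derivative
     1/4 * trace ((dd J x u ** J x) ** dd K x v + (dd J x u ** K x + dd K x u ** J x) ** dd J x v)
     + 1/2 * (dd (\<lambda>y. Lam' y v) x u - dd (\<lambda>y. Lam' y u) x v)) (at t)"
    unfolding ric_loc_def J_def[abs_def] K_def[abs_def]
    by (intro has_vector_derivative_add has_vector_derivative_diff has_vector_derivative_mult_right
      bounded_linear.has_vector_derivative[OF bounded_linear_trace]
      bounded_bilinear.has_vector_derivative[OF bounded_bilinear_matrix_mult] dd_L_time_derivative[OF x, unfolded K_def[abs_def]]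
      df slab_time_derivative[OF openS f_smooth x])
  moreover have "trace (dd J x u ** J x ** dd K x v) = - trace (dd K x v ** J x ** dd J x u)"
  proof -
    have "trace (dd J x u ** J x ** dd K x v) = trace (dd K x v ** (dd J x u ** J x))" by (rule trace_mul_sym)
    then show ?thesis by (simp add: ric_data.dJ_anti[OF rdJ x] mm_bilinear trace_linear matrix_mul_assoc)
  qed
  moreover have "trace (dd J x u ** K x ** dd J x v) = 0"
    using triple[OF x, of v u] by (metis trace_mul_sym matrix_mul_assoc)
  moreover have "dd (\<lambda>y. dd J y u) x v = dd (\<lambda>y. dd J y v) x u" by (rule dd_symmetric[OF openS J_smooth x])
  ultimately show ?thesis
    by (simp add: dd_Lam[OF x] mm_bilinear trace_linear triple[OF x] algebra_simps)
qed

lemma Lam_linear: "x \<in> S \<Longrightarrow> linear (Lam x)"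
  using linear_div_trace[of "dd K x"] dd_linear[OF smooth_on_differentiable[OF r_smooth]] dd_linear[OF smooth_on_differentiable[OF J_smooth]]
  by (auto simp: linear_iff Lam_def Lam'_def mv_bilinear mm_bilinear trace_linear add_divide_distrib algebra_simps)

text \<open>Since \<open>K\<close> anticommutes with \<open>J\<close>, the two terms of the Lie
  derivative that contain \<open>V\<close> contribute the same amount.\<close>

lemma trace_K_lie:
  assumes x: "x \<in> S"
  shows "trace (K x ** J x ** (B - V ** J x + J x ** V)) = trace (K x ** J x ** B) - 2 * trace (K x ** V)"
proof -
  note J2 = ric_data.J2[OF rdJ x]
  have "trace (K x ** J x ** (J x ** V)) = - trace (K x ** V)"
  proof -
    have "K x ** J x ** (J x ** V) = K x ** (J x ** J x) ** V" by (simp add: matrix_mul_assoc)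
    then show ?thesis by (simp add: J2 mm_bilinear trace_linear)
  qed
  moreover have "trace (K x ** J x ** (V ** J x)) = trace (K x ** V)"
  proof -
    have "trace (K x ** J x ** (V ** J x)) = trace (J x ** (K x ** J x) ** V)"
      by (metis trace_mul_sym matrix_mul_assoc)
    also have "J x ** (K x ** J x) = - (J x ** J x) ** K x" by (simp add: K_anti[OF x] mm_bilinear matrix_mul_assoc)
    finally show ?thesis by (simp add: J2)
  qed
  ultimately show ?thesis by (simp add: mm_bilinear trace_linear)
qed

context
  fixes a :: "'d \<Rightarrow> 'd \<Rightarrow> real^'d \<Rightarrow> real" and v :: "real^'d \<Rightarrow> real^'d"
  assumes a_smooth: "\<And>i j. smooth_on S (a i j)" and a_anti: "\<And>i j x. a j i x = - a i j x"
    and v_smooth: "smooth_on S v" and v: "\<And>x i. x \<in> S \<Longrightarrow> v x $ i * r x = (\<Sum>j\<in>UNIV. dd (a i j) x (axis j 1))"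
begin

text \<open>The first summand is the integration by parts that turns
  \<open>d\<Lambda> \<and> \<alpha>\<close> into \<open>\<Lambda>(v) \<rho>\<close>. The second is
  the vector density \<open>r K v\<close>, whose divergence supplies the term with
  \<open>tr (K Dv)\<close> in the Lie derivative.\<close>

definition W :: "'d \<Rightarrow> real^'d \<Rightarrow> real" where
  "W i y = (\<Sum>j\<in>UNIV. Lam y (axis j 1) * a i j y) + r y * (K y *v v y) $ i"

definition lie_term :: "real^'d \<Rightarrow> real" where
  "lie_term x = 1/2 * trace (K x ** J x ** (dd J x (v x) - matrix (dd v x) ** J x + J x ** matrix (dd v x))) * r x"

definition ric_term :: "real^'d \<Rightarrow> real" where
  "ric_term x = (\<Sum>i\<in>UNIV. \<Sum>j\<in>UNIV. 1/2 * (dd (\<lambda>y. Lam y (axis j 1)) x (axis i 1) - dd (\<lambda>y. Lam y (axis i 1)) x (axis j 1)) * a i j x)"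

lemma W_smooth: "smooth_on S (W i)"
  unfolding W_def[abs_def] by (intro smooth_intros openS Lam_smooth a_smooth r_smooth K_smooth v_smooth)

lemma dd_W:
  assumes x: "x \<in> S"
  shows "dd (W i) x h = (\<Sum>j\<in>UNIV. Lam x (axis j 1) * dd (a i j) x h + dd (\<lambda>y. Lam y (axis j 1)) x h * a i j x)
    + (r x * (K x *v dd v x h + dd K x h *v v x) $ i + dd r x h * (K x *v v x) $ i)"
proof -
  note d = smooth_on_has_derivative[OF Lam_smooth x] smooth_on_has_derivative[OF a_smooth x] smooth_on_has_derivative[OF r_smooth x]
    smooth_on_has_derivative[OF K_smooth x] smooth_on_has_derivative[OF v_smooth x]
  have "(W i has_derivative (\<lambda>h. (\<Sum>j\<in>UNIV. Lam x (axis j 1) * dd (a i j) x h + dd (\<lambda>y. Lam y (axis j 1)) x h * a i j x)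
    + (r x * (K x *v dd v x h + dd K x h *v v x) $ i + dd r x h * (K x *v v x) $ i))) (at x)"
    unfolding W_def[abs_def]
    by (intro has_derivative_add has_derivative_sum bounded_bilinear.FDERIV[OF bounded_bilinear_mult]
      bounded_linear.has_derivative[OF bounded_linear_vec_nth] bounded_bilinear.FDERIV[OF bounded_bilinear_matrix_vector_mult] d)
  from dd_eq[OF this] show ?thesis by simp
qed

text \<open>The derivatives of \<open>a\<close> give \<open>- r \<Lambda>(v)\<close>, and those of
  \<Lambda> give the Ricci term. The divergence of \<open>r K v\<close> is
  \<open>r \<Lambda>(v)\<close> minus the Lie term: \<Lambda> contains the derivatives of
  \<open>K\<close> and \<open>r\<close>, its last summand matches the part of the Lie term with
  \<open>D\<^sub>v J\<close>, and \<open>trace_K_lie\<close> provides the derivative of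
  \<open>v\<close>.\<close>

lemma divergence_W:
  assumes x: "x \<in> S"
  shows "(\<Sum>i\<in>UNIV. dd (W i) x (axis i 1)) = ric_term x - lie_term x"
proof -
  have "(\<Sum>i\<in>UNIV. \<Sum>j\<in>UNIV. Lam x (axis j 1) * dd (a i j) x (axis i 1)) = - r x * Lam x (v x)"
  proof -
    have anti: "dd (a i j) x h = - dd (a j i) x h" for i j h
    proof -
      have "a i j = (\<lambda>y. - a j i y)" by (rule ext) (rule a_anti)
      then have "dd (a i j) x = dd (\<lambda>y. - a j i y) x" by (rule arg_cong)
      then show ?thesis unfolding dd_eq[OF has_derivative_minus[OF smooth_on_has_derivative[OF a_smooth x]]] by (simp only:)
    qed
    have "(\<Sum>i\<in>UNIV. \<Sum>j\<in>UNIV. Lam x (axis j 1) * dd (a i j) x (axis i 1))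
      = (\<Sum>j\<in>UNIV. Lam x (axis j 1) * - (\<Sum>i\<in>UNIV. dd (a j i) x (axis i 1)))"
      unfolding sum_negf[symmetric] anti[symmetric] sum_distrib_left by (rule sum.swap)
    also have "\<dots> = - r x * Lam x (v x)"
      unfolding v[OF x, symmetric] linear_axis_expand[OF Lam_linear[OF x], of "v x"] sum_distrib_left
      by (intro sum.cong) simp_all
    finally show ?thesis .
  qed
  moreover have "(\<Sum>i\<in>UNIV. \<Sum>j\<in>UNIV. dd (\<lambda>y. Lam y (axis j 1)) x (axis i 1) * a i j x) = ric_term x"
  proof -
    define D where "D = (\<lambda>i j. dd (\<lambda>y. Lam y (axis j 1)) x (axis i 1))"
    \<comment> \<open>By antisymmetry of \<open>a\<close> the two halves of the exterior derivative
      of \<open>Lam\<close> pair equally with it.\<close>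
    have "(\<Sum>i\<in>UNIV. \<Sum>j\<in>UNIV. D j i * a i j x) = (\<Sum>i\<in>UNIV. \<Sum>j\<in>UNIV. - (D i j * a i j x))"
      unfolding sum.swap[of "\<lambda>i j. D j i * a i j x"]
    proof (intro sum.cong refl)
      fix i j show "D i j * a j i x = - (D i j * a i j x)" using a_anti[of j i x] by simp
    qed
    then have "(\<Sum>i\<in>UNIV. \<Sum>j\<in>UNIV. 1/2 * (D i j - D j i) * a i j x) = (\<Sum>i\<in>UNIV. \<Sum>j\<in>UNIV. D i j * a i j x)"
      by (simp add: left_diff_distrib right_diff_distrib sum_subtractf sum_negf sum_divide_distrib[symmetric])
    then show ?thesis unfolding ric_term_def D_def by simp
  qed
  moreover have "(\<Sum>i\<in>UNIV. (K x *v dd v x (axis i 1)) $ i) = trace (K x ** matrix (dd v x))"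
  proof -
    have "linear (dd v x)" by (rule dd_linear[OF smooth_on_differentiable[OF v_smooth x]])
    then have "K x *v dd v x h = (K x ** matrix (dd v x)) *v h" for h
      by (simp add: matrix_vector_mul_assoc[symmetric] matrix_apply)
    then show ?thesis by (simp add: trace_matrix_sum[symmetric])
  qed
  moreover have "(\<Sum>i\<in>UNIV. (dd K x (axis i 1) *v v x) $ i) = trace (matrix (\<lambda>h. dd K x h *v v x))"
    by (simp add: trace_matrix_sum)
  moreover have "(\<Sum>i\<in>UNIV. dd r x (axis i 1) * (K x *v v x) $ i) = dd r x (K x *v v x)"
    by (subst linear_axis_expand[OF dd_linear[OF smooth_on_differentiable[OF r_smooth x]]]) (simp add: mult.commute)
  ultimately have "(\<Sum>i\<in>UNIV. dd (W i) x (axis i 1)) = - r x * Lam x (v x) + ric_term x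
    + (r x * (trace (K x ** matrix (dd v x)) + trace (matrix (\<lambda>h. dd K x h *v v x))) + dd r x (K x *v v x))"
    unfolding dd_W[OF x] sum.distrib by (simp add: sum.distrib sum_distrib_left[symmetric])
  moreover have "r x * Lam x (v x) = r x * trace (matrix (\<lambda>h. dd K x h *v v x)) + dd r x (K x *v v x) + r x * trace (K x ** J x ** dd J x (v x)) / 2"
    using r_nonzero[OF x] by (simp add: Lam_def Lam'_def distrib_left)
  ultimately show ?thesis
    unfolding lie_term_def trace_K_lie[OF x] by (simp add: algebra_simps)
qed

context
  fixes K0 assumes K0: "compact K0" "K0 \<subseteq> S" and a_zero: "\<And>i j x. x \<in> S \<Longrightarrow> x \<notin> K0 \<Longrightarrow> a i j x = 0"
begin

lemma v_zero:
  assumes "x \<in> S" "x \<notin> K0"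
  shows "v x = 0"
proof -
  have "dd (a i j) x h = 0" for i j h
    by (rule dd_zero_open[of "S - K0"]) (use assms a_zero openS K0 in \<open>auto simp: open_Diff compact_imp_closed\<close>)
  then show ?thesis using v[OF assms(1)] r_nonzero[OF assms(1)] by (simp add: vec_eq_iff)
qed

lemma ric_pairing_smooth: "smooth_on (UNIV \<times> S)
  (\<lambda>z. \<Sum>i\<in>UNIV. \<Sum>j\<in>UNIV. ric_loc (\<lambda>y. f (fst z, y)) r (snd z) (axis i 1) (axis j 1) * a i j (snd z))"
proof -
  have o: "open (UNIV \<times> S :: (real \<times> (real^'d)) set)" by (rule open_slab[OF openS])
  have "smooth_on (UNIV \<times> S) (\<lambda>z. ric_loc (\<lambda>y. f (fst z, y)) r (snd z) u w)" for u w
  proof (rule smooth_on_eq_on[OF _ o])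
    show "smooth_on (UNIV \<times> S) (\<lambda>z. 1/4 * trace (dd f z (0, u) ** f z ** dd f z (0, w)) + 1/2 * (dd (L w) z (0, u) - dd (L u) z (0, w)))"
      by (intro smooth_intros o f_smooth L_smooth)
    fix z :: "real \<times> (real^'d)" assume "z \<in> UNIV \<times> S"
    then have x: "snd z \<in> S" by auto
    have "dd (\<lambda>y. lam_loc (\<lambda>y. f (fst z, y)) r y u) (snd z) h = dd (L u) z (0, h)" for u h
      using slab_dd[OF openS L_smooth[of u] x, of "fst z" h] by simp
    then show "ric_loc (\<lambda>y. f (fst z, y)) r (snd z) u w
      = 1/4 * trace (dd f z (0, u) ** f z ** dd f z (0, w)) + 1/2 * (dd (L w) z (0, u) - dd (L u) z (0, w))"
      unfolding ric_loc_def slab_dd[OF openS f_smooth x] by simp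
  qed
  moreover have "smooth_on (UNIV \<times> S) (\<lambda>z :: real \<times> (real^'d). a i j (snd z))" for i j
    by (rule smooth_on_compose[OF a_smooth _ o openS]) (auto intro!: smooth_intros o)
  ultimately show ?thesis by (intro smooth_on_sum smooth_on_mult o)
qed

text \<open>All integrands vanish outside \<open>K0\<close> and extend by zero to the whole space,
  which makes differentiation under the integral and translation invariance available. The time
  derivative and the Lie term then differ by a divergence of compactly supported functions.\<close>

lemma ricci_moment_local:
  "((\<lambda>s. integral S (\<lambda>x. \<Sum>i\<in>UNIV. \<Sum>j\<in>UNIV. ric_loc (\<lambda>y. f (s, y)) r x (axis i 1) (axis j 1) * a i j x))
    has_real_derivative integral S lie_term) (at t)"
proof -
  define H where "H = (\<lambda>z. \<Sum>i\<in>UNIV. \<Sum>j\<in>UNIV. ric_loc (\<lambda>y. f (fst z, y)) r (snd z) (axis i 1) (axis j 1) * a i j (snd z))"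
  define g where "g = (\<lambda>z. if z \<in> UNIV \<times> S then H z else 0)"
  define W0 where "W0 = (\<lambda>i x. if x \<in> S then W i x else 0)"
  have clK: "closed K0" using K0 by (simp add: compact_imp_closed)
  obtain b where b: "K0 \<subseteq> cbox (- b) b" using bounded_subset_cbox_symmetric[OF compact_imp_bounded[OF K0(1)]] .
  have H0: "H (s, x) = 0" if "x \<in> S" "x \<notin> K0" for s x using a_zero[OF that] by (simp add: H_def)
  have g_smooth: "smooth_on UNIV g"
    unfolding g_def
  proof (rule smooth_on_extend_zero[OF open_slab[OF openS]])
    show "closed (UNIV \<times> K0 :: (real \<times> (real^'d)) set)" using clK by (simp add: closed_Times)
    show "smooth_on (UNIV \<times> S) H" unfolding H_def by (rule ric_pairing_smooth)
  qed (use K0 H0 in auto)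
  have g0: "g (s, x) = 0" if "x \<notin> K0" for s x using that H0 by (auto simp: g_def)
  have W0_smooth: "smooth_on UNIV (W0 i)" for i
    unfolding W0_def
    by (rule smooth_on_extend_zero[OF openS clK K0(2) W_smooth]) (simp add: a_zero v_zero W_def)
  have W00: "W0 i x = 0" if "x \<notin> K0" for i x using that by (simp add: a_zero v_zero W0_def W_def)
  have dg0: "dd g (t, x) (1, 0) = 0" if "x \<notin> K0" for x
    by (rule dd_zero_open[OF open_slab[of "- K0"]]) (use that clK g0 in auto)
  have dW0: "dd (W0 i) x h = 0" if "x \<notin> K0" for i x h
    by (rule dd_zero_open[of "- K0"]) (use that clK W00 in auto)
  have int: "F integrable_on UNIV" if "smooth_on UNIV F" "\<And>x. x \<notin> K0 \<Longrightarrow> F x = 0" for F :: "real^'d \<Rightarrow> real"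
    using absolutely_integrable_compact_support[OF smooth_on_imp_continuous_on[OF that(1)] K0(1) that(2) subset_UNIV]
    by (rule set_lebesgue_integral_eq_integral(1))
  have dg: "dd g (t, x) (1, 0) = ric_term x" if x: "x \<in> S" for x
  proof -
    have "((\<lambda>s. \<Sum>i\<in>UNIV. \<Sum>j\<in>UNIV. ric_loc (\<lambda>y. f (s, y)) r x (axis i 1) (axis j 1) * a i j x) has_vector_derivative ric_term x) (at t)"
      unfolding ric_term_def
      by (intro has_vector_derivative_sum bounded_linear.has_vector_derivative[OF bounded_linear_mult_left] ric_time_derivative[OF x])
    then have "((\<lambda>s. g (s, x)) has_vector_derivative ric_term x) (at t)" using x by (simp add: g_def H_def)
    from vector_derivative_unique_at[OF slab_time_derivative[OF open_UNIV g_smooth[folded UNIV_Times_UNIV] UNIV_I] this] show ?thesis .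
  qed
  have "((\<lambda>s. integral (cbox (- b) b) (\<lambda>x. g (s, x))) has_real_derivative integral (cbox (- b) b) (\<lambda>x. dd g (t, x) (1, 0))) (at t)"
    by (rule parametric_integral_derivative[OF g_smooth])
  moreover have "integral (cbox (- b) b) (\<lambda>x. g (s, x)) = integral S (\<lambda>x. H (s, x))" for s
  proof -
    have "integral (cbox (- b) b) (\<lambda>x. g (s, x)) = integral UNIV (\<lambda>x. g (s, x))"
      by (rule integral_eq_off[symmetric]) (use b g0 in auto)
    also have "\<dots> = integral UNIV (\<lambda>x. if x \<in> S then H (s, x) else 0)" by (simp add: g_def)
    finally show ?thesis by (simp add: integral_restrict_UNIV)
  qed
  moreover have "integral (cbox (- b) b) (\<lambda>x. dd g (t, x) (1, 0)) = integral S lie_term"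
  proof -
    have ig: "(\<lambda>x. dd g (t, x) (1, 0)) integrable_on UNIV"
      by (rule int[OF slab_smooth[OF open_UNIV smooth_on_dd[OF g_smooth[folded UNIV_Times_UNIV]]] dg0])
    have iW: "(\<lambda>x. dd (W0 i) x (axis i 1)) integrable_on UNIV" for i
      by (rule int[OF smooth_on_dd[OF W0_smooth] dW0])
    have "integral (cbox (- b) b) (\<lambda>x. dd g (t, x) (1, 0)) = integral UNIV (\<lambda>x. dd g (t, x) (1, 0))"
      by (rule integral_eq_off[symmetric]) (use b dg0 in auto)
    \<comment> \<open>Each subtracted integral is zero, being that of a directional derivative of a
      compactly supported function; under the integral sign the subtraction turns the Ricci term
      into the Lie term.\<close>
    also have "\<dots> = integral UNIV (\<lambda>x. dd g (t, x) (1, 0)) - (\<Sum>i\<in>UNIV. integral UNIV (\<lambda>x. dd (W0 i) x (axis i 1)))"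
      using integral_directional_derivative_zero[OF W0_smooth K0(1) W00] by simp
    also have "\<dots> = integral UNIV (\<lambda>x. dd g (t, x) (1, 0) - (\<Sum>i\<in>UNIV. dd (W0 i) x (axis i 1)))"
      by (subst Henstock_Kurzweil_Integration.integral_diff[OF ig integrable_sum[OF _ iW]])
        (simp_all add: Henstock_Kurzweil_Integration.integral_sum[OF _ iW])
    also have "(\<lambda>x. dd g (t, x) (1, 0) - (\<Sum>i\<in>UNIV. dd (W0 i) x (axis i 1))) = (\<lambda>x. if x \<in> S then lie_term x else 0)"
    proof
      fix x
      show "dd g (t, x) (1, 0) - (\<Sum>i\<in>UNIV. dd (W0 i) x (axis i 1)) = (if x \<in> S then lie_term x else 0)"
      proof (cases "x \<in> S")
        case True
        have "dd (W0 i) x = dd (W i) x" for i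
          by (rule dd_cong[OF openS True]) (simp add: W0_def)
        then show ?thesis using True by (simp add: dg divergence_W)
      next
        case False
        then have "x \<notin> K0" using K0 by blast
        then show ?thesis using False by (simp add: dg0 dW0)
      qed
    qed
    finally show ?thesis by (simp add: integral_restrict_UNIV)
  qed
  ultimately show ?thesis by (simp add: H_def)
qed

end

end

end

section \<open>The moment map identity\<close>

context oriented_mfd begin

lemma smooth_fun_trace:
  assumes "smooth_endo A B"
  shows "smooth_fun A (\<lambda>p. trace (B p))"
  unfolding smooth_fun_def
proof
  fix c assume "c \<in> A"
  then have c: "compat A c" by (rule A_compat)
  have "smooth_on (cimg c) (\<lambda>x. trace (endo_rep A c B x))"
    using c by (intro smooth_intros smooth_endo_chart[OF assms]) auto
  then show "smooth_on (cimg c) ((\<lambda>p. trace (B p)) \<circ> cinv c)"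
  proof (rule smooth_on_eq_on)
    fix x assume x: "x \<in> cimg c"
    then show "((\<lambda>p. trace (B p)) \<circ> cinv c) x = trace (endo_rep A c B x)"
      using trace_endo_rep[OF c cinv_in[OF compat_chart[OF c] x]] c by simp
  qed (use c in simp)
qed

lemma wedge_in_forms:
  assumes \<omega>: "\<omega> \<in> forms A k" and \<eta>: "\<eta> \<in> forms A l"
  shows "wedge k l \<omega> \<eta> \<in> forms A (k + l)"
  unfolding forms_def
proof (intro CollectI conjI allI ballI)
  show "alternating_form (k + l) (wedge k l \<omega> \<eta> p)" for p
    by (rule wedge_alternating[OF forms_alternating[OF \<omega>] forms_alternating[OF \<eta>]])
  fix c and w :: "nat \<Rightarrow> real^'d" assume "c \<in> A"
  then have c: "compat A c" by (rule A_compat)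
  have "smooth_on (cimg c) (\<lambda>x. (\<Sum>\<sigma> | \<sigma> permutes {..<k + l}.
        of_int (sign \<sigma>) * form_rep A c \<omega> x (\<lambda>i. w (\<sigma> i)) * form_rep A c \<eta> x (\<lambda>i. w (\<sigma> (k + i)))) / (fact k * fact l))"
    using c by (intro smooth_intros smooth_form_chart[OF \<omega>] smooth_form_chart[OF \<eta>]) auto
  then show "smooth_on (cimg c) (\<lambda>x. form_rep A c (wedge k l \<omega> \<eta>) x w)"
    by (simp add: form_rep_def wedge_def)
qed

lemma smooth_lie_endo:
  assumes B: "smooth_endo A B" and v: "smooth_vf A v"
  shows "smooth_endo A (lie_endo A v B)"
  unfolding smooth_endo_def
proof
  fix c assume "c \<in> A"
  then have c: "compat A c" by (rule A_compat)
  have "smooth_on (cimg c) (\<lambda>x. dd (endo_rep A c B) x (vf_rep A c v x)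
      - matrix (dd (vf_rep A c v) x) ** endo_rep A c B x + endo_rep A c B x ** matrix (dd (vf_rep A c v) x))"
    using c by (intro smooth_intros smooth_endo_chart[OF B] smooth_vf_chart[OF v]) auto
  then show "smooth_on (cimg c) (endo_rep A c (lie_endo A v B))"
  proof (rule smooth_on_eq_on)
    fix x assume x: "x \<in> cimg c"
    have q: "cinv c x \<in> fst c" using c x by simp
    show "endo_rep A c (lie_endo A v B) x = dd (endo_rep A c B) x (vf_rep A c v x)
      - matrix (dd (vf_rep A c v) x) ** endo_rep A c B x + endo_rep A c B x ** matrix (dd (vf_rep A c v) x)"
      using endo_rep_of_conj[OF c q, of "lie_endo A v B", OF lie_endo_rep[OF B v c q]] c x by simp
  qed (use c in simp)
qed

text \<open>Vanishing at \<open>p\<close> alone would not suffice, since the first derivatives of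
  \<open>v\<close> enter; they vanish because \<open>v\<close> is zero near
  \<open>p\<close>.\<close>

lemma lie_endo_zero:
  assumes B: "smooth_endo A B" and v: "smooth_vf A v" and U: "open U" "p \<in> U" "\<And>q. q \<in> U \<Longrightarrow> v q = 0"
  shows "lie_endo A v B p = 0"
proof -
  let ?c = "chart_at A p"
  have c: "compat A ?c" "p \<in> fst ?c" "snd ?c p \<in> cimg ?c" using chart_at by auto
  have o: "open (snd ?c ` (U \<inter> fst ?c))" using U c by (intro open_coord_image) (auto intro!: open_Int)
  have z: "vf_rep A ?c v x = 0" if "x \<in> snd ?c ` (U \<inter> fst ?c)" for x
    using that U c by (auto simp: vf_rep_at)
  have "dd (vf_rep A ?c v) (snd ?c p) = (\<lambda>h. 0)"
    by (rule ext, rule dd_zero_open[OF o _ z]) (use U c in auto)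
  moreover have "vf_rep A ?c v (snd ?c p) = 0" by (rule z) (use U c in auto)
  moreover have "matrix (\<lambda>h :: real^'d. 0 :: real^'d) = 0" by (simp add: matrix_def vec_eq_iff)
  moreover have "dd (endo_rep A ?c B) (snd ?c p) 0 = 0"
    by (rule linear_0[OF dd_linear[OF smooth_on_differentiable[OF smooth_endo_chart[OF B c(1)] c(3)]]])
  ultimately show ?thesis unfolding lie_endo_rep[OF B v c(1,2)] by simp
qed

lemma lie_endo_sum:
  assumes B: "smooth_endo A B" and v: "\<And>a. a \<in> I \<Longrightarrow> smooth_vf A (v a)"
  shows "lie_endo A (\<lambda>q. \<Sum>a\<in>I. v a q) B p = (\<Sum>a\<in>I. lie_endo A (v a) B p)"
  using v
proof (induction I rule: infinite_finite_induct)
  case (insert a F)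
  let ?c = "chart_at A p" and ?w = "\<lambda>q. \<Sum>a\<in>F. v a q"
  have c: "compat A ?c" "p \<in> fst ?c" "snd ?c p \<in> cimg ?c" using chart_at by auto
  have s: "smooth_vf A (v a)" "smooth_vf A ?w" using insert.prems by (auto intro!: smooth_vf_sum)
  have "vf_rep A ?c (\<lambda>q. v a q + ?w q) = (\<lambda>x. vf_rep A ?c (v a) x + vf_rep A ?c ?w x)"
    by (simp add: fun_eq_iff vf_rep_add)
  then have d: "dd (vf_rep A ?c (\<lambda>q. v a q + ?w q)) (snd ?c p) = (\<lambda>h. dd (vf_rep A ?c (v a)) (snd ?c p) h + dd (vf_rep A ?c ?w) (snd ?c p) h)"
    using dd_eq[OF has_derivative_add[OF smooth_on_has_derivative[OF smooth_vf_chart[OF s(1) c(1)] c(3)]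
      smooth_on_has_derivative[OF smooth_vf_chart[OF s(2) c(1)] c(3)]]] by simp
  have m: "matrix (\<lambda>h. f h + g h) = matrix f + matrix g" for f g :: "real^'d \<Rightarrow> real^'d"
    by (simp add: matrix_def vec_eq_iff)
  note lin = linear_add[OF dd_linear[OF smooth_on_differentiable[OF smooth_endo_chart[OF B c(1)] c(3)]]]
  have "lie_endo A (\<lambda>q. v a q + ?w q) B p = lie_endo A (v a) B p + lie_endo A ?w B p"
    unfolding lie_endo_rep[OF B smooth_vf_add[OF s] c(1,2)] lie_endo_rep[OF B s(1) c(1,2)] lie_endo_rep[OF B s(2) c(1,2)]
      d m vf_rep_add lin by (simp add: mm_bilinear)
  then show ?case using insert by simp
qed (simp_all add: lie_endo_zero[OF B smooth_vf_zero open_UNIV UNIV_I])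

end

sublocale vol_mfd \<subseteq> framed_mfd by unfold_locales

context vol_mfd begin

lemma form_integral_cmult: "form_integral A (\<lambda>p w. a * \<omega> p w) = a * form_integral A \<omega>"
proof -
  obtain C \<theta> where f: "\<And>\<omega>. form_integral A \<omega> = (\<Sum>c\<in>C. chart_integral A c (\<lambda>p w. \<theta> c p * \<omega> p w))"
    using form_integral_partition by blast
  have "chart_integral A c (\<lambda>p w. \<theta> c p * (a * \<omega> p w)) = a * chart_integral A c (\<lambda>p w. \<theta> c p * \<omega> p w)" for c
  proof -
    have "(\<lambda>x. form_rep A c (\<lambda>p w. \<theta> c p * (a * \<omega> p w)) x std_frame) = (\<lambda>x. a * form_rep A c (\<lambda>p w. \<theta> c p * \<omega> p w) x std_frame)"
      by (simp add: form_rep_def fun_eq_iff)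
    then show ?thesis unfolding chart_integral_def by simp
  qed
  then show ?thesis unfolding f by (simp add: sum_distrib_left)
qed

context
  fixes J :: "real \<Rightarrow> ('m, 'd) endo" and t :: real
  assumes dim: "CARD('d) \<ge> 2" and path: "smooth_acs_path A J"
begin

lemma path_complex: "almost_complex A (J s)"
  using path by (auto simp: smooth_acs_path_def acs_def)

lemma path_smooth: "smooth_endo A (J s)"
  using path_complex by (auto simp: almost_complex_def)

abbreviation Jr :: "('m, 'd) chart \<Rightarrow> real \<times> (real, 'd) vec \<Rightarrow> ((real, 'd) vec, 'd) vec" where
  "Jr c z \<equiv> endo_rep A c (J (fst z)) (snd z)"

definition Jdot :: "('m, 'd) endo" where
  "Jdot p = vector_derivative (\<lambda>s. J s p) (at t)"

lemma path_chart:
  assumes c: "c \<in> A"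
  shows "ric_path (cimg c) (Jr c) (dens c)"
proof
  note cc = A_compat[OF c]
  show "open (cimg c)" using cc by simp
  have "(\<lambda>(t, x). endo_rep A c (J t) x) = Jr c" by (auto simp: fun_eq_iff)
  then show "smooth_on (UNIV \<times> cimg c) (Jr c)" using path c unfolding smooth_acs_path_def by auto
  show "smooth_on (cimg c) (dens c)" by (rule dens_smooth[OF cc])
qed (use almost_complex_rep[OF path_complex A_compat[OF c]] dens_nonzero[OF A_compat[OF c]] in auto)

lemma Jdot_rep:
  assumes c: "c \<in> A" and p: "p \<in> fst c"
  shows "Jdot p = from_chart A c p ** dd (Jr c) (t, snd c p) (1, 0) ** to_chart A c p"
  unfolding Jdot_def
proof (rule vector_derivative_at)
  note cc = A_compat[OF c]
  interpret P: ric_path "cimg c" "Jr c" "dens c" t by (rule path_chart[OF c])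
  have x: "snd c p \<in> cimg c" using p by simp
  have "((\<lambda>s. from_chart A c p ** Jr c (s, snd c p) ** to_chart A c p) has_vector_derivative
    from_chart A c p ** dd (Jr c) (t, snd c p) (1, 0) ** to_chart A c p) (at t)"
    by (rule bounded_linear.has_vector_derivative[OF bounded_bilinear.bounded_linear_left[OF bounded_bilinear_matrix_mult]])
      (rule bounded_linear.has_vector_derivative[OF bounded_bilinear.bounded_linear_right[OF bounded_bilinear_matrix_mult]],
        rule slab_time_derivative[OF P.openS P.f_smooth x])
  then show "((\<lambda>s. J s p) has_vector_derivative from_chart A c p ** dd (Jr c) (t, snd c p) (1, 0) ** to_chart A c p) (at t)"
    using endo_rep_conj(2)[OF cc p] by simp
qed

lemma Jdot_smooth: "smooth_endo A Jdot"
  unfolding smooth_endo_def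
proof
  fix c assume c: "c \<in> A"
  note cc = A_compat[OF c]
  interpret P: ric_path "cimg c" "Jr c" "dens c" t by (rule path_chart[OF c])
  show "smooth_on (cimg c) (endo_rep A c Jdot)"
  proof (rule smooth_on_eq_on[OF P.K_smooth P.openS])
    fix x assume x: "x \<in> cimg c"
    have q: "cinv c x \<in> fst c" using cc x by simp
    show "endo_rep A c Jdot x = P.K x"
      using endo_rep_of_conj[OF cc q, of Jdot, OF Jdot_rep[OF c q]] cc x by (simp add: P.K_def)
  qed
qed

definition lie_density :: "('m, 'd) form \<Rightarrow> ('m, 'd) form" where
  "lie_density \<alpha> p w = 1/2 * trace (Jdot p ** J t p ** lie_endo A (exact_vf A \<rho> \<alpha>) (J t) p) * \<rho> p w"

lemma moment_chart:
  assumes \<alpha>: "\<alpha> \<in> forms A (CARD('d) - 2)" and c: "c \<in> A"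
    and L: "closed L" "L \<subseteq> fst c" "\<forall>p w. p \<notin> L \<longrightarrow> \<alpha> p w = 0"
  shows "((\<lambda>s. chart_integral A c (wedge 2 (CARD('d) - 2) (\<lambda>p w. 2 * ricci_form A \<rho> (J s) p w) \<alpha>)) has_real_derivative
    chart_integral A c (lie_density \<alpha>)) (at t)"
proof -
  note cc = A_compat[OF c]
  interpret P: ric_path "cimg c" "Jr c" "dens c" t by (rule path_chart[OF c])
  define a where "a = (\<lambda>i j x. bivec (form_rep A c \<alpha> x) i j)"
  define v where "v = vf_rep A c (exact_vf A \<rho> \<alpha>)"
  have vs: "smooth_vf A (exact_vf A \<rho> \<alpha>)" by (rule exact_vf_smooth[OF dim \<alpha>])
  have "compact L" using compact_Int_closed[OF compact_UNIV L(1)] by simp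
  note cL = coord_image_compact[OF cc this L(2)]
  have a1: "smooth_on (cimg c) (a i j)" "a j i x = - a i j x" for i j x
    unfolding a_def by (rule bivec_smooth[OF dim \<alpha> cc], rule bivec_antisym[OF dim])
  have a2: "smooth_on (cimg c) v" unfolding v_def by (rule smooth_vf_chart[OF vs cc])
  have a3: "v x $ i * dens c x = (\<Sum>j\<in>UNIV. dd (a i j) x (axis j 1))" if "x \<in> cimg c" for x i
    unfolding v_def a_def by (rule interior_component[OF dim \<alpha> exact_vf_interior[OF dim \<alpha>] cc that])
  have a4: "a i j x = 0" if "x \<in> cimg c" "x \<notin> snd c ` L" for i j x
  proof -
    have "cinv c x \<notin> L" using that cc by (metis compat_chart coord_cinv imageI)
    then have "form_rep A c \<alpha> x = (\<lambda>w. 0)" using L(3) by (simp add: form_rep_def fun_eq_iff)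
    then show ?thesis by (simp add: a_def bivec_def cong: if_cong)
  qed
  have "chart_integral A c (wedge 2 (CARD('d) - 2) (\<lambda>p w. 2 * ricci_form A \<rho> (J s) p w) \<alpha>)
    = integral (cimg c) (\<lambda>x. \<Sum>i\<in>UNIV. \<Sum>j\<in>UNIV. ric_loc (\<lambda>y. Jr c (s, y)) (dens c) x (axis i 1) (axis j 1) * a i j x)" for s
    unfolding chart_integral_def
  proof (rule Henstock_Kurzweil_Integration.integral_cong)
    fix x assume x: "x \<in> cimg c"
    let ?B = "\<lambda>u v. 2 * ric_loc (endo_rep A c (J s)) (dens c) x u v"
    have k: "2 + (CARD('d) - 2) = CARD('d)" using dim by simp
    have r: "form_rep A c (\<lambda>p w. 2 * ricci_form A \<rho> (J s) p w) x w = ?B (w 0) (w 1)" for w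
      using ricci_form_rep[OF path_complex[of s] cc x, of w] by (simp add: form_rep_def)
    have "form_rep A c (wedge 2 (CARD('d) - 2) (\<lambda>p w. 2 * ricci_form A \<rho> (J s) p w) \<alpha>) x std_frame
      = (\<Sum>\<sigma> | \<sigma> permutes {..<2 + (CARD('d) - 2)}. of_int (sign \<sigma>) *
          form_rep A c (\<lambda>p w. 2 * ricci_form A \<rho> (J s) p w) x (\<lambda>i. std_frame (\<sigma> i)) *
          form_rep A c \<alpha> x (\<lambda>i. std_frame (\<sigma> (2 + i)))) / (fact 2 * fact (CARD('d) - 2))"
      by (simp only: form_rep_def wedge_def)
    also have "\<dots> = 1/2 * (\<Sum>i\<in>UNIV. \<Sum>j\<in>UNIV. ?B (axis i 1) (axis j 1) * a i j x)"
      unfolding k r a_def by (rule wedge_two_bivec[OF dim])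
    also have "\<dots> = (\<Sum>i\<in>UNIV. \<Sum>j\<in>UNIV. ric_loc (\<lambda>y. Jr c (s, y)) (dens c) x (axis i 1) (axis j 1) * a i j x)"
      by (simp add: sum_distrib_left)
    finally show "form_rep A c (wedge 2 (CARD('d) - 2) (\<lambda>p w. 2 * ricci_form A \<rho> (J s) p w) \<alpha>) x std_frame
      = (\<Sum>i\<in>UNIV. \<Sum>j\<in>UNIV. ric_loc (\<lambda>y. Jr c (s, y)) (dens c) x (axis i 1) (axis j 1) * a i j x)" .
  qed
  moreover have "chart_integral A c (lie_density \<alpha>) = integral (cimg c) (P.lie_term v)"
    unfolding chart_integral_def
  proof (rule Henstock_Kurzweil_Integration.integral_cong)
    fix x assume x: "x \<in> cimg c"
    let ?q = "cinv c x"
    have q: "?q \<in> fst c" "snd c ?q = x" using cc x by auto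
    have lt: "P.lie_term v x = 1/2 * trace (P.K x ** P.J x ** (dd P.J x (v x) - matrix (dd v x) ** P.J x + P.J x ** matrix (dd v x))) * dens c x"
      by (rule P.lie_term_def[of a v], (rule a1 a2 | erule a3)+)
    have "trace (Jdot ?q ** J t ?q ** lie_endo A (exact_vf A \<rho> \<alpha>) (J t) ?q)
      = trace (P.K x ** P.J x ** (dd P.J x (v x) - matrix (dd v x) ** P.J x + P.J x ** matrix (dd v x)))"
      using trace_conj3(1)[OF cc q(1), of Jdot _ "lie_endo A (exact_vf A \<rho> \<alpha>) (J t)", OF Jdot_rep[OF c q(1)]
        lie_endo_rep[OF path_smooth vs cc q(1)], of "J t"]
      unfolding q(2) v_def[symmetric] P.K_def by (simp add: P.J_def[abs_def])
    then show "form_rep A c (lie_density \<alpha>) x std_frame = P.lie_term v x"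
      unfolding lt by (simp add: form_rep_def lie_density_def dens_def)
  qed
  moreover have "((\<lambda>s. integral (cimg c) (\<lambda>x. \<Sum>i\<in>UNIV. \<Sum>j\<in>UNIV. ric_loc (\<lambda>y. Jr c (s, y)) (dens c) x (axis i 1) (axis j 1) * a i j x))
    has_real_derivative integral (cimg c) (P.lie_term v)) (at t)"
    by (rule P.ricci_moment_local, (rule a1 a2 cL | erule a3 | erule a4)+)
  ultimately show ?thesis by (simp only:)
qed

lemma exact_vf_zero:
  assumes \<alpha>: "\<alpha> \<in> forms A (CARD('d) - 2)" and L: "closed L" "\<forall>p w. p \<notin> L \<longrightarrow> \<alpha> p w = 0" and p: "p \<notin> L"
  shows "exact_vf A \<rho> \<alpha> p = 0"
proof -
  let ?c = "chart_at A p"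
  have c: "compat A ?c" "p \<in> fst ?c" "snd ?c p \<in> cimg ?c" using chart_at by auto
  have o: "open (snd ?c ` (fst ?c - L))" using L c by (intro open_coord_image) (auto intro!: open_Diff)
  have z: "bivec (form_rep A ?c \<alpha> x) i j = 0" if x: "x \<in> snd ?c ` (fst ?c - L)" for x i j
  proof -
    have "form_rep A ?c \<alpha> x = (\<lambda>w. 0)" using x L(2) c(1) by (auto simp: form_rep_def fun_eq_iff)
    then show ?thesis by (simp add: bivec_def cong: if_cong)
  qed
  have "dd (\<lambda>x. bivec (form_rep A ?c \<alpha> x) i j) (snd ?c p) h = 0" for i j h
    by (rule dd_zero_open[OF o _ z]) (use p c in auto)
  then have "vf_rep A ?c (exact_vf A \<rho> \<alpha>) (snd ?c p) = 0"
    unfolding exact_vf_rep[OF dim \<alpha> c(1,3)] by (simp add: vec_eq_iff)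
  then show ?thesis using c by (simp add: vf_rep_at)
qed

lemma lie_density_in_forms:
  assumes "\<alpha> \<in> forms A (CARD('d) - 2)"
  shows "lie_density \<alpha> \<in> forms A CARD('d)"
  unfolding lie_density_def[abs_def]
  by (intro forms_scale rho_form smooth_fun_mult smooth_fun_const smooth_fun_trace smooth_endo_mult
    Jdot_smooth path_smooth smooth_lie_endo exact_vf_smooth[OF dim] assms)

text \<open>The partition is applied to \<alpha> and not to the integrands: the local identity
  integrates by parts, so the form and its exact vector field have to be cut off together. Both
  sides are additive in \<alpha>.\<close>

lemma ricci_moment:
  assumes \<alpha>: "\<alpha> \<in> forms A (CARD('d) - 2)"
  shows "((\<lambda>s. form_integral A (wedge 2 (CARD('d) - 2) (\<lambda>p w. 2 * ricci_form A \<rho> (J s) p w) \<alpha>)) has_real_derivative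
    form_integral A (lie_density \<alpha>)) (at t)"
proof -
  let ?n = "CARD('d)" and ?R = "\<lambda>s p w. 2 * ricci_form A \<rho> (J s) p w"
  obtain C \<theta> where part: "partition_of_unity A C \<theta>" using partition_of_unity_exists by blast
  note \<theta> = partition_facts[OF part]
  define \<beta> where "\<beta> = (\<lambda>c p w. \<theta> c p * \<alpha> p w)"
  have \<beta>: "\<beta> c \<in> forms A (?n - 2)" if "c \<in> C" for c
    unfolding \<beta>_def by (rule forms_scale[OF \<alpha> \<theta>(3)[OF that]])
  have \<alpha>\<beta>: "\<alpha> = (\<lambda>p w. \<Sum>c\<in>C. \<beta> c p w)"
    unfolding \<beta>_def sum_distrib_right[symmetric] \<theta>(4) by simp
  have R: "?R s \<in> forms A 2" for s by (rule forms_cmult[OF ricci_form_in_forms[OF path_complex]])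
  have n: "2 + (?n - 2) = ?n" using dim by simp
  have W: "wedge 2 (?n - 2) (?R s) (\<beta> c) \<in> forms A ?n" if "c \<in> C" for s c
    using wedge_in_forms[OF R \<beta>[OF that]] unfolding n .
  have supp: "\<exists>L. closed L \<and> L \<subseteq> fst c \<and> (\<forall>p w. p \<notin> L \<longrightarrow> \<beta> c p w = 0)" if c: "c \<in> C" for c
  proof -
    obtain L where "closed L" "L \<subseteq> fst c" "\<forall>p. p \<notin> L \<longrightarrow> \<theta> c p = 0" using \<theta>(5)[OF c] by blast
    then show ?thesis unfolding \<beta>_def by (intro exI[of _ L]) simp
  qed
  have "form_integral A (wedge 2 (?n - 2) (?R s) \<alpha>) = (\<Sum>c\<in>C. chart_integral A c (wedge 2 (?n - 2) (?R s) (\<beta> c)))" for s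
  proof -
    have "wedge 2 (?n - 2) (?R s) \<alpha> = (\<lambda>p w. \<Sum>c\<in>C. wedge 2 (?n - 2) (?R s) (\<beta> c) p w)"
      unfolding \<alpha>\<beta> wedge_def sum_distrib_left sum_divide_distrib by (subst sum.swap) (rule refl)
    then have "form_integral A (wedge 2 (?n - 2) (?R s) \<alpha>) = form_integral A (\<lambda>p w. \<Sum>c\<in>C. wedge 2 (?n - 2) (?R s) (\<beta> c) p w)"
      by (rule arg_cong)
    also have "\<dots> = (\<Sum>c\<in>C. form_integral A (wedge 2 (?n - 2) (?R s) (\<beta> c)))"
      by (rule form_integral_sum[OF W \<theta>(1)])
    also have "\<dots> = (\<Sum>c\<in>C. chart_integral A c (wedge 2 (?n - 2) (?R s) (\<beta> c)))"
    proof (intro sum.cong refl)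
      fix c assume c: "c \<in> C"
      obtain L where L: "closed L" "L \<subseteq> fst c" "\<forall>p w. p \<notin> L \<longrightarrow> \<beta> c p w = 0" using supp[OF c] by blast
      have "\<forall>p w. p \<notin> L \<longrightarrow> wedge 2 (?n - 2) (?R s) (\<beta> c) p w = 0" using L(3) by (simp add: wedge_def)
      then show "form_integral A (wedge 2 (?n - 2) (?R s) (\<beta> c)) = chart_integral A c (wedge 2 (?n - 2) (?R s) (\<beta> c))"
        using form_integral_chart[OF W[OF c] _ L(1,2)] c \<theta>(2) by blast
    qed
    finally show ?thesis .
  qed
  moreover have "form_integral A (lie_density \<alpha>) = (\<Sum>c\<in>C. chart_integral A c (lie_density (\<beta> c)))"
  proof -
    have "exact_vf A \<rho> \<alpha> = (\<lambda>p. \<Sum>c\<in>C. exact_vf A \<rho> (\<beta> c) p)"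
      unfolding \<alpha>\<beta> by (rule ext, rule exact_vf_sum(2)[OF dim \<beta> \<theta>(1)])
    then have "lie_endo A (exact_vf A \<rho> \<alpha>) (J t) p = (\<Sum>c\<in>C. lie_endo A (exact_vf A \<rho> (\<beta> c)) (J t) p)" for p
      using lie_endo_sum[OF path_smooth exact_vf_smooth[OF dim \<beta>], of C "\<lambda>c. c" t p] by simp
    moreover have "trace (M ** (\<Sum>c\<in>C. N c)) = (\<Sum>c\<in>C. trace (M ** N c))" for M and N :: "_ \<Rightarrow> ((real, 'd) vec, 'd) vec"
    proof -
      have "linear (\<lambda>X. trace (M ** X))" by (auto simp: linear_iff mm_bilinear trace_linear)
      then show ?thesis by (rule linear_sum)
    qed
    ultimately have "lie_density \<alpha> = (\<lambda>p w. \<Sum>c\<in>C. lie_density (\<beta> c) p w)"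
      by (simp add: lie_density_def fun_eq_iff sum_distrib_left sum_distrib_right sum_divide_distrib)
    then have "form_integral A (lie_density \<alpha>) = form_integral A (\<lambda>p w. \<Sum>c\<in>C. lie_density (\<beta> c) p w)"
      by (rule arg_cong)
    also have "\<dots> = (\<Sum>c\<in>C. form_integral A (lie_density (\<beta> c)))"
      by (rule form_integral_sum[OF lie_density_in_forms[OF \<beta>] \<theta>(1)])
    also have "\<dots> = (\<Sum>c\<in>C. chart_integral A c (lie_density (\<beta> c)))"
    proof (intro sum.cong refl)
      fix c assume c: "c \<in> C"
      obtain L where L: "closed L" "L \<subseteq> fst c" "\<forall>p w. p \<notin> L \<longrightarrow> \<beta> c p w = 0" using supp[OF c] by blast
      have "lie_endo A (exact_vf A \<rho> (\<beta> c)) (J t) p = 0" if p: "p \<notin> L" for p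
        by (rule lie_endo_zero[OF path_smooth exact_vf_smooth[OF dim \<beta>[OF c]], of "- L"])
          (use L(1) p exact_vf_zero[OF \<beta>[OF c] L(1,3)] in auto)
      moreover have "trace (0 :: ((real, 'd) vec, 'd) vec) = 0" by (simp add: trace_def)
      ultimately have "\<forall>p w. p \<notin> L \<longrightarrow> lie_density (\<beta> c) p w = 0"
        by (simp add: lie_density_def mm_bilinear)
      then show "form_integral A (lie_density (\<beta> c)) = chart_integral A c (lie_density (\<beta> c))"
        using form_integral_chart[OF lie_density_in_forms[OF \<beta>[OF c]] _ L(1,2)] c \<theta>(2) by blast
    qed
    finally show ?thesis .
  qed
  moreover have "((\<lambda>s. \<Sum>c\<in>C. chart_integral A c (wedge 2 (?n - 2) (?R s) (\<beta> c))) has_real_derivative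
    (\<Sum>c\<in>C. chart_integral A c (lie_density (\<beta> c)))) (at t)"
  proof (rule DERIV_sum)
    fix c assume c: "c \<in> C"
    obtain L where L: "closed L" "L \<subseteq> fst c" "\<forall>p w. p \<notin> L \<longrightarrow> \<beta> c p w = 0" using supp[OF c] by blast
    show "((\<lambda>s. chart_integral A c (wedge 2 (?n - 2) (?R s) (\<beta> c))) has_real_derivative chart_integral A c (lie_density (\<beta> c))) (at t)"
      by (rule moment_chart[OF \<beta>[OF c] _ L]) (use c \<theta>(2) in blast)
  qed
  ultimately show ?thesis by simp
qed

lemma ricci_moment_trace:
  assumes "\<alpha> \<in> forms A (CARD('d) - 2)"
  shows "((\<lambda>s. form_integral A (wedge 2 (CARD('d) - 2) (\<lambda>p w. 2 * ricci_form A \<rho> (J s) p w) \<alpha>)) has_real_derivative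
    1/2 * form_integral A (\<lambda>p w. trace (vector_derivative (\<lambda>s. J s p) (at t) ** J t p
      ** lie_endo A (exact_vf A \<rho> \<alpha>) (J t) p) * \<rho> p w)) (at t)"
proof -
  have "form_integral A (lie_density \<alpha>) = 1/2 * form_integral A (\<lambda>p w. trace (vector_derivative (\<lambda>s. J s p) (at t) ** J t p
      ** lie_endo A (exact_vf A \<rho> \<alpha>) (J t) p) * \<rho> p w)"
    unfolding form_integral_cmult[symmetric] by (simp add: lie_density_def[abs_def] Jdot_def)
  with ricci_moment[OF assms] show ?thesis by simp
qed

end

end

section \<open>Exact volume preserving diffeomorphisms\<close>

context vol_mfd begin

text \<open>The divergence of \<open>r v\<close> is the double sum of second derivatives of an
  antisymmetric array, which vanishes by symmetry of second derivatives.\<close>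

lemma exact_divergence_free:
  assumes dim: "CARD('d) \<ge> 2" and \<alpha>: "\<alpha> \<in> forms A (CARD('d) - 2)"
    and v: "interior_prod v \<rho> = ext_d A (CARD('d) - 2) \<alpha>" and c: "compat A c" and vs: "smooth_on (cimg c) (vf_rep A c v)"
    and x: "x \<in> cimg c"
  shows "dd (dens c) x (vf_rep A c v x) + trace (matrix (dd (vf_rep A c v) x)) * dens c x = 0"
proof -
  let ?v = "vf_rep A c v" and ?r = "dens c"
  define a where "a = (\<lambda>i j y. bivec (form_rep A c \<alpha> y) i j)"
  define T where "T = (\<lambda>i j. dd (\<lambda>y. dd (a i j) y (axis j 1)) x (axis i 1))"
  have o: "open (cimg c)" using c by simp
  have as: "smooth_on (cimg c) (a i j)" for i j
    unfolding a_def by (rule bivec_smooth[OF dim \<alpha> c])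
  have anti: "a j i y = - a i j y" for i j y unfolding a_def by (rule bivec_antisym[OF dim])
  have "T j i = - T i j" for i j
  proof -
    have "dd (a j i) y (axis i 1) = - dd (a i j) y (axis i 1)" if y: "y \<in> cimg c" for y
    proof -
      have "dd (a j i) y = dd (\<lambda>y. - a i j y) y" by (rule arg_cong[of "a j i"]) (rule ext, rule anti)
      then show ?thesis by (simp add: dd_eq[OF has_derivative_minus[OF smooth_on_has_derivative[OF as y]]])
    qed
    then have "dd (\<lambda>y. dd (a j i) y (axis i 1)) x = dd (\<lambda>y. - dd (a i j) y (axis i 1)) x"
      by (rule dd_cong[OF o x])
    then have "T j i = dd (\<lambda>y. - dd (a i j) y (axis i 1)) x (axis j 1)"
      unfolding T_def by (rule fun_cong)
    also have "\<dots> = - dd (\<lambda>y. dd (a i j) y (axis i 1)) x (axis j 1)"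
      by (simp add: dd_eq[OF has_derivative_minus[OF smooth_on_has_derivative[OF smooth_on_dd[OF as] x]]])
    also have "\<dots> = - T i j"
      unfolding T_def by (simp only: dd_symmetric[OF o as x, of i j "axis i 1" "axis j 1"])
    finally show ?thesis .
  qed
  then have "(\<Sum>j\<in>UNIV. \<Sum>i\<in>UNIV. T j i) = (\<Sum>j\<in>UNIV. \<Sum>i\<in>UNIV. - T i j)"
    by (intro sum.cong refl)
  also have "\<dots> = (\<Sum>i\<in>UNIV. \<Sum>j\<in>UNIV. - T i j)" by (rule sum.swap)
  finally have "(\<Sum>i\<in>UNIV. \<Sum>j\<in>UNIV. T i j) = (\<Sum>i\<in>UNIV. \<Sum>j\<in>UNIV. - T i j)" .
  then have T0: "(\<Sum>i\<in>UNIV. \<Sum>j\<in>UNIV. T i j) = 0" by (simp add: sum_negf)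
  have "(\<Sum>j\<in>UNIV. T i j) = ?v x $ i * dd ?r x (axis i 1) + dd ?v x (axis i 1) $ i * ?r x" for i
  proof -
    have "((\<lambda>y. ?v y $ i * ?r y) has_derivative (\<lambda>h. ?v x $ i * dd ?r x h + dd ?v x h $ i * ?r x)) (at x)"
      by (intro bounded_bilinear.FDERIV[OF bounded_bilinear_mult] bounded_linear.has_derivative[OF bounded_linear_vec_nth]
        smooth_on_has_derivative[OF vs x] smooth_on_has_derivative[OF dens_smooth[OF c] x])
    then have 1: "((\<lambda>y. \<Sum>j\<in>UNIV. dd (a i j) y (axis j 1)) has_derivative (\<lambda>h. ?v x $ i * dd ?r x h + dd ?v x h $ i * ?r x)) (at x)"
      by (rule has_derivative_transform_within_open[OF _ o x])
        (unfold a_def, rule interior_component[OF dim \<alpha> v c])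
    have 2: "((\<lambda>y. \<Sum>j\<in>UNIV. dd (a i j) y (axis j 1)) has_derivative (\<lambda>h. \<Sum>j\<in>UNIV. dd (\<lambda>y. dd (a i j) y (axis j 1)) x h)) (at x)"
      by (intro has_derivative_sum smooth_on_has_derivative[OF smooth_on_dd[OF as] x])
    show ?thesis unfolding T_def by (rule fun_cong[OF has_derivative_unique[OF 2 1]])
  qed
  then have "0 = (\<Sum>i\<in>UNIV. ?v x $ i * dd ?r x (axis i 1) + dd ?v x (axis i 1) $ i * ?r x)"
    using T0 by simp
  also have "\<dots> = dd ?r x (?v x) + trace (matrix (dd ?v x)) * ?r x"
    by (simp add: sum.distrib linear_axis_expand[OF dd_linear[OF smooth_on_differentiable[OF dens_smooth[OF c] x]], of "?v x"]
      trace_matrix_sum sum_distrib_right)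
  finally show ?thesis by simp
qed

context
  fixes \<Phi> :: "real \<Rightarrow> 'm \<Rightarrow> 'm" and v :: "real \<Rightarrow> ('m, 'd) vfield" and I :: "real set"
  assumes dim: "CARD('d) \<ge> 2" and I: "open I" "{0..1} \<subseteq> I"
    and \<Phi>: "smooth_family_maps A I \<Phi>" and vf: "smooth_family_vf A I v"
    and flow_diffeo: "\<And>t. t \<in> {0..1} \<Longrightarrow> diffeo A (\<Phi> t)"
    and flow: "\<And>t p. t \<in> {0..1} \<Longrightarrow> ((\<lambda>s. snd (chart_at A (\<Phi> t p)) (\<Phi> s p)) has_vector_derivative v t (\<Phi> t p)) (at t)"
    and exact: "\<And>t. t \<in> {0..1} \<Longrightarrow> exact_form A (CARD('d) - 1) (interior_prod (v t) \<rho>)"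
begin

text \<open>The flow equation at time \<open>t\<close> is given in the preferred chart at
  \<open>\<Phi> t p\<close>. Continuity of the family keeps nearby times in that chart, so the chain
  rule carries the equation to any other chart around the point.\<close>

lemma flow_chart:
  assumes t: "t \<in> {0..1}" and c: "c \<in> A" and p: "\<Phi> t p \<in> fst c"
  shows "((\<lambda>s. snd c (\<Phi> s p)) has_vector_derivative vf_rep A c (v t) (snd c (\<Phi> t p))) (at t)"
proof -
  let ?q = "\<Phi> t p"
  let ?b = "chart_at A ?q"
  note cc = A_compat[OF c]
  have b: "compat A ?b" "?q \<in> fst ?b" using chart_at by auto
  have 1: "((snd c \<circ> cinv ?b) has_derivative (\<lambda>h. to_chart A c ?q *v h)) (at (snd ?b ?q))"
    using jac_has_derivative[OF b(1) cc b(2) p] by (simp add: to_chart_jac)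
  have 2: "((\<lambda>s. snd ?b (\<Phi> s p)) has_derivative (\<lambda>h. h *\<^sub>R v t ?q)) (at t)"
    using flow[OF t, of p] by (simp add: has_vector_derivative_def)
  have 3: "((\<lambda>s. (snd c \<circ> cinv ?b) (snd ?b (\<Phi> s p))) has_derivative (\<lambda>h. to_chart A c ?q *v (h *\<^sub>R v t ?q))) (at t)"
    by (rule has_derivative_compose[OF 2 1])
  have cont: "continuous_on I (\<lambda>s. \<Phi> s p)"
  proof -
    have "continuous_on (I \<times> UNIV) (\<lambda>(t, p). \<Phi> t p)" using \<Phi> by (simp add: smooth_family_maps_def)
    then have "continuous_on I (\<lambda>s. (\<lambda>(t, p). \<Phi> t p) (s, p))"
      by (rule continuous_on_compose2) (auto intro!: continuous_intros)
    then show ?thesis by simp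
  qed
  have o: "open (I \<inter> (\<lambda>s. \<Phi> s p) -` fst ?b)"
    by (rule continuous_open_preimage[OF cont I(1)]) (use b in simp)
  have "((\<lambda>s. snd c (\<Phi> s p)) has_derivative (\<lambda>h. to_chart A c ?q *v (h *\<^sub>R v t ?q))) (at t)"
    by (rule has_derivative_transform_within_open[OF 3 o]) (use t I b in auto)
  then show ?thesis
    unfolding has_vector_derivative_def vf_rep_at[OF cc p] by (simp add: mv_bilinear)
qed

text \<open>In a fixed chart the pullback is the volume form along the flow, applied to the images
  of \<open>w\<close> under the Jacobian. Differentiating the density gives \<open>dr(v)\<close>,
  differentiating the arguments gives \<open>tr (Dv) r\<close>, and their sum vanishes by
  \<open>exact_divergence_free\<close>.\<close>

lemma flow_volume_derivative:
  assumes t: "t \<in> {0..1}"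
  shows "((\<lambda>s. pull_form A (\<Phi> s) \<rho> p w) has_derivative (\<lambda>h. 0)) (at t within {0..1})"
proof -
  let ?b = "chart_at A p" and ?c = "chart_at A (\<Phi> t p)"
  define x0 where "x0 = coord_at A p"
  have b: "compat A ?b" "?b \<in> A" "p \<in> fst ?b" "cinv ?b x0 = p" "x0 \<in> cimg ?b"
    using chart_at[of p] by (auto simp: x0_def coord_at_def)
  have c: "compat A ?c" "?c \<in> A" "\<Phi> t p \<in> fst ?c" using chart_at by auto
  define F where "F = (\<lambda>z. snd ?c (\<Phi> (fst z) (cinv ?b (snd z))))"
  define U where "U = {(s, x). s \<in> I \<and> x \<in> cimg ?b \<and> \<Phi> s (cinv ?b x) \<in> fst ?c}"
  have F: "smooth_on U F"
  proof -
    have "(\<lambda>(t, x). snd ?c (\<Phi> t (cinv ?b x))) = F" by (auto simp: F_def)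
    moreover have "smooth_on U (\<lambda>(t, x). snd ?c (\<Phi> t (cinv ?b x)))"
      using \<Phi> b(2) c(2) unfolding smooth_family_maps_def U_def by blast
    ultimately show ?thesis by simp
  qed
  have U: "open U"
  proof -
    have "continuous_on (cimg ?b) (cinv ?b)"
      using compat_chart[OF b(1)] unfolding is_chart_def homeomorphism_def by blast
    then have "continuous_on (I \<times> cimg ?b) (\<lambda>z. cinv ?b (snd z))"
      by (rule continuous_on_compose2) (auto intro!: continuous_intros)
    then have 1: "continuous_on (I \<times> cimg ?b) (\<lambda>z. (fst z, cinv ?b (snd z)))"
      by (intro continuous_on_Pair continuous_on_fst continuous_on_id)
    have 2: "continuous_on (I \<times> UNIV) (\<lambda>(t, p). \<Phi> t p)" using \<Phi> by (simp add: smooth_family_maps_def)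
    have "continuous_on (I \<times> cimg ?b) (\<lambda>z. (\<lambda>(t, p). \<Phi> t p) (fst z, cinv ?b (snd z)))"
      by (rule continuous_on_compose2[OF 2 1]) auto
    then have "open ((I \<times> cimg ?b) \<inter> (\<lambda>z. (\<lambda>(t, p). \<Phi> t p) (fst z, cinv ?b (snd z))) -` fst ?c)"
      by (rule continuous_open_preimage) (use I b c in \<open>auto intro: open_Times\<close>)
    moreover have "(I \<times> cimg ?b) \<inter> (\<lambda>z. (\<lambda>(t, p). \<Phi> t p) (fst z, cinv ?b (snd z))) -` fst ?c = U" by (auto simp: U_def)
    ultimately show ?thesis by simp
  qed
  have tU: "(t, x0) \<in> U" using t I b c by (auto simp: U_def)
  let ?v = "vf_rep A ?c (v t)" and ?y = "F (t, x0)"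
  have y: "?y \<in> cimg ?c" "?y = snd ?c (\<Phi> t p)" using b c by (auto simp: F_def)
  have vs: "smooth_on (cimg ?c) ?v"
  proof -
    have 1: "smooth_on (I \<times> cimg ?c) (\<lambda>(t, x). vf_rep A ?c (v t) x)" using vf c(2) by (auto simp: smooth_family_vf_def)
    have 2: "open (I \<times> cimg ?c)" using I c by (auto intro: open_Times)
    have "smooth_on (cimg ?c) (\<lambda>x. (\<lambda>(t, x). vf_rep A ?c (v t) x) (t, x))"
      by (rule slice_smooth[OF 2 1]) (use c t I in auto)
    then show ?thesis by simp
  qed
  \<comment> \<open>The flow equation holds at time \<open>t\<close> for all nearby starting points,
    so it may be differentiated in \<open>x\<close>.\<close>
  have Ft: "dd F (t, x) (1, 0) = ?v (F (t, x))" if x: "(t, x) \<in> U" for x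
  proof -
    have "((\<lambda>s. F (s, x)) has_vector_derivative ?v (F (t, x))) (at t)"
      using flow_chart[OF t c(2), of "cinv ?b x"] x by (simp add: F_def U_def)
    from vector_derivative_unique_at[OF time_derivative[OF U F x] this] show ?thesis .
  qed
  \<comment> \<open>The linearised flow: the time derivative of the Jacobian is the derivative of
    the vector field composed with the Jacobian.\<close>
  have mixed: "((\<lambda>s. dd F (s, x0) (0, h)) has_vector_derivative dd ?v ?y (dd F (t, x0) (0, h))) (at t)" for h
  proof -
    have o: "open ((\<lambda>x. (t, x)) -` U)" by (rule open_vimage[OF U]) (intro continuous_intros)
    have "dd (\<lambda>x. dd F (t, x) (1, 0)) x0 h = dd (\<lambda>x. ?v (F (t, x))) x0 h"
      using dd_cong[OF o, of x0 "\<lambda>x. dd F (t, x) (1, 0)" "\<lambda>x. ?v (F (t, x))"] tU Ft by simp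
    also have "\<dots> = dd ?v ?y (dd F (t, x0) (0, h))"
    proof -
      have "smooth_on ((\<lambda>x. (t, x)) -` U) (\<lambda>x. F (t, x))" by (rule slice_smooth[OF U F o]) simp
      from smooth_on_has_derivative[OF this] tU
      have "((\<lambda>x. F (t, x)) has_derivative dd (\<lambda>x. F (t, x)) x0) (at x0)" by simp
      from has_derivative_compose[OF this smooth_on_has_derivative[OF vs y(1)]]
      show ?thesis using slice_dd[OF U F tU] by (simp add: dd_eq)
    qed
    finally show ?thesis using mixed_derivative[OF U F tU, of h] by simp
  qed
  define h where "h = (\<lambda>s. form_rep A ?c \<rho> (F (s, x0)) (\<lambda>i. dd F (s, x0) (0, w i)))"
  have pull: "pull_form A (\<Phi> s) \<rho> p w = h s" if s: "s \<in> {0..1}" "(s, x0) \<in> U" for s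
  proof -
    have q: "\<Phi> s p \<in> fst ?c" using s(2) b by (simp add: U_def)
    have "to_chart A ?c (\<Phi> s p) ** dmap A (\<Phi> s) p = jacobian (\<lambda>x. F (s, x)) (at x0)"
      unfolding dmap_chart[OF flow_diffeo[OF s(1)] c(2) q, symmetric]
      by (simp add: to_chart_def F_def o_def x0_def)
    moreover have "jacobian (\<lambda>x. F (s, x)) (at x0) *v z = dd F (s, x0) (0, z)" for z
    proof -
      have o: "open ((\<lambda>x. (s, x)) -` U)" by (rule open_vimage[OF U]) (intro continuous_intros)
      have "smooth_on ((\<lambda>x. (s, x)) -` U) (\<lambda>x. F (s, x))" by (rule slice_smooth[OF U F o]) simp
      from smooth_on_differentiable[OF this] s(2)
      have "linear (dd (\<lambda>x. F (s, x)) x0)" by (intro dd_linear) simp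
      then show ?thesis unfolding jacobian_def by (simp add: matrix_apply slice_dd[OF U F s(2)])
    qed
    ultimately have "to_chart A ?c (\<Phi> s p) *v (dmap A (\<Phi> s) p *v z) = dd F (s, x0) (0, z)" for z
      by (simp add: matrix_vector_mul_assoc)
    then show ?thesis
      unfolding h_def pull_form_def form_of_chart[OF c(1) q] using b by (simp add: F_def)
  qed
  have "(h has_derivative (\<lambda>h. 0)) (at t)"
  proof -
    define G where "G = (\<lambda>s. form_rep A ?c \<rho> (F (s, x0)))"
    let ?W = "\<lambda>i s. dd F (s, x0) (0, w i)"
    have Galt: "alternating_form CARD('d) (G s)" for s unfolding G_def by (rule form_rep_alternating[OF rho_alt])
    have Fd: "((\<lambda>s. F (s, x0)) has_derivative (\<lambda>h. h *\<^sub>R ?v ?y)) (at t)"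
      using time_derivative[OF U F tU] Ft[OF tU] by (simp add: has_vector_derivative_def)
    have Gd: "((\<lambda>s. G s W) has_derivative (\<lambda>h. frame_det W * dd (dens ?c) ?y (h *\<^sub>R ?v ?y))) (at t)" for W
      unfolding G_def rho_rep
      by (intro has_derivative_mult_right has_derivative_compose[OF Fd] smooth_on_has_derivative[OF dens_smooth[OF c(1)] y(1)])
    have Wd: "(?W i has_derivative (\<lambda>h. h *\<^sub>R dd ?v ?y (?W i t))) (at t)" for i
      using mixed[of "w i"] by (simp add: has_vector_derivative_def)
    have vlin: "linear (dd ?v ?y)" by (rule dd_linear[OF smooth_on_differentiable[OF vs y(1)]])
    have hG: "h = (\<lambda>s. G s (\<lambda>i. ?W i s))" by (simp add: h_def G_def)
    have "(h has_derivative (\<lambda>h. dd (\<lambda>s. G s (\<lambda>i. ?W i t)) t h + (\<Sum>i<CARD('d). G t ((\<lambda>j. ?W j t)(i := h *\<^sub>R dd ?v ?y (?W i t)))))) (at t)"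
      unfolding hG
      by (rule alternating_form_has_derivative[OF Galt _ Wd]) (use Gd differentiableI in blast)
    moreover have "dd (\<lambda>s. G s (\<lambda>i. ?W i t)) t h + (\<Sum>i<CARD('d). G t ((\<lambda>j. ?W j t)(i := h *\<^sub>R dd ?v ?y (?W i t)))) = 0" for h
    proof -
      have "G t ((\<lambda>j. ?W j t)(i := h *\<^sub>R dd ?v ?y (?W i t))) = h * G t ((\<lambda>j. ?W j t)(i := matrix (dd ?v ?y) *v ?W i t))" if "i < CARD('d)" for i
        using linear_scale[OF alternating_form_linear[OF Galt that]] by (simp add: matrix_apply[OF vlin])
      then have s1: "(\<Sum>i<CARD('d). G t ((\<lambda>j. ?W j t)(i := h *\<^sub>R dd ?v ?y (?W i t)))) = h * (trace (matrix (dd ?v ?y)) * G t (\<lambda>j. ?W j t))"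
        using top_form_trace[OF Galt[of t], of "\<lambda>j. ?W j t" "matrix (dd ?v ?y)"] by (simp add: sum_distrib_left[symmetric])
      have s2: "dd (\<lambda>s. G s (\<lambda>i. ?W i t)) t h = h * (frame_det (\<lambda>i. ?W i t) * dd (dens ?c) ?y (?v ?y))"
        using linear_scale[OF dd_linear[OF smooth_on_differentiable[OF dens_smooth[OF c(1)] y(1)]]] by (simp add: dd_eq[OF Gd])
      have div: "dd (dens ?c) ?y (?v ?y) + trace (matrix (dd ?v ?y)) * dens ?c ?y = 0"
      proof -
        have "CARD('d) - 1 - 1 = CARD('d) - 2" by simp
        then obtain \<beta> where "\<beta> \<in> forms A (CARD('d) - 2)" "interior_prod (v t) \<rho> = ext_d A (CARD('d) - 2) \<beta>"
          using exact[OF t] unfolding exact_form_def by metis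
        from exact_divergence_free[OF dim this c(1) vs y(1)] show ?thesis .
      qed
      have s3: "G t (\<lambda>i. ?W i t) = frame_det (\<lambda>i. ?W i t) * dens ?c ?y" unfolding G_def by (rule rho_rep)
      have "dd (\<lambda>s. G s (\<lambda>i. ?W i t)) t h + (\<Sum>i<CARD('d). G t ((\<lambda>j. ?W j t)(i := h *\<^sub>R dd ?v ?y (?W i t))))
        = h * frame_det (\<lambda>i. ?W i t) * (dd (dens ?c) ?y (?v ?y) + trace (matrix (dd ?v ?y)) * dens ?c ?y)"
        unfolding s1 s2 s3 by (simp only: distrib_left mult_ac)
      then show ?thesis unfolding div by simp
    qed
    ultimately show ?thesis by simp
  qed
  \<comment> \<open>The maps are known to be diffeomorphisms on the closed interval, so the pullback
    is identified with \<open>h\<close> there and the derivative is taken within it.\<close>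
  then have 1: "(h has_derivative (\<lambda>h. 0)) (at t within {0..1})" by (rule has_derivative_at_withinI)
  have "open ((\<lambda>s. (s, x0)) -` U)" by (rule open_vimage[OF U]) (intro continuous_intros)
  then obtain d where d: "d > 0" "\<And>s. dist s t < d \<Longrightarrow> (s, x0) \<in> U"
    using tU by (auto simp: open_dist)
  show ?thesis
    by (rule has_derivative_transform_within[OF 1 d(1) t]) (use pull d(2) in simp)
qed

lemma flow_volume_preserving:
  assumes "\<Phi> 0 = id"
  shows "pull_form A (\<Phi> 1) \<rho> = \<rho>"
proof (intro ext)
  fix p w
  have "pull_form A (\<Phi> 1) \<rho> p w = pull_form A (\<Phi> 0) \<rho> p w"
    by (rule has_derivative_zero_unique[OF _ flow_volume_derivative]) auto
  also have "dmap A id p = to_chart A (chart_at A p) p" by (simp add: dmap_def to_chart_def o_def)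
  then have "pull_form A (\<Phi> 0) \<rho> p w = \<rho> p w" by (simp add: assms pull_form_def)
  finally show "pull_form A (\<Phi> 1) \<rho> p w = \<rho> p w" .
qed

end

lemma Diff_ex_volume_preserving:
  assumes dim: "CARD('d) \<ge> 2" and \<phi>: "\<phi> \<in> Diff_ex A \<rho>"
  shows "diffeo A \<phi>" "pull_form A \<phi> \<rho> = \<rho>"
proof -
  obtain \<Phi> v e where *: "e > 0" "smooth_family_maps A {-e<..<1+e} \<Phi>" "smooth_family_vf A {-e<..<1+e} v"
    "\<Phi> 0 = id" "\<Phi> 1 = \<phi>" and
    "\<forall>t\<in>{0..1}. diffeo A (\<Phi> t) \<and>
        (\<forall>p. ((\<lambda>s. snd (chart_at A (\<Phi> t p)) (\<Phi> s p)) has_vector_derivative v t (\<Phi> t p)) (at t)) \<and>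
        exact_form A (CARD('d) - 1) (interior_prod (v t) \<rho>)"
    using \<phi> unfolding Diff_ex_def by blast
  then have t: "diffeo A (\<Phi> t)" "((\<lambda>s. snd (chart_at A (\<Phi> t p)) (\<Phi> s p)) has_vector_derivative v t (\<Phi> t p)) (at t)"
    "exact_form A (CARD('d) - 1) (interior_prod (v t) \<rho>)" if "t \<in> {0..1}" for t p
    using that by blast+
  show "diffeo A \<phi>" using t(1)[of 1] * by simp
  have "{0..1} \<subseteq> {-e<..<1+e}" using *(1) by auto
  from flow_volume_preserving[OF dim open_greaterThanLessThan this *(2,3) t *(4)] *(5)
  show "pull_form A \<phi> \<rho> = \<rho>" by simp
qed

text \<open>Invariance of a positive volume form forces the differential of \<phi> to have positive
  determinant, so bases adapted to the pulled back structure have the same orientation as their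
  images.\<close>

lemma pull_endo_acs:
  assumes pos: "positive_volume_form A \<rho>" and \<phi>: "diffeo A \<phi>" "pull_form A \<phi> \<rho> = \<rho>" and J: "J \<in> acs A"
  shows "pull_endo A \<phi> J \<in> acs A"
proof -
  have ac: "almost_complex A J" using J by (simp add: acs_def)
  have "frame_det w > 0" if "frame_det w \<noteq> 0"
    and w: "w = (\<lambda>i. if even i then z (i div 2) else pull_endo A \<phi> J p *v z (i div 2))" for w z p
  proof -
    let ?D = "dmap A \<phi> p"
    have "frame_det (std_frame :: nat \<Rightarrow> (real, 'd) vec) > 0" by (simp add: frame_det_std)
    then have r: "\<rho> p std_frame > 0" "\<rho> (\<phi> p) std_frame > 0" using pos unfolding positive_volume_form_def by blast+
    have "\<rho> p std_frame = \<rho> (\<phi> p) (\<lambda>i. ?D *v std_frame i)"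
      using fun_cong[OF fun_cong[OF \<phi>(2), of p], of std_frame] by (simp add: pull_form_def)
    also have "\<dots> = det ?D * \<rho> (\<phi> p) std_frame"
      using top_form_det[OF rho_alt, of "\<phi> p" "\<lambda>i. ?D *v std_frame i"] by (simp add: frame_det_matrix frame_det_std)
    finally have det: "det ?D > 0" using r by (simp add: zero_less_mult_iff)
    then have "invertible ?D" by (simp add: invertible_det_nz)
    then obtain N where "?D ** N = mat 1" "N ** ?D = mat 1" unfolding invertible_def by blast
    then have inv: "?D ** matrix_inv ?D = mat 1" using matrix_inv_eqI by metis
    have Dw: "(\<lambda>i. ?D *v w i) = (\<lambda>i. if even i then ?D *v z (i div 2) else J (\<phi> p) *v (?D *v z (i div 2)))"
      unfolding w pull_endo_def by (auto simp: fun_eq_iff matrix_vector_mul_assoc matrix_mul_assoc inv)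
    have "frame_det (\<lambda>i. ?D *v w i) \<noteq> 0" using that(1) det by (simp add: frame_det_matrix)
    moreover have "frame_det (\<lambda>i. ?D *v w i) \<noteq> 0 \<longrightarrow> frame_det (\<lambda>i. ?D *v w i) > 0"
    proof -
      have "\<forall>p v. let w = (\<lambda>i. if even i then v (i div 2) else J p *v v (i div 2)) in frame_det w \<noteq> 0 \<longrightarrow> frame_det w > 0"
        using J by (simp add: acs_def)
      from this[rule_format, of "\<lambda>k. ?D *v z k" "\<phi> p"] show ?thesis unfolding Dw Let_def .
    qed
    ultimately have "frame_det (\<lambda>i. ?D *v w i) > 0" by blast
    then show ?thesis using det by (simp add: frame_det_matrix zero_less_mult_iff)
  qed
  then show ?thesis
    unfolding acs_def Let_def using pull_almost_complex[OF \<phi>(1) ac] by simp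
qed

lemma ricci_moment_map:
  assumes dim: "CARD('d) \<ge> 2" and pos: "positive_volume_form A \<rho>"
  shows "moment_map_Diff_ex A \<rho> (\<lambda>J' p w. 2 * ricci_form A \<rho> J' p w)"
  unfolding moment_map_Diff_ex_def
proof (intro conjI ballI allI impI)
  fix \<phi> and J :: "('m, 'd) endo" assume \<phi>: "\<phi> \<in> Diff_ex A \<rho>" and J: "J \<in> acs A"
  note d = Diff_ex_volume_preserving[OF dim \<phi>]
  show "pull_endo A \<phi> J \<in> acs A" by (rule pull_endo_acs[OF pos d J])
  have "almost_complex A J" using J by (simp add: acs_def)
  from ricci_form_natural[OF d(1) this]
  have "ricci_form A \<rho> (pull_endo A \<phi> J) = pull_form A \<phi> (ricci_form A \<rho> J)" unfolding d(2) ..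
  then show "(\<lambda>p w. 2 * ricci_form A \<rho> (pull_endo A \<phi> J) p w) = pull_form A \<phi> (\<lambda>p w. 2 * ricci_form A \<rho> J p w)"
    by (simp add: pull_form_def fun_eq_iff)
next
  fix J :: "real \<Rightarrow> ('m, 'd) endo" and t \<alpha>
  assume "\<alpha> \<in> forms A (CARD('d) - 2)" "smooth_acs_path A J"
  from ricci_moment_trace[OF dim this(2,1)]
  show "((\<lambda>s. form_integral A (wedge 2 (CARD('d) - 2) (\<lambda>p w. 2 * ricci_form A \<rho> (J s) p w) \<alpha>)) has_real_derivative
    symp_form A \<rho> (J t) (\<lambda>p. vector_derivative (\<lambda>s. J s p) (at t)) (lie_endo A (exact_vf A \<rho> \<alpha>) (J t))) (at t)"
    unfolding symp_form_def .
qed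

end

theorem theoremA:
  fixes A :: "('m::t2_space, 'd::{finite,wellorder}) chart set"
    and \<rho> :: "('m, 'd) form"
    and J :: "('m, 'd) endo"
    and n :: nat
  assumes "CARD('d) = 2 * n"
    and "closed_connected_oriented_manifold A"
    and "positive_volume_form A \<rho>"
    and "J \<in> acs A"
  shows
    "(\<exists>nab. torsion_free_rho_connection A \<rho> nab) \<and>
     (\<forall>nab u v p. torsion_free_rho_connection A \<rho> nab \<and> smooth_vf A u \<and> smooth_vf A v \<longrightarrow>
        ricci A nab J u v p = ricci_form A \<rho> J p (\<lambda>i. if i = 0 then u p else v p)) \<and>
     ricci_form A \<rho> J \<in> forms A 2 \<and>
     closed_form A 2 (ricci_form A \<rho> J) \<and>
     de_rham_class A 2 (ricci_form A \<rho> J) = (\<lambda>\<omega> p w. 2 * pi * \<omega> p w) ` c1 A J \<and>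
     (\<forall>\<phi>. diffeo A \<phi> \<longrightarrow>
        pull_form A \<phi> (ricci_form A \<rho> J) = ricci_form A (pull_form A \<phi> \<rho>) (pull_endo A \<phi> J)) \<and>
     (\<forall>f. smooth_fun A f \<longrightarrow>
        ricci_form A (\<lambda>p w. exp (f p) * \<rho> p w) J =
        (\<lambda>p w. ricci_form A \<rho> J p w
               + 1/2 * ext_d A 1 (\<lambda>q v. dfun A f q (J q *v v 0)) p w)) \<and>
     moment_map_Diff_ex A \<rho> (\<lambda>J' p w. 2 * ricci_form A \<rho> J' p w) \<and>
     (\<forall>Jt t. \<forall>\<alpha>\<in>forms A (2 * n - 2). smooth_acs_path A Jt \<longrightarrow>
        ((\<lambda>s. form_integral A
                (wedge 2 (2 * n - 2) (\<lambda>p w. 2 * ricci_form A \<rho> (Jt s) p w) \<alpha>))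
          has_real_derivative
          1/2 * form_integral A (\<lambda>p w.
            trace (vector_derivative (\<lambda>s. Jt s p) (at t) ** Jt t p
                   ** lie_endo A (exact_vf A \<rho> \<alpha>) (Jt t) p) * \<rho> p w))
        (at t))"
proof -
  have geo: "oriented_atlas A" "compact (UNIV :: 'm set)"
    using assms(2) by (simp_all add: closed_connected_oriented_manifold_def)
  interpret vol_mfd A \<rho>
    by unfold_locales (use geo assms(3) in \<open>simp_all add: positive_volume_form_def\<close>)
  have ac: "almost_complex A J" using assms(4) by (simp add: acs_def)
  \<comment> \<open>The index type is nonempty, so \<open>n\<close> is at least 1 and the degree
    \<open>2 * n - 2\<close> is an honest difference of naturals.\<close>
  have "CARD('d) > 0" by simp
  then have dim: "CARD('d) \<ge> 2" using assms(1) by (cases n) auto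
  show ?thesis
  proof (intro conjI allI ballI impI)
    show "\<exists>nab. torsion_free_rho_connection A \<rho> nab" by (rule torsion_free_rho_connection_exists)
  next
    fix nab u v p assume "torsion_free_rho_connection A \<rho> nab \<and> smooth_vf A u \<and> smooth_vf A v"
    then show "ricci A nab J u v p = ricci_form A \<rho> J p (\<lambda>i. if i = 0 then u p else v p)"
      by (intro ricci_independent[OF _ ac]) simp_all
  next
    show "ricci_form A \<rho> J \<in> forms A 2" by (rule ricci_form_in_forms[OF ac])
  next
    show "closed_form A 2 (ricci_form A \<rho> J)" by (rule ricci_form_closed[OF ac])
  next
    show "de_rham_class A 2 (ricci_form A \<rho> J) = (\<lambda>\<omega> p w. 2 * pi * \<omega> p w) ` c1 A J"
      by (rule ricci_de_rham_class[OF ac])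
  next
    fix \<phi> assume "diffeo A \<phi>"
    then show "pull_form A \<phi> (ricci_form A \<rho> J) = ricci_form A (pull_form A \<phi> \<rho>) (pull_endo A \<phi> J)"
      by (rule ricci_form_natural[OF _ ac])
  next
    fix f assume "smooth_fun A f"
    then show "ricci_form A (\<lambda>p w. exp (f p) * \<rho> p w) J =
      (\<lambda>p w. ricci_form A \<rho> J p w + 1/2 * ext_d A 1 (\<lambda>q v. dfun A f q (J q *v v 0)) p w)"
      by (rule ricci_form_exp_scale[OF ac])
  next
    show "moment_map_Diff_ex A \<rho> (\<lambda>J' p w. 2 * ricci_form A \<rho> J' p w)"
      by (rule ricci_moment_map[OF dim assms(3)])
  next
    fix Jt t \<alpha> assume "\<alpha> \<in> forms A (2 * n - 2)" "smooth_acs_path A Jt"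
    then show "((\<lambda>s. form_integral A (wedge 2 (2 * n - 2) (\<lambda>p w. 2 * ricci_form A \<rho> (Jt s) p w) \<alpha>))
      has_real_derivative 1/2 * form_integral A (\<lambda>p w. trace (vector_derivative (\<lambda>s. Jt s p) (at t) ** Jt t p
        ** lie_endo A (exact_vf A \<rho> \<alpha>) (Jt t) p) * \<rho> p w)) (at t)"
      unfolding assms(1)[symmetric] by (intro ricci_moment_trace[OF dim])
  qed
qed

end
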